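(* Let $s,t$ be two fixed distinct vertices of the complete graph $K_n$, whose edges carry i.i.d.\ exponential weights with mean $1$, and let $X_k$ be the cost of the $k$-th cheapest path $P_k$ (defined in the context). Let $W_{(k)}$ denote the $k$-th smallest of $n-1$ i.i.d.\ $\mathrm{Exp}(1)$ random variables (so $\mathbb{E}W_{(k)}=\sum_{i=1}^k \frac{1}{n-i}$). Then $$\frac{X_k}{2\,\mathbb{E}W_{(k)}+\ln n/n}\ \xrightarrow{\ p\ }\ 1$$ uniformly for all $k\le n-1$; that is, for every $\varepsilon>0$, with probability tending to $1$ as $n\to\infty$, simultaneously for every $k=1,\dots,n-1$, $1-\varepsilon\le X_k/(2\,\mathbb{E}W_{(k)}+\ln n/n)\le 1+\varepsilon$.
   Context: The cost of a path is the sum of the weights of its edges. $P_1$ is a minimum-cost $s$--$t$ path; for $k\ge2$, $P_k$ is a minimum-cost $s$--$t$ path edge-disjoint from $P_1\cup\dots\cup P_{k-1}$, provided such a path exists, and $X_k$ is its cost. An inequality involving $X_k$ is understood to include that $P_k$ exists. $W_{(k)}$ has the law of the weight of the $k$-th cheapest edge incident to a fixed vertex. All asymptotics are as $n\to\infty$. *)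

theory Defs
  imports "HOL-Probability.Probability"
begin

definition complete_edges :: "nat \<Rightarrow> nat set set" where
  "complete_edges n = {e. e \<subseteq> {..<n} \<and> card e = 2}"

text \<open>A path is represented by its list of vertices.\<close>

definition path_edges :: "nat list \<Rightarrow> nat set set" where
  "path_edges p = {{p ! i, p ! Suc i} | i. Suc i < length p}"

definition st_path :: "nat set set \<Rightarrow> nat \<Rightarrow> nat \<Rightarrow> nat list \<Rightarrow> bool" where
  "st_path E s t p \<longleftrightarrow>
     p \<noteq> [] \<and> hd p = s \<and> last p = t \<and> distinct p \<and> path_edges p \<subseteq> E"

definition path_cost :: "(nat set \<Rightarrow> real) \<Rightarrow> nat list \<Rightarrow> real" where
  "path_cost w p = (\<Sum>e\<in>path_edges p. w e)"

text \<open>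
  Only the values \<open>P 1, \<dots>, P k\<close> matter. Minimisers need not be unique for weights with
  ties, so this is a predicate on sequences of paths rather than a function of the weights.
\<close>

definition successive_paths ::
    "nat set set \<Rightarrow> (nat set \<Rightarrow> real) \<Rightarrow> nat \<Rightarrow> nat \<Rightarrow> nat \<Rightarrow> (nat \<Rightarrow> nat list) \<Rightarrow> bool" where
  "successive_paths E w s t k P \<longleftrightarrow>
     (\<forall>j\<in>{1..k}. is_arg_min (path_cost w)
        (\<lambda>p. st_path E s t p \<and> path_edges p \<inter> (\<Union>i\<in>{1..<j}. path_edges (P i)) = {})
        (P j))"

text \<open>
  \<open>is_kth_cost E w s t k x\<close> says that \<open>P\<^sub>k\<close> exists and that \<open>X\<^sub>k = x\<close>; for weights
  without ties between paths there is at most one such \<open>x\<close>.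
\<close>

definition is_kth_cost ::
    "nat set set \<Rightarrow> (nat set \<Rightarrow> real) \<Rightarrow> nat \<Rightarrow> nat \<Rightarrow> nat \<Rightarrow> real \<Rightarrow> bool" where
  "is_kth_cost E w s t k x \<longleftrightarrow> (\<exists>P. successive_paths E w s t k P \<and> x = path_cost w (P k))"

definition kth_smallest :: "nat \<Rightarrow> nat \<Rightarrow> (nat \<Rightarrow> real) \<Rightarrow> real" where
  "kth_smallest m k y = sort (map y [0..<m]) ! (k - 1)"

text \<open>The expectation of \<open>W\<^sub>(\<^sub>k\<^sub>)\<close>, the \<open>k\<close>-th smallest of \<open>n - 1\<close> i.i.d. Exp(1) variables.\<close>

definition expected_W :: "nat \<Rightarrow> nat \<Rightarrow> real" where
  "expected_W n k =
     (\<integral>y. kth_smallest (n - 1) k y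
        \<partial>(\<Pi>\<^sub>M i\<in>{..<n - 1}. density lborel (exponential_density 1)))"

end

theory Submission
  imports Defs "HOL-Real_Asymp.Real_Asymp"
begin

text \<open>
  Write \<open>c\<^sub>k = 2 h\<^sub>k + ln n / n\<close> with \<open>h\<^sub>k = 1/(n-1) + \<dots> + 1/(n-k)\<close>. With high probability the number of edges of
  weight at most \<open>y\<close> at \<open>s\<close> and at \<open>t\<close> is controlled for all \<open>y\<close> simultaneously, so a path that leaves \<open>s\<close> and
  enters \<open>t\<close> through unused edges pays about \<open>h\<^sub>k\<close> at either end.

  Upper bound, by induction on \<open>k\<close>: the earlier paths are cheap, hence use few edges above any given weight,
  while expansion properties that hold uniformly over all vertex sets leave enough unused edges to connect
  slightly more than \<open>k\<close> cheap neighbours of \<open>s\<close> to those of \<open>t\<close>. For \<open>k \<le> (ln n)\<^sup>2\<close> the connection costs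
  \<open>(1 + o(1)) ln n / n\<close> and is found by first passage percolation that avoids all end points of heavy used
  edges; for larger \<open>k \<le> (1 - \<eta>) n\<close> a cost of order \<open>\<delta> k / n\<close> is negligible and coarse expansion suffices; for
  \<open>k > (1 - \<eta>) n\<close> two edges of bounded weight always do, because all earlier paths together have little
  weight away from \<open>s\<close> and \<open>t\<close>.

  Lower bound: the first and last edges of \<open>P\<^sub>1, \<dots>, P\<^sub>k\<close> are distinct edges at \<open>s\<close> and \<open>t\<close>, and for \<open>k = O(ln n)\<close> no
  path has a middle part much cheaper than \<open>ln n / n\<close>. This bounds \<open>X\<^sub>1 + \<dots> + X\<^sub>k\<close> from below, and together with
  the upper bound on a short window of indices it bounds \<open>X\<^sub>k\<close> itself. Near \<open>k = n\<close> a rerouting argument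
  shows that \<open>P\<^sub>k\<close> has end edges almost as heavy as any earlier path.
\<close>

section \<open>Events determined by the edge weights\<close>

text \<open>The obstacle is that the first k - 1 paths depend on all the weights, so conditioning on
  them destroys independence. All randomness is therefore put into events quantified over every
  vertex set that could matter; once these hold, the greedy sequence is treated deterministically,
  ties included. Of the used edges only the total cost is exploited: at most (total cost)/\<theta>
  of them are heavier than \<theta>. This is why expansion is measured by edges in a window (g/n,
  2g/n] bounded away from zero.

  Union bounds shape the regimes. At scale g = 200 ln n a failure probability exp(-g m/32) beats the
  n^m sets of size m, but for k of order ln n such an edge costs as much as a whole path; in that
  regime only sets attached by light edges to a much smaller set are counted. Once k exceeds (ln
  n)^2, even ln n / ln ln n steps of cost of order ln n / n are negligible against k/n.

  The lower bound goes through sums because a single late path might still find light end edges;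
  only the joint use of distinct edges at s and t is constrained.\<close>

type_synonym weights = "nat set \<Rightarrow> real"

lemma finite_complete_edges [simp]: "finite (complete_edges n)"
  unfolding complete_edges_def by (rule finite_subset[of _ "Pow {..<n}"]) auto

lemma complete_edges_doubleton: "{a, b} \<in> complete_edges n \<longleftrightarrow> a < n \<and> b < n \<and> a \<noteq> b"
  unfolding complete_edges_def by (auto simp: card_insert_if)

text \<open>Measurability over the product on \<open>G\<close> speaks about functions extensional on
  \<open>G\<close>; the second conjunct makes \<open>\<phi>\<close> meaningful on total weight
  functions as well. One predicate can thus be read over several edge sets, and disjoint sets
  \<open>G\<close> give independent events.\<close>

definition adm :: "'i set \<Rightarrow> (('i \<Rightarrow> real) \<Rightarrow> bool) \<Rightarrow> bool" where
  "adm G \<phi> \<longleftrightarrow> Measurable.pred (\<Pi>\<^sub>M e\<in>G. borel) \<phi> \<and> (\<forall>x y. (\<forall>e\<in>G. x e = y e) \<longrightarrow> \<phi> x = \<phi> y)"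

lemma admD: "adm G \<phi> \<Longrightarrow> (\<And>e. e \<in> G \<Longrightarrow> x e = y e) \<Longrightarrow> \<phi> x = \<phi> y"
  unfolding adm_def by blast

lemma adm_pred: "adm G \<phi> \<Longrightarrow> Measurable.pred (\<Pi>\<^sub>M e\<in>G. borel) \<phi>"
  unfolding adm_def by blast

lemma admI: "Measurable.pred (\<Pi>\<^sub>M e\<in>G. borel) \<phi> \<Longrightarrow> (\<And>x y. (\<And>e. e \<in> G \<Longrightarrow> x e = y e) \<Longrightarrow> \<phi> x = \<phi> y) \<Longrightarrow> adm G \<phi>"
  unfolding adm_def by blast

lemma adm_mono:
  assumes "adm G \<phi>" "G \<subseteq> H" shows "adm H \<phi>"
proof -
  have *: "\<phi> x = \<phi> (restrict x G)" for x by (rule admD[OF assms(1)]) simp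
  have "Measurable.pred (\<Pi>\<^sub>M e\<in>H. borel) (\<lambda>x. \<phi> (restrict x G))"
    using measurable_compose[OF measurable_restrict_subset[OF assms(2)] adm_pred[OF assms(1)]] .
  moreover have "(\<lambda>x. \<phi> (restrict x G)) = \<phi>" using * by (intro ext) simp
  ultimately have p: "Measurable.pred (\<Pi>\<^sub>M e\<in>H. borel) \<phi>" by simp
  show ?thesis by (rule admI[OF p]) (use assms admD[OF assms(1)] in blast)
qed

lemma adm_atom: "e \<in> G \<Longrightarrow> A \<in> sets borel \<Longrightarrow> adm G (\<lambda>x. x e \<in> A)"
  unfolding adm_def by simp

lemma adm_const [intro!]: "adm G (\<lambda>x. c)"
  unfolding adm_def by simp

lemma adm_not [intro!]: assumes "adm G \<phi>" shows "adm G (\<lambda>x. \<not> \<phi> x)"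
proof (rule admI)
  show "Measurable.pred (\<Pi>\<^sub>M e\<in>G. borel) (\<lambda>x. \<not> \<phi> x)" using adm_pred[OF assms] by measurable
  show "(\<And>e. e \<in> G \<Longrightarrow> x e = y e) \<Longrightarrow> (\<not> \<phi> x) = (\<not> \<phi> y)" for x y using admD[OF assms, of x y] by simp
qed

lemma adm_ball [intro!]:
  assumes "finite I" "\<And>i. i \<in> I \<Longrightarrow> adm G (\<phi> i)" shows "adm G (\<lambda>x. \<forall>i\<in>I. \<phi> i x)"
proof (rule admI)
  show "Measurable.pred (\<Pi>\<^sub>M e\<in>G. borel) (\<lambda>x. \<forall>i\<in>I. \<phi> i x)"
    using assms(1) adm_pred[OF assms(2)] by (rule pred_intros_finite)
  show "(\<And>e. e \<in> G \<Longrightarrow> x e = y e) \<Longrightarrow> (\<forall>i\<in>I. \<phi> i x) = (\<forall>i\<in>I. \<phi> i y)" for x y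
    using admD[OF assms(2), of _ x y] by simp
qed

lemma adm_conj [intro!]: assumes "adm G \<phi>" "adm G \<psi>" shows "adm G (\<lambda>x. \<phi> x \<and> \<psi> x)"
proof (rule admI)
  show "Measurable.pred (\<Pi>\<^sub>M e\<in>G. borel) (\<lambda>x. \<phi> x \<and> \<psi> x)"
    using adm_pred[OF assms(1)] adm_pred[OF assms(2)] by measurable
  show "(\<And>e. e \<in> G \<Longrightarrow> x e = y e) \<Longrightarrow> (\<phi> x \<and> \<psi> x) = (\<phi> y \<and> \<psi> y)" for x y
    using admD[OF assms(1), of x y] admD[OF assms(2), of x y] by simp
qed

lemma adm_disj [intro!]: assumes "adm G \<phi>" "adm G \<psi>" shows "adm G (\<lambda>x. \<phi> x \<or> \<psi> x)"
proof -
  have "adm G (\<lambda>x. \<not> (\<not> \<phi> x \<and> \<not> \<psi> x))" by (intro adm_not adm_conj assms)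
  thus ?thesis by simp
qed

lemma adm_imp [intro!]: assumes "adm G \<phi>" "adm G \<psi>" shows "adm G (\<lambda>x. \<phi> x \<longrightarrow> \<psi> x)"
proof -
  have "adm G (\<lambda>x. \<not> \<phi> x \<or> \<psi> x)" by (intro adm_not adm_disj assms)
  thus ?thesis by simp
qed

lemma adm_bex [intro!]:
  assumes "finite I" "\<And>i. i \<in> I \<Longrightarrow> adm G (\<phi> i)" shows "adm G (\<lambda>x. \<exists>i\<in>I. \<phi> i x)"
proof -
  have "adm G (\<lambda>x. \<not> (\<forall>i\<in>I. \<not> \<phi> i x))" using assms by (intro adm_not adm_ball)
  thus ?thesis by simp
qed

lemma adm_ex_less [intro!]:
  fixes k :: nat assumes "\<And>i. i < k \<Longrightarrow> adm G (\<phi> i)" shows "adm G (\<lambda>x. \<exists>i<k. \<phi> i x)"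
proof -
  have "adm G (\<lambda>x. \<exists>i\<in>{..<k}. \<phi> i x)" using assms by (intro adm_bex) auto
  thus ?thesis by (simp add: Bex_def)
qed

lemma adm_le [intro!]: "e \<in> G \<Longrightarrow> adm G (\<lambda>x. x e \<le> c)"
  using adm_atom[of e G "{..c}"] by simp

lemma adm_less [intro!]: "e \<in> G \<Longrightarrow> adm G (\<lambda>x. x e < c)"
  using adm_atom[of e G "{..<c}"] by simp

lemma adm_gt [intro!]: "e \<in> G \<Longrightarrow> adm G (\<lambda>x. c < x e)"
  using adm_atom[of e G "{c<..}"] by simp

text \<open>The random subset of \<open>V\<close> is guessed: the event is a finite disjunction over
  the possible subsets, so \<open>P\<close> may be arbitrary.\<close>

lemma adm_card:
  assumes "finite V" "\<And>v. v \<in> V \<Longrightarrow> adm G (X v)"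
  shows "adm G (\<lambda>x. P (card {v\<in>V. X v x}))"
proof -
  have "(\<lambda>x. P (card {v\<in>V. X v x})) = (\<lambda>x. \<exists>S\<in>Pow V. P (card S) \<and> (\<forall>v\<in>V. (v \<in> S) = X v x))" (is "?L = ?R")
  proof
    fix x
    have "?R x \<longleftrightarrow> (\<exists>S\<in>Pow V. P (card S) \<and> S = {v\<in>V. X v x})"
      by (intro bex_cong) auto
    also have "... \<longleftrightarrow> ?L x" by blast
    finally show "?L x = ?R x" by simp
  qed
  moreover have "adm G (\<lambda>x. \<exists>S\<in>Pow V. P (card S) \<and> (\<forall>v\<in>V. (v \<in> S) = X v x))"
  proof (intro adm_bex adm_conj adm_const adm_ball)
    fix S v assume v: "v \<in> V"
    show "adm G (\<lambda>x. (v \<in> S) = X v x)"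
      using assms(2)[OF v] adm_not[OF assms(2)[OF v]] by (cases "v \<in> S") simp_all
  qed (use assms in auto)
  ultimately show ?thesis by simp
qed

section \<open>Probabilities of edge events under independent exponential weights, with Chernoff
  bounds\<close>

locale exp_family = prob_space M for M :: "'a measure" +
  fixes E :: "'i set" and W :: "'i \<Rightarrow> 'a \<Rightarrow> real"
  assumes finE: "finite E" and indep: "indep_vars (\<lambda>_. borel) W E"
    and dist: "\<And>e. e \<in> E \<Longrightarrow> distributed M lborel (W e) (exponential_density 1)"
begin

definition Ev :: "(('i \<Rightarrow> real) \<Rightarrow> bool) \<Rightarrow> 'a set" where
  "Ev \<phi> = {\<omega>\<in>space M. \<phi> (\<lambda>e. W e \<omega>)}"

definition Pr :: "(('i \<Rightarrow> real) \<Rightarrow> bool) \<Rightarrow> real" where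
  "Pr \<phi> = prob (Ev \<phi>)"

lemma W_measurable: "e \<in> E \<Longrightarrow> W e \<in> borel_measurable M"
  using indep by (auto simp: indep_vars_def)

lemma Ev_restrict:
  assumes "adm G \<phi>"
  shows "Ev \<phi> = (\<lambda>\<omega>. \<lambda>e\<in>G. W e \<omega>) -` {x \<in> space (\<Pi>\<^sub>M e\<in>G. borel). \<phi> x} \<inter> space M"
proof -
  have "\<phi> (\<lambda>e. W e \<omega>) = \<phi> (\<lambda>e\<in>G. W e \<omega>)" for \<omega>
    by (rule admD[OF assms]) simp
  thus ?thesis by (auto simp: Ev_def space_PiM)
qed

lemma Ev_sets:
  assumes "adm G \<phi>" "G \<subseteq> E" shows "Ev \<phi> \<in> sets M"
proof -
  have "(\<lambda>\<omega>. \<lambda>e\<in>G. W e \<omega>) \<in> measurable M (\<Pi>\<^sub>M e\<in>G. borel)"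
    using assms W_measurable by (intro measurable_restrict) auto
  thus ?thesis using assms unfolding Ev_restrict[OF assms(1)] adm_def
    by (intro measurable_sets) (auto simp: pred_def)
qed

lemma Pr_nonneg [simp]: "0 \<le> Pr \<phi>" unfolding Pr_def by simp
lemma Pr_le_1 [simp]: "Pr \<phi> \<le> 1" unfolding Pr_def by simp
lemma Pr_True [simp]: "Pr (\<lambda>x. True) = 1" unfolding Pr_def Ev_def by (simp add: prob_space)
lemma Pr_False [simp]: "Pr (\<lambda>x. False) = 0" unfolding Pr_def Ev_def by simp

lemma Pr_mono: "adm E \<psi> \<Longrightarrow> (\<And>x. \<phi> x \<Longrightarrow> \<psi> x) \<Longrightarrow> Pr \<phi> \<le> Pr \<psi>"
  unfolding Pr_def using Ev_sets[of E \<psi>] by (intro finite_measure_mono) (auto simp: Ev_def)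

lemma Pr_cong: assumes "\<And>x. \<phi> x = \<psi> x" shows "Pr \<phi> = Pr \<psi>"
proof -
  have "\<phi> = \<psi>" using assms by blast
  thus ?thesis by simp
qed

lemma Pr_disj:
  assumes "adm E \<phi>" "adm E \<psi>" shows "Pr (\<lambda>x. \<phi> x \<or> \<psi> x) \<le> Pr \<phi> + Pr \<psi>"
proof -
  have "Ev (\<lambda>x. \<phi> x \<or> \<psi> x) = Ev \<phi> \<union> Ev \<psi>" by (auto simp: Ev_def)
  thus ?thesis unfolding Pr_def using Ev_sets[of E] assms by (auto intro: measure_Un_le)
qed

lemma Pr_split:
  assumes "adm E \<phi>" "adm E \<psi>" shows "Pr \<phi> = Pr (\<lambda>x. \<phi> x \<and> \<psi> x) + Pr (\<lambda>x. \<phi> x \<and> \<not> \<psi> x)"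
proof -
  have "Ev \<phi> = Ev (\<lambda>x. \<phi> x \<and> \<psi> x) \<union> Ev (\<lambda>x. \<phi> x \<and> \<not> \<psi> x)" by (auto simp: Ev_def)
  moreover have "prob (Ev (\<lambda>x. \<phi> x \<and> \<psi> x) \<union> Ev (\<lambda>x. \<phi> x \<and> \<not> \<psi> x)) = prob (Ev (\<lambda>x. \<phi> x \<and> \<psi> x)) + prob (Ev (\<lambda>x. \<phi> x \<and> \<not> \<psi> x))"
    using assms by (intro finite_measure_Union Ev_sets[of E]) (auto simp: Ev_def)
  ultimately show ?thesis unfolding Pr_def by simp
qed

lemma Pr_disjoint:
  assumes "adm E \<phi>" "adm E \<psi>" "\<And>x. \<not> (\<phi> x \<and> \<psi> x)"
  shows "Pr (\<lambda>x. \<phi> x \<or> \<psi> x) = Pr \<phi> + Pr \<psi>"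
proof -
  have "Pr (\<lambda>x. \<phi> x \<or> \<psi> x) = Pr (\<lambda>x. (\<phi> x \<or> \<psi> x) \<and> \<phi> x) + Pr (\<lambda>x. (\<phi> x \<or> \<psi> x) \<and> \<not> \<phi> x)"
    using assms by (intro Pr_split) auto
  moreover have "Pr (\<lambda>x. (\<phi> x \<or> \<psi> x) \<and> \<phi> x) = Pr \<phi>" "Pr (\<lambda>x. (\<phi> x \<or> \<psi> x) \<and> \<not> \<phi> x) = Pr \<psi>"
    using assms(3) by (auto intro!: Pr_cong)
  ultimately show ?thesis by simp
qed

lemma Pr_not: "adm E \<phi> \<Longrightarrow> Pr (\<lambda>x. \<not> \<phi> x) = 1 - Pr \<phi>"
  using Pr_split[of "\<lambda>x. True" \<phi>, OF adm_const] by simp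

lemma Pr_bex:
  assumes "finite I" "\<And>i. i \<in> I \<Longrightarrow> adm E (\<phi> i)"
  shows "Pr (\<lambda>x. \<exists>i\<in>I. \<phi> i x) \<le> (\<Sum>i\<in>I. Pr (\<phi> i))"
  using assms
proof (induction I)
  case (insert i I)
  have "Pr (\<lambda>x. \<exists>i\<in>insert i I. \<phi> i x) = Pr (\<lambda>x. \<phi> i x \<or> (\<exists>i\<in>I. \<phi> i x))" by (auto intro: Pr_cong)
  also have "... \<le> Pr (\<phi> i) + Pr (\<lambda>x. \<exists>i\<in>I. \<phi> i x)" using insert by (intro Pr_disj) auto
  also have "... \<le> Pr (\<phi> i) + (\<Sum>i\<in>I. Pr (\<phi> i))" using insert by simp
  finally show ?case using insert by simp
qed simp

lemma Pr_sum_disjoint: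
  assumes "finite I" "\<And>i. i \<in> I \<Longrightarrow> adm E (\<phi> i)" "\<And>i j x. i \<in> I \<Longrightarrow> j \<in> I \<Longrightarrow> \<phi> i x \<Longrightarrow> \<phi> j x \<Longrightarrow> i = j"
  shows "Pr (\<lambda>x. \<exists>i\<in>I. \<phi> i x) = (\<Sum>i\<in>I. Pr (\<phi> i))"
  using assms
proof (induction I)
  case (insert i I)
  have "Pr (\<lambda>x. \<exists>i\<in>insert i I. \<phi> i x) = Pr (\<lambda>x. \<phi> i x \<or> (\<exists>i\<in>I. \<phi> i x))" by (auto intro: Pr_cong)
  also have "... = Pr (\<phi> i) + Pr (\<lambda>x. \<exists>i\<in>I. \<phi> i x)"
  proof (intro Pr_disjoint)
    show "\<not> (\<phi> i x \<and> (\<exists>i\<in>I. \<phi> i x))" for x using insert.prems(2)[of i _ x] insert.hyps by blast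
  qed (use insert in auto)
  also have "... = Pr (\<phi> i) + (\<Sum>i\<in>I. Pr (\<phi> i))" using insert by simp
  finally show ?case using insert by simp
qed simp

text \<open>Independence of two blocks of edges is the family version indexed by the booleans,
  applied to the restrictions of the weights to \<open>G\<close> and to \<open>H\<close>.\<close>

lemma Pr_indep:
  assumes G: "adm G \<phi>" and H: "adm H \<psi>" and sub: "G \<subseteq> E" "H \<subseteq> E" and disj: "G \<inter> H = {}"
  shows "Pr (\<lambda>x. \<phi> x \<and> \<psi> x) = Pr \<phi> * Pr \<psi>"
proof -
  define K where "K b = (if b then G else H)" for b
  let ?X = "\<lambda>b \<omega>. \<lambda>e\<in>K b. W e \<omega>"
  define f where "f b = (if b then \<phi> else \<psi>)" for b
  have "indep_vars (\<lambda>b. \<Pi>\<^sub>M e\<in>K b. borel) ?X UNIV"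
    using sub disj by (intro indep_vars_restrict[OF indep]) (auto simp: K_def disjoint_family_on_def)
  moreover have "adm (K b) (f b)" for b using G H by (simp add: K_def f_def)
  ultimately have "prob (\<Inter>b\<in>UNIV. ?X b -` {x \<in> space (\<Pi>\<^sub>M e\<in>K b. borel). f b x} \<inter> space M) =
    (\<Prod>b\<in>UNIV. prob (?X b -` {x \<in> space (\<Pi>\<^sub>M e\<in>K b. borel). f b x} \<inter> space M))"
    unfolding adm_def by (intro indep_varsD) (auto simp: pred_def)
  hence "prob (\<Inter>b\<in>UNIV. Ev (f b)) = (\<Prod>b\<in>UNIV. prob (Ev (f b)))"
    using Ev_restrict[OF \<open>adm (K _) (f _)\<close>] by simp
  moreover have "(\<Inter>b\<in>UNIV. Ev (f b)) = Ev (\<lambda>x. \<phi> x \<and> \<psi> x)"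
    by (auto simp: Ev_def f_def UNIV_bool)
  ultimately show ?thesis by (simp add: Pr_def UNIV_bool f_def mult.commute)
qed

lemma Pr_indep_ball:
  assumes "finite V" "\<And>v. v \<in> V \<Longrightarrow> adm (G v) (\<phi> v)" "\<And>v. v \<in> V \<Longrightarrow> G v \<subseteq> E"
    "\<And>u v. u \<in> V \<Longrightarrow> v \<in> V \<Longrightarrow> u \<noteq> v \<Longrightarrow> G u \<inter> G v = {}"
  shows "Pr (\<lambda>x. \<forall>v\<in>V. \<phi> v x) = (\<Prod>v\<in>V. Pr (\<phi> v))"
  using assms
proof (induction V)
  case (insert v V)
  have "Pr (\<lambda>x. \<forall>v\<in>insert v V. \<phi> v x) = Pr (\<lambda>x. \<phi> v x \<and> (\<forall>v\<in>V. \<phi> v x))" by (auto intro: Pr_cong)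
  also have "... = Pr (\<phi> v) * Pr (\<lambda>x. \<forall>v\<in>V. \<phi> v x)"
  proof (rule Pr_indep)
    show "adm (G v) (\<phi> v)" using insert by auto
    show "adm (\<Union>(G ` V)) (\<lambda>x. \<forall>v\<in>V. \<phi> v x)"
      using insert.hyps insert.prems(1) by (intro adm_ball) (auto intro!: adm_mono[OF insert.prems(1)])
    show "G v \<inter> \<Union>(G ` V) = {}" using insert.hyps insert.prems(3)[of v] by blast
  qed (use insert.prems in auto)
  finally show ?case using insert by simp
qed simp

text \<open>Markov's inequality for z^count, proved by induction on \<open>V\<close> without forming
  the expectation. The event \<open>\<phi>\<close> and the side conditions \<open>A v\<close> are
  carried along so that the bound can be applied conditionally: in the exploration
  \<open>\<phi>\<close> belongs to the history and \<open>A v\<close> says that \<open>v\<close> has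
  not been reached yet.\<close>

lemma chernoff_lower:
  fixes z :: real
  assumes fin: "finite V" and z: "0 < z" "z \<le> 1"
    and \<phi>: "adm G \<phi>" "G \<subseteq> E"
    and H: "\<And>v. v \<in> V \<Longrightarrow> adm (H v) (A v)" "\<And>v. v \<in> V \<Longrightarrow> adm (H v) (X v)" "\<And>v. v \<in> V \<Longrightarrow> H v \<subseteq> E"
    and disj: "\<And>v. v \<in> V \<Longrightarrow> H v \<inter> G = {}" "\<And>u v. u \<in> V \<Longrightarrow> v \<in> V \<Longrightarrow> u \<noteq> v \<Longrightarrow> H u \<inter> H v = {}"
  shows "Pr (\<lambda>x. \<phi> x \<and> (\<forall>v\<in>V. A v x) \<and> card {v\<in>V. X v x} < y) * z ^ y
     \<le> Pr \<phi> * (\<Prod>v\<in>V. Pr (\<lambda>x. A v x \<and> \<not> X v x) + z * Pr (\<lambda>x. A v x \<and> X v x))"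
  using fin H disj
proof (induction V arbitrary: y)
  case empty
  show ?case
  proof (cases y)
    case (Suc m)
    have "z ^ y \<le> 1" using z by (intro power_le_one) auto
    thus ?thesis using Suc by (simp add: mult_left_le)
  qed simp
next
  case (insert v V)
  let ?P = "\<lambda>y. Pr (\<lambda>x. \<phi> x \<and> (\<forall>v\<in>V. A v x) \<and> card {v\<in>V. X v x} < y)"
  let ?a = "Pr (\<lambda>x. A v x \<and> \<not> X v x)" and ?b = "Pr (\<lambda>x. A v x \<and> X v x)"
  let ?R = "Pr \<phi> * (\<Prod>v\<in>V. Pr (\<lambda>x. A v x \<and> \<not> X v x) + z * Pr (\<lambda>x. A v x \<and> X v x))"
  define R where "R = ?R"
  have IH: "?P y * z ^ y \<le> R" for y
    unfolding R_def by (rule insert.IH) (use insert.prems in auto)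
  let ?G = "G \<union> \<Union>(H ` V)"
  have admG: "adm ?G (\<lambda>x. \<phi> x \<and> (\<forall>v\<in>V. A v x) \<and> card {v\<in>V. X v x} < y)" for y
    using insert.hyps insert.prems(1,2)
    by (intro adm_conj adm_ball adm_card) (auto intro: adm_mono[OF \<phi>(1)] adm_mono[OF insert.prems(1)] adm_mono[OF insert.prems(2)])
  have sub: "?G \<subseteq> E" "H v \<subseteq> E" using \<phi>(2) insert.prems(3) by blast+
  have dj: "?G \<inter> H v = {}"
  proof -
    have "G \<inter> H v = {}" using insert.prems(4)[of v] by auto
    moreover have "H u \<inter> H v = {}" if "u \<in> V" for u using insert.prems(5)[of u v] insert.hyps that by auto
    ultimately show ?thesis by auto
  qed
  have av: "adm (H v) (\<lambda>x. A v x \<and> \<not> X v x)" "adm (H v) (\<lambda>x. A v x \<and> X v x)" using insert.prems by auto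
  have E': "adm E (\<lambda>x. \<phi> x \<and> (\<forall>v\<in>V. A v x) \<and> card {v\<in>V. X v x} < y)" "adm E (\<lambda>x. A v x \<and> \<not> X v x)"
    "adm E (\<lambda>x. A v x \<and> X v x)" for y
    using adm_mono[OF admG sub(1)] adm_mono[OF av(1) sub(2)] adm_mono[OF av(2) sub(2)] by auto
  have cardi: "card {u\<in>insert v V. X u x} = (if X v x then Suc (card {u\<in>V. X u x}) else card {u\<in>V. X u x})" for x
  proof -
    have "{u\<in>insert v V. X u x} = (if X v x then insert v {u\<in>V. X u x} else {u\<in>V. X u x})" by auto
    thus ?thesis using insert.hyps by simp
  qed
  \<comment> \<open>Split on the event at \<open>v\<close>. The truncated subtraction is harmless:
    for \<open>y = 0\<close> both sides are impossible.\<close>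
  have "Pr (\<lambda>x. \<phi> x \<and> (\<forall>v\<in>insert v V. A v x) \<and> card {u\<in>insert v V. X u x} < y)
      = Pr (\<lambda>x. ((\<phi> x \<and> (\<forall>v\<in>V. A v x) \<and> card {v\<in>V. X v x} < y) \<and> (A v x \<and> \<not> X v x)) \<or>
                ((\<phi> x \<and> (\<forall>v\<in>V. A v x) \<and> card {v\<in>V. X v x} < y - 1) \<and> (A v x \<and> X v x)))"
    by (intro Pr_cong, unfold cardi) auto
  also have "... = Pr (\<lambda>x. (\<phi> x \<and> (\<forall>v\<in>V. A v x) \<and> card {v\<in>V. X v x} < y) \<and> (A v x \<and> \<not> X v x)) +
    Pr (\<lambda>x. (\<phi> x \<and> (\<forall>v\<in>V. A v x) \<and> card {v\<in>V. X v x} < y - 1) \<and> (A v x \<and> X v x))"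
    by (intro Pr_disjoint adm_conj[OF E'(1) E'(2)] adm_conj[OF E'(1) E'(3)]) auto
  also have "... = ?P y * ?a + ?P (y - 1) * ?b"
    using Pr_indep[OF admG av(1) sub dj] Pr_indep[OF admG av(2) sub dj] by simp
  finally have eq: "Pr (\<lambda>x. \<phi> x \<and> (\<forall>v\<in>insert v V. A v x) \<and> card {u\<in>insert v V. X u x} < y) = ?P y * ?a + ?P (y - 1) * ?b" .
  have "?P (y - 1) * z ^ y \<le> z * R"
  proof (cases y)
    case 0
    have "0 \<le> R" unfolding R_def using z by (auto intro!: mult_nonneg_nonneg prod_nonneg add_nonneg_nonneg)
    thus ?thesis using 0 z by simp
  next
    case (Suc m) thus ?thesis using IH[of m] z by (auto simp: mult.left_commute)
  qed
  hence "?P (y - 1) * z ^ y * ?b \<le> z * R * ?b" by (intro mult_right_mono) auto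
  moreover have "?P y * z ^ y * ?a \<le> R * ?a" using IH by (intro mult_right_mono) auto
  ultimately have "(?P y * ?a + ?P (y - 1) * ?b) * z ^ y \<le> R * (?a + z * ?b)" by (simp add: algebra_simps)
  thus ?case unfolding eq R_def using insert.hyps by (simp add: mult_ac)
qed

lemma chernoff_upper:
  fixes z :: real
  assumes fin: "finite V" and z: "1 \<le> z"
    and H: "\<And>v. v \<in> V \<Longrightarrow> adm (H v) (X v)" "\<And>v. v \<in> V \<Longrightarrow> H v \<subseteq> E"
    and disj: "\<And>u v. u \<in> V \<Longrightarrow> v \<in> V \<Longrightarrow> u \<noteq> v \<Longrightarrow> H u \<inter> H v = {}"
  shows "Pr (\<lambda>x. card {v\<in>V. X v x} \<ge> y) * z ^ y \<le> (\<Prod>v\<in>V. 1 + (z - 1) * Pr (X v))"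
  using fin H disj
proof (induction V arbitrary: y)
  case empty
  show ?case by (cases y) auto
next
  case (insert v V)
  let ?P = "\<lambda>y. Pr (\<lambda>x. card {v\<in>V. X v x} \<ge> y)"
  define R where "R = (\<Prod>v\<in>V. 1 + (z - 1) * Pr (X v))"
  have IH: "?P y * z ^ y \<le> R" for y
    unfolding R_def by (rule insert.IH) (use insert.prems in auto)
  let ?G = "\<Union>(H ` V)"
  have admG: "adm ?G (\<lambda>x. card {v\<in>V. X v x} \<ge> y)" for y
    using insert.hyps insert.prems(1) by (intro adm_card) (auto intro: adm_mono[OF insert.prems(1)])
  have sub: "?G \<subseteq> E" "H v \<subseteq> E" using insert.prems by auto
  have dj: "?G \<inter> H v = {}"
  proof -
    have "H u \<inter> H v = {}" if "u \<in> V" for u using insert.prems(3)[of u v] insert.hyps that by auto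
    thus ?thesis by auto
  qed
  have av: "adm (H v) (\<lambda>x. \<not> X v x)" "adm (H v) (X v)" using insert.prems by auto
  have E': "adm E (\<lambda>x. card {v\<in>V. X v x} \<ge> y)" "adm E (\<lambda>x. \<not> X v x)" "adm E (X v)" for y
    using adm_mono[OF admG sub(1)] adm_mono[OF av(1) sub(2)] adm_mono[OF av(2) sub(2)] by auto
  have cardi: "card {u\<in>insert v V. X u x} = (if X v x then Suc (card {u\<in>V. X u x}) else card {u\<in>V. X u x})" for x
  proof -
    have "{u\<in>insert v V. X u x} = (if X v x then insert v {u\<in>V. X u x} else {u\<in>V. X u x})" by auto
    thus ?thesis using insert.hyps by simp
  qed
  have "Pr (\<lambda>x. card {u\<in>insert v V. X u x} \<ge> y)
      = Pr (\<lambda>x. (card {v\<in>V. X v x} \<ge> y \<and> \<not> X v x) \<or> (card {v\<in>V. X v x} \<ge> y - 1 \<and> X v x))"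
    by (intro Pr_cong, unfold cardi) auto
  also have "... = Pr (\<lambda>x. card {v\<in>V. X v x} \<ge> y \<and> \<not> X v x) + Pr (\<lambda>x. card {v\<in>V. X v x} \<ge> y - 1 \<and> X v x)"
    by (intro Pr_disjoint adm_conj[OF E'(1) E'(2)] adm_conj[OF E'(1) E'(3)]) auto
  also have "... = ?P y * (1 - Pr (X v)) + ?P (y - 1) * Pr (X v)"
    using Pr_indep[OF admG av(1) sub dj] Pr_indep[OF admG av(2) sub dj] Pr_not[OF E'(3)] by simp
  finally have eq: "Pr (\<lambda>x. card {u\<in>insert v V. X u x} \<ge> y) = ?P y * (1 - Pr (X v)) + ?P (y - 1) * Pr (X v)" .
  have R1: "1 \<le> R" unfolding R_def using z by (intro prod_ge_1) auto
  have "?P (y - 1) * z ^ y \<le> z * R"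
  proof (cases y)
    case 0
    have "1 * 1 \<le> z * R" using R1 z by (intro mult_mono) auto
    thus ?thesis using 0 order_trans[OF Pr_le_1] by simp
  next
    case (Suc m) thus ?thesis using IH[of m] z by (auto simp: mult.left_commute)
  qed
  hence "?P (y - 1) * z ^ y * Pr (X v) \<le> z * R * Pr (X v)" by (intro mult_right_mono) auto
  moreover have "?P y * z ^ y * (1 - Pr (X v)) \<le> R * (1 - Pr (X v))" using IH by (intro mult_right_mono) auto
  ultimately have "(?P y * (1 - Pr (X v)) + ?P (y - 1) * Pr (X v)) * z ^ y \<le> R * (1 + (z - 1) * Pr (X v))" by (simp add: algebra_simps)
  thus ?case unfolding eq R_def using insert.hyps by (simp add: mult_ac)
qed

lemma Pr_gt: "e \<in> E \<Longrightarrow> 0 \<le> a \<Longrightarrow> Pr (\<lambda>x. a < x e) = exp (- a)"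
  using exponential_distributedD_gt[OF dist, of e a] by (simp add: Pr_def Ev_def)

lemma Pr_le: "e \<in> E \<Longrightarrow> 0 \<le> a \<Longrightarrow> Pr (\<lambda>x. x e \<le> a) = 1 - exp (- a)"
  using exponential_distributedD_le[OF dist, of e a] by (simp add: Pr_def Ev_def)

lemma Pr_window:
  assumes "e \<in> E" "0 \<le> a" "a \<le> b"
  shows "Pr (\<lambda>x. a < x e \<and> x e \<le> b) = exp (- a) - exp (- b)"
proof -
  have "Pr (\<lambda>x. a < x e) = Pr (\<lambda>x. a < x e \<and> b < x e) + Pr (\<lambda>x. a < x e \<and> \<not> b < x e)"
    using assms by (intro Pr_split) auto
  moreover have "Pr (\<lambda>x. a < x e \<and> b < x e) = Pr (\<lambda>x. b < x e)" using assms by (intro Pr_cong) auto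
  ultimately show ?thesis using assms by (simp add: Pr_gt not_less)
qed

lemma Pr_not_window:
  assumes "e \<in> E" "0 \<le> a" "a \<le> b"
  shows "Pr (\<lambda>x. \<not> (a < x e \<and> x e \<le> b)) = 1 - (exp (- a) - exp (- b))"
  using assms by (subst Pr_not) (auto simp: Pr_window)

end

section \<open>Order statistics of exponential variables\<close>

text \<open>Distribution function of a binomial variable, at values strictly below \<open>k\<close>;
  its recursion conditions on one trial.\<close>

definition binom_cdf :: "nat \<Rightarrow> nat \<Rightarrow> real \<Rightarrow> real" where
  "binom_cdf m k p = (\<Sum>j<k. real (m choose j) * p ^ j * (1 - p) ^ (m - j))"

lemma binom_cdf_Suc_Suc:
  "binom_cdf (Suc m) (Suc k) p = (1 - p) * binom_cdf m (Suc k) p + p * binom_cdf m k p"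
proof (induction k)
  case 0
  show ?case by (simp add: binom_cdf_def)
next
  case (Suc k)
  let ?b = "\<lambda>m j. real (m choose j) * p ^ j * (1 - p) ^ (m - j)"
  have step: "binom_cdf m (Suc j) p = binom_cdf m j p + ?b m j" for m j by (simp add: binom_cdf_def)
  have "real (m choose Suc k) * (1 - p) ^ (m - k) = (1 - p) * (real (m choose Suc k) * (1 - p) ^ (m - Suc k))"
  proof (cases "k < m")
    case True
    hence "m - k = Suc (m - Suc k)" by simp
    thus ?thesis by simp
  qed simp
  note e = this
  have "?b (Suc m) (Suc k) = p * p ^ k * (real (m choose Suc k) * (1 - p) ^ (m - k) + real (m choose k) * (1 - p) ^ (m - k))"
    by (simp add: algebra_simps)
  also have "... = (1 - p) * ?b m (Suc k) + p * ?b m k" unfolding e by (simp add: algebra_simps)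
  finally have "?b (Suc m) (Suc k) = (1 - p) * ?b m (Suc k) + p * ?b m k" .
  thus ?case unfolding step[of "Suc m" "Suc k"] Suc.IH step[of m "Suc k"] step[of m k] by (simp add: algebra_simps)
qed

text \<open>Tail of the \<open>k\<close>-th smallest of \<open>m\<close> independent unit
  exponentials: it exceeds \<open>y\<close> iff fewer than \<open>k\<close> of them are at most
  \<open>y\<close>.\<close>

definition F :: "nat \<Rightarrow> nat \<Rightarrow> real \<Rightarrow> real" where
  "F m k y = (\<Sum>j<k. real (m choose j) * (1 - exp (- y)) ^ j * exp (- y) ^ (m - j))"

lemma F_binom: "F m k y = binom_cdf m k (1 - exp (- y))"
  by (simp add: F_def binom_cdf_def)

lemma F_Suc: "F m (Suc j) y = F m j y + real (m choose j) * (1 - exp (- y)) ^ j * exp (- y) ^ (m - j)"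
  by (simp add: F_def)

text \<open>The derivative telescopes into a Kolmogorov equation: while exactly \<open>j\<close>
  variables lie below \<open>y\<close>, the next one arrives at rate \<open>m - j\<close>. Both tail
  bounds and the mean of the order statistics are derived from it.\<close>

lemma F_deriv:
  assumes "j \<le> m"
  shows "(F m (Suc j) has_real_derivative - (real (m - j) * (F m (Suc j) y - F m j y))) (at y)"
  using assms
proof (induction j)
  case 0
  have "F m (Suc 0) = (\<lambda>y. exp (- y) ^ m)" by (auto simp: F_def)
  moreover have "((\<lambda>y. exp (- y) ^ m) has_real_derivative - (real m * exp (- y) ^ m)) (at y)"
    by (auto intro!: derivative_eq_intros simp: exp_of_nat_mult[symmetric] exp_add[symmetric])
  ultimately show ?case by (simp add: F_def)
next
  case (Suc j)
  let ?x = "exp (- y)" and ?q = "1 - exp (- y)"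
  define i where "i = m - Suc j"
  have mi: "m - j = Suc i" using Suc.prems i_def by simp
  have abs: "real (Suc j) * real (m choose Suc j) = real (m - j) * real (m choose j)"
  proof -
    have "Suc j * (m choose Suc j) = (m - j) * (m choose j)"
      by (metis binomial_absorb_comp binomial_absorption mult.commute Suc.prems Suc_le_lessD Suc_pred binomial_absorption diff_Suc_1 less_imp_Suc_add times_binomial_minus1_eq zero_less_Suc)
    thus ?thesis by (metis of_nat_mult)
  qed
  have "((\<lambda>y. real (m choose Suc j) * (1 - exp (- y)) ^ Suc j * exp (- y) ^ i) has_real_derivative
     real (m choose Suc j) * (real (Suc j) * ?q ^ j * ?x) * ?x ^ i - real (m choose Suc j) * ?q ^ Suc j * (real i * ?x ^ i)) (at y)"
  proof -
    have d1: "((\<lambda>y. 1 - exp (- y)) has_real_derivative ?x) (at y)" and d2: "((\<lambda>y. exp (- y)) has_real_derivative - ?x) (at y)"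
      by (auto intro!: derivative_eq_intros)
    have d3: "((\<lambda>y. exp (- y) ^ i) has_real_derivative - (real i * ?x ^ i)) (at y)"
      by (rule DERIV_cong[OF DERIV_power[OF d2]]) (cases i; simp)
    have d4: "((\<lambda>y. real (m choose Suc j) * (1 - exp (- y)) ^ Suc j) has_real_derivative real (m choose Suc j) * (real (Suc j) * ?q ^ j * ?x)) (at y)"
      by (rule DERIV_cong[OF DERIV_cmult[OF DERIV_power[OF d1]]]) (simp add: mult_ac)
    show ?thesis by (rule DERIV_cong[OF DERIV_mult[OF d4 d3]]) simp
  qed
  from DERIV_add[OF Suc.IH this]
  have "((\<lambda>y. F m (Suc j) y + real (m choose Suc j) * (1 - exp (- y)) ^ Suc j * exp (- y) ^ i) has_real_derivative
     - (real (m - j) * (F m (Suc j) y - F m j y)) +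
     (real (m choose Suc j) * (real (Suc j) * ?q ^ j * ?x) * ?x ^ i - real (m choose Suc j) * ?q ^ Suc j * (real i * ?x ^ i))) (at y)"
    using Suc.prems by simp
  moreover have "(\<lambda>y. F m (Suc j) y + real (m choose Suc j) * (1 - exp (- y)) ^ Suc j * exp (- y) ^ i) = F m (Suc (Suc j))"
    unfolding i_def by (intro ext) (subst F_Suc[of m "Suc j"], simp)
  moreover have "real (m choose Suc j) * (real (Suc j) * ?q ^ j * ?x) * ?x ^ i = real (m - j) * (F m (Suc j) y - F m j y)"
  proof -
    have "real (m choose Suc j) * (real (Suc j) * ?q ^ j * ?x) * ?x ^ i = (real (Suc j) * real (m choose Suc j)) * ?q ^ j * ?x ^ Suc i"
      by (simp add: mult_ac)
    thus ?thesis unfolding abs F_Suc mi by (simp add: mult_ac)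
  qed
  ultimately show ?case unfolding F_Suc[of m "Suc j"] i_def by (simp add: mult_ac)
qed

lemma F_0 [simp]: "F m 0 y = 0" by (simp add: F_def)

lemma F_at_0: "F m (Suc j) 0 = 1"
  by (induction j) (auto simp: F_def)

text \<open>The right-hand side is the Chernoff bound for a sum of independent exponentials of rates
  m, m - 1, ..., m - k + 1, which has the law of the \<open>k\<close>-th order statistic. It is
  obtained here by comparison in the equation of \<open>F_deriv\<close>: after multiplication by the
  integrating factor exp(r y) the difference has a derivative that is nonnegative by
  induction.\<close>

lemma F_upper:
  assumes "k \<le> m" "0 \<le> \<theta>" "\<theta> < real m - real k + 1" "0 \<le> y"
  shows "F m k y \<le> exp (- (\<theta> * y)) * (\<Prod>i<k. 1 / (1 - \<theta> / (real m - real i)))"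
  using assms
proof (induction k arbitrary: y)
  case (Suc j)
  define c where "c k = (\<Prod>i<k. 1 / (1 - \<theta> / (real m - real i)))" for k
  define r where "r = real m - real j"
  have r: "r > \<theta>" "r = real (m - j)" "r > 0" using Suc.prems by (auto simp: r_def)
  have cA: "1 / (1 - \<theta> / r) * (r - \<theta>) = r" using r by (simp add: divide_simps)
  have cB: "c (Suc j) = c j * (1 / (1 - \<theta> / r))" by (simp add: c_def r_def)
  \<comment> \<open>This recursion of the moment generating functions makes c_k exp(-\<theta> y) an
    exact solution of the same differential equation.\<close>
  have cS: "c (Suc j) * (r - \<theta>) = r * c j" unfolding cB mult.assoc cA by (rule mult.commute)
  have c1: "1 \<le> c k" if "k \<le> Suc j" for k unfolding c_def
  proof (intro prod_ge_1)
    fix i assume "i \<in> {..<k}"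
    hence "real i \<le> real j" using that by simp
    hence t: "\<theta> < real m - real i" using r(1) unfolding r_def by linarith
    hence "\<theta> / (real m - real i) < 1" using Suc.prems(2) by simp
    moreover have "0 \<le> \<theta> / (real m - real i)" using t Suc.prems(2) by simp
    ultimately show "1 \<le> 1 / (1 - \<theta> / (real m - real i))" by (simp add: le_divide_eq_1)
  qed
  let ?D = "\<lambda>y. exp (r * y) * (c (Suc j) * exp (- (\<theta> * y)) - F m (Suc j) y)"
  have "?D 0 \<le> ?D y"
  proof (rule DERIV_nonneg_imp_nondecreasing[OF Suc.prems(4)])
    fix x assume x: "0 \<le> x" "x \<le> y"
    have d: "(?D has_real_derivative exp (r * x) * (r * (c j * exp (- (\<theta> * x)) - F m j x))) (at x)"
    proof -
      have dF: "(F m (Suc j) has_real_derivative - (r * (F m (Suc j) x - F m j x))) (at x)"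
        using F_deriv[of j m x] Suc.prems r by simp
      have d0: "((\<lambda>y. exp (r * y)) has_real_derivative r * exp (r * x)) (at x)"
        by (auto intro!: derivative_eq_intros)
      have d1: "((\<lambda>y. c (Suc j) * exp (- (\<theta> * y))) has_real_derivative - (c (Suc j) * \<theta> * exp (- (\<theta> * x)))) (at x)"
        by (auto intro!: derivative_eq_intros)
      show ?thesis
      proof (rule DERIV_cong[OF DERIV_mult[OF d0 DERIV_diff[OF d1 dF]]])
        have "r * exp (r * x) * (c (Suc j) * exp (- (\<theta> * x)) - F m (Suc j) x) +
          (- (c (Suc j) * \<theta> * exp (- (\<theta> * x))) - - (r * (F m (Suc j) x - F m j x))) * exp (r * x)
          = exp (r * x) * ((c (Suc j) * (r - \<theta>)) * exp (- (\<theta> * x)) - r * F m j x)" by (simp add: algebra_simps)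
        thus "r * exp (r * x) * (c (Suc j) * exp (- (\<theta> * x)) - F m (Suc j) x) +
          (- (c (Suc j) * \<theta> * exp (- (\<theta> * x))) - - (r * (F m (Suc j) x - F m j x))) * exp (r * x)
          = exp (r * x) * (r * (c j * exp (- (\<theta> * x)) - F m j x))" unfolding cS by (simp add: algebra_simps)
      qed
    qed
    have "F m j x \<le> exp (- (\<theta> * x)) * c j" unfolding c_def using Suc.prems x by (intro Suc.IH) auto
    hence "0 \<le> exp (r * x) * (r * (c j * exp (- (\<theta> * x)) - F m j x))" using r by (auto simp: mult.commute)
    with d show "\<exists>z. (?D has_real_derivative z) (at x) \<and> 0 \<le> z" by blast
  qed
  moreover have "0 \<le> ?D 0" using c1[of "Suc j"] by (simp add: F_at_0)
  ultimately have "0 \<le> ?D y" by linarith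
  hence "F m (Suc j) y \<le> c (Suc j) * exp (- (\<theta> * y))" by (simp add: zero_le_mult_iff)
  thus ?case unfolding c_def by (simp add: mult.commute)
qed simp

text \<open>The mirror image of \<open>F_upper\<close>: exp(\<theta> y) times the Laplace transform
  of the same sum of exponentials, by the same comparison.\<close>

lemma F_lower:
  assumes "k \<le> m" "0 \<le> \<theta>" "0 \<le> y"
  shows "1 - F m k y \<le> exp (\<theta> * y) * (\<Prod>i<k. 1 / (1 + \<theta> / (real m - real i)))"
  using assms
proof (induction k arbitrary: y)
  case (Suc j)
  define c where "c k = (\<Prod>i<k. 1 / (1 + \<theta> / (real m - real i)))" for k
  define r where "r = real m - real j"
  have r: "r = real (m - j)" "r > 0" using Suc.prems by (auto simp: r_def)
  have cA: "1 / (1 + \<theta> / r) * (r + \<theta>) = r" using r Suc.prems by (simp add: divide_simps)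
  have cB: "c (Suc j) = c j * (1 / (1 + \<theta> / r))" by (simp add: c_def r_def)
  have cS: "c (Suc j) * (r + \<theta>) = r * c j" unfolding cB mult.assoc cA by (rule mult.commute)
  have c1: "0 \<le> c k" if "k \<le> Suc j" for k unfolding c_def
    using that Suc.prems by (intro prod_nonneg) auto
  let ?D = "\<lambda>y. exp (r * y) * (c (Suc j) * exp (\<theta> * y) - (1 - F m (Suc j) y))"
  have "?D 0 \<le> ?D y"
  proof (rule DERIV_nonneg_imp_nondecreasing[OF Suc.prems(3)])
    fix x assume x: "0 \<le> x" "x \<le> y"
    have d: "(?D has_real_derivative exp (r * x) * (r * (c j * exp (\<theta> * x) - (1 - F m j x)))) (at x)"
    proof -
      have dF: "(F m (Suc j) has_real_derivative - (r * (F m (Suc j) x - F m j x))) (at x)"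
        using F_deriv[of j m x] Suc.prems r by simp
      have d0: "((\<lambda>y. exp (r * y)) has_real_derivative r * exp (r * x)) (at x)"
        by (auto intro!: derivative_eq_intros)
      have d1: "((\<lambda>y. c (Suc j) * exp (\<theta> * y)) has_real_derivative c (Suc j) * \<theta> * exp (\<theta> * x)) (at x)"
        by (auto intro!: derivative_eq_intros)
      show ?thesis
      proof (rule DERIV_cong[OF DERIV_mult[OF d0 DERIV_diff[OF d1 DERIV_diff[OF DERIV_const dF]]]])
        have "r * exp (r * x) * (c (Suc j) * exp (\<theta> * x) - (1 - F m (Suc j) x)) +
          (c (Suc j) * \<theta> * exp (\<theta> * x) - (0 - - (r * (F m (Suc j) x - F m j x)))) * exp (r * x)
          = exp (r * x) * ((c (Suc j) * (r + \<theta>)) * exp (\<theta> * x) - r * (1 - F m j x))" by (simp add: algebra_simps)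
        thus "r * exp (r * x) * (c (Suc j) * exp (\<theta> * x) - (1 - F m (Suc j) x)) +
          (c (Suc j) * \<theta> * exp (\<theta> * x) - (0 - - (r * (F m (Suc j) x - F m j x)))) * exp (r * x)
          = exp (r * x) * (r * (c j * exp (\<theta> * x) - (1 - F m j x)))" unfolding cS by (simp add: algebra_simps)
      qed
    qed
    have "1 - F m j x \<le> exp (\<theta> * x) * c j" unfolding c_def using Suc.prems x by (intro Suc.IH) auto
    hence "0 \<le> exp (r * x) * (r * (c j * exp (\<theta> * x) - (1 - F m j x)))" using r by (auto simp: mult.commute)
    with d show "\<exists>z. (?D has_real_derivative z) (at x) \<and> 0 \<le> z" by blast
  qed
  moreover have "0 \<le> ?D 0" using c1[of "Suc j"] by (simp add: F_at_0)
  ultimately have "0 \<le> ?D y" by linarith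
  hence "1 - F m (Suc j) y \<le> c (Suc j) * exp (\<theta> * y)" by (simp add: zero_le_mult_iff)
  thus ?case unfolding c_def by (simp add: mult.commute)
qed (simp add: assms)

lemma (in exp_family) Pr_count_less:
  assumes fin: "finite V" and H: "\<And>v. v \<in> V \<Longrightarrow> adm (H v) (X v)" "\<And>v. v \<in> V \<Longrightarrow> H v \<subseteq> E"
    and disj: "\<And>u v. u \<in> V \<Longrightarrow> v \<in> V \<Longrightarrow> u \<noteq> v \<Longrightarrow> H u \<inter> H v = {}"
    and p: "\<And>v. v \<in> V \<Longrightarrow> Pr (X v) = p"
  shows "Pr (\<lambda>x. card {v\<in>V. X v x} < k) = binom_cdf (card V) k p"
  using fin H disj p
proof (induction V arbitrary: k)
  case empty
  show ?case by (cases k) (auto simp: binom_cdf_def lessThan_Suc_atMost sum.atMost_shift)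
next
  case (insert v V)
  show ?case
  proof (cases k)
    case 0 thus ?thesis by (simp add: binom_cdf_def)
  next
    case (Suc k')
    let ?P = "\<lambda>y. Pr (\<lambda>x. card {v\<in>V. X v x} < y)"
    have IH: "?P y = binom_cdf (card V) y p" for y
      by (rule insert.IH) (use insert.prems in auto)
    let ?G = "\<Union>(H ` V)"
    have admG: "adm ?G (\<lambda>x. card {v\<in>V. X v x} < y)" for y
      using insert.hyps insert.prems(1) by (intro adm_card) (auto intro: adm_mono[OF insert.prems(1)])
    have sub: "?G \<subseteq> E" "H v \<subseteq> E" using insert.prems(2) by blast+
    have dj: "?G \<inter> H v = {}"
    proof -
      have "H u \<inter> H v = {}" if "u \<in> V" for u using insert.prems(3)[of u v] insert.hyps that by auto
      thus ?thesis by auto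
    qed
    have av: "adm (H v) (\<lambda>x. \<not> X v x)" "adm (H v) (X v)" using insert.prems by auto
    have E': "adm E (\<lambda>x. card {v\<in>V. X v x} < y)" "adm E (\<lambda>x. \<not> X v x)" "adm E (X v)" for y
      using adm_mono[OF admG sub(1)] adm_mono[OF av(1) sub(2)] adm_mono[OF av(2) sub(2)] by auto
    have cardi: "card {u\<in>insert v V. X u x} = (if X v x then Suc (card {u\<in>V. X u x}) else card {u\<in>V. X u x})" for x
    proof -
      have "{u\<in>insert v V. X u x} = (if X v x then insert v {u\<in>V. X u x} else {u\<in>V. X u x})" by auto
      thus ?thesis using insert.hyps by simp
    qed
    have "Pr (\<lambda>x. card {u\<in>insert v V. X u x} < k)
        = Pr (\<lambda>x. (card {v\<in>V. X v x} < Suc k' \<and> \<not> X v x) \<or> (card {v\<in>V. X v x} < k' \<and> X v x))"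
      by (intro Pr_cong, unfold cardi Suc) auto
    also have "... = Pr (\<lambda>x. card {v\<in>V. X v x} < Suc k' \<and> \<not> X v x) + Pr (\<lambda>x. card {v\<in>V. X v x} < k' \<and> X v x)"
      by (intro Pr_disjoint adm_conj[OF E'(1) E'(2)] adm_conj[OF E'(1) E'(3)]) auto
    also have "... = ?P (Suc k') * (1 - p) + ?P k' * p"
      using Pr_indep[OF admG av(1) sub dj] Pr_indep[OF admG av(2) sub dj] Pr_not[OF E'(3)] insert.prems(4) by simp
    finally show ?thesis unfolding IH using insert.hyps Suc by (simp add: binom_cdf_Suc_Suc mult.commute)
  qed
qed

lemma kth_smallest_le_iff:
  assumes "k \<in> {1..m}"
  shows "kth_smallest m k y \<le> c \<longleftrightarrow> k \<le> card {i\<in>{..<m}. y i \<le> c}"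
proof -
  define s where "s = sort (map y [0..<m])"
  have len: "length s = m" and sorted: "sorted s" by (simp_all add: s_def)
  have "mset (filter (\<lambda>z. z \<le> c) s) = mset (filter (\<lambda>z. z \<le> c) (map y [0..<m]))" by (simp add: s_def mset_filter)
  hence "length (filter (\<lambda>z. z \<le> c) s) = length (filter (\<lambda>z. z \<le> c) (map y [0..<m]))" by (metis size_mset)
  hence c1: "card {i. i < m \<and> s ! i \<le> c} = card {i\<in>{..<m}. y i \<le> c}"
    by (simp add: length_filter_conv_card len cong: conj_cong)
  have "s ! (k - 1) \<le> c \<longleftrightarrow> k \<le> card {i. i < m \<and> s ! i \<le> c}"
  proof
    assume "s ! (k - 1) \<le> c"
    moreover have "s ! i \<le> s ! (k - 1)" if "i < k" for i
      using that assms len by (intro sorted_nth_mono[OF sorted]) auto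
    ultimately have "{..<k} \<subseteq> {i. i < m \<and> s ! i \<le> c}"
      using assms by (auto intro: order_trans)
    from card_mono[OF _ this] show "k \<le> card {i. i < m \<and> s ! i \<le> c}" by simp
  next
    assume k: "k \<le> card {i. i < m \<and> s ! i \<le> c}"
    show "s ! (k - 1) \<le> c"
    proof (rule ccontr)
      assume n: "\<not> s ! (k - 1) \<le> c"
      have "{i. i < m \<and> s ! i \<le> c} \<subseteq> {..<k - 1}"
      proof
        fix i assume i: "i \<in> {i. i < m \<and> s ! i \<le> c}"
        show "i \<in> {..<k - 1}"
        proof (rule ccontr)
          assume "i \<notin> {..<k - 1}"
          hence "s ! (k - 1) \<le> s ! i" using i len by (intro sorted_nth_mono[OF sorted]) auto
          thus False using i n by auto
        qed
      qed
      from card_mono[OF _ this] show False using k assms by auto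
    qed
  qed
  thus ?thesis unfolding c1 by (simp add: kth_smallest_def s_def)
qed

text \<open>The expected length of the time during which exactly \<open>j\<close> variables lie
  below is a waiting time at rate m - j; by \<open>F_deriv\<close> the integrand has the
  antiderivative -F_(j+1)/(m - j).\<close>

lemma nn_integral_order_term:
  assumes "j < m"
  shows "(\<integral>\<^sup>+y. ennreal (real (m choose j) * (1 - exp (- y)) ^ j * exp (- y) ^ (m - j)) * indicator {0..} y \<partial>lborel) = ennreal (1 / (real m - real j))"
proof -
  let ?f = "\<lambda>y. real (m choose j) * (1 - exp (- y)) ^ j * exp (- y) ^ (m - j)"
  define r where "r = real m - real j"
  have r: "r > 0" "r = real (m - j)" using assms by (auto simp: r_def)
  have lim: "((\<lambda>y. - F m (Suc j) y / r) \<longlongrightarrow> - 0 / r) at_top"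
  proof (intro tendsto_intros)
    have "((\<lambda>y::real. exp (- y)) \<longlongrightarrow> 0) at_top" by real_asymp
    hence "((\<lambda>y. \<Sum>i<Suc j. real (m choose i) * (1 - exp (- y)) ^ i * exp (- y) ^ (m - i)) \<longlongrightarrow>
      (\<Sum>i<Suc j. real (m choose i) * (1 - 0) ^ i * 0 ^ (m - i))) at_top"
      by (intro tendsto_intros)
    also have "(\<Sum>i<Suc j. real (m choose i) * (1 - 0) ^ i * 0 ^ (m - i)) = 0"
      using assms by (intro sum.neutral) auto
    finally show "(F m (Suc j) \<longlongrightarrow> 0) at_top" unfolding F_def[abs_def] .
  qed (use r in auto)
  have "(\<integral>\<^sup>+y. ennreal (?f y) * indicator {0..} y \<partial>lborel) = ennreal (- 0 / r - (- F m (Suc j) 0 / r))"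
  proof (rule nn_integral_FTC_atLeast[OF _ _ _ lim])
    show "DERIV (\<lambda>y. - F m (Suc j) y / r) x :> ?f x" for x
      by (rule DERIV_cong[OF DERIV_cdivide[OF DERIV_minus[OF F_deriv]]]) (use assms r in \<open>auto simp: F_Suc\<close>)
  qed auto
  thus ?thesis by (simp add: F_at_0 r_def)
qed

text \<open>The mean is the integral of the tail, and the tail is a sum over the number j < k of
  variables below the level, which gives the waiting times. The coordinates of the product measure
  are themselves an instance of \<open>exp_family\<close>, so \<open>Pr_count_less\<close>
  identifies the tail.\<close>

lemma expected_kth_smallest:
  assumes k: "k \<in> {1..m}"
  shows "(\<integral>y. kth_smallest m k y \<partial>(\<Pi>\<^sub>M i\<in>{..<m}. density lborel (exponential_density 1))) = (\<Sum>j<k. 1 / (real m - real j))"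
proof -
  define N :: "real measure" where "N = density lborel (exponential_density 1)"
  define P where "P = (\<Pi>\<^sub>M i\<in>{..<m}. N)"
  interpret N: prob_space N unfolding N_def by (rule prob_space_exponential_density) simp
  interpret pp: product_prob_space "\<lambda>_. N" "{..<m}" by unfold_locales
  interpret P: prob_space P unfolding P_def by (rule pp.prob_space_axioms)
  have setsN [measurable_cong]: "sets N = sets borel" by (simp add: N_def)
  have [measurable]: "(\<lambda>y. y i) \<in> borel_measurable P" if "i < m" for i
    using measurable_component_singleton[of i "{..<m}" "\<lambda>_. N"] that unfolding P_def
    by (simp add: measurable_cong_sets[OF refl setsN])
  have dN: "distr P N (\<lambda>y. y i) = N" if "i < m" for i
    unfolding P_def using that by (intro distr_PiM_component) (auto intro: N.prob_space_axioms)
  interpret Pf: exp_family P "{..<m}" "\<lambda>i y. y i"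
  proof
    show "P.indep_vars (\<lambda>_. borel) (\<lambda>i y. y i) {..<m}"
    proof (cases "m = 0")
      case True thus ?thesis using k by simp
    next
      case False
      have "P.indep_vars (\<lambda>_. N) (\<lambda>i y. y i) {..<m}"
      proof (subst P.indep_vars_iff_distr_eq_PiM')
        have "distr P (\<Pi>\<^sub>M i\<in>{..<m}. N) (\<lambda>x. \<lambda>i\<in>{..<m}. x i) = distr P P (\<lambda>x. x)"
          unfolding P_def by (intro distr_cong) (auto simp: space_PiM PiE_def extensional_restrict)
        also have "... = P" by simp
        also have "P = (\<Pi>\<^sub>M i\<in>{..<m}. distr P N (\<lambda>x. x i))"
          using dN by (subst P_def, intro PiM_cong) auto
        finally show "distr P (\<Pi>\<^sub>M i\<in>{..<m}. N) (\<lambda>x. \<lambda>i\<in>{..<m}. x i) = (\<Pi>\<^sub>M i\<in>{..<m}. distr P N (\<lambda>x. x i))" .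
      qed (use False in \<open>auto simp: P_def\<close>)
      thus ?thesis unfolding P.indep_vars_def by (auto simp: setsN measurable_cong_sets[OF refl setsN])
    qed
    show "distributed P lborel (\<lambda>y. y e) (exponential_density 1)" if "e \<in> {..<m}" for e
    proof -
      have "distr P lborel (\<lambda>y. y e) = distr P N (\<lambda>y. y e)" by (intro distr_cong) (auto simp: setsN)
      thus ?thesis using dN[of e] that by (auto simp: distributed_def N_def)
    qed
  qed simp
  define Z where "Z = kth_smallest m k"
  have pred: "Measurable.pred P (\<lambda>y. Z y \<le> c)" for c unfolding Z_def kth_smallest_le_iff[OF k]
  proof -
    have "adm {..<m} (\<lambda>y. k \<le> card {i\<in>{..<m}. y i \<le> c})" by (intro adm_card) auto
    from Pf.Ev_sets[OF this] show "Measurable.pred P (\<lambda>y. k \<le> card {i\<in>{..<m}. y i \<le> c})"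
      by (simp add: Pf.Ev_def pred_def)
  qed
  have [measurable]: "Z \<in> borel_measurable P"
    using pred by (simp add: borel_measurable_iff_le pred_def)
  have tail: "emeasure P {y\<in>space P. c < Z y} = ennreal (F m k c)" if c: "0 \<le> c" for c
  proof -
    have "{y\<in>space P. c < Z y} = Pf.Ev (\<lambda>y. card {i\<in>{..<m}. y i \<le> c} < k)"
      using kth_smallest_le_iff[OF k, of _ c] by (auto simp: Pf.Ev_def Z_def not_le[symmetric])
    hence "emeasure P {y\<in>space P. c < Z y} = ennreal (Pf.Pr (\<lambda>y. card {i\<in>{..<m}. y i \<le> c} < k))"
      by (simp add: Pf.Pr_def P.emeasure_eq_measure)
    also have "Pf.Pr (\<lambda>y. card {i\<in>{..<m}. y i \<le> c} < k) = binom_cdf (card {..<m}) k (1 - exp (- c))"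
      by (rule Pf.Pr_count_less[where H = "\<lambda>i. {i}"]) (use c in \<open>auto simp: Pf.Pr_le\<close>)
    finally show ?thesis by (simp add: F_binom)
  qed
  have pos: "AE y in P. 0 \<le> Z y"
  proof -
    have "P.prob {y\<in>space P. 0 < Z y} = 1"
      using tail[of 0] k F_at_0[of m "k - 1"] by (simp add: P.emeasure_eq_measure)
    hence "AE y in P. 0 < Z y" by (subst (asm) P.prob_Collect_eq_1) auto
    thus ?thesis by eventually_elim simp
  qed
  interpret pair: pair_sigma_finite lborel P by unfold_locales
  have "(\<integral>\<^sup>+y. ennreal (Z y) \<partial>P) = (\<integral>\<^sup>+y. (\<integral>\<^sup>+x. indicator {0..<Z y} x \<partial>lborel) \<partial>P)"
    using pos by (intro nn_integral_cong_AE) (auto elim!: eventually_mono)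
  also have "... = (\<integral>\<^sup>+y. (\<integral>\<^sup>+x. indicator {p\<in>space (lborel \<Otimes>\<^sub>M P). 0 \<le> fst p \<and> fst p < Z (snd p)} (x, y) \<partial>lborel) \<partial>P)"
    by (intro nn_integral_cong) (auto simp: indicator_def space_pair_measure)
  also have "... = (\<integral>\<^sup>+x. (\<integral>\<^sup>+y. indicator {p\<in>space (lborel \<Otimes>\<^sub>M P). 0 \<le> fst p \<and> fst p < Z (snd p)} (x, y) \<partial>P) \<partial>lborel)"
    by (rule pair.Fubini', unfold case_prod_eta, rule borel_measurable_indicator, measurable)
  also have "... = (\<integral>\<^sup>+x. (\<integral>\<^sup>+y. indicator {0..} x * indicator {y\<in>space P. x < Z y} y \<partial>P) \<partial>lborel)"
    by (intro nn_integral_cong) (auto simp: indicator_def space_pair_measure)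
  also have "... = (\<integral>\<^sup>+x. ennreal (F m k x) * indicator {0..} x \<partial>lborel)"
    by (intro nn_integral_cong) (auto simp: nn_integral_cmult tail mult.commute split: split_indicator)
  also have "... = (\<integral>\<^sup>+x. (\<Sum>j<k. ennreal (real (m choose j) * (1 - exp (- x)) ^ j * exp (- x) ^ (m - j)) * indicator {0..} x) \<partial>lborel)"
    unfolding F_def by (intro nn_integral_cong) (auto simp: sum_ennreal simp flip: lessThan_def split: split_indicator)
  also have "... = (\<Sum>j<k. ennreal (1 / (real m - real j)))"
    using k by (subst nn_integral_sum) (auto intro!: sum.cong nn_integral_order_term)
  also have "... = ennreal (\<Sum>j<k. 1 / (real m - real j))"
    using k by (intro sum_ennreal) auto
  finally have nn: "(\<integral>\<^sup>+y. ennreal (Z y) \<partial>P) = ennreal (\<Sum>j<k. 1 / (real m - real j))" .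
  have "(\<integral>y. Z y \<partial>P) = enn2real (\<integral>\<^sup>+y. ennreal (Z y) \<partial>P)"
    using pos by (intro integral_eq_nn_integral) auto
  also have "... = (\<Sum>j<k. 1 / (real m - real j))" unfolding nn using k by (intro enn2real_ennreal sum_nonneg) auto
  finally show ?thesis unfolding Z_def P_def N_def .
qed

definition hsum :: "nat \<Rightarrow> nat \<Rightarrow> real" where
  "hsum n k = (\<Sum>i = 1..k. 1 / (real n - real i))"

lemma hsum_lessThan: "n \<ge> 1 \<Longrightarrow> hsum n k = (\<Sum>j<k. 1 / (real (n - 1) - real j))"
  unfolding hsum_def by (rule sum.reindex_bij_witness[of _ "\<lambda>j. j + 1" "\<lambda>i. i - 1"]) (auto simp: of_nat_diff)

lemma expected_W_eq: "k \<in> {1..n - 1} \<Longrightarrow> expected_W n k = hsum n k"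
  unfolding expected_W_def by (subst expected_kth_smallest) (auto simp: hsum_lessThan)

section \<open>The edges at a fixed vertex\<close>

lemma hsum_nonneg: "k \<le> n \<Longrightarrow> 0 \<le> hsum n k"
  unfolding hsum_def by (intro sum_nonneg) (auto simp: of_nat_diff)

lemma hsum_Suc: "hsum n (Suc k) = hsum n k + 1 / (real n - real (Suc k))"
  unfolding hsum_def by simp

lemma hsum_0 [simp]: "hsum n 0 = 0"
  unfolding hsum_def by simp

lemma hsum_ge_ln:
  assumes "k < n" shows "ln (real n / real (n - k)) \<le> hsum n k"
  using assms
proof (induction k)
  case (Suc k)
  define m where "m = n - Suc k"
  have m: "n - k = Suc m" "m > 0" "real n - real (Suc k) = real m" using Suc.prems by (auto simp: m_def of_nat_diff)
  have "ln (real n / real m) = ln (real n / real (Suc m)) + ln (1 + 1 / real m)"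
  proof -
    have "real n / real m = (real n / real (Suc m)) * (1 + 1 / real m)" using m by (simp add: divide_simps)
    thus ?thesis using m Suc.prems by (simp only:) (rule ln_mult_pos, auto intro!: divide_pos_pos add_pos_pos)
  qed
  also have "ln (1 + 1 / real m) \<le> 1 / real m" using m by (intro ln_add_one_self_le_self) auto
  finally show ?case using Suc.IH Suc.prems m unfolding hsum_Suc m_def[symmetric] by simp
qed simp

lemma hsum_ge: "k < n \<Longrightarrow> real k / real n \<le> hsum n k"
proof -
  assume k: "k < n"
  have "(\<Sum>i = 1..k. 1 / real n) \<le> hsum n k" unfolding hsum_def
    using k by (intro sum_mono divide_left_mono) (auto simp: of_nat_diff)
  thus ?thesis by simp
qed

lemma hsum_diff_le:
  assumes "j \<le> k" "k < n"
  shows "hsum n k - hsum n j \<le> (real k - real j) / (real n - real k)"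
proof -
  have "hsum n k - hsum n j = (\<Sum>i\<in>{j+1..k}. 1 / (real n - real i))"
  proof -
    have "{1..k} = {1..j} \<union> {j+1..k}" using assms by auto
    hence "hsum n k = hsum n j + (\<Sum>i\<in>{j+1..k}. 1 / (real n - real i))" unfolding hsum_def
      by (subst sum.union_disjoint[symmetric]) auto
    thus ?thesis by simp
  qed
  also have "... \<le> (\<Sum>i\<in>{j+1..k}. 1 / (real n - real k))"
    using assms by (intro sum_mono divide_left_mono) auto
  also have "... = (real k - real j) / (real n - real k)" using assms by (simp add: of_nat_diff)
  finally show ?thesis .
qed

lemma hsum_mono: "j \<le> k \<Longrightarrow> k < n \<Longrightarrow> hsum n j \<le> hsum n k"
  unfolding hsum_def by (intro sum_mono2) auto

lemma ln_le_half: "x > 0 \<Longrightarrow> ln x \<le> x / 2" for x :: real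
  using ln_le_minus_one[of "x / 2"] ln_2_less_1 by (simp add: ln_div)

text \<open>This is the exponent available in the large deviation bounds at index \<open>k\<close>.
  It is at least of order ln n everywhere and grows with the distance of \<open>k\<close> from both
  ends of the range, so the failure probabilities have a vanishing sum over
  \<open>k\<close>.\<close>

lemma rate_lower_bound:
  assumes k: "1 \<le> k" "k < n"
  shows "(ln (real n) + real (min k (n - k))) / 4 \<le> real (n - k) * (hsum n k + ln (real n) / real n)"
proof (cases "2 * k \<le> n")
  case True
  have ln: "0 \<le> ln (real n)" using k by simp
  have "1 / 2 * (real k + ln (real n)) \<le> (real (n - k) / real n) * (real k + ln (real n))"
    using True k ln by (intro mult_right_mono) (auto simp: field_simps of_nat_diff)
  also have "... = real (n - k) * (real k / real n + ln (real n) / real n)" by (simp add: add_divide_distrib distrib_left)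
  also have "... \<le> real (n - k) * (hsum n k + ln (real n) / real n)"
    using hsum_ge[OF k(2)] by (intro mult_left_mono) auto
  finally have a: "1 / 2 * (real k + ln (real n)) \<le> real (n - k) * (hsum n k + ln (real n) / real n)" .
  have "real (min k (n - k)) \<le> real k" by simp
  hence "(ln (real n) + real (min k (n - k))) / 4 \<le> 1 / 2 * (real k + ln (real n))" using ln by simp
  thus ?thesis using a by (rule order_trans)
next
  case False
  define m where "m = real (n - k)"
  have m: "1 \<le> m" "2 * m \<le> real n" using False k by (auto simp: m_def of_nat_diff)
  have n: "real n \<ge> 2" using m by linarith
  define L where "L = ln (real n / m)"
  have "ln 2 \<le> L" unfolding L_def using m by (subst ln_le_cancel_iff) (auto simp: field_simps)
  hence L: "1 / 2 \<le> L" using ln2_ge_two_thirds by linarith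
  \<comment> \<open>For m up to sqrt n the factor L is at least (ln n)/2; beyond that, m L is at
    least of order sqrt n, which dominates ln n.\<close>
  have b: "ln (real n) \<le> 2 * (m * L)"
  proof (cases "m \<le> sqrt (real n)")
    case True
    have "sqrt (real n) \<le> real n / m"
    proof -
      have "m * sqrt (real n) \<le> sqrt (real n) * sqrt (real n)" using True by (intro mult_right_mono) auto
      thus ?thesis using m by (simp add: field_simps)
    qed
    hence "ln (sqrt (real n)) \<le> L" unfolding L_def using m n by (subst ln_le_cancel_iff) auto
    hence "ln (real n) \<le> 2 * L" using n by (simp add: ln_sqrt)
    also have "... \<le> 2 * (m * L)" using m L by auto
    finally show ?thesis .
  next
    case False
    have "ln (real n) = 2 * ln (sqrt (real n))" using n by (simp add: ln_sqrt)
    also have "... \<le> sqrt (real n)" using ln_le_half[of "sqrt (real n)"] n by simp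
    also have "... \<le> 2 * (m * (1 / 2))" using False by simp
    also have "... \<le> 2 * (m * L)" using m L by (intro mult_left_mono) auto
    finally show ?thesis .
  qed
  define p where "p = m * L"
  have "m * (1 / 2) \<le> p" unfolding p_def using m L by (intro mult_left_mono) auto
  hence "(ln (real n) + m) / 4 \<le> p" using b unfolding p_def[symmetric] by (simp add: field_simps)
  also have "p = m * L" by (rule p_def)
  also have "m * L \<le> m * (hsum n k + ln (real n) / real n)"
  proof (intro mult_left_mono)
    show "L \<le> hsum n k + ln (real n) / real n" using hsum_ge_ln[OF k(2)] n unfolding L_def m_def
      by (simp add: add_increasing2)
  qed (use m in auto)
  finally show ?thesis using m_def by auto
qed

lemma sum_rate_le:
  assumes c: "0 < c" and n: "n \<ge> 1"
  shows "(\<Sum>k\<in>{1..n-1}. exp (- (c * (real (n - k) * (hsum n k + ln (real n) / real n))))) \<le> 2 / (exp (c / 4) - 1) * real n powr (- (c / 4))"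
proof -
  define d where "d = c / 4"
  have d: "d > 0" using c by (simp add: d_def)
  define r where "r = exp (- d)"
  have r: "0 < r" "r < 1" using d by (auto simp: r_def)
  have bnd: "exp (- (c * (real (n - k) * (hsum n k + ln (real n) / real n)))) \<le> real n powr (- d) * (r ^ k + r ^ (n - k))"
    if "k \<in> {1..n-1}" for k
  proof -
    have k: "1 \<le> k" "k < n" using that n by auto
    have "exp (- (c * (real (n - k) * (hsum n k + ln (real n) / real n)))) \<le> exp (- (c * ((ln (real n) + real (min k (n - k))) / 4)))"
      using c by (simp only: exp_le_cancel_iff neg_le_iff_le) (intro mult_left_mono rate_lower_bound[OF k], simp)
    also have "... = exp (- d * ln (real n)) * exp (- d * real (min k (n - k)))"
      by (simp add: exp_add[symmetric] d_def algebra_simps)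
    also have "exp (- d * ln (real n)) = real n powr (- d)" using n by (simp add: powr_def)
    also have "exp (- d * real (min k (n - k))) = r ^ (min k (n - k))" by (simp add: r_def exp_of_nat_mult[symmetric] mult.commute)
    also have "... \<le> r ^ k + r ^ (n - k)" using r by (auto simp: min_def)
    finally show ?thesis by (simp add: mult_left_mono)
  qed
  have geo: "(\<Sum>k\<in>{1..n-1}. r ^ k) \<le> 1 / (exp d - 1)"
  proof -
    have "(\<Sum>k\<in>{1..n-1}. r ^ k) = (\<Sum>k<n-1. r * r ^ k)"
      by (rule sum.reindex_bij_witness[of _ Suc "\<lambda>k. k - 1"]) (auto simp flip: power_Suc)
    also have "... = r * ((1 - r ^ (n - 1)) / (1 - r))" using r by (simp add: sum_distrib_left[symmetric] sum_gp_strict)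
    also have "... \<le> r * (1 / (1 - r))" using r by (intro mult_left_mono divide_right_mono) auto
    also have "... = 1 / (exp d - 1)" using d by (simp add: r_def exp_minus field_simps)
    finally show ?thesis .
  qed
  have sym: "(\<Sum>k\<in>{1..n-1}. r ^ (n - k)) = (\<Sum>k\<in>{1..n-1}. r ^ k)"
    by (rule sum.reindex_bij_witness[of _ "\<lambda>k. n - k" "\<lambda>k. n - k"]) auto
  have "(\<Sum>k\<in>{1..n-1}. exp (- (c * (real (n - k) * (hsum n k + ln (real n) / real n))))) \<le> (\<Sum>k\<in>{1..n-1}. real n powr (- d) * (r ^ k + r ^ (n - k)))"
    by (intro sum_mono bnd)
  also have "... = real n powr (- d) * (2 * (\<Sum>k\<in>{1..n-1}. r ^ k))" by (simp only: sum_distrib_left[symmetric] sum.distrib sym mult_2)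
  also have "... \<le> real n powr (- d) * (2 * (1 / (exp d - 1)))" using geo by (intro mult_left_mono) auto
  finally show ?thesis by (simp add: d_def mult.commute)
qed

locale exp_graph = exp_family M "complete_edges n" W for M :: "'a measure" and n :: nat and W
begin

abbreviation "E \<equiv> complete_edges n"
abbreviation "fails_at_most A b \<equiv> \<exists>\<psi>. adm E \<psi> \<and> (\<forall>x. \<not> A x \<longrightarrow> \<psi> x) \<and> Pr \<psi> \<le> b"

lemma Pr_star_less:
  assumes s: "s < n" and y: "0 \<le> y"
  shows "Pr (\<lambda>x. card {v\<in>{..<n} - {s}. x {s, v} \<le> y} < k) = F (n - 1) k y"
proof -
  have "Pr (\<lambda>x. card {v\<in>{..<n} - {s}. x {s, v} \<le> y} < k) = binom_cdf (card ({..<n} - {s})) k (1 - exp (- y))"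
    by (rule Pr_count_less[where H = "\<lambda>v. {{s, v}}"]) (use s y in \<open>auto simp: Pr_le complete_edges_doubleton doubleton_eq_iff\<close>)
  thus ?thesis using s by (simp add: F_binom)
qed

text \<open>\<open>F_upper\<close> with \<theta> a fixed fraction of n - k: each ratio \<theta>/(n -
  1 - i) is then at most \<epsilon>/4, so replacing 1/(1 - x) by exp(x + 2x^2) costs only a factor 1
  + \<epsilon>/2 in the exponent. The summand \<epsilon> ln n / n of the threshold keeps the bound
  useful for bounded \<open>k\<close>, where the order statistic is not concentrated.\<close>

lemma star_upper:
  assumes s: "s < n" and k: "k \<in> {1..n-1}" and \<epsilon>: "0 < \<epsilon>" "\<epsilon> \<le> 1"
  shows "Pr (\<lambda>x. card {v\<in>{..<n} - {s}. x {s, v} \<le> (1 + \<epsilon>) * hsum n k + \<epsilon> * ln (real n) / real n} < k)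
    \<le> exp (- (\<epsilon>\<^sup>2 / 8 * (real (n - k) * (hsum n k + ln (real n) / real n))))"
proof -
  define l where "l = ln (real n) / real n"
  define h where "h = hsum n k"
  define \<theta> where "\<theta> = \<epsilon> / 4 * real (n - k)"
  define x where "x i = \<theta> / (real (n - 1) - real i)" for i
  have n: "n \<ge> 2" using k by auto
  have h0: "0 \<le> h" "0 \<le> l" using k n by (auto simp: h_def l_def hsum_nonneg)
  have x: "0 \<le> x i" "x i \<le> \<epsilon> / 4" if "i < k" for i
  proof -
    have d: "real (n - k) \<le> real (n - 1) - real i" "0 < real (n - k)" using that k by (auto simp: of_nat_diff)
    show "0 \<le> x i" unfolding x_def \<theta>_def using d \<epsilon> by (intro divide_nonneg_pos mult_nonneg_nonneg) linarith+
    have "\<theta> \<le> \<epsilon> / 4 * (real (n - 1) - real i)" unfolding \<theta>_def using d \<epsilon> by (intro mult_left_mono) auto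
    thus "x i \<le> \<epsilon> / 4" unfolding x_def using d by (subst pos_divide_le_eq) linarith+
  qed
  have sumx: "(\<Sum>i<k. x i) = \<theta> * h" using n by (simp add: x_def h_def hsum_lessThan sum_distrib_left)
  have "F (n - 1) k ((1 + \<epsilon>) * h + \<epsilon> * l) \<le> exp (- (\<theta> * ((1 + \<epsilon>) * h + \<epsilon> * l))) * (\<Prod>i<k. 1 / (1 - x i))"
    unfolding x_def
  proof (rule F_upper)
    have "\<epsilon> * real (n - k) \<le> 1 * real (n - k)" using \<epsilon> by (intro mult_right_mono) auto
    thus "\<theta> < real (n - 1) - real k + 1" using k n \<epsilon> by (auto simp: \<theta>_def of_nat_diff)
  qed (use k \<epsilon> h0 in \<open>auto simp: \<theta>_def\<close>)
  also have "(\<Prod>i<k. 1 / (1 - x i)) \<le> (\<Prod>i<k. exp (x i + \<epsilon> / 2 * x i))"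
  proof (intro prod_mono conjI)
    fix i assume "i \<in> {..<k}" hence i: "0 \<le> x i" "x i \<le> \<epsilon> / 4" using x by auto
    thus "0 \<le> 1 / (1 - x i)" using \<epsilon> by auto
    have "- x i - 2 * (x i)\<^sup>2 \<le> ln (1 - x i)" using i \<epsilon> by (intro ln_one_minus_pos_lower_bound) auto
    moreover have "2 * (x i)\<^sup>2 \<le> \<epsilon> / 2 * x i" using mult_right_mono[OF i(2) i(1)] by (simp add: power2_eq_square)
    ultimately have "- (x i + \<epsilon> / 2 * x i) \<le> ln (1 - x i)" by linarith
    hence "exp (- (x i + \<epsilon> / 2 * x i)) \<le> 1 - x i" using i \<epsilon> by (subst (asm) ln_ge_iff) auto
    thus "1 / (1 - x i) \<le> exp (x i + \<epsilon> / 2 * x i)" using i \<epsilon> by (auto simp: exp_minus field_simps)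
  qed
  also have "... = exp (\<Sum>i<k. x i + \<epsilon> / 2 * x i)" by (simp add: exp_sum)
  also have "(\<Sum>i<k. x i + \<epsilon> / 2 * x i) = \<theta> * h + \<epsilon> / 2 * (\<theta> * h)"
    by (simp only: sum.distrib sum_distrib_left[symmetric] sumx)
  also have "exp (- (\<theta> * ((1 + \<epsilon>) * h + \<epsilon> * l))) * exp (\<theta> * h + \<epsilon> / 2 * (\<theta> * h)) = exp (- (\<theta> * (\<epsilon> / 2 * h + \<epsilon> * l)))"
    by (simp add: exp_add[symmetric] algebra_simps)
  also have "... \<le> exp (- (\<epsilon>\<^sup>2 / 8 * (real (n - k) * (h + l))))"
  proof -
    have "\<theta> * (\<epsilon> / 2 * (h + l)) \<le> \<theta> * (\<epsilon> / 2 * h + \<epsilon> * l)"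
      using \<epsilon> h0 by (intro mult_left_mono) (auto simp: \<theta>_def algebra_simps)
    thus ?thesis by (simp add: \<theta>_def power2_eq_square algebra_simps)
  qed
  finally have "F (n - 1) k ((1 + \<epsilon>) * h + \<epsilon> * l) \<le> exp (- (\<epsilon>\<^sup>2 / 8 * (real (n - k) * (h + l))))" by (simp add: mult_left_mono)
  moreover have "Pr (\<lambda>x. card {v\<in>{..<n} - {s}. x {s, v} \<le> (1 + \<epsilon>) * h + \<epsilon> * l} < k) = F (n - 1) k ((1 + \<epsilon>) * h + \<epsilon> * l)"
    using \<epsilon> h0 by (intro Pr_star_less s) auto
  ultimately show ?thesis by (simp add: h_def l_def)
qed

lemma star_lower:
  assumes s: "s < n" and k: "k \<in> {1..n-1}" and \<epsilon>: "0 < \<epsilon>" "\<epsilon> \<le> 1" and y0: "0 \<le> (1 - \<epsilon>) * hsum n k - \<epsilon> * ln (real n) / real n"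
  shows "Pr (\<lambda>x. k \<le> card {v\<in>{..<n} - {s}. x {s, v} \<le> (1 - \<epsilon>) * hsum n k - \<epsilon> * ln (real n) / real n})
    \<le> exp (- (\<epsilon>\<^sup>2 / 8 * (real (n - k) * (hsum n k + ln (real n) / real n))))"
proof -
  define l where "l = ln (real n) / real n"
  define h where "h = hsum n k"
  define \<theta> where "\<theta> = \<epsilon> / 2 * real (n - k)"
  define x where "x i = \<theta> / (real (n - 1) - real i)" for i
  define y where "y = (1 - \<epsilon>) * h - \<epsilon> * l"
  have y: "0 \<le> y" using y0 by (simp add: y_def h_def l_def)
  have n: "n \<ge> 2" using k by auto
  have h0: "0 \<le> h" "0 \<le> l" using k n by (auto simp: h_def l_def hsum_nonneg)
  have x: "0 \<le> x i" "x i \<le> \<epsilon> / 2" if "i < k" for i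
  proof -
    have d: "real (n - k) \<le> real (n - 1) - real i" "0 < real (n - k)" using that k by (auto simp: of_nat_diff)
    show "0 \<le> x i" unfolding x_def \<theta>_def using d \<epsilon> by (intro divide_nonneg_pos mult_nonneg_nonneg) linarith+
    have "\<theta> \<le> \<epsilon> / 2 * (real (n - 1) - real i)" unfolding \<theta>_def using d \<epsilon> by (intro mult_left_mono) auto
    thus "x i \<le> \<epsilon> / 2" unfolding x_def using d by (subst pos_divide_le_eq) linarith+
  qed
  have sumx: "(\<Sum>i<k. x i) = \<theta> * h" using n by (simp add: x_def h_def hsum_lessThan sum_distrib_left)
  have "1 - F (n - 1) k y \<le> exp (\<theta> * y) * (\<Prod>i<k. 1 / (1 + x i))"
    unfolding x_def by (rule F_lower) (use k \<epsilon> y in \<open>auto simp: \<theta>_def\<close>)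
  also have "(\<Prod>i<k. 1 / (1 + x i)) \<le> (\<Prod>i<k. exp (- x i + \<epsilon> / 2 * x i))"
  proof (intro prod_mono conjI)
    fix i assume "i \<in> {..<k}" hence i: "0 \<le> x i" "x i \<le> \<epsilon> / 2" using x by auto
    thus "0 \<le> 1 / (1 + x i)" using \<epsilon> by auto
    have "x i - (x i)\<^sup>2 \<le> ln (1 + x i)" using i \<epsilon> by (intro ln_one_plus_pos_lower_bound) auto
    moreover have "(x i)\<^sup>2 \<le> \<epsilon> / 2 * x i" using mult_right_mono[OF i(2) i(1)] by (simp add: power2_eq_square)
    ultimately have "x i - \<epsilon> / 2 * x i \<le> ln (1 + x i)" by linarith
    hence "exp (x i - \<epsilon> / 2 * x i) \<le> 1 + x i" using i by (subst (asm) ln_ge_iff) auto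
    moreover have "exp (- x i + \<epsilon> / 2 * x i) = 1 / exp (x i - \<epsilon> / 2 * x i)" by (simp add: exp_minus[symmetric] inverse_eq_divide[symmetric])
    ultimately show "1 / (1 + x i) \<le> exp (- x i + \<epsilon> / 2 * x i)" using i by (auto simp: intro!: divide_left_mono)
  qed
  also have "... = exp (\<Sum>i<k. - x i + \<epsilon> / 2 * x i)" by (simp add: exp_sum)
  also have "(\<Sum>i<k. - x i + \<epsilon> / 2 * x i) = - (\<theta> * h) + \<epsilon> / 2 * (\<theta> * h)"
    by (simp only: sum.distrib sum_distrib_left[symmetric] sumx sum_negf)
  also have "exp (\<theta> * y) * exp (- (\<theta> * h) + \<epsilon> / 2 * (\<theta> * h)) = exp (- (\<theta> * (\<epsilon> / 2 * h + \<epsilon> * l)))"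
    by (simp add: y_def exp_add[symmetric] algebra_simps)
  also have "... \<le> exp (- (\<epsilon>\<^sup>2 / 8 * (real (n - k) * (h + l))))"
  proof -
    have "\<theta> * (\<epsilon> / 4 * (h + l)) \<le> \<theta> * (\<epsilon> / 2 * h + \<epsilon> * l)"
      using \<epsilon> h0 by (intro mult_left_mono) (auto simp: \<theta>_def algebra_simps)
    thus ?thesis by (simp add: \<theta>_def power2_eq_square algebra_simps)
  qed
  finally have F: "1 - F (n - 1) k y \<le> exp (- (\<epsilon>\<^sup>2 / 8 * (real (n - k) * (h + l))))" by (simp add: mult_left_mono)
  have "Pr (\<lambda>x. k \<le> card {v\<in>{..<n} - {s}. x {s, v} \<le> y}) = Pr (\<lambda>x. \<not> (card {v\<in>{..<n} - {s}. x {s, v} \<le> y} < k))"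
    by (intro Pr_cong) auto
  also have "... = 1 - F (n - 1) k y"
  proof -
    have "adm E (\<lambda>x. card {v\<in>{..<n} - {s}. x {s, v} \<le> y} < k)"
      using s by (intro adm_card) (auto simp: complete_edges_doubleton)
    from Pr_not[OF this] show ?thesis by (simp only: Pr_star_less[OF s y])
  qed
  finally show ?thesis using F by (simp add: h_def l_def y_def)
qed

lemma Pr_negative: "e \<in> E \<Longrightarrow> Pr (\<lambda>x. x e < 0) = 0"
  using Pr_mono[of "\<lambda>x. x e \<le> 0" "\<lambda>x. x e < 0"] Pr_le[of e 0] Pr_nonneg[of "\<lambda>x. x e < 0"] by (auto simp del: Pr_nonneg)

end

definition star_lo :: "nat \<Rightarrow> real \<Rightarrow> nat \<Rightarrow> real" where
  "star_lo n \<epsilon> k = (1 - \<epsilon>) * hsum n k - \<epsilon> * ln (real n) / real n"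

definition star_hi :: "nat \<Rightarrow> real \<Rightarrow> nat \<Rightarrow> real" where
  "star_hi n \<epsilon> k = (1 + \<epsilon>) * hsum n k + \<epsilon> * ln (real n) / real n"

text \<open>The lower half is restricted to nonnegative thresholds, the range of
  \<open>F_lower\<close>; negative ones are handled in \<open>star_lo_count\<close> by nonnegativity
  of the weights.\<close>

definition star_ok :: "real \<Rightarrow> nat \<Rightarrow> nat \<Rightarrow> weights \<Rightarrow> bool" where
  "star_ok \<epsilon> n s w \<longleftrightarrow> (\<forall>k\<in>{1..n-1}. k \<le> card {v\<in>{..<n} - {s}. w {s, v} \<le> star_hi n \<epsilon> k} \<and>
     (0 \<le> star_lo n \<epsilon> k \<longrightarrow> card {v\<in>{..<n} - {s}. w {s, v} \<le> star_lo n \<epsilon> k} < k))"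

section \<open>Sequences of graphs and events of probability tending to one\<close>

locale exp_graphs =
  fixes M :: "nat \<Rightarrow> 'a measure"
    and W :: "nat \<Rightarrow> nat set \<Rightarrow> 'a \<Rightarrow> real"
    and s t :: "nat \<Rightarrow> nat"
  assumes graphs: "\<And>n. exp_graph (M n) n (W n)"
    and st: "\<And>n. n \<ge> 2 \<Longrightarrow> s n < n \<and> t n < n \<and> s n \<noteq> t n"
begin

abbreviation "PR n \<equiv> exp_family.Pr (M n) (W n)"

text \<open>The failure event need not be measurable; it only has to lie in a measurable event of vanishing probability.\<close>
definition whp :: "(nat \<Rightarrow> weights \<Rightarrow> bool) \<Rightarrow> bool" where
  "whp \<Phi> \<longleftrightarrow> (\<exists>B. (\<forall>n. B n \<in> sets (M n) \<and> (\<forall>\<omega>\<in>space (M n). \<not> \<Phi> n (\<lambda>e. W n e \<omega>) \<longrightarrow> \<omega> \<in> B n)) \<and>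
     (\<lambda>n. measure (M n) (B n)) \<longlonglongrightarrow> 0)"

lemma whpI:
  assumes "\<forall>\<^sub>F n in sequentially. adm (complete_edges n) (\<psi> n) \<and> (\<forall>x. \<not> \<Phi> n x \<longrightarrow> \<psi> n x) \<and> PR n (\<psi> n) \<le> b n"
    and "b \<longlonglongrightarrow> 0"
  shows "whp \<Phi>"
proof -
  define ok where "ok n \<longleftrightarrow> adm (complete_edges n) (\<psi> n) \<and> (\<forall>x. \<not> \<Phi> n x \<longrightarrow> \<psi> n x) \<and> PR n (\<psi> n) \<le> b n" for n
  define B where "B n = (if ok n then exp_family.Ev (M n) (W n) (\<psi> n) else space (M n))" for n
  have "B n \<in> sets (M n) \<and> (\<forall>\<omega>\<in>space (M n). \<not> \<Phi> n (\<lambda>e. W n e \<omega>) \<longrightarrow> \<omega> \<in> B n)" for n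
  proof -
    interpret exp_graph "M n" n "W n" by (rule graphs)
    show ?thesis using Ev_sets[of E "\<psi> n"] by (auto simp: B_def ok_def Ev_def)
  qed
  moreover have "(\<lambda>n. measure (M n) (B n)) \<longlonglongrightarrow> 0"
  proof (rule tendsto_sandwich[OF _ _ tendsto_const assms(2)])
    show "\<forall>\<^sub>F n in sequentially. measure (M n) (B n) \<le> b n"
      using assms(1)
    proof eventually_elim
      case (elim n)
      interpret exp_graph "M n" n "W n" by (rule graphs)
      show ?case using elim by (simp add: B_def ok_def Pr_def)
    qed
  qed auto
  ultimately show ?thesis unfolding whp_def by blast
qed

lemma whp_conj:
  assumes "whp \<Phi>" "whp \<Psi>" shows "whp (\<lambda>n w. \<Phi> n w \<and> \<Psi> n w)"
proof -
  obtain B where B: "\<And>n. B n \<in> sets (M n)" "\<And>n \<omega>. \<omega> \<in> space (M n) \<Longrightarrow> \<not> \<Phi> n (\<lambda>e. W n e \<omega>) \<Longrightarrow> \<omega> \<in> B n"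
    "(\<lambda>n. measure (M n) (B n)) \<longlonglongrightarrow> 0" using assms(1) unfolding whp_def by blast
  obtain C where C: "\<And>n. C n \<in> sets (M n)" "\<And>n \<omega>. \<omega> \<in> space (M n) \<Longrightarrow> \<not> \<Psi> n (\<lambda>e. W n e \<omega>) \<Longrightarrow> \<omega> \<in> C n"
    "(\<lambda>n. measure (M n) (C n)) \<longlonglongrightarrow> 0" using assms(2) unfolding whp_def by blast
  have "(\<lambda>n. measure (M n) (B n) + measure (M n) (C n)) \<longlonglongrightarrow> 0 + 0" by (intro tendsto_add B C)
  hence l0: "(\<lambda>n. measure (M n) (B n) + measure (M n) (C n)) \<longlonglongrightarrow> 0" by simp
  have lim: "(\<lambda>n. measure (M n) (B n \<union> C n)) \<longlonglongrightarrow> 0"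
    by (rule tendsto_sandwich[OF _ _ tendsto_const l0]) (auto intro!: always_eventually measure_Un_le B C)
  show ?thesis unfolding whp_def
    by (intro exI[of _ "\<lambda>n. B n \<union> C n"] conjI allI ballI impI lim) (use B C in auto)
qed

lemma whp_mono:
  assumes "whp \<Phi>" "\<forall>\<^sub>F n in sequentially. \<forall>w. \<Phi> n w \<longrightarrow> \<Psi> n w" shows "whp \<Psi>"
proof -
  obtain B where B: "\<And>n. B n \<in> sets (M n)" "\<And>n \<omega>. \<omega> \<in> space (M n) \<Longrightarrow> \<not> \<Phi> n (\<lambda>e. W n e \<omega>) \<Longrightarrow> \<omega> \<in> B n"
    "(\<lambda>n. measure (M n) (B n)) \<longlonglongrightarrow> 0" using assms(1) unfolding whp_def by blast
  define C where "C n = (if \<forall>w. \<Phi> n w \<longrightarrow> \<Psi> n w then B n else space (M n))" for n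
  have "(\<lambda>n. measure (M n) (C n)) \<longlonglongrightarrow> 0"
    by (rule Lim_transform_eventually[OF B(3)]) (use assms(2) in \<open>auto elim!: eventually_mono simp: C_def\<close>)
  thus ?thesis unfolding whp_def by (intro exI[of _ C] conjI allI ballI impI) (use B in \<open>auto simp: C_def\<close>)
qed

lemma whp_star:
  assumes \<epsilon>: "0 < \<epsilon>" "\<epsilon> \<le> 1" and u: "\<And>n. n \<ge> 2 \<Longrightarrow> u n < n"
  shows "whp (\<lambda>n. star_ok \<epsilon> n (u n))"
proof (rule whpI)
  define c where "c = \<epsilon>\<^sup>2 / 8"
  have c: "c > 0" using \<epsilon> by (simp add: c_def)
  define A where "A n k x \<longleftrightarrow> card {v\<in>{..<n} - {u n}. x {u n, v} \<le> star_hi n \<epsilon> k} < k \<or>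
    0 \<le> star_lo n \<epsilon> k \<and> k \<le> card {v\<in>{..<n} - {u n}. x {u n, v} \<le> star_lo n \<epsilon> k}" for n k x
  define b where "b n = 2 * (2 / (exp (c / 4) - 1) * real n powr (- (c / 4)))" for n
  show "\<forall>\<^sub>F n in sequentially. adm (complete_edges n) (\<lambda>x. \<exists>k\<in>{1..n-1}. A n k x) \<and>
    (\<forall>x. \<not> star_ok \<epsilon> n (u n) x \<longrightarrow> (\<exists>k\<in>{1..n-1}. A n k x)) \<and> PR n (\<lambda>x. \<exists>k\<in>{1..n-1}. A n k x) \<le> b n"
    using eventually_ge_at_top[of 2]
  proof eventually_elim
    case (elim n)
    interpret exp_graph "M n" n "W n" by (rule graphs)
    have un: "u n < n" using u elim by simp
    have cnt: "adm E (\<lambda>x. P (card {v\<in>{..<n} - {u n}. x {u n, v} \<le> y}))" for P y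
      using un by (intro adm_card) (auto simp: complete_edges_doubleton)
    have adm1: "adm E (A n k)" for k unfolding A_def by (intro adm_disj adm_conj adm_const cnt)
    have "Pr (\<lambda>x. \<exists>k\<in>{1..n-1}. A n k x) \<le> (\<Sum>k\<in>{1..n-1}. Pr (A n k))" by (intro Pr_bex adm1) auto
    also have "... \<le> (\<Sum>k\<in>{1..n-1}. 2 * exp (- (c * (real (n - k) * (hsum n k + ln (real n) / real n)))))"
    proof (intro sum_mono)
      fix k assume k: "k \<in> {1..n-1}"
      let ?e = "exp (- (c * (real (n - k) * (hsum n k + ln (real n) / real n))))"
      have "Pr (A n k) \<le> Pr (\<lambda>x. card {v\<in>{..<n} - {u n}. x {u n, v} \<le> star_hi n \<epsilon> k} < k) +
        Pr (\<lambda>x. 0 \<le> star_lo n \<epsilon> k \<and> k \<le> card {v\<in>{..<n} - {u n}. x {u n, v} \<le> star_lo n \<epsilon> k})"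
        unfolding A_def by (intro Pr_disj adm_conj adm_const cnt)
      moreover have "Pr (\<lambda>x. card {v\<in>{..<n} - {u n}. x {u n, v} \<le> star_hi n \<epsilon> k} < k) \<le> ?e"
        unfolding star_hi_def c_def by (rule star_upper[OF un k \<epsilon>])
      moreover have "Pr (\<lambda>x. 0 \<le> star_lo n \<epsilon> k \<and> k \<le> card {v\<in>{..<n} - {u n}. x {u n, v} \<le> star_lo n \<epsilon> k}) \<le> ?e"
      proof (cases "0 \<le> star_lo n \<epsilon> k")
        case True
        thus ?thesis using star_lower[OF un k \<epsilon>] by (simp add: star_lo_def c_def)
      qed simp
      ultimately show "Pr (A n k) \<le> 2 * ?e" by linarith
    qed
    also have "... \<le> b n" using sum_rate_le[OF c, of n] elim unfolding b_def sum_distrib_left[symmetric] by simp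
    finally have "Pr (\<lambda>x. \<exists>k\<in>{1..n-1}. A n k x) \<le> b n" .
    moreover have "adm E (\<lambda>x. \<exists>k\<in>{1..n-1}. A n k x)" by (intro adm_bex adm1) auto
    moreover have "\<forall>x. \<not> star_ok \<epsilon> n (u n) x \<longrightarrow> (\<exists>k\<in>{1..n-1}. A n k x)"
      unfolding star_ok_def A_def by (auto simp: not_le not_less)
    ultimately show ?case by blast
  qed
  show "b \<longlonglongrightarrow> 0" unfolding b_def using c by real_asymp
qed

lemma whp_nonneg: "whp (\<lambda>n w. \<forall>e\<in>complete_edges n. 0 \<le> w e)"
proof (rule whpI)
  show "\<forall>\<^sub>F n in sequentially. adm (complete_edges n) (\<lambda>x. \<exists>e\<in>complete_edges n. x e < 0) \<and>
    (\<forall>x :: nat set \<Rightarrow> real. \<not> (\<forall>e\<in>complete_edges n. 0 \<le> x e) \<longrightarrow> (\<exists>e\<in>complete_edges n. x e < 0)) \<and> PR n (\<lambda>x. \<exists>e\<in>complete_edges n. x e < 0) \<le> 0"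
  proof (rule always_eventually, rule allI)
    fix n
    interpret exp_graph "M n" n "W n" by (rule graphs)
    have "Pr (\<lambda>x. \<exists>e\<in>E. x e < 0) \<le> (\<Sum>e\<in>E. Pr (\<lambda>x. x e < 0))" by (intro Pr_bex) auto
    moreover have "adm E (\<lambda>x. \<exists>e\<in>E. x e < 0)" by auto
    moreover have "\<forall>x :: nat set \<Rightarrow> real. \<not> (\<forall>e\<in>E. 0 \<le> x e) \<longrightarrow> (\<exists>e\<in>E. x e < 0)" by (meson not_le)
    ultimately show "adm E (\<lambda>x. \<exists>e\<in>E. x e < 0) \<and> (\<forall>x :: nat set \<Rightarrow> real. \<not> (\<forall>e\<in>E. 0 \<le> x e) \<longrightarrow> (\<exists>e\<in>E. x e < 0)) \<and> Pr (\<lambda>x. \<exists>e\<in>E. x e < 0) \<le> 0"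
      by (simp add: Pr_negative)
  qed
qed simp

end

section \<open>Expansion of vertex sets\<close>

text \<open>Edges of weight at most \<open>lo\<close> are left out so that used edges inside the
  window can be counted: each of them costs more than \<open>lo\<close>. The set \<open>X\<close> is
  typically \<open>Y\<close> together with vertices explored before.\<close>

definition hits :: "nat \<Rightarrow> weights \<Rightarrow> real \<Rightarrow> real \<Rightarrow> nat set \<Rightarrow> nat set \<Rightarrow> nat set" where
  "hits n w lo hi Y X = {v\<in>{..<n} - X. \<exists>a\<in>Y. lo < w {a, v} \<and> w {a, v} \<le> hi}"

lemma one_minus_power_le:
  fixes q :: real
  assumes "0 \<le> q" "q \<le> 1" "q * real m \<le> 1"
  shows "(1 - q) ^ m \<le> 1 - q * real m / 2"
proof -
  have "(1 - q) ^ m \<le> exp (- q) ^ m" using assms exp_ge_add_one_self[of "- q"] by (intro power_mono) auto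
  also have "... = exp (- (q * real m))" by (simp add: exp_of_nat_mult[symmetric] mult.commute)
  also have "... \<le> 1 - q * real m / 2"
  proof -
    define x where "x = q * real m"
    have x: "0 \<le> x" "x \<le> 1" using assms by (auto simp: x_def)
    have "exp (- x) * (1 + x) \<le> exp (- x) * exp x" by (intro mult_left_mono) auto
    hence "exp (- x) * (1 + x) \<le> 1" by (simp add: exp_minus)
    moreover have "1 \<le> (1 - x / 2) * (1 + x)" using x mult_left_le[of x x] by (simp add: algebra_simps)
    ultimately have "exp (- x) * (1 + x) \<le> (1 - x / 2) * (1 + x)" by linarith
    thus ?thesis using x unfolding x_def[symmetric] by (simp add: mult_le_cancel_right)
  qed
  finally show ?thesis .
qed

lemma window_mass:
  fixes x :: real
  assumes "0 \<le> x" "x \<le> 1 / 4"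
  shows "x / 2 \<le> exp (- x) - exp (- (2 * x))"
proof -
  define e where "e = exp (- x)"
  have e1: "1 - x \<le> e" using exp_ge_add_one_self[of "- x"] by (simp add: e_def)
  have "e * (1 + x) \<le> e * exp x" unfolding e_def by (intro mult_left_mono) auto
  hence "e * (1 + x) \<le> 1" by (simp add: e_def exp_minus)
  hence e2: "e * x \<le> 1 - e" by (simp add: algebra_simps)
  have "x / 2 \<le> (1 - x) * ((1 - x) * x)"
  proof -
    have "1 / 2 \<le> (3/4) * (3/4 :: real)" by simp
    also have "... \<le> (1 - x) * (1 - x)" using assms by (intro mult_mono) auto
    finally have "1 / 2 * x \<le> (1 - x) * (1 - x) * x" using assms by (intro mult_right_mono) auto
    thus ?thesis by (simp add: mult.assoc)
  qed
  also have "... \<le> e * (e * x)" using e1 assms by (intro mult_mono) auto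
  also have "... \<le> e * (1 - e)" using e2 by (intro mult_left_mono) (auto simp: e_def)
  also have "... = exp (- x) - exp (- (2 * x))" by (simp add: e_def algebra_simps exp_add[symmetric])
  finally show ?thesis .
qed

lemma two_power_ceiling_le:
  fixes \<mu> :: real
  assumes "0 \<le> \<mu>" shows "2 ^ nat \<lceil>\<mu>\<rceil> \<le> 2 * exp \<mu>"
proof -
  have "(2 :: real) ^ nat \<lceil>\<mu>\<rceil> = 2 powr real (nat \<lceil>\<mu>\<rceil>)" by (simp add: powr_realpow)
  also have "... \<le> 2 powr (\<mu> + 1)" using assms by (intro powr_mono) linarith+
  also have "... = 2 * 2 powr \<mu>" by (simp add: powr_add)
  also have "2 powr \<mu> \<le> exp \<mu>" using assms ln_2_less_1 by (auto simp: powr_def mult_left_le)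
  finally show ?thesis by simp
qed

lemma less_real_iff_ceiling: "real m < \<mu> \<longleftrightarrow> m < nat \<lceil>\<mu>\<rceil>"
  by linarith

context exp_graph
begin

lemma Pr_not_hit:
  assumes "finite Y" "\<And>a. a \<in> Y \<Longrightarrow> {a, v} \<in> E" "0 \<le> lo" "lo \<le> hi"
  shows "Pr (\<lambda>x. \<not> (\<exists>a\<in>Y. lo < x {a, v} \<and> x {a, v} \<le> hi)) = (1 - (exp (- lo) - exp (- hi))) ^ card Y"
proof -
  have "Pr (\<lambda>x. \<forall>a\<in>Y. \<not> (lo < x {a, v} \<and> x {a, v} \<le> hi)) = (\<Prod>a\<in>Y. Pr (\<lambda>x. \<not> (lo < x {a, v} \<and> x {a, v} \<le> hi)))"
    by (rule Pr_indep_ball[where G = "\<lambda>a. {{a, v}}"]) (use assms in \<open>auto simp: doubleton_eq_iff\<close>)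
  also have "... = (1 - (exp (- lo) - exp (- hi))) ^ card Y"
  proof -
    have "(\<Prod>a\<in>Y. Pr (\<lambda>x. \<not> (lo < x {a, v} \<and> x {a, v} \<le> hi))) = (\<Prod>a\<in>Y. 1 - (exp (- lo) - exp (- hi)))"
      by (intro prod.cong refl Pr_not_window assms)
    thus ?thesis by simp
  qed
  finally show ?thesis by simp
qed

lemma adm_hits_aux:
  assumes "Y \<subseteq> X" "X \<subseteq> {..<n}" "v \<in> {..<n} - X"
  shows "adm ((\<lambda>a. {a, v}) ` Y) (\<lambda>x. \<exists>a\<in>Y. lo < x {a, v} \<and> x {a, v} \<le> hi)"
  using assms finite_subset[of Y "{..<n}"] by (intro adm_bex) auto

lemma adm_hits:
  assumes "Y \<subseteq> X" "X \<subseteq> {..<n}"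
  shows "adm E (\<lambda>x. P (card (hits n x lo hi Y X)))"
  unfolding hits_def
proof (rule adm_card)
  fix v assume v: "v \<in> {..<n} - X"
  show "adm E (\<lambda>x. \<exists>a\<in>Y. lo < x {a, v} \<and> x {a, v} \<le> hi)"
    by (rule adm_mono[OF adm_hits_aux[OF assms v]]) (use v assms in \<open>auto simp: complete_edges_doubleton subset_iff\<close>)
qed auto

text \<open>Chernoff with z = 1/2. At least n/2 outside vertices are hit with probability at least
  q|Y|/2 each, so the mean is at least 4\<mu>; the moment is at most exp(-2\<mu>), and paying 2^y
  for the threshold leaves exp(-\<mu>). The event \<open>\<phi>\<close> lives on edges inside
  \<open>X\<close>, hence is independent of the hits.\<close>

lemma hits_prob:
  assumes X: "Y \<subseteq> X" "X \<subseteq> {..<n}" "2 * card X \<le> n"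
    and lo: "0 \<le> lo" "lo \<le> hi" "0 \<le> q" "q \<le> exp (- lo) - exp (- hi)" "q * real (card Y) \<le> 1"
    and \<phi>: "adm G \<phi>" "G \<subseteq> E" "\<And>e. e \<in> G \<Longrightarrow> e \<subseteq> X"
  shows "Pr (\<lambda>x. \<phi> x \<and> real (card (hits n x lo hi Y X)) < real n * q * real (card Y) / 16)
     \<le> Pr \<phi> * (2 * exp (- (real n * q * real (card Y) / 16)))"
proof -
  let ?V = "{..<n} - X"
  let ?X = "\<lambda>v x. \<exists>a\<in>Y. lo < x {a, v} \<and> x {a, v} \<le> hi"
  define \<mu> where "\<mu> = real n * q * real (card Y) / 16"
  define y where "y = nat \<lceil>\<mu>\<rceil>"
  have \<mu>0: "0 \<le> \<mu>" using lo by (simp add: \<mu>_def)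
  have finY: "finite Y" using X by (meson finite_lessThan finite_subset)
  have H: "adm ((\<lambda>a. {a, v}) ` Y) (?X v)" "(\<lambda>a. {a, v}) ` Y \<subseteq> E" if "v \<in> ?V" for v
    using that X adm_hits_aux[OF X(1,2) that] by (auto simp: complete_edges_doubleton subset_iff)
  have q1: "q \<le> 1" using lo exp_ge_zero[of "- hi"] by (smt (verit) exp_le_one_iff)
  have pv: "Pr (\<lambda>x. \<not> ?X v x) \<le> 1 - q * real (card Y) / 2" if v: "v \<in> ?V" for v
  proof -
    have "Pr (\<lambda>x. \<not> ?X v x) = (1 - (exp (- lo) - exp (- hi))) ^ card Y"
      by (rule Pr_not_hit) (use finY v X lo in \<open>auto simp: complete_edges_doubleton subset_iff\<close>)
    also have "... \<le> (1 - q) ^ card Y"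
    proof (intro power_mono)
      have "exp (- lo) \<le> 1" "0 < exp (- hi)" using lo(1) by auto
      thus "0 \<le> 1 - (exp (- lo) - exp (- hi))" by linarith
    qed (use lo in simp)
    also have "... \<le> 1 - q * real (card Y) / 2" using lo q1 by (intro one_minus_power_le)
    finally show ?thesis .
  qed
  have "Pr (\<lambda>x. \<phi> x \<and> (\<forall>v\<in>?V. True) \<and> card {v\<in>?V. ?X v x} < y) * (1/2) ^ y
     \<le> Pr \<phi> * (\<Prod>v\<in>?V. Pr (\<lambda>x. True \<and> \<not> ?X v x) + (1/2) * Pr (\<lambda>x. True \<and> ?X v x))"
  proof (rule chernoff_lower[where H = "\<lambda>v. (\<lambda>a. {a, v}) ` Y"])
    show "(\<lambda>a. {a, u}) ` Y \<inter> (\<lambda>a. {a, v}) ` Y = {}" if "u \<in> ?V" "v \<in> ?V" "u \<noteq> v" for u v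
      using that X(1) by (auto simp: doubleton_eq_iff)
    show "(\<lambda>a. {a, v}) ` Y \<inter> G = {}" if "v \<in> ?V" for v
      using that \<phi>(3) by auto
  qed (use \<phi> H in auto)
  also have "... \<le> Pr \<phi> * (\<Prod>v\<in>?V. exp (- (q * real (card Y) / 4)))"
  proof (intro mult_left_mono prod_mono conjI)
    fix v assume v: "v \<in> ?V"
    have "Pr (?X v) = 1 - Pr (\<lambda>x. \<not> ?X v x)"
      using Pr_not[OF adm_not[OF adm_mono[OF H[OF v]]]] by simp
    hence "Pr (\<lambda>x. True \<and> \<not> ?X v x) + (1/2) * Pr (\<lambda>x. True \<and> ?X v x) = 1/2 + Pr (\<lambda>x. \<not> ?X v x) / 2" by (simp add: field_simps)
    also have "... \<le> 1 + - (q * real (card Y) / 4)" using pv[OF v] by simp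
    also have "... \<le> exp (- (q * real (card Y) / 4))" by (rule exp_ge_add_one_self)
    finally show "Pr (\<lambda>x. True \<and> \<not> ?X v x) + (1/2) * Pr (\<lambda>x. True \<and> ?X v x) \<le> exp (- (q * real (card Y) / 4))" .
  qed auto
  also have "(\<Prod>v\<in>?V. exp (- (q * real (card Y) / 4))) = exp (- (real (card ?V) * (q * real (card Y) / 4)))"
    by (simp add: exp_of_nat_mult[symmetric])
  also have "... \<le> exp (- (2 * \<mu>))"
  proof -
    have "card ?V = n - card X" using X by (subst card_Diff_subset) (auto intro: finite_subset)
    hence "real n / 2 \<le> real (card ?V)" using X(3) by linarith
    hence "real n / 2 * (q * real (card Y) / 4) \<le> real (card ?V) * (q * real (card Y) / 4)" using lo by (intro mult_right_mono) auto
    thus ?thesis by (simp add: \<mu>_def)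
  qed
  finally have "Pr (\<lambda>x. \<phi> x \<and> card {v\<in>?V. ?X v x} < y) * (1/2) ^ y \<le> Pr \<phi> * exp (- (2 * \<mu>))" by (simp add: mult_left_mono)
  hence "Pr (\<lambda>x. \<phi> x \<and> card {v\<in>?V. ?X v x} < y) * (1/2) ^ y * 2 ^ y \<le> Pr \<phi> * exp (- (2 * \<mu>)) * 2 ^ y" by (intro mult_right_mono) auto
  hence "Pr (\<lambda>x. \<phi> x \<and> card {v\<in>?V. ?X v x} < y) \<le> Pr \<phi> * exp (- (2 * \<mu>)) * 2 ^ y" by (simp add: power_divide)
  also have "... \<le> Pr \<phi> * exp (- (2 * \<mu>)) * (2 * exp \<mu>)" unfolding y_def using \<mu>0 by (intro mult_left_mono two_power_ceiling_le) auto
  also have "... = Pr \<phi> * (2 * exp (- \<mu>))" by (simp add: exp_add[symmetric])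
  finally show ?thesis unfolding hits_def \<mu>_def[symmetric] y_def less_real_iff_ceiling .
qed

lemma hits_prob_window:
  assumes X: "Y \<subseteq> X" "X \<subseteq> {..<n}" "2 * card X \<le> n"
    and g: "0 \<le> g" "4 * g \<le> real n" "g * real (card Y) \<le> 2 * real n" "n > 0"
    and \<phi>: "adm G \<phi>" "G \<subseteq> E" "\<And>e. e \<in> G \<Longrightarrow> e \<subseteq> X"
  shows "Pr (\<lambda>x. \<phi> x \<and> real (card (hits n x (g / real n) (2 * g / real n) Y X)) < g * real (card Y) / 32)
     \<le> Pr \<phi> * (2 * exp (- (g * real (card Y) / 32)))"
proof -
  have "g / real n / 2 \<le> exp (- (g / real n)) - exp (- (2 * (g / real n)))"
    by (rule window_mass) (use g in \<open>auto simp: field_simps\<close>)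
  moreover have "real n * (g / (2 * real n)) * real (card Y) / 16 = g * real (card Y) / 32" using g by simp
  ultimately show ?thesis using hits_prob[OF X _ _ _ _ _ \<phi>, of "g / real n" "2 * g / real n" "g / (2 * real n)"] g
    by (simp add: field_simps)
qed

lemma Pr_ex_subset:
  assumes "\<And>S. S \<subseteq> {..<n} \<Longrightarrow> card S = m \<Longrightarrow> adm E (\<phi> S)" "\<And>S. S \<subseteq> {..<n} \<Longrightarrow> card S = m \<Longrightarrow> Pr (\<phi> S) \<le> b" "0 \<le> b"
  shows "Pr (\<lambda>x. \<exists>S\<in>{S. S \<subseteq> {..<n} \<and> card S = m}. \<phi> S x) \<le> real n ^ m * b"
proof -
  let ?A = "{S. S \<subseteq> {..<n} \<and> card S = m}"
  have fin: "finite ?A" by simp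
  have "card ?A = n choose m" using n_subsets[of "{..<n}" m] by simp
  also have "... \<le> n ^ m" by (cases "m \<le> n") (auto intro: binomial_le_pow simp: binomial_eq_0)
  finally have c: "real (card ?A) \<le> real n ^ m" by (metis of_nat_le_iff of_nat_power)
  have "Pr (\<lambda>x. \<exists>S\<in>?A. \<phi> S x) \<le> (\<Sum>S\<in>?A. Pr (\<phi> S))" by (intro Pr_bex fin) (use assms in auto)
  also have "... \<le> real (card ?A) * b" using assms by (intro sum_bounded_above) auto
  also have "... \<le> real n ^ m * b" using c assms by (intro mult_right_mono)
  finally show ?thesis .
qed

end

definition spread :: "nat \<Rightarrow> real \<Rightarrow> weights \<Rightarrow> bool" where
  "spread n g w \<longleftrightarrow> (\<forall>S. S \<subseteq> {..<n} \<longrightarrow> S \<noteq> {} \<longrightarrow> g * real (card S) \<le> real n \<longrightarrow>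
     g * real (card S) / 32 \<le> real (card (hits n w (g / real n) (2 * g / real n) S S)))"

text \<open>There are at most n^m sets of size m, and g \<ge> 200 ln n makes each of them fail with
  probability at most 2 n^(-6m). The scale ln n is thus the price of uniformity over all
  sets.\<close>

lemma (in exp_graph) spread_prob:
  assumes g: "200 * ln (real n) \<le> g" "4 * g \<le> real n" "2 \<le> g" and n: "n \<ge> 2"
  shows "fails_at_most (spread n g) (2 * real n powr (- 4))"
proof -
  define bad where "bad S x \<longleftrightarrow> g * real (card S) \<le> real n \<and> real (card (hits n x (g / real n) (2 * g / real n) S S)) < g * real (card S) / 32" for S x
  define \<psi> where "\<psi> x \<longleftrightarrow> (\<exists>m\<in>{1..n}. \<exists>S\<in>{S. S \<subseteq> {..<n} \<and> card S = m}. bad S x)" for x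
  have admb: "adm E (bad S)" if "S \<subseteq> {..<n}" for S unfolding bad_def
    using that by (intro adm_conj adm_const adm_hits) auto
  have ln0: "0 < ln (real n)" using n by simp
  have "Pr \<psi> \<le> (\<Sum>m\<in>{1..n}. Pr (\<lambda>x. \<exists>S\<in>{S. S \<subseteq> {..<n} \<and> card S = m}. bad S x))"
    unfolding \<psi>_def by (intro Pr_bex adm_bex admb) auto
  also have "... \<le> (\<Sum>m\<in>{1..n}. 2 * real n powr (- 5))"
  proof (intro sum_mono)
    fix m assume m: "m \<in> {1..n}"
    have "Pr (\<lambda>x. \<exists>S\<in>{S. S \<subseteq> {..<n} \<and> card S = m}. bad S x) \<le> real n ^ m * (2 * real n powr (- 6 * real m))"
    proof (intro Pr_ex_subset admb)
      fix S assume S: "S \<subseteq> {..<n}" "card S = m"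
      show "Pr (bad S) \<le> 2 * real n powr (- 6 * real m)"
      proof (cases "g * real (card S) \<le> real n")
        case True
        have "2 * real m \<le> g * real m" using g by (intro mult_right_mono) auto
        moreover have "g * real m \<le> real n" using True S by simp
        ultimately have c: "2 * card S \<le> n" using S by linarith
        have "Pr (bad S) \<le> Pr (\<lambda>x. True) * (2 * exp (- (g * real (card S) / 32)))"
        proof -
          have "Pr (bad S) = Pr (\<lambda>x. True \<and> real (card (hits n x (g / real n) (2 * g / real n) S S)) < g * real (card S) / 32)"
            using True by (intro Pr_cong) (simp only: bad_def simp_thms)
          also have "... \<le> Pr (\<lambda>x. True) * (2 * exp (- (g * real (card S) / 32)))"
            by (rule hits_prob_window[where G = "{}"]) (use S c g n True in auto)
          finally show ?thesis .
        qed
        also have "... \<le> 2 * exp (- (6 * ln (real n) * real m))"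
        proof -
          have "6 * ln (real n) * real m \<le> g / 32 * real m" using g ln0 by (intro mult_right_mono) auto
          thus ?thesis using S by simp
        qed
        also have "exp (- (6 * ln (real n) * real m)) = real n powr (- 6 * real m)" using n by (simp add: powr_def)
        finally show ?thesis .
      next
        case False
        hence "bad S = (\<lambda>x. False)" by (auto simp: bad_def fun_eq_iff)
        thus ?thesis by simp
      qed
    qed auto
    also have "... = 2 * real n powr (- 5 * real m)" using n by (simp add: powr_realpow[symmetric] powr_add[symmetric])
    also have "... \<le> 2 * real n powr (- 5)" using m n by (intro mult_left_mono powr_mono) auto
    finally show "Pr (\<lambda>x. \<exists>S\<in>{S. S \<subseteq> {..<n} \<and> card S = m}. bad S x) \<le> 2 * real n powr (- 5)" .
  qed
  also have "... = 2 * (real n powr 1 * real n powr (- 5))" using n by simp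
  also have "... = 2 * real n powr (- 4)" by (subst powr_add[symmetric]) simp
  finally have "Pr \<psi> \<le> 2 * real n powr (- 4)" .
  moreover have "adm E \<psi>" unfolding \<psi>_def by (intro adm_bex admb) auto
  moreover have "\<psi> x" if ns: "\<not> spread n g x" for x
  proof -
    obtain S where S: "S \<subseteq> {..<n}" "S \<noteq> {}" "bad S x" using ns unfolding spread_def bad_def by (meson not_le)
    have "card S \<in> {1..n}" using S card_mono[of "{..<n}" S] finite_subset[of S "{..<n}"] by (auto simp: Suc_le_eq card_gt_0_iff)
    thus ?thesis unfolding \<psi>_def using S by blast
  qed
  ultimately show ?thesis by blast
qed

definition joined :: "nat \<Rightarrow> real \<Rightarrow> real \<Rightarrow> weights \<Rightarrow> bool" where
  "joined n \<rho> g w \<longleftrightarrow> (\<forall>S T. S \<subseteq> {..<n} \<longrightarrow> T \<subseteq> {..<n} \<longrightarrow> S \<inter> T = {} \<longrightarrow> \<rho> * real n \<le> real (card S) \<longrightarrow> \<rho> * real n \<le> real (card T) \<longrightarrow>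
     \<rho>\<^sup>2 * real n * g / 8 \<le> real (card {p\<in>S \<times> T. g / real n < w {fst p, snd p} \<and> w {fst p, snd p} \<le> 2 * g / real n}))"

text \<open>The condition 24 \<le> \<rho>^2 g makes the exponent at least 3n, against at most 4^n
  \<le> exp(2n) pairs of sets.\<close>

lemma (in exp_graph) joined_prob:
  assumes \<rho>: "0 < \<rho>" and g: "24 \<le> \<rho>\<^sup>2 * g" "4 * g \<le> real n" "0 < g" and n: "n \<ge> 1"
  shows "fails_at_most (joined n \<rho> g) (2 * exp (- real n))"
proof -
  let ?X = "\<lambda>p x. g / real n < x {fst p, snd p} \<and> x {fst p, snd p} \<le> 2 * g / real n"
  define \<mu> where "\<mu> = \<rho>\<^sup>2 * real n * g / 8"
  have \<mu>0: "0 \<le> \<mu>" using g by (simp add: \<mu>_def)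
  define A where "A = {(S, T). S \<subseteq> {..<n} \<and> T \<subseteq> {..<n} \<and> S \<inter> T = {} \<and> \<rho> * real n \<le> real (card S) \<and> \<rho> * real n \<le> real (card T)}"
  have Asub: "A \<subseteq> Pow {..<n} \<times> Pow {..<n}" by (auto simp: A_def)
  have finA: "finite A" by (rule finite_subset[OF Asub]) auto
  define bad where "bad R x \<longleftrightarrow> real (card {p\<in>fst R \<times> snd R. ?X p x}) < \<mu>" for R :: "nat set \<times> nat set" and x
  have e: "{a, b} \<in> E" if "(S, T) \<in> A" "a \<in> S" "b \<in> T" for S T a b
    using that by (auto simp: A_def complete_edges_doubleton)
  have admb: "adm E (bad R)" if "R \<in> A" for R unfolding bad_def
  proof (intro adm_card)
    have "fst R \<subseteq> {..<n}" "snd R \<subseteq> {..<n}" using that by (auto simp: A_def)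
    thus "finite (fst R \<times> snd R)" by (intro finite_cartesian_product) (auto intro: finite_subset)
    show "adm E (?X p)" if "p \<in> fst R \<times> snd R" for p
      using e[of "fst R" "snd R" "fst p" "snd p"] that \<open>R \<in> A\<close> by (intro adm_conj) auto
  qed
  have prb: "Pr (bad R) \<le> 2 * exp (- \<mu>)" if R: "R \<in> A" for R
  proof -
    obtain S T where ST: "R = (S, T)" by force
    define y where "y = nat \<lceil>\<mu>\<rceil>"
    have "S \<subseteq> {..<n}" "T \<subseteq> {..<n}" using R by (auto simp: A_def ST)
    hence fin: "finite (S \<times> T)" by (intro finite_cartesian_product) (auto intro: finite_subset)
    have "Pr (\<lambda>x. True \<and> (\<forall>p\<in>S \<times> T. True) \<and> card {p\<in>S \<times> T. ?X p x} < y) * (1/2) ^ y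
      \<le> Pr (\<lambda>x. True) * (\<Prod>p\<in>S \<times> T. Pr (\<lambda>x. True \<and> \<not> ?X p x) + (1/2) * Pr (\<lambda>x. True \<and> ?X p x))"
    proof (rule chernoff_lower[where H = "\<lambda>p. {{fst p, snd p}}" and G = "{}"])
      show "{{fst u, snd u}} \<inter> {{fst v, snd v}} = {}" if "u \<in> S \<times> T" "v \<in> S \<times> T" "u \<noteq> v" for u v
        using that R by (auto simp: A_def ST doubleton_eq_iff prod_eq_iff)
    qed (use fin e R in \<open>auto simp: ST adm_const\<close>)
    also have "... \<le> Pr (\<lambda>x. True) * (\<Prod>p\<in>S \<times> T. exp (- (g / (4 * real n))))"
    proof (intro mult_left_mono prod_mono conjI)
      fix p assume p: "p \<in> S \<times> T"
      have "{fst p, snd p} \<in> E" using e R p by (auto simp: ST)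
      hence pw: "Pr (?X p) = exp (- (g / real n)) - exp (- (2 * (g / real n)))" "Pr (\<lambda>x. \<not> ?X p x) = 1 - Pr (?X p)"
        using g n Pr_window[of "{fst p, snd p}" "g / real n" "2 * g / real n"] Pr_not_window[of "{fst p, snd p}" "g / real n" "2 * g / real n"]
        by (auto simp: field_simps)
      have "g / real n / 2 \<le> Pr (?X p)" unfolding pw by (rule window_mass) (use g n in \<open>auto simp: field_simps\<close>)
      hence "Pr (\<lambda>x. True \<and> \<not> ?X p x) + (1/2) * Pr (\<lambda>x. True \<and> ?X p x) \<le> 1 + - (g / (4 * real n))" using pw(2) by simp
      also have "... \<le> exp (- (g / (4 * real n)))" by (rule exp_ge_add_one_self)
      finally show "Pr (\<lambda>x. True \<and> \<not> ?X p x) + (1/2) * Pr (\<lambda>x. True \<and> ?X p x) \<le> exp (- (g / (4 * real n)))" .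
    qed auto
    also have "... = exp (- (real (card S) * real (card T) * (g / (4 * real n))))"
      by (simp add: exp_of_nat_mult[symmetric] card_cartesian_product)
    also have "... \<le> exp (- (2 * \<mu>))"
    proof -
      have "(\<rho> * real n) * (\<rho> * real n) \<le> real (card S) * real (card T)"
        using R \<rho> by (intro mult_mono) (auto simp: A_def ST)
      hence "(\<rho> * real n) * (\<rho> * real n) * (g / (4 * real n)) \<le> real (card S) * real (card T) * (g / (4 * real n))" using g by (intro mult_right_mono) auto
      moreover have "(\<rho> * real n) * (\<rho> * real n) * (g / (4 * real n)) = 2 * \<mu>" using n by (simp add: \<mu>_def power2_eq_square)
      ultimately show ?thesis by simp
    qed
    finally have "Pr (bad R) * (1/2) ^ y \<le> exp (- (2 * \<mu>))" unfolding bad_def ST y_def less_real_iff_ceiling by simp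
    hence "Pr (bad R) * (1/2) ^ y * 2 ^ y \<le> exp (- (2 * \<mu>)) * 2 ^ y" by (intro mult_right_mono) auto
    hence "Pr (bad R) \<le> exp (- (2 * \<mu>)) * 2 ^ y" by (simp add: power_divide)
    also have "... \<le> exp (- (2 * \<mu>)) * (2 * exp \<mu>)" unfolding y_def using \<mu>0 by (intro mult_left_mono two_power_ceiling_le) auto
    also have "... = 2 * exp (- \<mu>)" by (simp add: exp_add[symmetric])
    finally show ?thesis .
  qed
  have "card A \<le> card (Pow {..<n} \<times> Pow {..<n})" by (rule card_mono[OF _ Asub]) auto
  also have "... = 4 ^ n" by (simp add: card_cartesian_product card_Pow power_mult_distrib[symmetric])
  finally have cA: "real (card A) \<le> 4 ^ n" by (metis of_nat_le_iff of_nat_numeral of_nat_power)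
  have "Pr (\<lambda>x. \<exists>R\<in>A. bad R x) \<le> (\<Sum>R\<in>A. Pr (bad R))" by (intro Pr_bex finA admb)
  also have "... \<le> real (card A) * (2 * exp (- \<mu>))" by (intro sum_bounded_above prb)
  also have "... \<le> 4 ^ n * (2 * exp (- \<mu>))" using cA by (intro mult_right_mono) auto
  also have "... \<le> exp (2 * real n) * (2 * exp (- (3 * real n)))"
  proof (rule mult_mono)
    have "2 * 2 \<le> exp 1 * exp (1 :: real)" using exp_ge_add_one_self[of "1 :: real"] by (intro mult_mono) auto
    hence "(4 :: real) \<le> exp 2" by (simp add: exp_add[symmetric])
    hence "(4 :: real) ^ n \<le> exp 2 ^ n" by (intro power_mono) auto
    thus "4 ^ n \<le> exp (2 * real n)" by (simp add: exp_of_nat_mult[symmetric] mult.commute)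
    have "24 * real n / 8 \<le> (\<rho>\<^sup>2 * g) * real n / 8" using g by (intro divide_right_mono mult_right_mono) auto
    thus "2 * exp (- \<mu>) \<le> 2 * exp (- (3 * real n))" by (simp add: \<mu>_def mult_ac)
  qed auto
  also have "... = 2 * exp (- real n)" by (simp add: exp_add[symmetric])
  finally have "Pr (\<lambda>x. \<exists>R\<in>A. bad R x) \<le> 2 * exp (- real n)" .
  moreover have "adm E (\<lambda>x. \<exists>R\<in>A. bad R x)" by (intro adm_bex finA admb)
  moreover have "\<exists>R\<in>A. bad R x" if nj: "\<not> joined n \<rho> g x" for x
  proof -
    obtain S T where "S \<subseteq> {..<n}" "T \<subseteq> {..<n}" "S \<inter> T = {}" "\<rho> * real n \<le> real (card S)" "\<rho> * real n \<le> real (card T)"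
      and c: "\<not> \<mu> \<le> real (card {p\<in>S \<times> T. ?X p x})" using nj unfolding joined_def \<mu>_def[symmetric] by blast
    hence "(S, T) \<in> A" by (simp add: A_def)
    moreover have "bad (S, T) x" using c by (simp only: bad_def fst_conv snd_conv not_le)
    ultimately show ?thesis by blast
  qed
  ultimately show ?thesis by blast
qed

text \<open>The cut-offs leave so few unsuitable neighbours that two vertices keep a common suitable
  one even after used edges are removed. The lower cut-off serves the removal: used edges heavier
  than 1/16 are limited by their total cost.\<close>

definition deg_ok :: "nat \<Rightarrow> weights \<Rightarrow> bool" where
  "deg_ok n w \<longleftrightarrow> (\<forall>u<n. real (card {x\<in>{..<n} - {u}. \<not> (1 / 16 < w {u, x} \<and> w {u, x} \<le> 3)}) < real n / 4)"

lemma (in exp_graph) deg_prob: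
  assumes n: "n \<ge> 1"
  shows "fails_at_most (deg_ok n) (real n * exp (- (real n / 20)))"
proof -
  let ?X = "\<lambda>u v x. \<not> (1 / 16 < x {u, v} \<and> x {u, v} \<le> (3 :: real))"
  define y where "y = nat \<lceil>real n / 4\<rceil>"
  define bad where "bad u x \<longleftrightarrow> y \<le> card {v\<in>{..<n} - {u}. ?X u v x}" for u x
  have admb: "adm E (bad u)" if "u \<in> {..<n}" for u unfolding bad_def
    using that by (intro adm_card adm_not adm_conj adm_gt adm_le) (auto simp: complete_edges_doubleton)
  have prb: "Pr (bad u) \<le> exp (- (real n / 20))" if u: "u \<in> {..<n}" for u
  proof -
    have "Pr (bad u) * 2 ^ y \<le> (\<Prod>v\<in>{..<n} - {u}. 1 + (2 - 1) * Pr (?X u v))"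
      unfolding bad_def
    proof (rule chernoff_upper[where H = "\<lambda>v. {{u, v}}"])
      show "adm {{u, v}} (?X u v)" for v by (intro adm_not adm_conj adm_gt adm_le) auto
    qed (use u in \<open>auto simp: complete_edges_doubleton doubleton_eq_iff\<close>)
    \<comment> \<open>The excluded probability is at most 1/16 + 53/1000 < 29/250, and 29/250 < 1/6
      \<le> (ln 2)/4 makes the quotient by 2^(n/4) decay.\<close>
    also have "... \<le> (\<Prod>v\<in>{..<n} - {u}. exp (29 / 250))"
    proof (intro prod_mono conjI)
      fix v assume v: "v \<in> {..<n} - {u}"
      have "Pr (?X u v) = 1 - (exp (- (1/16)) - exp (- 3))"
        using v u by (intro Pr_not_window) (auto simp: complete_edges_doubleton)
      moreover have "1 - 1/16 \<le> exp (- (1/16) :: real)" using exp_ge_add_one_self[of "- (1/16) :: real"] by simp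
      moreover have "exp (- 3 :: real) \<le> 53 / 1000"
      proof -
        have e1: "2.67 \<le> exp (1 :: real)" using exp_lower_Taylor_quadratic[of "1/4 :: real"]
        proof -
          have "1.28 \<le> exp (1/4 :: real)" using exp_lower_Taylor_quadratic[of "1/4 :: real"] by (simp add: power2_eq_square)
          hence "1.28 ^ 4 \<le> exp (1/4 :: real) ^ 4" by (intro power_mono) auto
          also have "... = exp 1" by (simp add: exp_of_nat_mult[symmetric])
          finally show ?thesis by (simp add: eval_nat_numeral)
        qed
        have "2.67 ^ 3 \<le> exp (1 :: real) ^ 3" using e1 by (intro power_mono) auto
        also have "... = exp 3" by (simp add: exp_of_nat_mult[symmetric])
        finally have "1000 / 53 \<le> exp (3 :: real)" by (simp add: eval_nat_numeral)
        thus ?thesis by (simp add: exp_minus field_simps)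
      qed
      ultimately have "1 + (2 - 1) * Pr (?X u v) \<le> 1 + 29 / 250" by simp
      also have "... \<le> exp (29 / 250)" by (rule exp_ge_add_one_self)
      finally show "1 + (2 - 1) * Pr (?X u v) \<le> exp (29 / 250)" .
    qed auto
    also have "... \<le> exp (29 / 250 * real n)"
      using u n by (auto simp: exp_of_nat_mult[symmetric])
    finally have a: "Pr (bad u) * 2 ^ y \<le> exp (29 / 250 * real n)" .
    have "real n / 4 * (2 / 3) \<le> real n / 4 * ln 2" by (intro mult_left_mono ln2_ge_two_thirds) auto
    hence "exp (real n / 6) \<le> exp (real n / 4 * ln 2)" by simp
    also have "... = 2 powr (real n / 4)" by (simp add: powr_def)
    also have "... \<le> 2 powr real y" unfolding y_def by (intro powr_mono) linarith+
    also have "... = 2 ^ y" by (simp add: powr_realpow)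
    finally have "Pr (bad u) * exp (real n / 6) \<le> Pr (bad u) * 2 ^ y" by (intro mult_left_mono) auto
    hence "Pr (bad u) * exp (real n / 6) \<le> exp (29 / 250 * real n)" using a by linarith
    hence "Pr (bad u) * exp (real n / 6) * exp (- (real n / 6)) \<le> exp (29 / 250 * real n) * exp (- (real n / 6))" by (intro mult_right_mono) auto
    moreover have "exp (real n / 6) * exp (- (real n / 6)) = 1" by (simp add: exp_add[symmetric])
    ultimately have "Pr (bad u) \<le> exp (29 / 250 * real n) * exp (- (real n / 6))" by (simp only: mult.assoc mult_1_right)
    also have "... = exp (29 / 250 * real n + - (real n / 6))" by (simp only: exp_add)
    also have "... \<le> exp (- (real n / 20))" by simp
    finally show ?thesis .
  qed
  have "Pr (\<lambda>x. \<exists>u\<in>{..<n}. bad u x) \<le> (\<Sum>u\<in>{..<n}. Pr (bad u))" by (intro Pr_bex admb) auto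
  also have "... \<le> real (card {..<n}) * exp (- (real n / 20))" by (intro sum_bounded_above prb)
  finally have "Pr (\<lambda>x. \<exists>u\<in>{..<n}. bad u x) \<le> real n * exp (- (real n / 20))" by simp
  moreover have "adm E (\<lambda>x. \<exists>u\<in>{..<n}. bad u x)" by (intro adm_bex admb) auto
  moreover have "\<exists>u\<in>{..<n}. bad u x" if "\<not> deg_ok n x" for x
    using that unfolding deg_ok_def bad_def y_def less_real_iff_ceiling by (auto simp: not_less)
  ultimately show ?thesis by blast
qed

definition attached :: "nat \<Rightarrow> real \<Rightarrow> nat set \<Rightarrow> nat set \<Rightarrow> weights \<Rightarrow> bool" where
  "attached n L Z Y w \<longleftrightarrow> (\<forall>y\<in>Y. \<exists>z\<in>Z. w {z, y} \<le> L / real n)"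

text \<open>Expansion at a scale \<open>g\<close> that may be a small multiple of ln n, too small
  for \<open>spread\<close>. Counting all sets \<open>Y\<close> of size \<open>m\<close> costs n^m,
  but being attached to \<open>Z\<close> has probability about (zL/n)^m, so only n^z (zL)^m is
  paid.\<close>

definition local_spread :: "nat \<Rightarrow> real \<Rightarrow> real \<Rightarrow> nat \<Rightarrow> nat \<Rightarrow> weights \<Rightarrow> bool" where
  "local_spread n L g z m w \<longleftrightarrow> (\<forall>Z Y. Z \<subseteq> {..<n} \<longrightarrow> Y \<subseteq> {..<n} \<longrightarrow> card Z = z \<longrightarrow> card Y = m \<longrightarrow> Z \<inter> Y = {} \<longrightarrow> attached n L Z Y w \<longrightarrow>
     g * real m / 32 \<le> real (card (hits n w (g / real n) (2 * g / real n) Y (Z \<union> Y))))"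

context exp_graph
begin

lemma adm_attached:
  assumes "Z \<subseteq> {..<n}" "Y \<subseteq> {..<n}" "Z \<inter> Y = {}"
  shows "adm ((\<lambda>(z, y). {z, y}) ` (Z \<times> Y)) (attached n L Z Y)" "(\<lambda>(z, y). {z, y}) ` (Z \<times> Y) \<subseteq> E"
proof -
  have "finite Y" "finite Z" using assms finite_subset by blast+
  thus "adm ((\<lambda>(z, y). {z, y}) ` (Z \<times> Y)) (attached n L Z Y)" unfolding attached_def by (intro adm_ball adm_bex adm_le) auto
  show "(\<lambda>(z, y). {z, y}) ` (Z \<times> Y) \<subseteq> E" using assms by (auto simp: complete_edges_doubleton)
qed

lemma Pr_attached:
  assumes Z: "Z \<subseteq> {..<n}" "Y \<subseteq> {..<n}" "Z \<inter> Y = {}" and L: "0 \<le> L"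
  shows "Pr (attached n L Z Y) \<le> (real (card Z) * L / real n) ^ card Y"
proof -
  have fin: "finite Y" "finite Z" using Z finite_subset by blast+
  have "Pr (attached n L Z Y) = (\<Prod>y\<in>Y. Pr (\<lambda>x. \<exists>z\<in>Z. x {z, y} \<le> L / real n))"
    unfolding attached_def
  proof (rule Pr_indep_ball[where G = "\<lambda>y. (\<lambda>z. {z, y}) ` Z"])
    show "(\<lambda>z. {z, u}) ` Z \<inter> (\<lambda>z. {z, v}) ` Z = {}" if "u \<in> Y" "v \<in> Y" "u \<noteq> v" for u v
      using that Z by (auto simp: doubleton_eq_iff)
    show "(\<lambda>z. {z, v}) ` Z \<subseteq> E" if "v \<in> Y" for v using that Z by (auto simp: complete_edges_doubleton)
  qed (use fin in auto)
  also have "... \<le> (\<Prod>y\<in>Y. real (card Z) * L / real n)"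
  proof (intro prod_mono conjI)
    fix y assume y: "y \<in> Y"
    have e: "{z, y} \<in> E" if "z \<in> Z" for z using that y Z by (auto simp: complete_edges_doubleton)
    have "Pr (\<lambda>x. \<exists>z\<in>Z. x {z, y} \<le> L / real n) \<le> (\<Sum>z\<in>Z. Pr (\<lambda>x. x {z, y} \<le> L / real n))" using fin e by (intro Pr_bex) auto
    also have "... \<le> real (card Z) * (L / real n)"
    proof (intro sum_bounded_above)
      fix z assume "z \<in> Z"
      hence "Pr (\<lambda>x. x {z, y} \<le> L / real n) = 1 - exp (- (L / real n))" using L e by (intro Pr_le) auto
      also have "... \<le> L / real n" using exp_ge_add_one_self[of "- (L / real n)"] by linarith
      finally show "Pr (\<lambda>x. x {z, y} \<le> L / real n) \<le> L / real n" .
    qed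
    finally show "Pr (\<lambda>x. \<exists>z\<in>Z. x {z, y} \<le> L / real n) \<le> real (card Z) * L / real n" by simp
  qed auto
  finally show ?thesis by simp
qed

text \<open>Attachment depends on edges between \<open>Z\<close> and \<open>Y\<close>, the hits on
  edges from \<open>Y\<close> to the outside of \<open>Z \<union> Y\<close>; these are independent,
  so the two probabilities multiply.\<close>

lemma local_spread_prob:
  assumes L: "0 \<le> L" and g: "0 \<le> g" "4 * g \<le> real n" "g * real m \<le> 2 * real n" and zm: "2 * (z + m) \<le> n" and n: "n > 0"
  shows "fails_at_most (local_spread n L g z m) (real n ^ z * (real z * L) ^ m * (2 * exp (- (g * real m / 32))))"
proof -
  define bad where "bad Z Y x \<longleftrightarrow> Z \<inter> Y = {} \<and> attached n L Z Y x \<and>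
    real (card (hits n x (g / real n) (2 * g / real n) Y (Z \<union> Y))) < g * real (card Y) / 32" for Z Y x
  define \<psi> where "\<psi> x \<longleftrightarrow> (\<exists>Z\<in>{Z. Z \<subseteq> {..<n} \<and> card Z = z}. \<exists>Y\<in>{Y. Y \<subseteq> {..<n} \<and> card Y = m}. bad Z Y x)" for x
  have admb: "adm E (bad Z Y)" if "Z \<subseteq> {..<n}" "Y \<subseteq> {..<n}" for Z Y
  proof (cases "Z \<inter> Y = {}")
    case True
    from adm_mono[OF adm_attached[OF that True]] show ?thesis unfolding bad_def
      using that by (intro adm_conj adm_const adm_hits) auto
  next
    case False
    hence "bad Z Y = (\<lambda>x. False)" by (auto simp: bad_def fun_eq_iff)
    thus ?thesis by (simp add: adm_const)
  qed
  let ?b = "(real z * L / real n) ^ m * (2 * exp (- (g * real m / 32)))"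
  have b0: "0 \<le> ?b" using L by auto
  have prb: "Pr (bad Z Y) \<le> ?b"
    if Z: "Z \<subseteq> {..<n}" "card Z = z" and Y: "Y \<subseteq> {..<n}" "card Y = m" for Z Y
  proof (cases "Z \<inter> Y = {}")
    case True
    have "card (Z \<union> Y) \<le> z + m" using Z Y card_Un_le by metis
    hence "Pr (bad Z Y) \<le> Pr (attached n L Z Y) * (2 * exp (- (g * real (card Y) / 32)))"
      using hits_prob_window[of Y "Z \<union> Y" g _ "attached n L Z Y", OF _ _ _ _ _ _ _ adm_attached[OF Z(1) Y(1) True]] Z Y zm g n True
      unfolding bad_def by auto
    also have "... \<le> ?b" using Pr_attached[OF Z(1) Y(1) True L] Z Y L by (intro mult_mono) (auto intro!: zero_le_power)
    finally show ?thesis .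
  next
    case False
    hence "bad Z Y = (\<lambda>x. False)" by (auto simp: bad_def fun_eq_iff)
    thus ?thesis using b0 by simp
  qed
  have "Pr \<psi> \<le> real n ^ z * (real n ^ m * ?b)" unfolding \<psi>_def
    by (intro Pr_ex_subset prb admb adm_bex) (use b0 in auto)
  also have "... = real n ^ z * (real z * L) ^ m * (2 * exp (- (g * real m / 32)))"
    using n by (simp add: power_divide)
  finally have "Pr \<psi> \<le> real n ^ z * (real z * L) ^ m * (2 * exp (- (g * real m / 32)))" .
  moreover have "adm E \<psi>" unfolding \<psi>_def by (intro adm_bex admb) auto
  moreover have "\<psi> x" if "\<not> local_spread n L g z m x" for x
    using that unfolding local_spread_def \<psi>_def bad_def by (auto simp: not_le)
  ultimately show ?thesis by blast
qed

end

section \<open>First passage percolation in discrete time\<close>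

text \<open>
  First passage percolation started from \<open>S\<close> inside \<open>V\<close> in discrete time: \<open>hist j\<close> lists the sets of
  vertices reached by the times \<open>tm 0, ..., tm j\<close>. Edges lighter than \<open>\<theta>\<close> are never used.
\<close>

definition hit :: "(nat \<Rightarrow> real) \<Rightarrow> real \<Rightarrow> weights \<Rightarrow> nat set list \<Rightarrow> nat \<Rightarrow> nat \<Rightarrow> bool" where
  "hit tm \<theta> w h j v \<longleftrightarrow> (\<exists>i<length h. \<exists>a\<in>h ! i. \<theta> < w {a, v} \<and> w {a, v} \<le> tm j - tm i)"

definition nxt :: "(nat \<Rightarrow> real) \<Rightarrow> real \<Rightarrow> nat set \<Rightarrow> weights \<Rightarrow> nat set list \<Rightarrow> nat set" where
  "nxt tm \<theta> V w h = {v\<in>V - \<Union>(set h). hit tm \<theta> w h (length h) v}"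

primrec hist :: "(nat \<Rightarrow> real) \<Rightarrow> real \<Rightarrow> nat set \<Rightarrow> nat set \<Rightarrow> nat \<Rightarrow> weights \<Rightarrow> nat set list" where
  "hist tm \<theta> V S 0 w = [S]"
| "hist tm \<theta> V S (Suc j) w = hist tm \<theta> V S j w @ [nxt tm \<theta> V w (hist tm \<theta> V S j w)]"

lemma length_hist [simp]: "length (hist tm \<theta> V S j w) = Suc j"
  by (induction j) auto

lemma hist_subset: "set (hist tm \<theta> V S j w) \<subseteq> Pow (S \<union> V)"
  by (induction j) (auto simp: nxt_def)

lemma Union_hist_Suc: "\<Union>(set (hist tm \<theta> V S (Suc j) w)) = \<Union>(set (hist tm \<theta> V S j w)) \<union> nxt tm \<theta> V w (hist tm \<theta> V S j w)"
  by auto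

lemma Union_hist_mono: "i \<le> j \<Longrightarrow> \<Union>(set (hist tm \<theta> V S i w)) \<subseteq> \<Union>(set (hist tm \<theta> V S j w))"
proof (induction j)
  case (Suc j)
  show ?case
  proof (cases "i = Suc j")
    case False
    hence "\<Union>(set (hist tm \<theta> V S i w)) \<subseteq> \<Union>(set (hist tm \<theta> V S j w))" using Suc by simp
    thus ?thesis unfolding Union_hist_Suc by blast
  qed blast
qed simp

lemma card_Union_hist_Suc:
  assumes "finite S" "finite V"
  shows "card (\<Union>(set (hist tm \<theta> V S (Suc j) w))) = card (\<Union>(set (hist tm \<theta> V S j w))) + card (nxt tm \<theta> V w (hist tm \<theta> V S j w))"
  unfolding Union_hist_Suc
proof (rule card_Un_disjoint)
  have "\<Union>(set (hist tm \<theta> V S j w)) \<subseteq> S \<union> V" using hist_subset[of tm \<theta> V S j w] by auto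
  thus "finite (\<Union>(set (hist tm \<theta> V S j w)))" using assms by (meson finite_UnI finite_subset)
qed (use assms in \<open>auto simp: nxt_def\<close>)

lemma take_hist: "take (Suc i) (hist tm \<theta> V S j w) = hist tm \<theta> V S i w" if "i \<le> j"
  using that by (induction j) (auto simp: le_Suc_eq)

text \<open>Disjointness of the levels makes the edges between the explored set and an outside vertex distinct.\<close>

definition valid_hist :: "nat set \<Rightarrow> nat set \<Rightarrow> nat set list \<Rightarrow> bool" where
  "valid_hist S V h \<longleftrightarrow> (\<forall>i<length h. h ! i \<subseteq> S \<union> V) \<and> (\<forall>i<length h. \<forall>i'<length h. i \<noteq> i' \<longrightarrow> h ! i \<inter> h ! i' = {})"

lemma valid_hist_append:
  assumes "valid_hist S V h" "X \<subseteq> V" "X \<inter> \<Union>(set h) = {}"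
  shows "valid_hist S V (h @ [X])"
proof -
  have "h ! i \<inter> X = {}" if "i < length h" for i using assms(3) that nth_mem by blast
  thus ?thesis using assms unfolding valid_hist_def by (auto simp: nth_append less_Suc_eq)
qed

lemma valid_hist_hist: "valid_hist S V (hist tm \<theta> V S j w)"
proof (induction j)
  case (Suc j)
  show ?case unfolding hist.simps by (rule valid_hist_append[OF Suc]) (auto simp: nxt_def)
qed (auto simp: valid_hist_def)

section \<open>Conditional independence given the explored history\<close>

context exp_graph
begin

definition edges_in :: "nat set \<Rightarrow> nat set set" where
  "edges_in B = {e\<in>E. e \<subseteq> B}"

text \<open>The Markov property of the exploration: the event that the history is \<open>h\<close>
  splits into an event on edges inside the explored set and, for each outside vertex, the event that
  no explored vertex has reached it yet. Given the history, the edges to different outside vertices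
  therefore stay independent.\<close>

lemma hist_factor:
  assumes inc: "incseq tm" and \<theta>: "0 \<le> \<theta>" and SV: "S \<subseteq> {..<n}" "V \<subseteq> {..<n}" "S \<inter> V = {}"
    and len: "length h = Suc j"
  shows "\<exists>\<phi>. adm (edges_in (\<Union>(set h))) \<phi> \<and> (\<forall>w. hist tm \<theta> V S j w = h \<longleftrightarrow> \<phi> w \<and> (\<forall>v\<in>V - \<Union>(set h). \<not> hit tm \<theta> w h j v))"
  using len
proof (induction j arbitrary: h)
  case 0
  then obtain X where h: "h = [X]" by (cases h) auto
  have "\<not> hit tm \<theta> w [X] 0 v" for w v using \<theta> by (auto simp: hit_def)
  thus ?case unfolding h by (intro exI[of _ "\<lambda>w. S = X"]) (auto simp: adm_const)
next
  case (Suc j)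
  define h' where "h' = butlast h"
  define X where "X = last h"
  have h: "h = h' @ [X]" using Suc.prems by (auto simp: h'_def X_def intro!: append_butlast_last_id[symmetric])
  have len': "length h' = Suc j" using Suc.prems by (simp add: h)
  let ?B = "\<Union>(set h')"
  obtain \<phi> where \<phi>: "adm (edges_in ?B) \<phi>" "\<And>w. hist tm \<theta> V S j w = h' \<longleftrightarrow> \<phi> w \<and> (\<forall>v\<in>V - ?B. \<not> hit tm \<theta> w h' j v)"
    using Suc.IH[OF len'] by blast
  have mono: "hit tm \<theta> w h' (Suc j) v" if "hit tm \<theta> w h' j v" for w v
    using that inc unfolding hit_def by (meson diff_right_mono incseq_SucD order_trans)
  \<comment> \<open>The newest level has age 0 at this time and \<open>\<theta> \<ge> 0\<close>, so
    it contributes no hit and the shorter history decides.\<close>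
  have last: "hit tm \<theta> w h (Suc j) v \<longleftrightarrow> hit tm \<theta> w h' (Suc j) v" for w v
    using \<theta> len' unfolding hit_def h by (auto simp: less_Suc_eq nth_append)
  show ?case
  proof (cases "X \<subseteq> V - ?B \<and> ?B \<subseteq> S \<union> V")
    case False
    have "hist tm \<theta> V S (Suc j) w \<noteq> h" for w
    proof
      assume eq: "hist tm \<theta> V S (Suc j) w = h"
      hence "hist tm \<theta> V S j w = h'" "X = nxt tm \<theta> V w h'" by (auto simp: h)
      thus False using False hist_subset[of tm \<theta> V S j w] by (auto simp: nxt_def)
    qed
    thus ?thesis by (intro exI[of _ "\<lambda>w. False"]) (auto simp: adm_const simp del: hist.simps)
  next
    case True
    define \<psi> where "\<psi> w \<longleftrightarrow> \<phi> w \<and> (\<forall>v\<in>X. \<not> hit tm \<theta> w h' j v \<and> hit tm \<theta> w h' (Suc j) v)" for w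
    have fin: "finite X" "\<And>i. i < length h' \<Longrightarrow> finite (h' ! i)"
    proof -
      show "finite X" using True SV by (meson Diff_subset finite_lessThan finite_subset)
      show "finite (h' ! i)" if "i < length h'" for i
      proof -
        have "h' ! i \<subseteq> {..<n}" using True SV nth_mem[OF that] by blast
        thus ?thesis by (rule finite_subset) simp
      qed
    qed
    have "adm (edges_in (\<Union>(set h))) (\<lambda>w. hit tm \<theta> w h' i v)" if v: "v \<in> X" for v i
      unfolding hit_def
    proof (intro adm_ex_less adm_bex adm_conj adm_gt adm_le fin(2))
      fix i a assume ia: "i < length h'" "a \<in> h' ! i"
      have "a \<in> ?B" using ia nth_mem by blast
      moreover have "a < n" "v < n" using calculation v True SV by blast+
      moreover have "a \<noteq> v" using calculation v True by blast
      ultimately show "{a, v} \<in> edges_in (\<Union>(set h))" "{a, v} \<in> edges_in (\<Union>(set h))"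
        using v by (auto simp: edges_in_def h complete_edges_doubleton)
    qed
    moreover have "adm (edges_in (\<Union>(set h))) \<phi>" by (rule adm_mono[OF \<phi>(1)]) (auto simp: edges_in_def h)
    ultimately have "adm (edges_in (\<Union>(set h))) \<psi>" unfolding \<psi>_def by (intro adm_conj adm_ball adm_not fin) auto
    moreover have "hist tm \<theta> V S (Suc j) w = h \<longleftrightarrow> \<psi> w \<and> (\<forall>v\<in>V - \<Union>(set h). \<not> hit tm \<theta> w h (Suc j) v)" for w
    proof -
      have "hist tm \<theta> V S (Suc j) w = h \<longleftrightarrow> hist tm \<theta> V S j w = h' \<and> nxt tm \<theta> V w h' = X" by (auto simp: h)
      also have "nxt tm \<theta> V w h' = X \<longleftrightarrow> (\<forall>v\<in>X. hit tm \<theta> w h' (Suc j) v) \<and> (\<forall>v\<in>V - ?B - X. \<not> hit tm \<theta> w h' (Suc j) v)"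
        using True unfolding nxt_def len' by blast
      finally have 1: "hist tm \<theta> V S (Suc j) w = h \<longleftrightarrow> (\<phi> w \<and> (\<forall>v\<in>V - ?B. \<not> hit tm \<theta> w h' j v)) \<and>
        (\<forall>v\<in>X. hit tm \<theta> w h' (Suc j) v) \<and> (\<forall>v\<in>V - ?B - X. \<not> hit tm \<theta> w h' (Suc j) v)" unfolding \<phi>(2) .
      have 2: "V - \<Union>(set h) = V - ?B - X" unfolding h by auto
      have 3: "V - ?B = X \<union> (V - ?B - X)" using True by blast
      have 4: "(\<forall>v\<in>V - ?B. \<not> hit tm \<theta> w h' j v) \<longleftrightarrow> (\<forall>v\<in>X. \<not> hit tm \<theta> w h' j v) \<and> (\<forall>v\<in>V - ?B - X. \<not> hit tm \<theta> w h' j v)"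
        by (subst 3) blast
      show ?thesis unfolding 1 \<psi>_def last 2 4 using mono by blast
    qed
    ultimately show ?thesis by blast
  qed
qed

definition hist_space :: "nat \<Rightarrow> nat set list set" where
  "hist_space j = {h. set h \<subseteq> Pow {..<n} \<and> length h = Suc j}"

lemma finite_hist_space: "finite (hist_space j)"
  unfolding hist_space_def by (rule finite_lists_length_eq) simp

lemma hist_in_space: "S \<subseteq> {..<n} \<Longrightarrow> V \<subseteq> {..<n} \<Longrightarrow> hist tm \<theta> V S j w \<in> hist_space j"
  using hist_subset[of tm \<theta> V S j w] unfolding hist_space_def by auto

lemma adm_hist_eq:
  assumes inc: "incseq tm" and \<theta>: "0 \<le> \<theta>" and SV: "S \<subseteq> {..<n}" "V \<subseteq> {..<n}" "S \<inter> V = {}"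
  shows "adm (edges_in (S \<union> V)) (\<lambda>w. hist tm \<theta> V S j w = h)"
proof (cases "length h = Suc j \<and> \<Union>(set h) \<subseteq> S \<union> V")
  case True
  obtain \<phi> where \<phi>: "adm (edges_in (\<Union>(set h))) \<phi>" "\<And>w. hist tm \<theta> V S j w = h \<longleftrightarrow> \<phi> w \<and> (\<forall>v\<in>V - \<Union>(set h). \<not> hit tm \<theta> w h j v)"
    using hist_factor[OF assms, of h j] True by blast
  have finV: "finite V" using SV finite_subset by blast
  have finh: "finite (h ! i)" if "i < length h" for i
  proof -
    have "h ! i \<subseteq> {..<n}" using True SV nth_mem[OF that] by blast
    thus ?thesis by (rule finite_subset) simp
  qed
  have "adm (edges_in (S \<union> V)) \<phi>" by (rule adm_mono[OF \<phi>(1)]) (use True in \<open>unfold edges_in_def, blast\<close>)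
  moreover have "adm (edges_in (S \<union> V)) (\<lambda>w. hit tm \<theta> w h j v)" if v: "v \<in> V - \<Union>(set h)" for v
    unfolding hit_def
  proof (intro adm_ex_less adm_bex adm_conj adm_gt adm_le finh)
    fix i a assume ia: "i < length h" "a \<in> h ! i"
    have "a \<in> \<Union>(set h)" using ia nth_mem by blast
    moreover have "a \<in> S \<union> V" using calculation True by blast
    moreover have "a < n" "v < n" "a \<noteq> v" using calculation v SV by blast+
    ultimately show "{a, v} \<in> edges_in (S \<union> V)" "{a, v} \<in> edges_in (S \<union> V)"
      using v by (auto simp: edges_in_def complete_edges_doubleton)
  qed
  ultimately show ?thesis unfolding \<phi>(2) using finV by (intro adm_conj adm_ball adm_not) auto
next
  case False
  hence "hist tm \<theta> V S j w \<noteq> h" for w using hist_subset[of tm \<theta> V S j w] by auto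
  thus ?thesis by (simp add: adm_const)
qed

lemma hist_pred_iff:
  assumes "S \<subseteq> {..<n}" "V \<subseteq> {..<n}"
  shows "P (hist tm \<theta> V S j w) w \<longleftrightarrow> (\<exists>h\<in>hist_space j. hist tm \<theta> V S j w = h \<and> P h w)"
  using hist_in_space[OF assms] by blast

text \<open>Law of total probability over the finitely many histories: a bound valid given each of
  them holds unconditionally.\<close>

lemma hist_sum_bound:
  assumes inc: "incseq tm" and \<theta>: "0 \<le> \<theta>" and SV: "S \<subseteq> {..<n}" "V \<subseteq> {..<n}" "S \<inter> V = {}"
    and P: "\<And>h. h \<in> hist_space j \<Longrightarrow> adm E (\<lambda>w. hist tm \<theta> V S j w = h \<and> P h w)"
    and b: "\<And>h. h \<in> hist_space j \<Longrightarrow> Pr (\<lambda>w. hist tm \<theta> V S j w = h \<and> P h w) \<le> b * Pr (\<lambda>w. hist tm \<theta> V S j w = h)" and b0: "0 \<le> b"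
  shows "Pr (\<lambda>w. P (hist tm \<theta> V S j w) w) \<le> b"
proof -
  have eqE: "adm E (\<lambda>w. hist tm \<theta> V S j w = h)" for h
    by (rule adm_mono[OF adm_hist_eq[OF inc \<theta> SV]]) (auto simp: edges_in_def)
  have "Pr (\<lambda>w. P (hist tm \<theta> V S j w) w) = Pr (\<lambda>w. \<exists>h\<in>hist_space j. hist tm \<theta> V S j w = h \<and> P h w)"
    by (intro Pr_cong hist_pred_iff SV)
  also have "... \<le> (\<Sum>h\<in>hist_space j. Pr (\<lambda>w. hist tm \<theta> V S j w = h \<and> P h w))"
    by (intro Pr_bex finite_hist_space P)
  also have "... \<le> (\<Sum>h\<in>hist_space j. b * Pr (\<lambda>w. hist tm \<theta> V S j w = h))"
    by (intro sum_mono b)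
  also have "... = b * (\<Sum>h\<in>hist_space j. Pr (\<lambda>w. hist tm \<theta> V S j w = h))" by (simp add: sum_distrib_left)
  also have "(\<Sum>h\<in>hist_space j. Pr (\<lambda>w. hist tm \<theta> V S j w = h)) = Pr (\<lambda>w. \<exists>h\<in>hist_space j. hist tm \<theta> V S j w = h)"
    by (intro Pr_sum_disjoint[symmetric] finite_hist_space eqE) auto
  also have "b * ... \<le> b * 1" using b0 by (intro mult_left_mono) auto
  finally show ?thesis by simp
qed

text \<open>Given that \<open>v\<close> is still unreached at step j, every explored vertex outside
  the newest level has a fresh chance of at least \<open>q\<close>: its edge to \<open>v\<close> may
  weigh between its ages at steps j and j + 1. The newest level waits one step, and this delay is
  why the growth recursion involves two past terms.\<close>

lemma Pr_not_hit_step: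
  assumes inc: "incseq tm" and \<theta>: "0 \<le> \<theta>" and q: "0 \<le> q" "q \<le> 1"
    and h: "length h = Suc j" "\<And>i i'. i \<le> j \<Longrightarrow> i' \<le> j \<Longrightarrow> i \<noteq> i' \<Longrightarrow> h ! i \<inter> h ! i' = {}" "\<And>i. i \<le> j \<Longrightarrow> h ! i \<subseteq> {..<n}"
    and v: "v < n" "v \<notin> \<Union>(set h)"
    and step: "\<And>i. i < j \<Longrightarrow> \<theta> \<le> tm j - tm i \<and> q \<le> exp (- (tm j - tm i)) - exp (- (tm (Suc j) - tm i))"
  shows "Pr (\<lambda>w. \<not> hit tm \<theta> w h (Suc j) v) \<le> Pr (\<lambda>w. \<not> hit tm \<theta> w h j v) * (1 - q) ^ card (\<Union>(set (take j h)))"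
proof -
  define I where "I = (SIGMA i:{..j}. h ! i)"
  have fin: "finite (h ! i)" if "i \<le> j" for i using h(3)[OF that] by (rule finite_subset) simp
  have finI: "finite I" unfolding I_def using fin by auto
  have edge: "{a, v} \<in> E" if "i \<le> j" "a \<in> h ! i" for i a
  proof -
    have "a \<in> \<Union>(set h)" using that h(1) by (auto intro!: bexI[of _ "h ! i"])
    thus ?thesis using that h(3) v by (auto simp: complete_edges_doubleton)
  qed
  define f where "f c p = Pr (\<lambda>w. \<not> (\<theta> < w {snd p, v} \<and> w {snd p, v} \<le> tm c - tm (fst p)))" for c :: nat and p :: "nat \<times> nat"
  have prodf: "Pr (\<lambda>w. \<not> hit tm \<theta> w h c v) = (\<Prod>p\<in>I. f c p)" for c
  proof -
    have "Pr (\<lambda>w. \<not> hit tm \<theta> w h c v) = Pr (\<lambda>w. \<forall>p\<in>I. \<not> (\<theta> < w {snd p, v} \<and> w {snd p, v} \<le> tm c - tm (fst p)))"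
      by (intro Pr_cong) (auto simp: hit_def h(1) I_def less_Suc_eq_le)
    also have "... = (\<Prod>p\<in>I. f c p)" unfolding f_def
    proof (rule Pr_indep_ball[where G = "\<lambda>p. {{snd p, v}}"])
      fix u p assume up: "u \<in> I" "p \<in> I" "u \<noteq> p"
      have "snd u \<noteq> snd p"
      proof
        assume eq: "snd u = snd p"
        hence "fst u \<noteq> fst p" using up(3) by (auto simp: prod_eq_iff)
        thus False using h(2)[of "fst u" "fst p"] up(1,2) eq by (auto simp: I_def)
      qed
      thus "{{snd u, v}} \<inter> {{snd p, v}} = {}" by (auto simp: doubleton_eq_iff)
    qed (use finI edge in \<open>auto simp: I_def\<close>)
    finally show ?thesis .
  qed
  define r where "r p = (if fst p < j then 1 - q else (1 :: real))" for p :: "nat \<times> nat"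
  \<comment> \<open>The drop from f(j) to f(j+1) is at least q, hence at least q f(j), because f(j)
    is a probability.\<close>
  have fac: "f (Suc j) p \<le> f j p * r p" if p: "p \<in> I" for p
  proof -
    have e: "{snd p, v} \<in> E" using edge p by (auto simp: I_def)
    have le: "tm j \<le> tm (Suc j)" using inc by (simp add: incseq_SucD)
    show ?thesis
    proof (cases "fst p < j")
      case True
      define c c' where "c = tm j - tm (fst p)" and "c' = tm (Suc j) - tm (fst p)"
      have c: "\<theta> \<le> c" "c \<le> c'" "q \<le> exp (- c) - exp (- c')" using step[OF True] le by (auto simp: c_def c'_def)
      have fj: "f j p = 1 - (exp (- \<theta>) - exp (- c))" unfolding f_def c_def[symmetric] using e c \<theta> by (intro Pr_not_window) auto
      have fSj: "f (Suc j) p = 1 - (exp (- \<theta>) - exp (- c'))" unfolding f_def c'_def[symmetric] using e c \<theta> by (intro Pr_not_window) auto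
      have "f j p * q \<le> 1 * q" using q unfolding f_def by (intro mult_right_mono) auto
      moreover have "f (Suc j) p = f j p - (exp (- c) - exp (- c'))" using fj fSj by simp
      moreover have "f j p * r p = f j p - f j p * q" using True by (simp add: r_def algebra_simps)
      ultimately show ?thesis using c(3) by linarith
    next
      case False
      have "f (Suc j) p \<le> f j p" unfolding f_def using e le
        by (intro Pr_mono adm_not adm_conj) auto
      thus ?thesis using False by (simp add: r_def)
    qed
  qed
  have "Pr (\<lambda>w. \<not> hit tm \<theta> w h (Suc j) v) = (\<Prod>p\<in>I. f (Suc j) p)" by (rule prodf)
  also have "... \<le> (\<Prod>p\<in>I. f j p * r p)" by (intro prod_mono) (auto simp: fac, simp add: f_def)
  also have "... = Pr (\<lambda>w. \<not> hit tm \<theta> w h j v) * (\<Prod>p\<in>I. r p)" by (simp add: prod.distrib prodf)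
  also have "(\<Prod>p\<in>I. r p) = (1 - q) ^ card {p\<in>I. fst p < j}"
    unfolding r_def prod.inter_filter[OF finI, symmetric] by simp
  also have "card {p\<in>I. fst p < j} = card (\<Union>(set (take j h)))"
  proof -
    have "bij_betw snd {p\<in>I. fst p < j} (\<Union>(set (take j h)))"
    proof (rule bij_betwI')
      fix x y assume "x \<in> {p\<in>I. fst p < j}" "y \<in> {p\<in>I. fst p < j}"
      thus "(snd x = snd y) = (x = y)" using h(2)[of "fst x" "fst y"]
        by (cases "fst x = fst y") (auto simp: I_def disjoint_iff)
    next
      fix x assume "x \<in> {p\<in>I. fst p < j}"
      hence x: "fst x < j" "snd x \<in> h ! fst x" by (auto simp: I_def)
      hence "take j h ! fst x \<in> set (take j h)" using h(1) by (intro nth_mem) simp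
      thus "snd x \<in> \<Union>(set (take j h))" using x by auto
    next
      fix y assume "y \<in> \<Union>(set (take j h))"
      then obtain i where "i < j" "y \<in> h ! i" using h(1) by (auto simp: set_conv_nth)
      thus "\<exists>x\<in>{p\<in>I. fst p < j}. y = snd x" by (intro bexI[of _ "(i, y)"]) (auto simp: I_def)
    qed
    thus ?thesis by (rule bij_betw_same_card)
  qed
  finally show ?thesis .
qed

text \<open>Chernoff with z = 1 - \<epsilon>, conditionally on each history. \<open>\<beta>\<close>
  bounds from below the number of vertices old enough to reproduce, \<open>N\<close> the number of
  unexplored vertices, and \<open>r\<close> the chance that one of these is reached in the next
  step, so r N is a lower bound for the mean.\<close>

lemma growth_step:
  assumes inc: "incseq tm" and \<theta>: "0 \<le> \<theta>" and SV: "S \<subseteq> {..<n}" "V \<subseteq> {..<n}" "S \<inter> V = {}"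
    and q: "0 \<le> q" "q \<le> 1" and \<epsilon>: "0 < \<epsilon>" "\<epsilon> \<le> 1/2"
    and step: "\<And>i. i < j \<Longrightarrow> \<theta> \<le> tm j - tm i \<and> q \<le> exp (- (tm j - tm i)) - exp (- (tm (Suc j) - tm i))"
    and r: "0 \<le> r" "r \<le> 1" "\<And>m. real m \<ge> \<beta> \<Longrightarrow> (1 - q) ^ m \<le> 1 - r" and N: "0 \<le> N"
  shows "Pr (\<lambda>w. (\<beta> \<le> real (card (\<Union>(set (take j (hist tm \<theta> V S j w))))) \<and> N \<le> real (card (V - \<Union>(set (hist tm \<theta> V S j w))))) \<and>
     real (card (nxt tm \<theta> V w (hist tm \<theta> V S j w))) < (1 - 3 * \<epsilon>) * (r * N)) \<le> 2 * exp (- (\<epsilon>\<^sup>2 * (r * N)))"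
proof -
  define \<mu> where "\<mu> = r * N"
  have \<mu>0: "0 \<le> \<mu>" using r N by (simp add: \<mu>_def)
  define y where "y = nat \<lceil>(1 - 3 * \<epsilon>) * \<mu>\<rceil>"
  define C where "C h \<longleftrightarrow> \<beta> \<le> real (card (\<Union>(set (take j h)))) \<and> N \<le> real (card (V - \<Union>(set h)))" for h
  \<comment> \<open>With l = \<epsilon> + 2\<epsilon>^2 one has \<epsilon>^2 + l(1 - 3\<epsilon>) =
    \<epsilon> - 6\<epsilon>^3, which is at most \<epsilon>; the factor 2 pays for rounding
    \<open>y\<close> up, since 1 - \<epsilon> \<ge> 1/2.\<close>
  have zy: "exp (- (\<epsilon> * \<mu>)) \<le> 2 * exp (- (\<epsilon>\<^sup>2 * \<mu>)) * (1 - \<epsilon>) ^ y"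
  proof -
    define l where "l = \<epsilon> + 2 * \<epsilon>\<^sup>2"
    have "- \<epsilon> - 2 * \<epsilon>\<^sup>2 \<le> ln (1 - \<epsilon>)" using \<epsilon> by (intro ln_one_minus_pos_lower_bound) auto
    hence l: "exp (- l) \<le> 1 - \<epsilon>" unfolding l_def using \<epsilon> by (subst ln_ge_iff[symmetric]) auto
    show ?thesis
    proof (cases "0 \<le> (1 - 3 * \<epsilon>) * \<mu>")
      case False
      hence y: "y = 0" unfolding y_def by simp
      have "\<epsilon>\<^sup>2 * \<mu> \<le> \<epsilon> * \<mu>" using \<epsilon> \<mu>0 by (intro mult_right_mono) (auto simp: power2_eq_square mult_left_le)
      hence "exp (- (\<epsilon> * \<mu>)) \<le> exp (- (\<epsilon>\<^sup>2 * \<mu>))" by simp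
      also have "... \<le> 2 * exp (- (\<epsilon>\<^sup>2 * \<mu>))" by simp
      finally show ?thesis by (simp add: y)
    next
      case True
      have yr: "real y \<le> (1 - 3 * \<epsilon>) * \<mu> + 1" unfolding y_def using True by linarith
      have "(1 - \<epsilon>) powr ((1 - 3 * \<epsilon>) * \<mu> + 1) \<le> (1 - \<epsilon>) powr real y"
        using yr \<epsilon> by (intro powr_mono') auto
      hence "(1 - \<epsilon>) * (1 - \<epsilon>) powr ((1 - 3 * \<epsilon>) * \<mu>) \<le> (1 - \<epsilon>) ^ y"
        using \<epsilon> by (simp add: powr_add powr_realpow mult.commute)
      moreover have "exp (- l * ((1 - 3 * \<epsilon>) * \<mu>)) \<le> (1 - \<epsilon>) powr ((1 - 3 * \<epsilon>) * \<mu>)"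
      proof -
        have "- l \<le> ln (1 - \<epsilon>)" using l \<epsilon> by (subst ln_ge_iff) auto
        hence "- l * ((1 - 3 * \<epsilon>) * \<mu>) \<le> ln (1 - \<epsilon>) * ((1 - 3 * \<epsilon>) * \<mu>)" using True by (intro mult_right_mono)
        thus ?thesis using \<epsilon> by (simp add: powr_def mult.commute)
      qed
      moreover have "1 / 2 * exp (- l * ((1 - 3 * \<epsilon>) * \<mu>)) \<le> (1 - \<epsilon>) * exp (- l * ((1 - 3 * \<epsilon>) * \<mu>))" using \<epsilon> by (intro mult_right_mono) auto
      moreover have "(1 - \<epsilon>) * exp (- l * ((1 - 3 * \<epsilon>) * \<mu>)) \<le> (1 - \<epsilon>) * (1 - \<epsilon>) powr ((1 - 3 * \<epsilon>) * \<mu>)"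
        using calculation \<epsilon> by (intro mult_left_mono) auto
      ultimately have "1 / 2 * exp (- l * ((1 - 3 * \<epsilon>) * \<mu>)) \<le> (1 - \<epsilon>) ^ y" by linarith
      hence "2 * exp (- (\<epsilon>\<^sup>2 * \<mu>)) * (1 / 2 * exp (- l * ((1 - 3 * \<epsilon>) * \<mu>))) \<le> 2 * exp (- (\<epsilon>\<^sup>2 * \<mu>)) * (1 - \<epsilon>) ^ y" by (intro mult_left_mono) auto
      moreover have "2 * exp (- (\<epsilon>\<^sup>2 * \<mu>)) * (1 / 2 * exp (- l * ((1 - 3 * \<epsilon>) * \<mu>))) = exp (- (\<epsilon>\<^sup>2 * \<mu>) - l * ((1 - 3 * \<epsilon>) * \<mu>))"
        by (simp add: exp_add[symmetric] exp_diff exp_minus field_simps)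
      moreover have "- (\<epsilon> * \<mu>) \<le> - (\<epsilon>\<^sup>2 * \<mu>) - l * ((1 - 3 * \<epsilon>) * \<mu>)"
      proof -
        have "- (\<epsilon>\<^sup>2 * \<mu>) - l * ((1 - 3 * \<epsilon>) * \<mu>) = - (\<epsilon> * \<mu>) + 6 * \<epsilon>^3 * \<mu>"
          unfolding l_def by (simp add: algebra_simps power2_eq_square power3_eq_cube)
        thus ?thesis using \<epsilon> \<mu>0 by simp
      qed
      ultimately show ?thesis by (smt (verit) exp_le_cancel_iff)
    qed
  qed
  have main: "adm E (\<lambda>w. hist tm \<theta> V S j w = h \<and> (C h \<and> card (nxt tm \<theta> V w h) < y))"
    "Pr (\<lambda>w. hist tm \<theta> V S j w = h \<and> (C h \<and> card (nxt tm \<theta> V w h) < y)) \<le> 2 * exp (- (\<epsilon>\<^sup>2 * \<mu>)) * Pr (\<lambda>w. hist tm \<theta> V S j w = h)"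
    if hs: "h \<in> hist_space j" for h
  proof -
    have "adm E (\<lambda>w. hist tm \<theta> V S j w = h \<and> (C h \<and> card (nxt tm \<theta> V w h) < y)) \<and>
      Pr (\<lambda>w. hist tm \<theta> V S j w = h \<and> (C h \<and> card (nxt tm \<theta> V w h) < y)) \<le> 2 * exp (- (\<epsilon>\<^sup>2 * \<mu>)) * Pr (\<lambda>w. hist tm \<theta> V S j w = h)"
    proof (cases "valid_hist S V h \<and> C h")
      case False
      hence "\<not> (hist tm \<theta> V S j w = h \<and> (C h \<and> card (nxt tm \<theta> V w h) < y))" for w
        using valid_hist_hist[of S V tm \<theta> j w] by auto
      hence "(\<lambda>w. hist tm \<theta> V S j w = h \<and> (C h \<and> card (nxt tm \<theta> V w h) < y)) = (\<lambda>w. False)" by blast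
      thus ?thesis by (simp add: adm_const)
    next
      case True
      let ?B = "\<Union>(set h)" and ?U = "V - \<Union>(set h)"
      have len: "length h = Suc j" and sub: "?B \<subseteq> {..<n}" using hs by (auto simp: hist_space_def)
      have hn: "h ! i \<subseteq> {..<n}" if "i \<le> j" for i
      proof -
        have "h ! i \<in> set h" using that len by simp
        thus ?thesis using sub by blast
      qed
      have finB: "finite ?B" using sub by (rule finite_subset) simp
      have finU: "finite ?U" using SV(2) by (meson Diff_subset finite_lessThan finite_subset)
      obtain \<phi> where \<phi>: "adm (edges_in ?B) \<phi>" "\<And>w. hist tm \<theta> V S j w = h \<longleftrightarrow> \<phi> w \<and> (\<forall>v\<in>?U. \<not> hit tm \<theta> w h j v)"
        using hist_factor[OF inc \<theta> SV len] by blast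
      have ed: "(\<lambda>a. {a, v}) ` ?B \<subseteq> E" if "v \<in> ?U" for v
      proof
        fix e assume "e \<in> (\<lambda>a. {a, v}) ` ?B"
        then obtain a where a: "a \<in> ?B" "e = {a, v}" by blast
        hence "a < n" using sub by blast
        moreover have "v < n" "a \<noteq> v" using that a SV(2) by blast+
        ultimately show "e \<in> E" using a by (simp add: complete_edges_doubleton)
      qed
      have admh: "adm ((\<lambda>a. {a, v}) ` ?B) (\<lambda>w. hit tm \<theta> w h c v)" if "v \<in> ?U" for v c
        unfolding hit_def
      proof (intro adm_ex_less adm_bex adm_conj adm_gt adm_le)
        fix i a assume "i < length h" "a \<in> h ! i"
        thus "{a, v} \<in> (\<lambda>a. {a, v}) ` ?B" "{a, v} \<in> (\<lambda>a. {a, v}) ` ?B" using nth_mem by blast+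
      next
        fix i assume "i < length h"
        thus "finite (h ! i)" using hn[of i] len finite_subset by fastforce
      qed
      have nx: "nxt tm \<theta> V w h = {v\<in>?U. hit tm \<theta> w h (Suc j) v}" for w by (simp add: nxt_def len)
      have eqs: "(\<lambda>w. hist tm \<theta> V S j w = h \<and> (C h \<and> card (nxt tm \<theta> V w h) < y)) =
        (\<lambda>w. \<phi> w \<and> (\<forall>v\<in>?U. \<not> hit tm \<theta> w h j v) \<and> card {v\<in>?U. hit tm \<theta> w h (Suc j) v} < y)"
        using True by (auto simp: \<phi>(2) nx)
      have sE: "edges_in ?B \<subseteq> E" by (auto simp: edges_in_def)
      have admE: "adm E (\<lambda>w. \<phi> w \<and> (\<forall>v\<in>?U. \<not> hit tm \<theta> w h j v) \<and> card {v\<in>?U. hit tm \<theta> w h (Suc j) v} < y)"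
        by (intro adm_conj adm_ball adm_card adm_not finU) (auto intro: adm_mono[OF \<phi>(1) sE] adm_mono[OF admh ed])
      let ?a = "\<lambda>v. Pr (\<lambda>w. \<not> hit tm \<theta> w h j v)"
      have "Pr (\<lambda>w. \<phi> w \<and> (\<forall>v\<in>?U. \<not> hit tm \<theta> w h j v) \<and> card {v\<in>?U. hit tm \<theta> w h (Suc j) v} < y) * (1 - \<epsilon>) ^ y
        \<le> Pr \<phi> * (\<Prod>v\<in>?U. Pr (\<lambda>w. \<not> hit tm \<theta> w h j v \<and> \<not> hit tm \<theta> w h (Suc j) v) + (1 - \<epsilon>) * Pr (\<lambda>w. \<not> hit tm \<theta> w h j v \<and> hit tm \<theta> w h (Suc j) v))"
      proof (rule chernoff_lower[where H = "\<lambda>v. (\<lambda>a. {a, v}) ` ?B"])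
        show "(\<lambda>a. {a, u}) ` ?B \<inter> (\<lambda>a. {a, v}) ` ?B = {}" if "u \<in> ?U" "v \<in> ?U" "u \<noteq> v" for u v
          using that by (auto simp: doubleton_eq_iff)
        show "(\<lambda>a. {a, v}) ` ?B \<inter> edges_in ?B = {}" if "v \<in> ?U" for v
          using that by (auto simp: edges_in_def)
      qed (use finU \<epsilon> \<phi> sE admh ed in auto)
      also have "... \<le> Pr \<phi> * (\<Prod>v\<in>?U. ?a v * exp (- (\<epsilon> * r)))"
      proof (intro mult_left_mono prod_mono conjI)
        fix v assume v: "v \<in> ?U"
        let ?x = "Pr (\<lambda>w. \<not> hit tm \<theta> w h (Suc j) v)"
        have mono: "hit tm \<theta> w h (Suc j) v" if "hit tm \<theta> w h j v" for w
          using that inc unfolding hit_def by (meson diff_right_mono incseq_SucD order_trans)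
        have e1: "Pr (\<lambda>w. \<not> hit tm \<theta> w h j v \<and> \<not> hit tm \<theta> w h (Suc j) v) = ?x" using mono by (intro Pr_cong) blast
        have aE: "adm E (\<lambda>w. hit tm \<theta> w h c v)" for c by (rule adm_mono[OF admh ed]) (use v in auto)
        have e2: "?a v = ?x + Pr (\<lambda>w. \<not> hit tm \<theta> w h j v \<and> hit tm \<theta> w h (Suc j) v)"
          using Pr_split[OF adm_not[OF aE[of j]] aE[of "Suc j"]] e1 by simp
        have "?x \<le> ?a v * (1 - q) ^ card (\<Union>(set (take j h)))"
        proof (rule Pr_not_hit_step[OF inc \<theta> q len _ hn _ _ step])
          show "h ! i \<inter> h ! i' = {}" if "i \<le> j" "i' \<le> j" "i \<noteq> i'" for i i'
            using True that len unfolding valid_hist_def by auto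
          show "v < n" "v \<notin> ?B" using v SV by auto
        qed
        also have "... \<le> ?a v * (1 - r)" using True r(3) by (intro mult_left_mono) (auto simp: C_def)
        finally have x: "?x \<le> ?a v * (1 - r)" .
        have "?x + (1 - \<epsilon>) * (?a v - ?x) = (1 - \<epsilon>) * ?a v + \<epsilon> * ?x" by (simp add: algebra_simps)
        also have "... \<le> (1 - \<epsilon>) * ?a v + \<epsilon> * (?a v * (1 - r))" using x \<epsilon> by simp
        also have "... = ?a v * (1 + - (\<epsilon> * r))" by (simp add: algebra_simps)
        also have "... \<le> ?a v * exp (- (\<epsilon> * r))" by (intro mult_left_mono exp_ge_add_one_self) auto
        finally show "Pr (\<lambda>w. \<not> hit tm \<theta> w h j v \<and> \<not> hit tm \<theta> w h (Suc j) v) + (1 - \<epsilon>) * Pr (\<lambda>w. \<not> hit tm \<theta> w h j v \<and> hit tm \<theta> w h (Suc j) v) \<le> ?a v * exp (- (\<epsilon> * r))"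
          using e1 e2 by simp
      qed (use \<epsilon> in \<open>auto intro!: add_nonneg_nonneg mult_nonneg_nonneg\<close>)
      also have "... = (Pr \<phi> * (\<Prod>v\<in>?U. ?a v)) * exp (- (real (card ?U) * (\<epsilon> * r)))"
        by (simp add: prod.distrib exp_of_nat_mult[symmetric])
      also have "Pr \<phi> * (\<Prod>v\<in>?U. ?a v) = Pr (\<lambda>w. hist tm \<theta> V S j w = h)"
      proof -
        have "(\<Prod>v\<in>?U. ?a v) = Pr (\<lambda>w. \<forall>v\<in>?U. \<not> hit tm \<theta> w h j v)"
          by (rule Pr_indep_ball[symmetric, where G = "\<lambda>v. (\<lambda>a. {a, v}) ` ?B"]) (use finU admh ed in \<open>auto simp: doubleton_eq_iff\<close>)
        moreover have "Pr (\<lambda>w. \<phi> w \<and> (\<forall>v\<in>?U. \<not> hit tm \<theta> w h j v)) = Pr \<phi> * Pr (\<lambda>w. \<forall>v\<in>?U. \<not> hit tm \<theta> w h j v)"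
        proof (rule Pr_indep[OF \<phi>(1)])
          show "adm (\<Union>v\<in>?U. (\<lambda>a. {a, v}) ` ?B) (\<lambda>w. \<forall>v\<in>?U. \<not> hit tm \<theta> w h j v)"
            by (intro adm_ball finU adm_not adm_mono[OF admh]) auto
          show "(\<Union>v\<in>?U. (\<lambda>a. {a, v}) ` ?B) \<subseteq> E" using ed by blast
          show "edges_in ?B \<inter> (\<Union>v\<in>?U. (\<lambda>a. {a, v}) ` ?B) = {}" by (auto simp: edges_in_def)
        qed (rule sE)
        ultimately show ?thesis by (simp add: \<phi>(2))
      qed
      also have "Pr (\<lambda>w. hist tm \<theta> V S j w = h) * exp (- (real (card ?U) * (\<epsilon> * r))) \<le> Pr (\<lambda>w. hist tm \<theta> V S j w = h) * exp (- (\<epsilon> * \<mu>))"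
      proof (intro mult_left_mono)
        have "N * (\<epsilon> * r) \<le> real (card ?U) * (\<epsilon> * r)" using True \<epsilon> r by (intro mult_right_mono) (auto simp: C_def)
        thus "exp (- (real (card ?U) * (\<epsilon> * r))) \<le> exp (- (\<epsilon> * \<mu>))" by (simp add: \<mu>_def mult_ac)
      qed auto
      also have "... \<le> Pr (\<lambda>w. hist tm \<theta> V S j w = h) * (2 * exp (- (\<epsilon>\<^sup>2 * \<mu>)) * (1 - \<epsilon>) ^ y)" by (intro mult_left_mono zy) auto
      finally have "Pr (\<lambda>w. \<phi> w \<and> (\<forall>v\<in>?U. \<not> hit tm \<theta> w h j v) \<and> card {v\<in>?U. hit tm \<theta> w h (Suc j) v} < y) * (1 - \<epsilon>) ^ y
        \<le> (2 * exp (- (\<epsilon>\<^sup>2 * \<mu>)) * Pr (\<lambda>w. hist tm \<theta> V S j w = h)) * (1 - \<epsilon>) ^ y" by (simp add: mult_ac)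
      hence "Pr (\<lambda>w. \<phi> w \<and> (\<forall>v\<in>?U. \<not> hit tm \<theta> w h j v) \<and> card {v\<in>?U. hit tm \<theta> w h (Suc j) v} < y) \<le> 2 * exp (- (\<epsilon>\<^sup>2 * \<mu>)) * Pr (\<lambda>w. hist tm \<theta> V S j w = h)"
        using \<epsilon> by (simp add: mult_le_cancel_right)
      thus ?thesis unfolding eqs using admE by blast
    qed
    thus "adm E (\<lambda>w. hist tm \<theta> V S j w = h \<and> (C h \<and> card (nxt tm \<theta> V w h) < y))"
    "Pr (\<lambda>w. hist tm \<theta> V S j w = h \<and> (C h \<and> card (nxt tm \<theta> V w h) < y)) \<le> 2 * exp (- (\<epsilon>\<^sup>2 * \<mu>)) * Pr (\<lambda>w. hist tm \<theta> V S j w = h)" by blast+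
  qed
  have "Pr (\<lambda>w. C (hist tm \<theta> V S j w) \<and> card (nxt tm \<theta> V w (hist tm \<theta> V S j w)) < y) \<le> 2 * exp (- (\<epsilon>\<^sup>2 * \<mu>))"
    by (rule hist_sum_bound[OF inc \<theta> SV, where P = "\<lambda>h w. C h \<and> card (nxt tm \<theta> V w h) < y"]) (use main in auto)
  thus ?thesis unfolding C_def y_def less_real_iff_ceiling \<mu>_def .
qed

end

text \<open>Multiply by the Taylor bound for exp x: (1 - x + x^2/2)(1 + x + x^2/2) = 1 +
  x^4/4.\<close>

lemma exp_minus_le_quadratic:
  fixes x :: real
  assumes "0 \<le> x" shows "exp (- x) \<le> 1 - x + x\<^sup>2 / 2"
proof -
  have "0 < exp x" by simp
  have "1 \<le> (1 - x + x\<^sup>2 / 2) * (1 + x + x\<^sup>2 / 2)"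
  proof -
    have "(1 - x + x\<^sup>2 / 2) * (1 + x + x\<^sup>2 / 2) = 1 + x ^ 4 / 4" by (simp add: field_simps power2_eq_square power4_eq_xxxx)
    thus ?thesis by simp
  qed
  also have "... \<le> (1 - x + x\<^sup>2 / 2) * exp x"
  proof (intro mult_left_mono exp_lower_Taylor_quadratic assms)
    have "1 - x + x\<^sup>2 / 2 = ((1 - x)\<^sup>2 + 1) / 2" by (simp add: field_simps power2_eq_square)
    show "0 \<le> 1 - x + x\<^sup>2 / 2" unfolding \<open>1 - x + x\<^sup>2 / 2 = ((1 - x)\<^sup>2 + 1) / 2\<close>
      by (intro divide_nonneg_nonneg add_nonneg_nonneg) auto
  qed
  finally have "exp (- x) * 1 \<le> exp (- x) * ((1 - x + x\<^sup>2 / 2) * exp x)" by (intro mult_left_mono) auto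
  also have "... = (1 - x + x\<^sup>2 / 2) * (exp x * exp (- x))" by (simp only: mult_ac)
  finally show ?thesis unfolding exp_minus_inverse by simp
qed

text \<open>One long step of length 2g/n, then short steps of length \<tau>/n. The long step creates
  a population of order g|S|, large enough to make all later failure probabilities exponentially
  small in it, which the union bound over starting sets requires.\<close>

definition grow_time :: "nat \<Rightarrow> real \<Rightarrow> real \<Rightarrow> nat \<Rightarrow> real" where
  "grow_time n g \<tau> j = (if j = 0 then 0 else (2 * g + real (j - 1) * \<tau>) / real n)"

lemma grow_time_0 [simp]: "grow_time n g \<tau> 0 = 0" by (simp add: grow_time_def)
lemma grow_time_Suc: "grow_time n g \<tau> (Suc j) = (2 * g + real j * \<tau>) / real n" by (simp add: grow_time_def)

lemma grow_time_le: "0 \<le> \<tau> \<Longrightarrow> 0 \<le> g \<Longrightarrow> grow_time n g \<tau> j \<le> (2 * g + real j * \<tau>) / real n"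
  by (auto simp: grow_time_def intro!: divide_right_mono mult_right_mono)

lemma incseq_grow_time:
  assumes "0 \<le> g" "0 \<le> \<tau>" shows "incseq (grow_time n g \<tau>)"
proof (rule incseq_SucI)
  fix j show "grow_time n g \<tau> j \<le> grow_time n g \<tau> (Suc j)"
    using assms by (cases j) (auto simp: grow_time_Suc intro!: divide_right_mono mult_right_mono divide_nonneg_nonneg)
qed

definition grown :: "nat \<Rightarrow> real \<Rightarrow> real \<Rightarrow> nat set \<Rightarrow> nat set \<Rightarrow> nat set \<Rightarrow> nat \<Rightarrow> weights \<Rightarrow> bool" where
  "grown n g \<tau> V S T J w \<longleftrightarrow> (\<exists>a\<in>\<Union>(set (hist (grow_time n g \<tau>) (\<tau> / real n) V S J w)). \<exists>b\<in>T.
     \<tau> / real n < w {a, b} \<and> w {a, b} \<le> 2 * g / real n)"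

context exp_graph
begin

lemma adm_hist_pred:
  assumes inc: "incseq tm" and \<theta>: "0 \<le> \<theta>" and SV: "S \<subseteq> {..<n}" "V \<subseteq> {..<n}" "S \<inter> V = {}"
  shows "adm (edges_in (S \<union> V)) (\<lambda>w. P (hist tm \<theta> V S j w))"
proof -
  have "(\<lambda>w. P (hist tm \<theta> V S j w)) = (\<lambda>w. \<exists>h\<in>hist_space j. hist tm \<theta> V S j w = h \<and> P h)"
    using hist_in_space[OF SV(1,2)] by blast
  moreover have "adm (edges_in (S \<union> V)) (\<lambda>w. \<exists>h\<in>hist_space j. hist tm \<theta> V S j w = h \<and> P h)"
    by (intro adm_bex adm_conj adm_const adm_hist_eq finite_hist_space assms)
  ultimately show ?thesis by simp
qed

lemma adm_grown:
  assumes g: "0 \<le> g" "0 \<le> \<tau>" and SV: "S \<subseteq> {..<n}" "V \<subseteq> {..<n}" "S \<inter> V = {}" and T: "T \<subseteq> {..<n}" "T \<inter> (S \<union> V) = {}"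
  shows "adm (edges_in (S \<union> V \<union> T)) (grown n g \<tau> V S T J)"
proof -
  let ?H = "\<lambda>w. hist (grow_time n g \<tau>) (\<tau> / real n) V S J w"
  define R where "R h w \<longleftrightarrow> (\<exists>a\<in>\<Union>(set h). \<exists>b\<in>T. \<tau> / real n < w {a, b} \<and> w {a, b} \<le> 2 * g / real n)" for h :: "nat set list" and w
  have 1: "grown n g \<tau> V S T J = (\<lambda>w. \<exists>h\<in>{h\<in>hist_space J. \<Union>(set h) \<subseteq> S \<union> V}. ?H w = h \<and> R h w)"
  proof
    fix w
    have "\<Union>(set (?H w)) \<subseteq> S \<union> V" "?H w \<in> hist_space J"
      using hist_subset[of "grow_time n g \<tau>" "\<tau> / real n" V S J w] hist_in_space[OF SV(1,2)] by auto
    thus "grown n g \<tau> V S T J w = (\<exists>h\<in>{h\<in>hist_space J. \<Union>(set h) \<subseteq> S \<union> V}. ?H w = h \<and> R h w)"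
      unfolding grown_def R_def by blast
  qed
  have fT: "finite T" using T finite_subset by blast
  have "adm (edges_in (S \<union> V \<union> T)) (R h)" if h: "\<Union>(set h) \<subseteq> S \<union> V" for h
    unfolding R_def
  proof (intro adm_bex adm_conj adm_gt adm_le fT)
    show "finite (\<Union>(set h))" using h SV by (meson finite_UnI finite_lessThan finite_subset)
    fix a b assume ab: "a \<in> \<Union>(set h)" "b \<in> T"
    hence "a \<in> S \<union> V" using h by blast
    hence "a < n" "b < n" "a \<noteq> b" "a \<in> S \<union> V" using ab SV T by blast+
    thus "{a, b} \<in> edges_in (S \<union> V \<union> T)" "{a, b} \<in> edges_in (S \<union> V \<union> T)" using ab by (auto simp: edges_in_def complete_edges_doubleton)
  qed
  moreover have "adm (edges_in (S \<union> V \<union> T)) (\<lambda>w. ?H w = h)" for h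
    by (rule adm_mono[OF adm_hist_eq[OF incseq_grow_time[OF g] _ SV]]) (use g in \<open>auto simp: edges_in_def\<close>)
  ultimately show ?thesis unfolding 1 using finite_hist_space by (intro adm_bex adm_conj) auto
qed

text \<open>\<open>T\<close> lies outside the explored region, so its edges to the explored set are
  independent of the history; once \<rho> n vertices are explored, each vertex of \<open>T\<close>
  is missed with probability at most exp(-g \<rho>/2).\<close>

lemma final_hit_prob:
  assumes g: "0 \<le> g" "0 \<le> \<tau>" "\<tau> \<le> g" "4 * g \<le> real n" and SV: "S \<subseteq> {..<n}" "V \<subseteq> {..<n}" "S \<inter> V = {}" and T: "T \<subseteq> {..<n}" "T \<inter> (S \<union> V) = {}"
    and n: "n > 0" and \<rho>: "0 \<le> \<rho>"
  shows "Pr (\<lambda>w. \<rho> * real n \<le> real (card (\<Union>(set (hist (grow_time n g \<tau>) (\<tau> / real n) V S J w)))) \<and> \<not> grown n g \<tau> V S T J w)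
    \<le> exp (- (g * \<rho> * real (card T) / 2))"
proof -
  let ?H = "\<lambda>w. hist (grow_time n g \<tau>) (\<tau> / real n) V S J w"
  define R where "R h w \<longleftrightarrow> (\<exists>b\<in>T. \<exists>a\<in>\<Union>(set h). \<tau> / real n < w {a, b} \<and> w {a, b} \<le> 2 * g / real n)" for h :: "nat set list" and w
  have fT: "finite T" using T finite_subset by blast
  note inc = incseq_grow_time[OF g(1,2)]
  have \<theta>: "0 \<le> \<tau> / real n" using g by simp
  have eqE: "adm (edges_in (S \<union> V)) (\<lambda>w. ?H w = h)" for h by (rule adm_hist_eq[OF inc \<theta> SV])
  have sE: "edges_in B \<subseteq> E" for B by (auto simp: edges_in_def)
  have main: "adm E (\<lambda>w. ?H w = h \<and> (\<rho> * real n \<le> real (card (\<Union>(set h))) \<and> \<not> R h w)) \<and>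
    Pr (\<lambda>w. ?H w = h \<and> (\<rho> * real n \<le> real (card (\<Union>(set h))) \<and> \<not> R h w)) \<le> exp (- (g * \<rho> * real (card T) / 2)) * Pr (\<lambda>w. ?H w = h)" for h
  proof (cases "\<Union>(set h) \<subseteq> S \<union> V \<and> \<rho> * real n \<le> real (card (\<Union>(set h)))")
    case False
    hence "\<not> (?H w = h \<and> (\<rho> * real n \<le> real (card (\<Union>(set h))) \<and> \<not> R h w))" for w
      using hist_subset[of "grow_time n g \<tau>" "\<tau> / real n" V S J w] by auto
    hence "(\<lambda>w. ?H w = h \<and> (\<rho> * real n \<le> real (card (\<Union>(set h))) \<and> \<not> R h w)) = (\<lambda>w. False)" by blast
    thus ?thesis by (simp add: adm_const)
  next
    case True
    let ?B = "\<Union>(set h)"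
    have Bn: "?B \<subseteq> {..<n}" using True SV by blast
    have fB: "finite ?B" by (rule finite_subset[OF Bn]) simp
    let ?G = "\<lambda>b. (\<lambda>a. {a, b}) ` ?B"
    have GE: "?G b \<subseteq> E" if "b \<in> T" for b
    proof
      fix e assume "e \<in> ?G b"
      then obtain a where a: "a \<in> ?B" "e = {a, b}" by blast
      hence "a < n" "b < n" "a \<noteq> b" using Bn that T True by blast+
      thus "e \<in> E" using a by (simp add: complete_edges_doubleton)
    qed
    have adR: "adm (?G b) (\<lambda>w. \<exists>a\<in>?B. \<tau> / real n < w {a, b} \<and> w {a, b} \<le> 2 * g / real n)" for b
      by (intro adm_bex fB adm_conj) auto
    have a2: "adm (\<Union>(?G ` T)) (\<lambda>w. \<not> R h w)" unfolding R_def by (intro adm_not adm_bex[OF fT] adm_mono[OF adR]) auto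
    have dj: "edges_in (S \<union> V) \<inter> \<Union>(?G ` T) = {}" using T by (auto simp: edges_in_def)
    have GE2: "\<Union>(?G ` T) \<subseteq> E" using GE by blast
    have "Pr (\<lambda>w. ?H w = h \<and> \<not> R h w) = Pr (\<lambda>w. ?H w = h) * Pr (\<lambda>w. \<not> R h w)"
      by (rule Pr_indep[OF eqE a2 sE GE2 dj])
    also have "Pr (\<lambda>w. \<not> R h w) = Pr (\<lambda>w. \<forall>b\<in>T. \<not> (\<exists>a\<in>?B. \<tau> / real n < w {a, b} \<and> w {a, b} \<le> 2 * g / real n))"
      by (intro Pr_cong) (simp add: R_def)
    also have "... = (\<Prod>b\<in>T. Pr (\<lambda>w. \<not> (\<exists>a\<in>?B. \<tau> / real n < w {a, b} \<and> w {a, b} \<le> 2 * g / real n)))"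
    proof (rule Pr_indep_ball[OF fT adm_not[OF adR] GE])
      show "?G u \<inter> ?G v = {}" if "u \<in> T" "v \<in> T" "u \<noteq> v" for u v
      proof -
        have "u \<notin> ?B" "v \<notin> ?B" using that True T by blast+
        thus ?thesis using that by (auto simp: doubleton_eq_iff)
      qed
    qed
    also have "... \<le> (\<Prod>b\<in>T. exp (- (g * \<rho> / 2)))"
    proof (intro prod_mono conjI)
      fix b assume b: "b \<in> T"
      define q where "q = exp (- (\<tau> / real n)) - exp (- (2 * g / real n))"
      have "Pr (\<lambda>w. \<not> (\<exists>a\<in>?B. \<tau> / real n < w {a, b} \<and> w {a, b} \<le> 2 * g / real n)) = (1 - q) ^ card ?B"
        unfolding q_def by (rule Pr_not_hit) (use fB GE[OF b] g n in \<open>auto simp: divide_right_mono\<close>)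
      also have "... \<le> exp (- q) ^ card ?B"
      proof (intro power_mono)
        have "exp (- (\<tau> / real n)) \<le> 1" using \<theta> by simp
        thus "0 \<le> 1 - q" unfolding q_def using exp_ge_zero[of "- (2 * g / real n)"] by linarith
      qed (use exp_ge_add_one_self[of "- q"] in simp)
      also have "... = exp (- (q * real (card ?B)))" by (simp add: exp_of_nat_mult[symmetric] mult.commute)
      also have "... \<le> exp (- (g * \<rho> / 2))"
      proof -
        have a: "g / real n / 2 \<le> exp (- (g / real n)) - exp (- (2 * (g / real n)))"
          by (rule window_mass) (use g n in \<open>auto simp: field_simps\<close>)
        have b: "exp (- (g / real n)) \<le> exp (- (\<tau> / real n))" using g by (simp add: divide_right_mono)
        have q: "g / real n / 2 \<le> q" using a b unfolding q_def times_divide_eq_right by linarith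
        have "(g / real n / 2) * (\<rho> * real n) \<le> q * real (card ?B)" using q True g \<rho> by (intro mult_mono) (auto intro: order_trans[of 0 "g / real n / 2"])
        thus ?thesis using n by (simp add: field_simps)
      qed
      finally show "Pr (\<lambda>w. \<not> (\<exists>a\<in>?B. \<tau> / real n < w {a, b} \<and> w {a, b} \<le> 2 * g / real n)) \<le> exp (- (g * \<rho> / 2))" .
    qed auto
    also have "... = exp (- (g * \<rho> * real (card T) / 2))" by (simp add: exp_of_nat_mult[symmetric] mult_ac)
    finally have "Pr (\<lambda>w. ?H w = h \<and> \<not> R h w) \<le> Pr (\<lambda>w. ?H w = h) * exp (- (g * \<rho> * real (card T) / 2))" by (simp add: mult_left_mono)
    moreover have "adm E (\<lambda>w. ?H w = h \<and> \<not> R h w)" by (intro adm_conj adm_mono[OF eqE sE] adm_mono[OF a2 GE2])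
    ultimately show ?thesis using True by (simp add: mult.commute)
  qed
  have "Pr (\<lambda>w. (\<lambda>h w. \<rho> * real n \<le> real (card (\<Union>(set h))) \<and> \<not> R h w) (?H w) w) \<le> exp (- (g * \<rho> * real (card T) / 2))"
    by (rule hist_sum_bound[OF inc \<theta> SV]) (use main in auto)
  moreover have "grown n g \<tau> V S T J w \<longleftrightarrow> R (?H w) w" for w unfolding grown_def R_def by blast
  ultimately show ?thesis by simp
qed

text \<open>The three error terms are: the long first step fails, one of the short steps fails
  before the size \<rho> n is reached, or the final jump to \<open>T\<close> fails. Otherwise lower
  bounds b_j for the population satisfy b_(j+1) \<le> b_j + (1 - 7\<epsilon>)\<tau> b_(j-1), and the
  inequality for \<gamma>^2 shows that b_j = m1 \<gamma>^(j-2) is such a sequence.\<close>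

lemma growth_prob:
  assumes \<epsilon>: "0 < \<epsilon>" "\<epsilon> \<le> 1/20" and \<tau>: "0 < \<tau>" "\<tau> \<le> 1" and g: "\<tau> \<le> g" "4 * g \<le> real n" "g * real (card S) \<le> 2 * real n"
    and SV: "S \<subseteq> {..<n}" "V \<subseteq> {..<n}" "S \<inter> V = {}" and T: "T \<subseteq> {..<n}" "T \<inter> (S \<union> V) = {}"
    and cV: "(1 - \<epsilon>) * real n \<le> real (card V)" and n: "n > 0" and \<rho>: "0 < \<rho>" "\<rho> \<le> \<epsilon>"
    and J: "2 \<le> J" "2 * g + real J * \<tau> \<le> \<epsilon> / 2 * real n"
    and \<gamma>: "1 \<le> \<gamma>" "\<gamma> \<le> 2" "\<gamma>\<^sup>2 \<le> \<gamma> + (1 - 7 * \<epsilon>) * \<tau>"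
    and m1: "m1 = g * real (card S) / 32" and reach: "\<rho> * real n \<le> m1 * \<gamma> ^ (J - 2)"
  shows "Pr (\<lambda>w. \<not> grown n g \<tau> V S T J w) \<le> 2 * exp (- m1) + real J * (2 * exp (- (\<epsilon>\<^sup>2 * \<tau> * m1 / 4))) + exp (- (g * \<rho> * real (card T) / 2))"
proof -
  let ?tm = "grow_time n g \<tau>" and ?\<theta> = "\<tau> / real n"
  let ?H = "\<lambda>j w. hist ?tm ?\<theta> V S j w"
  let ?B = "\<lambda>j w. \<Union>(set (?H j w))"
  have g0: "0 \<le> g" "0 \<le> \<tau>" using g \<tau> by auto
  note inc = incseq_grow_time[OF g0]
  have \<theta>: "0 \<le> ?\<theta>" using \<tau> by simp
  have fin: "finite S" "finite V" using SV finite_subset by blast+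
  have m10: "0 \<le> m1" unfolding m1 using g0 by simp
  \<comment> \<open>The target size m1 \<gamma>^(j-2), written with a division so that it makes
    sense at j = 1, where it is at most m1.\<close>
  define b where "b j = m1 * \<gamma> ^ j / \<gamma>\<^sup>2" for j
  define q where "q = ?\<theta> * (1 - \<epsilon>)"
  define r where "r j = q * b (j - 1) * (1 - \<epsilon>)" for j
  define N where "N = (1 - 2 * \<epsilon>) * real n"
  define C where "C j w \<longleftrightarrow> b (j - 1) \<le> real (card (\<Union>(set (take j (?H j w))))) \<and> N \<le> real (card (V - ?B j w))" for j w
  define D where "D j w \<longleftrightarrow> C j w \<and> real (card (nxt ?tm ?\<theta> V w (?H j w))) < (1 - 3 * \<epsilon>) * (r j * N)" for j w
  \<comment> \<open>Only steps whose target is at most \<rho> n are tracked: up to that size the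
    chance 1 - exp(-x) of being reached is at least (1 - \<epsilon>)x.\<close>
  define Js where "Js = {j\<in>{2..<J}. b (j - 1) \<le> \<rho> * real n}"
  define A0 where "A0 w \<longleftrightarrow> real (card (nxt ?tm ?\<theta> V w (?H 0 w))) < m1" for w
  have b0: "0 \<le> b j" for j unfolding b_def using m10 \<gamma> by auto
  have bmono: "m1 / 2 \<le> b j" if "1 \<le> j" for j
  proof -
    have "\<gamma> ^ 1 \<le> \<gamma> ^ j" using that \<gamma> by (intro power_increasing) auto
    hence "m1 * \<gamma> / \<gamma>\<^sup>2 \<le> b j" unfolding b_def using m10 \<gamma> by (intro divide_right_mono mult_left_mono) auto
    moreover have "m1 * \<gamma> / \<gamma>\<^sup>2 = m1 / \<gamma>" by (simp add: power2_eq_square)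
    moreover have "m1 / 2 \<le> m1 / \<gamma>" using m10 \<gamma> by (intro divide_left_mono) auto
    ultimately show ?thesis by linarith
  qed
  have \<theta>\<epsilon>: "?\<theta> \<le> \<epsilon> / 2"
  proof -
    have "1 * \<tau> \<le> real J * \<tau>" using J(1) \<tau> by (intro mult_right_mono) auto
    hence "\<tau> \<le> \<epsilon> / 2 * real n" using J(2) g0 by linarith
    thus ?thesis using n by (simp add: field_simps)
  qed
  have q01: "0 \<le> q" "q \<le> 1"
  proof -
    show "0 \<le> q" unfolding q_def by (intro mult_nonneg_nonneg \<theta>) (use \<epsilon> in simp)
    have "?\<theta> * (1 - \<epsilon>) \<le> 1 * 1" using \<theta>\<epsilon> \<epsilon> by (intro mult_mono) auto
    thus "q \<le> 1" by (simp add: q_def)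
  qed
  have qrate: "?\<theta> \<le> ?tm j - ?tm i \<and> q \<le> exp (- (?tm j - ?tm i)) - exp (- (?tm (Suc j) - ?tm i))" if "i < j" "2 \<le> j" "j < J" for i j
  proof -
    define c where "c = ?tm j - ?tm i"
    define j' where "j' = j - 1"
    have j': "j = Suc j'" using that by (simp add: j'_def)
    have tS: "?tm (Suc j) = ?tm j + ?\<theta>" unfolding j' grow_time_Suc by (simp add: add_divide_distrib distrib_right)
    have c1: "?\<theta> \<le> c"
    proof -
      have "?tm i \<le> ?tm j'" using that j' incseqD[OF inc] by auto
      moreover have "?tm j = ?tm j' + ?\<theta>"
      proof -
        have "j' = Suc (j' - 1)" using that j' by simp
        then obtain j'' where "j' = Suc j''" by blast
        thus ?thesis unfolding j' by (simp add: grow_time_Suc add_divide_distrib distrib_right)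
      qed
      ultimately show ?thesis by (simp add: c_def)
    qed
    have "c \<le> ?tm j" unfolding c_def using incseqD[OF inc, of 0 i] by simp
    also have "... \<le> (2 * g + real j * \<tau>) / real n" by (rule grow_time_le[OF g0(2,1)])
    also have "... \<le> (\<epsilon> / 2 * real n) / real n"
    proof (intro divide_right_mono)
      have "real j * \<tau> \<le> real J * \<tau>" using that \<tau> by (intro mult_right_mono) auto
      thus "2 * g + real j * \<tau> \<le> \<epsilon> / 2 * real n" using J(2) by linarith
    qed simp
    also have "... = \<epsilon> / 2" using n by simp
    finally have c2: "c \<le> \<epsilon> / 2" .
    have e1: "1 - \<epsilon> / 2 \<le> exp (- c)" using exp_ge_add_one_self[of "- c"] c2 by linarith
    have e2: "?\<theta> * (1 - \<epsilon> / 2) \<le> 1 - exp (- ?\<theta>)"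
    proof -
      have le: "?\<theta> \<le> \<epsilon>" using \<theta>\<epsilon> \<epsilon> by linarith
      have "?\<theta> * ?\<theta> / 2 \<le> ?\<theta> * \<epsilon> / 2" using mult_left_mono[OF le \<theta>] by (rule divide_right_mono) simp
      hence "?\<theta>\<^sup>2 / 2 \<le> ?\<theta> * (\<epsilon> / 2)" unfolding power2_eq_square times_divide_eq_right .
      thus ?thesis using exp_minus_le_quadratic[OF \<theta>] by (simp add: algebra_simps)
    qed
    have "q \<le> (1 - \<epsilon> / 2) * (?\<theta> * (1 - \<epsilon> / 2))"
    proof -
      have "1 - \<epsilon> \<le> (1 - \<epsilon> / 2) * (1 - \<epsilon> / 2)" by (simp add: algebra_simps)
      hence "?\<theta> * (1 - \<epsilon>) \<le> ?\<theta> * ((1 - \<epsilon> / 2) * (1 - \<epsilon> / 2))" using \<theta> by (rule mult_left_mono)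
      thus ?thesis by (simp add: q_def mult_ac)
    qed
    also have "... \<le> exp (- c) * (1 - exp (- ?\<theta>))"
    proof (rule mult_mono[OF e1 e2])
      show "0 \<le> ?\<theta> * (1 - \<epsilon> / 2)" by (intro mult_nonneg_nonneg \<theta>) (use \<epsilon> in simp)
    qed simp
    also have "... = exp (- c) - exp (- (?tm (Suc j) - ?tm i))" unfolding tS c_def by (simp add: algebra_simps exp_add[symmetric])
    finally show ?thesis using c1 by (simp add: c_def)
  qed
  have rstep: "0 \<le> r j" "r j \<le> 1" "\<And>m. real m \<ge> b (j - 1) \<Longrightarrow> (1 - q) ^ m \<le> 1 - r j" if "b (j - 1) \<le> \<rho> * real n" for j
  proof -
    define x where "x = q * b (j - 1)"
    have x0: "0 \<le> x" unfolding x_def using q01 b0 by auto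
    have "x \<le> q * (\<rho> * real n)" unfolding x_def using that q01 by (intro mult_left_mono)
    also have "... \<le> ?\<theta> * (\<rho> * real n)"
    proof (rule mult_right_mono)
      have "?\<theta> * (1 - \<epsilon>) \<le> ?\<theta> * 1" by (rule mult_left_mono[OF _ \<theta>]) (use \<epsilon> in simp)
      thus "q \<le> ?\<theta>" unfolding q_def by simp
    qed (use \<rho> in simp)
    also have "... = \<tau> * \<rho>" using n by simp
    also have "... \<le> 1 * \<epsilon>" using \<tau> \<rho> by (intro mult_mono) auto
    finally have x1: "x \<le> \<epsilon>" by simp
    show "0 \<le> r j" unfolding r_def x_def[symmetric] using x0 \<epsilon> by auto
    have "x * (1 - \<epsilon>) \<le> 1 * 1" using x0 x1 \<epsilon> by (intro mult_mono) auto
    thus "r j \<le> 1" unfolding r_def x_def[symmetric] by simp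
    fix m assume m: "real m \<ge> b (j - 1)"
    have "(1 - q) ^ m \<le> exp (- q) ^ m" using q01 exp_ge_add_one_self[of "- q"] by (intro power_mono) auto
    also have "... = exp (- (q * real m))" by (simp add: exp_of_nat_mult[symmetric] mult.commute)
    also have "... \<le> exp (- x)" unfolding x_def using m q01 by (simp add: mult_left_mono)
    also have "... \<le> 1 - x + x\<^sup>2 / 2" by (rule exp_minus_le_quadratic[OF x0])
    also have "... \<le> 1 - x * (1 - \<epsilon>)"
    proof -
      have "x * x \<le> x * \<epsilon>" using x0 x1 by (intro mult_left_mono)
      moreover have "0 \<le> x * \<epsilon>" using x0 \<epsilon> by simp
      ultimately show ?thesis by (simp add: power2_eq_square algebra_simps)
    qed
    finally show "(1 - q) ^ m \<le> 1 - r j" unfolding r_def x_def .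
  qed
  \<comment> \<open>The losses are 1 - \<epsilon> from \<open>q\<close>, 1 - \<epsilon> from
    \<open>r\<close>, 1 - 2\<epsilon> from \<open>N\<close> and 1 - 3\<epsilon> from the deviation;
    their product is at least 1 - 7\<epsilon>.\<close>
  have rN: "(1 - 7 * \<epsilon>) * \<tau> * b (j - 1) \<le> (1 - 3 * \<epsilon>) * (r j * N)" "\<tau> * b (j - 1) / 2 \<le> r j * N" for j
  proof -
    have eq: "r j * N = (\<tau> * b (j - 1)) * ((1 - \<epsilon>)\<^sup>2 * (1 - 2 * \<epsilon>))"
      using n by (simp add: r_def N_def q_def power2_eq_square)
    have tb: "0 \<le> \<tau> * b (j - 1)" using \<tau> b0 by simp
    have k1: "(1 - 2 * \<epsilon>) \<le> (1 - \<epsilon>)\<^sup>2" by (simp add: power2_eq_square algebra_simps)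
    have "(1 - 2 * \<epsilon>) * (1 - 2 * \<epsilon>) \<le> (1 - \<epsilon>)\<^sup>2 * (1 - 2 * \<epsilon>)" using k1 \<epsilon> by (intro mult_right_mono) auto
    moreover have "1 - 4 * \<epsilon> \<le> (1 - 2 * \<epsilon>) * (1 - 2 * \<epsilon>)" by (simp add: algebra_simps)
    ultimately have k2: "1 - 4 * \<epsilon> \<le> (1 - \<epsilon>)\<^sup>2 * (1 - 2 * \<epsilon>)" by linarith
    have "(1 - 3 * \<epsilon>) * (1 - 4 * \<epsilon>) \<le> (1 - 3 * \<epsilon>) * ((1 - \<epsilon>)\<^sup>2 * (1 - 2 * \<epsilon>))" using k2 \<epsilon> by (intro mult_left_mono) auto
    moreover have "1 - 7 * \<epsilon> \<le> (1 - 3 * \<epsilon>) * (1 - 4 * \<epsilon>)" using \<epsilon> by (simp add: algebra_simps)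
    ultimately have k3: "1 - 7 * \<epsilon> \<le> (1 - 3 * \<epsilon>) * ((1 - \<epsilon>)\<^sup>2 * (1 - 2 * \<epsilon>))" by linarith
    have "(\<tau> * b (j - 1)) * (1 - 7 * \<epsilon>) \<le> (\<tau> * b (j - 1)) * ((1 - 3 * \<epsilon>) * ((1 - \<epsilon>)\<^sup>2 * (1 - 2 * \<epsilon>)))" using k3 tb by (rule mult_left_mono)
    thus "(1 - 7 * \<epsilon>) * \<tau> * b (j - 1) \<le> (1 - 3 * \<epsilon>) * (r j * N)" unfolding eq by (simp add: mult_ac)
    have "(\<tau> * b (j - 1)) * (1 / 2) \<le> (\<tau> * b (j - 1)) * ((1 - \<epsilon>)\<^sup>2 * (1 - 2 * \<epsilon>))" using k2 \<epsilon> tb by (intro mult_left_mono) auto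
    thus "\<tau> * b (j - 1) / 2 \<le> r j * N" unfolding eq by simp
  qed
  have admD: "adm E (D j)" for j
  proof -
    define Q where "Q h \<longleftrightarrow> (b (j - 1) \<le> real (card (\<Union>(set (take j (butlast h))))) \<and> N \<le> real (card (V - \<Union>(set (butlast h))))) \<and>
       real (card (last h)) < (1 - 3 * \<epsilon>) * (r j * N)" for h :: "nat set list"
    have "D j = (\<lambda>w. Q (?H (Suc j) w))" by (auto simp: D_def C_def Q_def)
    moreover have "adm E (\<lambda>w. Q (?H (Suc j) w))"
      by (rule adm_mono[OF adm_hist_pred[OF inc \<theta> SV]]) (auto simp: edges_in_def)
    ultimately show ?thesis by (simp only:)
  qed
  have admA: "adm E A0"
  proof -
    define Q where "Q h \<longleftrightarrow> real (card (last h)) < m1" for h :: "nat set list"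
    have "A0 = (\<lambda>w. Q (?H (Suc 0) w))" by (auto simp: A0_def Q_def)
    moreover have "adm E (\<lambda>w. Q (?H (Suc 0) w))"
      by (rule adm_mono[OF adm_hist_pred[OF inc \<theta> SV]]) (auto simp: edges_in_def)
    ultimately show ?thesis by (simp only:)
  qed
  define Fh where "Fh w \<longleftrightarrow> \<rho> * real n \<le> real (card (?B J w)) \<and> \<not> grown n g \<tau> V S T J w" for w
  have admF: "adm E Fh" unfolding Fh_def
  proof (intro adm_conj adm_not)
    show "adm E (\<lambda>w. \<rho> * real n \<le> real (card (?B J w)))"
      by (rule adm_mono[OF adm_hist_pred[OF inc \<theta> SV]]) (auto simp: edges_in_def)
    show "adm E (grown n g \<tau> V S T J)"
      by (rule adm_mono[OF adm_grown[OF g0 SV T]]) (auto simp: edges_in_def)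
  qed
  have prD: "Pr (D j) \<le> 2 * exp (- (\<epsilon>\<^sup>2 * \<tau> * m1 / 4))" if j: "j \<in> Js" for j
  proof -
    have jj: "2 \<le> j" "j < J" "b (j - 1) \<le> \<rho> * real n" using j by (auto simp: Js_def)
    have "Pr (D j) \<le> 2 * exp (- (\<epsilon>\<^sup>2 * (r j * N)))" unfolding D_def C_def
      by (rule growth_step[OF inc \<theta> SV q01 \<epsilon>(1) _ qrate rstep[OF jj(3)]]) (use \<epsilon> jj in \<open>auto simp: N_def\<close>)
    also have "... \<le> 2 * exp (- (\<epsilon>\<^sup>2 * \<tau> * m1 / 4))"
    proof -
      have "\<tau> * (m1 / 2) / 2 \<le> \<tau> * b (j - 1) / 2" using bmono[of "j - 1"] jj \<tau> by (intro divide_right_mono mult_left_mono) auto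
      hence "\<tau> * m1 / 4 \<le> r j * N" using rN(2)[of j] by linarith
      hence "\<epsilon>\<^sup>2 * (\<tau> * m1 / 4) \<le> \<epsilon>\<^sup>2 * (r j * N)" by (intro mult_left_mono) auto
      thus ?thesis by (simp add: mult.assoc)
    qed
    finally show ?thesis .
  qed
  have prA: "Pr A0 \<le> 2 * exp (- m1)"
  proof -
    let ?X = "{..<n} - V"
    have cX: "2 * card ?X \<le> n"
    proof -
      have "card ?X = n - card V" using SV fin by (subst card_Diff_subset) auto
      moreover have "card V \<le> n" using card_mono[OF _ SV(2)] by simp
      moreover have "\<epsilon> * real n \<le> 1/20 * real n" using \<epsilon> by (intro mult_right_mono) auto
      ultimately show ?thesis using cV by (simp add: algebra_simps; linarith)
    qed
    have "hits n w (g / real n) (2 * g / real n) S ?X \<subseteq> nxt ?tm ?\<theta> V w (?H 0 w)" for w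
    proof
      fix v assume v: "v \<in> hits n w (g / real n) (2 * g / real n) S ?X"
      have "?\<theta> \<le> g / real n" using g by (simp add: divide_right_mono)
      moreover have "?tm (Suc 0) = 2 * g / real n" by (simp add: grow_time_def)
      ultimately show "v \<in> nxt ?tm ?\<theta> V w (?H 0 w)" using v SV by (auto simp: hits_def nxt_def hit_def)
    qed
    hence "real (card (hits n w (g / real n) (2 * g / real n) S ?X)) \<le> real (card (nxt ?tm ?\<theta> V w (?H 0 w)))" for w
      using fin by (intro of_nat_mono card_mono) (auto simp: nxt_def)
    hence imp: "A0 w \<Longrightarrow> True \<and> real (card (hits n w (g / real n) (2 * g / real n) S ?X)) < g * real (card S) / 32" for w
      unfolding A0_def m1 by (meson le_less_trans)
    have SX: "S \<subseteq> ?X" using SV by blast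
    have "Pr A0 \<le> Pr (\<lambda>w. True \<and> real (card (hits n w (g / real n) (2 * g / real n) S ?X)) < g * real (card S) / 32)"
      by (intro Pr_mono adm_conj adm_const adm_hits SX imp) auto
    also have "... \<le> Pr (\<lambda>x. True) * (2 * exp (- (g * real (card S) / 32)))"
      by (rule hits_prob_window[where G = "{}"]) (use SX cX g g0 n in auto)
    finally show ?thesis by (simp add: m1)
  qed
  have prF: "Pr Fh \<le> exp (- (g * \<rho> * real (card T) / 2))"
    unfolding Fh_def by (rule final_hit_prob[OF g0 g(1,2) SV T n]) (use \<rho> in auto)
  have cover: "A0 w \<or> (\<exists>j\<in>Js. D j w) \<or> Fh w" if ng: "\<not> grown n g \<tau> V S T J w" for w
  proof (rule ccontr)
    assume con: "\<not> (A0 w \<or> (\<exists>j\<in>Js. D j w) \<or> Fh w)"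
    have fB: "finite (?B j w)" for j
    proof -
      have "?B j w \<subseteq> S \<union> V" using hist_subset[of ?tm ?\<theta> V S j w] by blast
      thus ?thesis using fin by (meson finite_UnI finite_subset)
    qed
    have small: "real (card (?B J w)) < \<rho> * real n" using con ng by (auto simp: Fh_def)
    have cm: "card (?B i w) \<le> card (?B j w)" if "i \<le> j" for i j using Union_hist_mono[OF that] fB by (intro card_mono)
    have sm: "real (card (?B j w)) < \<rho> * real n" if "j \<le> J" for j using cm[OF that] small by linarith
    have cS: "real (card (?B (Suc j) w)) = real (card (?B j w)) + real (card (nxt ?tm ?\<theta> V w (?H j w)))" for j
      using card_Union_hist_Suc[OF fin, of ?tm ?\<theta> j w] by simp
    have lb: "b j \<le> real (card (?B j w))" if "1 \<le> j" "j \<le> J" for j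
      using that
    proof (induction j rule: less_induct)
      case (less j)
      have B1: "m1 \<le> real (card (?B 1 w))" using con cS[of 0] by (simp add: A0_def)
      consider "j = 1" | "j = 2" | "3 \<le> j" using less.prems by linarith
      thus ?case
      proof cases
        case 1
        have "b 1 \<le> m1" unfolding b_def using m10 \<gamma> mult_left_mono[of 1 \<gamma> m1] by (auto simp: power2_eq_square divide_simps)
        thus ?thesis using B1 1 by simp
      next
        case 2
        have "b 2 = m1" unfolding b_def using \<gamma> by simp
        thus ?thesis using B1 cm[of 1 2] 2 by simp
      next
        case 3
        define i where "i = j - 1"
        have i: "j = Suc i" "2 \<le> i" "i < J" using 3 less.prems by (auto simp: i_def)
        have bi: "b i \<le> real (card (?B i w))" "b (i - 1) \<le> real (card (?B (i - 1) w))" using less.IH[of i] less.IH[of "i - 1"] i by auto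
        have "b (i - 1) \<le> \<rho> * real n" using bi(2) sm[of "i - 1"] i by linarith
        hence "i \<in> Js" using i by (simp add: Js_def)
        hence nD: "\<not> D i w" using con by blast
        have "C i w" unfolding C_def
        proof
          have "take i (?H i w) = ?H (i - 1) w" using take_hist[of "i - 1" i ?tm ?\<theta> V S w] i by simp
          thus "b (i - 1) \<le> real (card (\<Union>(set (take i (?H i w)))))" using bi by simp
          have "card V \<le> card (?B i w) + card (V - ?B i w)"
            using fin fB card_mono[of "?B i w \<union> (V - ?B i w)" V] card_Un_le[of "?B i w" "V - ?B i w"] by auto
          moreover have "\<rho> * real n \<le> \<epsilon> * real n" using \<rho> by (intro mult_right_mono) auto
          moreover have "real (card (?B i w)) < \<rho> * real n" using sm[of i] i by simp
          ultimately show "N \<le> real (card (V - ?B i w))" unfolding N_def using cV by (simp add: algebra_simps; linarith)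
        qed
        hence "(1 - 3 * \<epsilon>) * (r i * N) \<le> real (card (nxt ?tm ?\<theta> V w (?H i w)))" using nD by (auto simp: D_def)
        hence ge: "b i + (1 - 7 * \<epsilon>) * \<tau> * b (i - 1) \<le> real (card (?B j w))" using rN(1)[of i] bi(1) cS[of i] i(1) by simp
        obtain k where k: "i = Suc k" using i by (cases i) auto
        have "b j = b k * \<gamma>\<^sup>2" unfolding b_def i(1) k using \<gamma> by (simp add: power2_eq_square)
        also have "... \<le> b k * (\<gamma> + (1 - 7 * \<epsilon>) * \<tau>)" using \<gamma> b0 by (intro mult_left_mono) auto
        also have "... = b i + (1 - 7 * \<epsilon>) * \<tau> * b (i - 1)"
        proof -
          have "b i = b k * \<gamma>" by (simp add: b_def k)
          thus ?thesis by (simp add: k algebra_simps)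
        qed
        finally show ?thesis using ge by linarith
      qed
    qed
    have "\<gamma> ^ J = \<gamma> ^ (J - 2) * \<gamma>\<^sup>2" by (metis J(1) le_add_diff_inverse2 power_add)
    hence "b J = m1 * \<gamma> ^ (J - 2)" unfolding b_def using \<gamma> by simp
    hence "\<rho> * real n \<le> real (card (?B J w))" using lb[of J] J(1) reach by simp
    thus False using small by simp
  qed
  have "Pr (\<lambda>w. \<not> grown n g \<tau> V S T J w) \<le> Pr (\<lambda>w. A0 w \<or> ((\<exists>j\<in>Js. D j w) \<or> Fh w))"
    using cover by (intro Pr_mono adm_disj admA admF adm_bex admD) (auto simp: Js_def)
  also have "... \<le> Pr A0 + Pr (\<lambda>w. (\<exists>j\<in>Js. D j w) \<or> Fh w)" by (intro Pr_disj adm_disj admA admF adm_bex admD) (auto simp: Js_def)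
  also have "... \<le> Pr A0 + (Pr (\<lambda>w. \<exists>j\<in>Js. D j w) + Pr Fh)" by (intro add_left_mono Pr_disj admF adm_bex admD) (auto simp: Js_def)
  also have "Pr (\<lambda>w. \<exists>j\<in>Js. D j w) \<le> (\<Sum>j\<in>Js. Pr (D j))" by (intro Pr_bex admD) (auto simp: Js_def)
  also have "... \<le> real (card Js) * (2 * exp (- (\<epsilon>\<^sup>2 * \<tau> * m1 / 4)))" by (intro sum_bounded_above prD)
  also have "... \<le> real J * (2 * exp (- (\<epsilon>\<^sup>2 * \<tau> * m1 / 4)))"
  proof (intro mult_right_mono)
    have "card Js \<le> card {2..<J}" by (intro card_mono) (auto simp: Js_def)
    thus "real (card Js) \<le> real J" by simp
  qed auto
  finally show ?thesis using prA prF by linarith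
qed

end

section \<open>Uniform growth from small sets\<close>

text \<open>\<open>F\<close> collects the end points of the edges that earlier paths may have used up.\<close>

definition grow_all :: "nat \<Rightarrow> real \<Rightarrow> real \<Rightarrow> real \<Rightarrow> nat \<Rightarrow> nat \<Rightarrow> nat \<Rightarrow> nat \<Rightarrow> weights \<Rightarrow> bool" where
  "grow_all n L g \<tau> z m f J w \<longleftrightarrow> (\<forall>Z S Z' T F. Z \<subseteq> {..<n} \<longrightarrow> S \<subseteq> {..<n} \<longrightarrow> Z' \<subseteq> {..<n} \<longrightarrow> T \<subseteq> {..<n} \<longrightarrow> F \<subseteq> {..<n} \<longrightarrow>
     card Z = z \<longrightarrow> card S = m \<longrightarrow> card Z' = z \<longrightarrow> card T = m \<longrightarrow> card F = f \<longrightarrow>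
     Z \<inter> S = {} \<longrightarrow> Z' \<inter> T = {} \<longrightarrow> (Z \<union> S) \<inter> (Z' \<union> T) = {} \<longrightarrow> attached n L Z S w \<longrightarrow> attached n L Z' T w \<longrightarrow>
     grown n g \<tau> ({..<n} - (Z \<union> S \<union> Z' \<union> T \<union> F)) S T J w)"

text \<open>The union bound over the five sets costs n^(2z+f) for \<open>Z\<close>,
  \<open>Z'\<close> and \<open>F\<close>, but only (zL)^(2m) for \<open>S\<close> and
  \<open>T\<close>, since the attachment probabilities cancel n^(2m). Attachment and growth use
  disjoint edge sets because \<open>Z\<close> and \<open>Z'\<close> are removed from the explored
  region.\<close>

lemma (in exp_graph) grow_all_prob:
  assumes \<epsilon>: "0 < \<epsilon>" "\<epsilon> \<le> 1/20" and \<tau>: "0 < \<tau>" "\<tau> \<le> 1" and g: "\<tau> \<le> g" "4 * g \<le> real n" "g * real m \<le> 2 * real n"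
    and L: "0 \<le> L" and card: "real (2 * z + 2 * m + f) \<le> \<epsilon> * real n" and n: "n > 0" and \<rho>: "0 < \<rho>" "\<rho> \<le> \<epsilon>"
    and J: "2 \<le> J" "2 * g + real J * \<tau> \<le> \<epsilon> / 2 * real n"
    and \<gamma>: "1 \<le> \<gamma>" "\<gamma> \<le> 2" "\<gamma>\<^sup>2 \<le> \<gamma> + (1 - 7 * \<epsilon>) * \<tau>"
    and reach: "\<rho> * real n \<le> g * real m / 32 * \<gamma> ^ (J - 2)"
    and b: "b = 2 * exp (- (g * real m / 32)) + real J * (2 * exp (- (\<epsilon>\<^sup>2 * \<tau> * (g * real m / 32) / 4))) + exp (- (g * \<rho> * real m / 2))"
  shows "fails_at_most (grow_all n L g \<tau> z m f J) (real n ^ (2 * z + f) * (real z * L) ^ (2 * m) * b)"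
proof -
  define V where "V Z S Z' T F = {..<n} - (Z \<union> S \<union> Z' \<union> T \<union> F)" for Z S Z' T F :: "nat set"
  define bad where "bad Z S Z' T F w \<longleftrightarrow> Z \<inter> S = {} \<and> Z' \<inter> T = {} \<and> (Z \<union> S) \<inter> (Z' \<union> T) = {} \<and>
    attached n L Z S w \<and> attached n L Z' T w \<and> \<not> grown n g \<tau> (V Z S Z' T F) S T J w" for Z S Z' T F w
  define sub where "sub c = {S. S \<subseteq> {..<n} \<and> card S = c}" for c
  define \<psi> where "\<psi> x \<longleftrightarrow> (\<exists>Z\<in>sub z. \<exists>S\<in>sub m. \<exists>Z'\<in>sub z. \<exists>T\<in>sub m. \<exists>F\<in>sub f. bad Z S Z' T F x)" for x
  let ?p = "(real z * L / real n) ^ m"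
  have g0: "0 \<le> g" "0 \<le> \<tau>" using g \<tau> by auto
  have b0: "0 \<le> b" unfolding b by (intro add_nonneg_nonneg mult_nonneg_nonneg) auto
  have p0: "0 \<le> ?p" using L by auto
  have main: "adm E (bad Z S Z' T F) \<and> Pr (bad Z S Z' T F) \<le> ?p * (?p * b)"
    if Z: "Z \<in> sub z" and S: "S \<in> sub m" and Z': "Z' \<in> sub z" and T: "T \<in> sub m" and F: "F \<in> sub f" for Z S Z' T F
  proof (cases "Z \<inter> S = {} \<and> Z' \<inter> T = {} \<and> (Z \<union> S) \<inter> (Z' \<union> T) = {}")
    case False
    hence "bad Z S Z' T F = (\<lambda>x. False)" by (auto simp: bad_def fun_eq_iff)
    thus ?thesis using p0 b0 by (simp add: adm_const)
  next
    case True
    have subs: "Z \<subseteq> {..<n}" "S \<subseteq> {..<n}" "Z' \<subseteq> {..<n}" "T \<subseteq> {..<n}" "F \<subseteq> {..<n}"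
      and cards: "card Z = z" "card S = m" "card Z' = z" "card T = m" "card F = f" using Z S Z' T F by (auto simp: sub_def)
    let ?V = "V Z S Z' T F"
    have Vn: "?V \<subseteq> {..<n}" "S \<inter> ?V = {}" "T \<inter> (S \<union> ?V) = {}" using True by (auto simp: V_def)
    have dZ: "Z \<inter> S = {}" "Z' \<inter> T = {}" using True by auto
    let ?G1 = "(\<lambda>(z, y). {z, y}) ` (Z \<times> S)" and ?G2 = "(\<lambda>(z, y). {z, y}) ` (Z' \<times> T)" and ?G3 = "edges_in (S \<union> ?V \<union> T)"
    have a1: "adm ?G1 (attached n L Z S)" "?G1 \<subseteq> E" by (rule adm_attached[OF subs(1,2) dZ(1)])+
    have a2: "adm ?G2 (attached n L Z' T)" "?G2 \<subseteq> E" by (rule adm_attached[OF subs(3,4) dZ(2)])+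
    have a3: "adm ?G3 (\<lambda>w. \<not> grown n g \<tau> ?V S T J w)" by (intro adm_not adm_grown g0 subs Vn)
    have G3: "?G3 \<subseteq> E" by (auto simp: edges_in_def)
    have d23: "?G2 \<inter> ?G3 = {}" using True by (auto simp: edges_in_def V_def)
    have d1: "?G1 \<inter> (?G2 \<union> ?G3) = {}" using True by (auto simp: edges_in_def V_def doubleton_eq_iff)
    have a23: "adm (?G2 \<union> ?G3) (\<lambda>w. attached n L Z' T w \<and> \<not> grown n g \<tau> ?V S T J w)"
      by (intro adm_conj adm_mono[OF a2(1)] adm_mono[OF a3]) auto
    have eq: "bad Z S Z' T F = (\<lambda>w. attached n L Z S w \<and> (attached n L Z' T w \<and> \<not> grown n g \<tau> ?V S T J w))"
      using True by (auto simp: bad_def fun_eq_iff)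
    have "Pr (bad Z S Z' T F) = Pr (attached n L Z S) * (Pr (attached n L Z' T) * Pr (\<lambda>w. \<not> grown n g \<tau> ?V S T J w))"
      unfolding eq using Pr_indep[OF a1(1) a23 a1(2) _ d1] Pr_indep[OF a2(1) a3 a2(2) G3 d23] a2(2) G3 by simp
    also have "... \<le> ?p * (?p * b)"
    proof (intro mult_mono)
      show "Pr (attached n L Z S) \<le> ?p" using Pr_attached[OF subs(1,2) dZ(1) L] cards by simp
      show "Pr (attached n L Z' T) \<le> ?p" using Pr_attached[OF subs(3,4) dZ(2) L] cards by simp
      have "(1 - \<epsilon>) * real n \<le> real (card ?V)"
      proof -
        have "n \<le> card (?V \<union> (Z \<union> S \<union> Z' \<union> T \<union> F))"
          using subs by (intro card_mono[of _ "{..<n}", simplified]) (auto simp: V_def intro: finite_subset)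
        also have "... \<le> card ?V + (card Z + card S + card Z' + card T + card F)"
          using card_Un_le[of ?V "Z \<union> S \<union> Z' \<union> T \<union> F"] card_Un_le[of "Z \<union> S \<union> Z' \<union> T" F] card_Un_le[of "Z \<union> S \<union> Z'" T]
            card_Un_le[of "Z \<union> S" Z'] card_Un_le[of Z S] by linarith
        finally have "real n \<le> real (card ?V) + real (2 * z + 2 * m + f)" unfolding cards by linarith
        thus ?thesis using card by (simp add: algebra_simps)
      qed
      from growth_prob[OF \<epsilon> \<tau> g(1,2) _ subs(2) Vn(1,2) subs(4) Vn(3) this n \<rho> J \<gamma> refl] reach g(3)
      show "Pr (\<lambda>w. \<not> grown n g \<tau> ?V S T J w) \<le> b" unfolding b cards by simp
    qed (use p0 in auto)
    finally have "Pr (bad Z S Z' T F) \<le> ?p * (?p * b)" .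
    moreover have "adm E (bad Z S Z' T F)" unfolding eq
      by (intro adm_conj adm_mono[OF a1(1) a1(2)] adm_mono[OF a2(1) a2(2)] adm_mono[OF a3 G3])
    ultimately show ?thesis by blast
  qed
  have admb: "adm E (bad Z S Z' T F)" if "Z \<in> sub z" "S \<in> sub m" "Z' \<in> sub z" "T \<in> sub m" "F \<in> sub f" for Z S Z' T F
    using main[OF that] by blast
  have pp0: "0 \<le> ?p * (?p * b)" using p0 b0 by auto
  have fs: "finite (sub c)" for c by (simp add: sub_def)
  have "Pr \<psi> \<le> real n ^ z * (real n ^ m * (real n ^ z * (real n ^ m * (real n ^ f * (?p * (?p * b))))))"
    unfolding \<psi>_def
    apply (subst (1) sub_def, rule Pr_ex_subset, intro adm_bex fs admb, (simp_all add: sub_def)[5])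
    apply (subst (1) sub_def, rule Pr_ex_subset, intro adm_bex fs admb, (simp_all add: sub_def)[5])
    apply (subst (1) sub_def, rule Pr_ex_subset, intro adm_bex fs admb, (simp_all add: sub_def)[5])
    apply (subst (1) sub_def, rule Pr_ex_subset, intro adm_bex fs admb, (simp_all add: sub_def)[5])
    apply (subst (1) sub_def, rule Pr_ex_subset, intro adm_bex fs admb, (simp_all add: sub_def)[5])
    using main pp0 by (auto simp: sub_def intro!: mult_nonneg_nonneg)
  also have "... = real n ^ (2 * z + f) * (real z * L) ^ (2 * m) * b"
  proof -
    have AP: "real n ^ m * ?p = (real z * L) ^ m" using n by (simp add: power_divide)
    have "real n ^ z * (real n ^ m * (real n ^ z * (real n ^ m * (real n ^ f * (?p * (?p * b)))))) =
      (real n ^ z * real n ^ z * real n ^ f) * ((real n ^ m * ?p) * (real n ^ m * ?p)) * b" by (simp only: mult_ac)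
    also have "... = real n ^ (2 * z + f) * (real z * L) ^ (2 * m) * b" unfolding AP by (simp only: power_add mult_2 mult.assoc)
    finally show ?thesis .
  qed
  finally have "Pr \<psi> \<le> real n ^ (2 * z + f) * (real z * L) ^ (2 * m) * b" .
  moreover have "adm E \<psi>" unfolding \<psi>_def by (intro adm_bex fs admb)
  moreover have "\<psi> x" if "\<not> grow_all n L g \<tau> z m f J x" for x
    using that unfolding grow_all_def \<psi>_def bad_def V_def sub_def by blast
  ultimately show ?thesis by blast
qed

text \<open>A population in which a vertex starts to reproduce one time step \<open>\<tau>\<close> after its birth, at rate almost
  \<open>1\<close>, grows by the factor \<open>\<gamma>\<close> per step; a fine discretisation reaches the exponential growth rate \<open>1\<close>.\<close>

lemma growth_rate_exists:
  fixes \<eta> :: real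
  assumes "0 < \<eta>"
  shows "\<exists>\<epsilon> \<tau> \<gamma>. 0 < \<epsilon> \<and> \<epsilon> \<le> 1/20 \<and> 0 < \<tau> \<and> \<tau> \<le> 1 \<and> 1 < \<gamma> \<and> \<gamma> \<le> 2 \<and> \<gamma>\<^sup>2 \<le> \<gamma> + (1 - 7 * \<epsilon>) * \<tau> \<and> \<tau> \<le> (1 + \<eta>) * ln \<gamma>"
proof -
  define e where "e = min (1/20) (\<eta> / (9 * (1 + \<eta>)))"
  have "0 < e" using assms by (auto simp: e_def)
  moreover have "e \<le> 1/20" "e \<le> \<eta> / (9 * (1 + \<eta>))" unfolding e_def by (rule min.cobounded1, rule min.cobounded2)
  ultimately have e: "0 < e" "e \<le> 1/20" "e \<le> \<eta> / (9 * (1 + \<eta>))" by blast+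
  define t where "t = (1 - 7 * e) * e"
  have t: "0 < t" "t \<le> e" using e by (auto simp: t_def mult_le_cancel_right1)
  \<comment> \<open>The positive root of x^2 = x + t is 1 + t - t^2 plus terms of order t^3; the
    truncation stays below the root.\<close>
  define \<gamma> where "\<gamma> = 1 + (t - t\<^sup>2)"
  have tt: "t\<^sup>2 \<le> t / 20" using t e mult_left_mono[of t "1/20" t] by (simp add: power2_eq_square)
  have t20: "0 \<le> t\<^sup>2" by simp
  have \<gamma>: "1 < \<gamma>" "\<gamma> \<le> 2" using t e tt t20 unfolding \<gamma>_def by linarith+
  have sq: "\<gamma>\<^sup>2 \<le> \<gamma> + t"
  proof -
    have "\<gamma> + t - \<gamma>\<^sup>2 = t ^ 3 * (2 - t)" unfolding \<gamma>_def by (simp add: algebra_simps power2_eq_square power3_eq_cube)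
    moreover have "0 \<le> t ^ 3 * (2 - t)" using t e by (intro mult_nonneg_nonneg) auto
    ultimately show ?thesis by linarith
  qed
  have "(t - t\<^sup>2) - (t - t\<^sup>2)\<^sup>2 \<le> ln \<gamma>" unfolding \<gamma>_def using \<gamma> t e tt by (intro ln_one_plus_pos_lower_bound) (auto simp: \<gamma>_def)
  moreover have "(t - t\<^sup>2)\<^sup>2 \<le> t\<^sup>2" using \<gamma> t by (intro power_mono) (auto simp: \<gamma>_def)
  ultimately have l1: "t - 2 * t\<^sup>2 \<le> ln \<gamma>" by linarith
  have "t * t \<le> t * e" using t by (intro mult_left_mono) auto
  hence "t * (1 - 2 * e) \<le> ln \<gamma>" using l1 by (simp add: algebra_simps power2_eq_square)
  moreover have "e * (1 - 9 * e) \<le> t * (1 - 2 * e)" using e by (simp add: t_def algebra_simps)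
  ultimately have l2: "e * (1 - 9 * e) \<le> ln \<gamma>" by linarith
  have "1 \<le> (1 + \<eta>) * (1 - 9 * e)"
  proof -
    have "(1 + \<eta>) * (9 * e) \<le> (1 + \<eta>) * (9 * (\<eta> / (9 * (1 + \<eta>))))" using e assms by (intro mult_left_mono) auto
    also have "... = \<eta>" using assms by (simp add: field_simps)
    finally show ?thesis by (simp add: algebra_simps)
  qed
  hence "e * 1 \<le> e * ((1 + \<eta>) * (1 - 9 * e))" using e by (intro mult_left_mono) auto
  also have "... = (1 + \<eta>) * (e * (1 - 9 * e))" by (simp add: mult_ac)
  also have "... \<le> (1 + \<eta>) * ln \<gamma>" using l2 assms by (intro mult_left_mono) auto
  finally have "e \<le> (1 + \<eta>) * ln \<gamma>" by simp
  thus ?thesis using e \<gamma> sq by (intro exI[of _ e] exI[of _ e] exI[of _ \<gamma>]) (auto simp: t_def)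
qed

text \<open>With \<open>K = k + ln n\<close>, the first \<open>k - 1\<close> paths cost \<open>O(K/n)\<close> each, so they can block at most \<open>O(K\<^sup>2)\<close>
  vertices. Two exploration steps from \<open>\<zeta>K\<close> unused neighbours give order \<open>K\<^sup>3\<close> vertices, which is enough
  for the growth estimate to survive a union bound over the blocked set.\<close>

definition level1 :: "real \<Rightarrow> real \<Rightarrow> nat" where "level1 \<zeta> K = nat \<lceil>\<zeta> * K\<rceil>"
definition level2 :: "real \<Rightarrow> real \<Rightarrow> real \<Rightarrow> nat" where "level2 \<zeta> \<delta> K = nat \<lceil>\<zeta> * \<delta> * K\<^sup>2 / 64\<rceil>"
definition level3 :: "real \<Rightarrow> real \<Rightarrow> real \<Rightarrow> nat" where "level3 \<zeta> \<delta> K = nat \<lceil>\<zeta> * \<delta>\<^sup>2 * K ^ 3 / 4096\<rceil>"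
definition blocked :: "real \<Rightarrow> real \<Rightarrow> nat" where "blocked c K = nat \<lceil>c * K\<^sup>2\<rceil>"
definition steps :: "real \<Rightarrow> nat \<Rightarrow> nat" where "steps \<gamma> n = nat \<lceil>ln (real n) / ln \<gamma>\<rceil> + 2"

text \<open>Each clause expands a set attached to the preceding one: level 1 attached to an end
  point, level 2 to level 1, level 3 to level 2. The bound 4K/n covers every attaching weight, and
  \<delta>K is the window scale.\<close>

definition small_event :: "real \<Rightarrow> real \<Rightarrow> real \<Rightarrow> real \<Rightarrow> real \<Rightarrow> nat \<Rightarrow> nat \<Rightarrow> weights \<Rightarrow> bool" where
  "small_event \<zeta> \<delta> c \<tau> \<gamma> n k w \<longleftrightarrow> (let K = real k + ln (real n) in
     local_spread n (4 * K) (\<delta> * K) 1 (level1 \<zeta> K) w \<and>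
     local_spread n (4 * K) (\<delta> * K) (level1 \<zeta> K) (level2 \<zeta> \<delta> K) w \<and>
     grow_all n (4 * K) (\<delta> * K) \<tau> (level2 \<zeta> \<delta> K) (level3 \<zeta> \<delta> K) (blocked c K) (steps \<gamma> n) w)"

lemma (in exp_graph) Pr_conj3:
  assumes "fails_at_most A a" "fails_at_most B b"
    "fails_at_most C c"
  shows "fails_at_most (\<lambda>x. A x \<and> B x \<and> C x) (a + b + c)"
proof -
  obtain f where f: "adm E f" "\<And>x. \<not> A x \<Longrightarrow> f x" "Pr f \<le> a" using assms(1) by blast
  obtain g where g: "adm E g" "\<And>x. \<not> B x \<Longrightarrow> g x" "Pr g \<le> b" using assms(2) by blast
  obtain h where h: "adm E h" "\<And>x. \<not> C x \<Longrightarrow> h x" "Pr h \<le> c" using assms(3) by blast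
  have "Pr (\<lambda>x. f x \<or> (g x \<or> h x)) \<le> Pr f + Pr (\<lambda>x. g x \<or> h x)" by (intro Pr_disj adm_disj f g h)
  also have "... \<le> Pr f + (Pr g + Pr h)" by (intro add_left_mono Pr_disj f g h)
  finally have "Pr (\<lambda>x. f x \<or> (g x \<or> h x)) \<le> a + b + c" using f g h by linarith
  thus ?thesis using f g h by (intro exI[of _ "\<lambda>x. f x \<or> (g x \<or> h x)"]) (auto intro!: adm_disj)
qed

lemma eventually_all_ge:
  assumes "eventually P (at_top :: real filter)"
  shows "\<forall>\<^sub>F X in at_top. \<forall>K\<ge>X. P K"
proof -
  obtain N where N: "\<And>K. K \<ge> N \<Longrightarrow> P K" using assms by (auto simp: eventually_at_top_linorder)
  show ?thesis using eventually_ge_at_top[of N] by eventually_elim (auto intro: N)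
qed

abbreviation small_rates :: "real \<Rightarrow> real \<Rightarrow> real \<Rightarrow> real \<Rightarrow> real \<Rightarrow> real \<Rightarrow> real \<Rightarrow> bool" where
  "small_rates \<zeta> \<delta> c \<tau> lg \<kappa> K \<equiv> 1 \<le> K \<and> \<tau> \<le> \<delta> * K \<and> 1 \<le> \<delta> * K * (\<zeta> * \<delta>\<^sup>2 * K ^ 3 / 4096) / 32 \<and>
     ln (4 * K) - \<delta> * K / 32 \<le> - (\<delta> * K / 64) \<and> ln ((\<zeta> * K + 1) * (4 * K)) - \<delta> * K / 32 \<le> - (\<delta> * K / 64) \<and>
     2 * ln ((\<zeta> * \<delta> * K\<^sup>2 / 64 + 1) * (4 * K)) - \<kappa> * \<delta> * K \<le> - (\<kappa> * \<delta> * K / 2) \<and>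
     K + 1 - (\<zeta> * K) * (\<delta> * K / 64) \<le> - (2 * K) \<and>
     K * (\<zeta> * K + 1) + 1 - (\<zeta> * \<delta> * K\<^sup>2 / 64) * (\<delta> * K / 64) \<le> - (2 * K) \<and>
     K * (2 * (\<zeta> * \<delta> * K\<^sup>2 / 64 + 1) + (c * K\<^sup>2 + 1)) - (\<zeta> * \<delta>\<^sup>2 * K ^ 3 / 4096) * (\<kappa> * \<delta> * K / 2) + 3 + 2 * (K / lg + 3) \<le> - (2 * K)"

abbreviation small_sizes :: "real \<Rightarrow> real \<Rightarrow> real \<Rightarrow> real \<Rightarrow> real \<Rightarrow> real \<Rightarrow> real \<Rightarrow> real \<Rightarrow> bool" where
  "small_sizes \<zeta> \<delta> c \<tau> lg \<epsilon> X K \<equiv> 1 \<le> X \<and> 4 * (\<delta> * K) \<le> exp X \<and> \<delta> * K * (\<zeta> * \<delta>\<^sup>2 * K ^ 3 / 4096 + 1) \<le> 2 * exp X \<and> \<delta> * K * (\<zeta> * K + 1) \<le> 2 * exp X \<and>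
     \<delta> * K * (\<zeta> * \<delta> * K\<^sup>2 / 64 + 1) \<le> 2 * exp X \<and>
     2 * (\<zeta> * \<delta> * K\<^sup>2 / 64 + 1) + 2 * (\<zeta> * \<delta>\<^sup>2 * K ^ 3 / 4096 + 1) + (c * K\<^sup>2 + 1) \<le> \<epsilon> * exp X \<and>
     2 * (\<zeta> * K + 1 + (\<zeta> * \<delta> * K\<^sup>2 / 64 + 1)) \<le> exp X \<and> 2 * (1 + (\<zeta> * K + 1)) \<le> exp X \<and>
     2 * (\<delta> * K) + (X / lg + 3) * \<tau> \<le> \<epsilon> / 2 * exp X"

text \<open>Reduces asymptotics in two variables to one: \<open>small_rates\<close> holds for all
  large \<open>K\<close>, while the left sides in \<open>small_sizes\<close> increase with
  \<open>K\<close> and are checked at the largest value 2 X^2. Here X stands for ln n and exp X for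
  n.\<close>

lemma small_numeric:
  fixes \<zeta> \<delta> c \<tau> lg \<epsilon> \<kappa> :: real
  assumes pos: "0 < \<zeta>" "0 < \<delta>" "0 < c" "0 < \<tau>" "0 < lg" "0 < \<epsilon>" "0 < \<kappa>"
  shows "\<forall>\<^sub>F X in at_top. \<forall>K. X \<le> K \<and> K \<le> 2 * X\<^sup>2 \<longrightarrow>
    small_sizes \<zeta> \<delta> c \<tau> lg \<epsilon> X K \<and> small_rates \<zeta> \<delta> c \<tau> lg \<kappa> K"
proof -
  have A: "\<forall>\<^sub>F K in at_top. small_rates \<zeta> \<delta> c \<tau> lg \<kappa> K"
    using pos by (intro eventually_conj; real_asymp)
  have B: "\<forall>\<^sub>F X in at_top. small_sizes \<zeta> \<delta> c \<tau> lg \<epsilon> X (2 * X\<^sup>2)"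
    using pos by (intro eventually_conj; real_asymp)
  show ?thesis using eventually_all_ge[OF A] B eventually_ge_at_top[of 1]
  proof eventually_elim
    case (elim X)
    show ?case
    proof (intro allI impI)
      fix K assume K: "X \<le> K \<and> K \<le> 2 * X\<^sup>2"
      define Y where "Y = 2 * X\<^sup>2"
      have KY: "K \<le> Y" "0 \<le> K" using K elim(3) by (auto simp: Y_def)
      have m: "K\<^sup>2 \<le> Y\<^sup>2" "K ^ 3 \<le> Y ^ 3" using KY by (auto intro: power_mono)
      have p2: "\<zeta> * \<delta> * K\<^sup>2 / 64 \<le> \<zeta> * \<delta> * Y\<^sup>2 / 64" using m pos by (intro divide_right_mono mult_left_mono) auto
      have p3: "\<zeta> * \<delta>\<^sup>2 * K ^ 3 / 4096 \<le> \<zeta> * \<delta>\<^sup>2 * Y ^ 3 / 4096" using m pos by (intro divide_right_mono mult_left_mono) auto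
      have p1: "\<zeta> * K \<le> \<zeta> * Y" "\<delta> * K \<le> \<delta> * Y" using KY pos by (auto intro: mult_left_mono)
      have pc: "c * K\<^sup>2 \<le> c * Y\<^sup>2" using m pos by (intro mult_left_mono) auto
      have n0: "0 \<le> \<delta> * K" "0 \<le> \<delta> * Y" "0 \<le> \<zeta> * K" "0 \<le> \<zeta> * \<delta> * K\<^sup>2 / 64" "0 \<le> \<zeta> * \<delta>\<^sup>2 * K ^ 3 / 4096" using KY pos by auto
      have q: "\<delta> * K * (\<zeta> * \<delta>\<^sup>2 * K ^ 3 / 4096 + 1) \<le> \<delta> * Y * (\<zeta> * \<delta>\<^sup>2 * Y ^ 3 / 4096 + 1)"
        "\<delta> * K * (\<zeta> * K + 1) \<le> \<delta> * Y * (\<zeta> * Y + 1)" "\<delta> * K * (\<zeta> * \<delta> * K\<^sup>2 / 64 + 1) \<le> \<delta> * Y * (\<zeta> * \<delta> * Y\<^sup>2 / 64 + 1)"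
        using p1 p2 p3 n0 by (auto intro!: mult_mono simp del: mult_pos_pos)
      note B = elim(2)[folded Y_def]
      have "small_sizes \<zeta> \<delta> c \<tau> lg \<epsilon> X K"
      proof (intro conjI)
        have b: "4 * (\<delta> * Y) \<le> exp X" "\<delta> * Y * (\<zeta> * \<delta>\<^sup>2 * Y ^ 3 / 4096 + 1) \<le> 2 * exp X" "\<delta> * Y * (\<zeta> * Y + 1) \<le> 2 * exp X"
          "\<delta> * Y * (\<zeta> * \<delta> * Y\<^sup>2 / 64 + 1) \<le> 2 * exp X"
          "2 * (\<zeta> * \<delta> * Y\<^sup>2 / 64 + 1) + 2 * (\<zeta> * \<delta>\<^sup>2 * Y ^ 3 / 4096 + 1) + (c * Y\<^sup>2 + 1) \<le> \<epsilon> * exp X"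
          "2 * (\<zeta> * Y + 1 + (\<zeta> * \<delta> * Y\<^sup>2 / 64 + 1)) \<le> exp X" "2 * (1 + (\<zeta> * Y + 1)) \<le> exp X"
          "2 * (\<delta> * Y) + (X / lg + 3) * \<tau> \<le> \<epsilon> / 2 * exp X" using B by blast+
        show "1 \<le> X" by (rule elim(3))
        show "4 * (\<delta> * K) \<le> exp X" using b(1) p1 by linarith
        show "\<delta> * K * (\<zeta> * \<delta>\<^sup>2 * K ^ 3 / 4096 + 1) \<le> 2 * exp X" using b(2) q(1) by (rule order_trans[rotated])
        show "\<delta> * K * (\<zeta> * K + 1) \<le> 2 * exp X" using b(3) q(2) by (rule order_trans[rotated])
        show "\<delta> * K * (\<zeta> * \<delta> * K\<^sup>2 / 64 + 1) \<le> 2 * exp X" using b(4) q(3) by (rule order_trans[rotated])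
        show "2 * (\<zeta> * \<delta> * K\<^sup>2 / 64 + 1) + 2 * (\<zeta> * \<delta>\<^sup>2 * K ^ 3 / 4096 + 1) + (c * K\<^sup>2 + 1) \<le> \<epsilon> * exp X"
          by (rule order_trans[OF _ b(5)]) (intro add_mono mult_left_mono p2 p3 pc order_refl, auto)
        show "2 * (\<zeta> * K + 1 + (\<zeta> * \<delta> * K\<^sup>2 / 64 + 1)) \<le> exp X"
          by (rule order_trans[OF _ b(6)]) (intro mult_left_mono[of _ _ 2] add_mono p2 p1 order_refl, auto)
        show "2 * (1 + (\<zeta> * K + 1)) \<le> exp X"
          by (rule order_trans[OF _ b(7)]) (intro mult_left_mono[of _ _ 2] add_mono p1 order_refl, auto)
        show "2 * (\<delta> * K) + (X / lg + 3) * \<tau> \<le> \<epsilon> / 2 * exp X" using b(8) p1(2) by linarith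
      qed
      moreover note elim(1)[rule_format, of K]
      ultimately show "small_sizes \<zeta> \<delta> c \<tau> lg \<epsilon> X K \<and> small_rates \<zeta> \<delta> c \<tau> lg \<kappa> K"
        using K by blast
    qed
  qed
qed

lemma power_le_exp_ln:
  fixes x y :: real
  assumes "0 \<le> x" "x \<le> y" "1 \<le> y" shows "x ^ m \<le> exp (real m * ln y)"
proof -
  have "x ^ m \<le> y ^ m" using assms by (intro power_mono) auto
  also have "... = exp (real m * ln y)" using assms by (simp add: exp_of_nat_mult)
  finally show ?thesis .
qed

lemma steps_bound:
  assumes "n \<ge> 2" "1 < \<gamma>"
  shows "2 \<le> steps \<gamma> n" "real (steps \<gamma> n) \<le> ln (real n) / ln \<gamma> + 3" "real n \<le> \<gamma> ^ (steps \<gamma> n - 2)"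
proof -
  have q: "0 \<le> ln (real n) / ln \<gamma>" using assms by auto
  show "2 \<le> steps \<gamma> n" by (simp add: steps_def)
  show "real (steps \<gamma> n) \<le> ln (real n) / ln \<gamma> + 3" unfolding steps_def using q by linarith
  have "ln (real n) = (ln (real n) / ln \<gamma>) * ln \<gamma>" using assms by auto
  also have "... \<le> real (nat \<lceil>ln (real n) / ln \<gamma>\<rceil>) * ln \<gamma>" using assms by (intro mult_right_mono) (linarith, auto)
  also have "... = ln (\<gamma> ^ (steps \<gamma> n - 2))" using assms by (simp add: steps_def ln_realpow)
  finally show "real n \<le> \<gamma> ^ (steps \<gamma> n - 2)" using assms by (subst (asm) ln_le_cancel_iff) auto
qed

context exp_graph
begin

text \<open>In the three clauses the exponent gained is of order K^2, K^3 and K^4, while choosing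
  the anchor sets and the blocked set costs order K, K^2 and K^3; the logarithmic cost per attached
  vertex is absorbed by half of the rate. \<open>\<kappa>\<close> is the smallest of the three decay
  rates in \<open>growth_prob\<close>.\<close>

lemma small_event_prob:
  assumes pos: "0 < \<zeta>" "0 < \<delta>" "0 < c" "0 < \<tau>" "\<tau> \<le> 1" "0 < \<epsilon>" "\<epsilon> \<le> 1/20"
    and \<gamma>: "1 < \<gamma>" "\<gamma> \<le> 2" "\<gamma>\<^sup>2 \<le> \<gamma> + (1 - 7 * \<epsilon>) * \<tau>"
    and \<kappa>: "\<kappa> = min (1/32) (min (\<epsilon>\<^sup>2 * \<tau> / 128) (\<epsilon> / 2))"
    and n: "n \<ge> 2" and X: "X = ln (real n)" and K: "K = real k + X" and kK: "X \<le> K \<and> K \<le> 2 * X\<^sup>2"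
    and num: "small_sizes \<zeta> \<delta> c \<tau> (ln \<gamma>) \<epsilon> X K \<and> small_rates \<zeta> \<delta> c \<tau> (ln \<gamma>) \<kappa> K"
  shows "fails_at_most (small_event \<zeta> \<delta> c \<tau> \<gamma> n k) (3 * real n powr (- 2))"
proof -
  have eX: "exp X = real n" using n X by simp
  note num' = num[unfolded eX]
  have K1: "1 \<le> K" using num kK by linarith
  define u z m f J where "u = level1 \<zeta> K" and "z = level2 \<zeta> \<delta> K" and "m = level3 \<zeta> \<delta> K" and "f = blocked c K" and "J = steps \<gamma> n"
  define a2 a3 where "a2 = \<zeta> * \<delta> * K\<^sup>2 / 64" and "a3 = \<zeta> * \<delta>\<^sup>2 * K ^ 3 / 4096"
  note num2 = num'[folded a2_def a3_def]
  have N: "2 * (1 + (\<zeta> * K + 1)) \<le> real n" "2 * (\<zeta> * K + 1 + (a2 + 1)) \<le> real n"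
    "2 * (a2 + 1) + 2 * (a3 + 1) + (c * K\<^sup>2 + 1) \<le> \<epsilon> * real n" "2 * (\<delta> * K) + (X / ln \<gamma> + 3) * \<tau> \<le> \<epsilon> / 2 * real n"
    "ln (4 * K) - \<delta> * K / 32 \<le> - (\<delta> * K / 64)" "ln ((\<zeta> * K + 1) * (4 * K)) - \<delta> * K / 32 \<le> - (\<delta> * K / 64)"
    "2 * ln ((a2 + 1) * (4 * K)) - \<kappa> * \<delta> * K \<le> - (\<kappa> * \<delta> * K / 2)" "K + 1 - (\<zeta> * K) * (\<delta> * K / 64) \<le> - (2 * K)"
    "1 \<le> X"
    using num2 by blast+
  have a0: "0 \<le> a2" "0 \<le> a3" "0 \<le> \<zeta> * K" "0 \<le> c * K\<^sup>2" "0 \<le> \<delta> * K" using pos K1 by (auto simp: a2_def a3_def)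
  have u: "\<zeta> * K \<le> real u" "real u \<le> \<zeta> * K + 1" using a0 unfolding u_def level1_def by linarith+
  have z: "a2 \<le> real z" "real z \<le> a2 + 1" using a0 unfolding z_def level2_def a2_def by linarith+
  have m: "a3 \<le> real m" "real m \<le> a3 + 1" using a0 unfolding m_def level3_def a3_def by linarith+
  have f: "real f \<le> c * K\<^sup>2 + 1" using a0 unfolding f_def blocked_def by linarith
  note J = steps_bound[OF n \<gamma>(1), folded J_def]
  have nexp: "real n ^ i = exp (real i * X)" for i using n X by (simp add: exp_of_nat_mult)
  have two: "(2 :: real) \<le> exp 1" using exp_ge_add_one_self[of "1 :: real"] by simp
  have fin: "exp (- (2 * K)) \<le> real n powr (- 2)" using kK n X by (simp add: powr_def)
  have gm: "\<delta> * K * real m \<le> \<delta> * K * (a3 + 1)" "\<delta> * K * real u \<le> \<delta> * K * (\<zeta> * K + 1)" "\<delta> * K * real z \<le> \<delta> * K * (a2 + 1)"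
    using m u z a0 by (auto intro: mult_left_mono)
  have M: "\<delta> * K * (a3 + 1) \<le> 2 * real n" "\<delta> * K * (\<zeta> * K + 1) \<le> 2 * real n" "\<delta> * K * (a2 + 1) \<le> 2 * real n" using num2 by blast+
  have G: "\<delta> * K * real m \<le> 2 * real n" "\<delta> * K * real u \<le> 2 * real n" "\<delta> * K * real z \<le> 2 * real n"
    using gm M by (blast intro: order_trans)+
  have 1: "fails_at_most (local_spread n (4 * K) (\<delta> * K) 1 u) (real n powr (- 2))"
  proof -
    have "fails_at_most (local_spread n (4 * K) (\<delta> * K) 1 u) (real n ^ 1 * (real 1 * (4 * K)) ^ u * (2 * exp (- (\<delta> * K * real u / 32))))"
    proof (rule local_spread_prob)
      show "2 * (1 + u) \<le> n"
      proof -
        define q where "q = \<zeta> * K"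
        have "2 * (1 + (q + 1)) \<le> real n" "real u \<le> q + 1" using N(1) u unfolding q_def by blast+
        hence "real (2 * (1 + u)) \<le> real n" by simp
        thus ?thesis by (simp only: of_nat_le_iff)
      qed
    qed (use K1 num2 G a0 n in auto)
    moreover have "real n ^ 1 * (real 1 * (4 * K)) ^ u * (2 * exp (- (\<delta> * K * real u / 32))) \<le> real n powr (- 2)"
    proof -
      have pw: "(real 1 * (4 * K)) ^ u \<le> exp (real u * ln (4 * K))" using K1 by (intro power_le_exp_ln) auto
      have "real n ^ 1 * (real 1 * (4 * K)) ^ u * (2 * exp (- (\<delta> * K * real u / 32))) \<le> exp X * exp (real u * ln (4 * K)) * (exp 1 * exp (- (\<delta> * K * real u / 32)))"
        using K1 n eX two by (intro mult_mono pw) auto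
      also have "... = exp (X + 1 + real u * (ln (4 * K) - \<delta> * K / 32))" by (simp add: exp_add[symmetric] algebra_simps)
      also have "... \<le> exp (- (2 * K))"
      proof -
        have "real u * (ln (4 * K) - \<delta> * K / 32) \<le> real u * (- (\<delta> * K / 64))" by (rule mult_left_mono[OF N(5)]) simp
        moreover have "\<zeta> * K * (\<delta> * K / 64) \<le> real u * (\<delta> * K / 64)" using u a0 by (intro mult_right_mono) auto
        moreover have "real u * (- (\<delta> * K / 64)) = - (real u * (\<delta> * K / 64))" by simp
        ultimately have "X + 1 + real u * (ln (4 * K) - \<delta> * K / 32) \<le> - (2 * K)" using N(8) kK by linarith
        thus ?thesis by simp
      qed
      finally show ?thesis using fin by linarith
    qed
    ultimately show ?thesis by (meson order_trans)
  qed
  have 2: "fails_at_most (local_spread n (4 * K) (\<delta> * K) u z) (real n powr (- 2))"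
  proof -
    have "fails_at_most (local_spread n (4 * K) (\<delta> * K) u z) (real n ^ u * (real u * (4 * K)) ^ z * (2 * exp (- (\<delta> * K * real z / 32))))"
    proof (rule local_spread_prob)
      show "2 * (u + z) \<le> n"
      proof -
        define q where "q = \<zeta> * K"
        have "2 * (q + 1 + (a2 + 1)) \<le> real n" "real u \<le> q + 1" using N(2) u unfolding q_def by blast+
        hence "2 * (real u + real z) \<le> real n" using z unfolding distrib_left by linarith
        hence "real (2 * (u + z)) \<le> real n" by simp
        thus ?thesis by (simp only: of_nat_le_iff)
      qed
    qed (use K1 num2 G a0 n in auto)
    moreover have "real n ^ u * (real u * (4 * K)) ^ z * (2 * exp (- (\<delta> * K * real z / 32))) \<le> real n powr (- 2)"
    proof -
      have "1 * 1 \<le> (\<zeta> * K + 1) * (4 * K)" using a0 K1 by (intro mult_mono) auto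
      moreover have "real u * (4 * K) \<le> (\<zeta> * K + 1) * (4 * K)" using u K1 by (intro mult_right_mono) auto
      ultimately have pw: "(real u * (4 * K)) ^ z \<le> exp (real z * ln ((\<zeta> * K + 1) * (4 * K)))" using K1 by (intro power_le_exp_ln) auto
      have "real n ^ u * (real u * (4 * K)) ^ z * (2 * exp (- (\<delta> * K * real z / 32))) \<le>
        exp (real u * X) * exp (real z * ln ((\<zeta> * K + 1) * (4 * K))) * (exp 1 * exp (- (\<delta> * K * real z / 32)))"
        unfolding nexp using K1 two by (intro mult_mono pw) auto
      also have "... = exp (real u * X + 1 + real z * (ln ((\<zeta> * K + 1) * (4 * K)) - \<delta> * K / 32))" by (simp add: exp_add[symmetric] algebra_simps)
      also have "... \<le> exp (- (2 * K))"
      proof -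
        have "real z * (ln ((\<zeta> * K + 1) * (4 * K)) - \<delta> * K / 32) \<le> real z * (- (\<delta> * K / 64))" by (rule mult_left_mono[OF N(6)]) simp
        moreover have "real z * (- (\<delta> * K / 64)) = - (real z * (\<delta> * K / 64))" by simp
        moreover have "a2 * (\<delta> * K / 64) \<le> real z * (\<delta> * K / 64)" using z a0 by (intro mult_right_mono) auto
        moreover have "real u * X \<le> (\<zeta> * K + 1) * K" using u kK N(9) a0 by (intro mult_mono) auto
        moreover have "K * (\<zeta> * K + 1) + 1 - a2 * (\<delta> * K / 64) \<le> - (2 * K)" using num2 by blast
        ultimately have "real u * X + 1 + real z * (ln ((\<zeta> * K + 1) * (4 * K)) - \<delta> * K / 32) \<le> - (2 * K)" by (simp only: mult.commute[of K "\<zeta> * K + 1"]; linarith)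
        thus ?thesis by simp
      qed
      finally show ?thesis using fin by linarith
    qed
    ultimately show ?thesis by (meson order_trans)
  qed
  have 3: "fails_at_most (grow_all n (4 * K) (\<delta> * K) \<tau> z m f J) (real n powr (- 2))"
  proof -
    define b where "b = 2 * exp (- (\<delta> * K * real m / 32)) + real J * (2 * exp (- (\<epsilon>\<^sup>2 * \<tau> * (\<delta> * K * real m / 32) / 4))) + exp (- (\<delta> * K * \<epsilon> * real m / 2))"
    have "fails_at_most (grow_all n (4 * K) (\<delta> * K) \<tau> z m f J) (real n ^ (2 * z + f) * (real z * (4 * K)) ^ (2 * m) * b)"
    proof (rule grow_all_prob[where \<epsilon> = \<epsilon> and \<rho> = \<epsilon>])
      show "real (2 * z + 2 * m + f) \<le> \<epsilon> * real n" using N(3) z m f unfolding distrib_left by simp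
      have "(X / ln \<gamma> + 3) * \<tau> \<ge> real J * \<tau>" using J pos X by (intro mult_right_mono) auto
      thus "2 * (\<delta> * K) + real J * \<tau> \<le> \<epsilon> / 2 * real n" using N(4) by linarith
      have "1 \<le> \<delta> * K * a3 / 32" using num2 by blast
      also have "... \<le> \<delta> * K * real m / 32" using m a0 by (intro divide_right_mono mult_left_mono) auto
      finally have "1 * \<gamma> ^ (J - 2) \<le> \<delta> * K * real m / 32 * \<gamma> ^ (J - 2)" using \<gamma> by (intro mult_right_mono) auto
      moreover have "\<epsilon> * real n \<le> 1 * real n" using pos by (intro mult_right_mono) auto
      ultimately show "\<epsilon> * real n \<le> \<delta> * K * real m / 32 * \<gamma> ^ (J - 2)" using J(3) by linarith
    qed (use K1 num2 G a0 n pos \<gamma> J in \<open>auto simp: b_def\<close>)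
    moreover have "real n ^ (2 * z + f) * (real z * (4 * K)) ^ (2 * m) * b \<le> real n powr (- 2)"
    proof -
      define y where "y = (a2 + 1) * (4 * K)"
      have y: "1 \<le> y" "real z * (4 * K) \<le> y"
      proof -
        have "1 * 1 \<le> (a2 + 1) * (4 * K)" using a0 K1 by (intro mult_mono) auto
        thus "1 \<le> y" by (simp add: y_def)
        show "real z * (4 * K) \<le> y" unfolding y_def using z K1 by (intro mult_right_mono) auto
      qed
      define e where "e = \<kappa> * (\<delta> * K * real m)"
      have dm: "0 \<le> \<delta> * K * real m" using a0 by auto
      have \<kappa>3: "\<kappa> \<le> 1/32" "\<kappa> \<le> \<epsilon>\<^sup>2 * \<tau> / 128" "\<kappa> \<le> \<epsilon> / 2" unfolding \<kappa> by auto
      have "e \<le> 1/32 * (\<delta> * K * real m)" "e \<le> \<epsilon>\<^sup>2 * \<tau> / 128 * (\<delta> * K * real m)" "e \<le> \<epsilon> / 2 * (\<delta> * K * real m)"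
        unfolding e_def by (rule mult_right_mono[OF \<kappa>3(1) dm], rule mult_right_mono[OF \<kappa>3(2) dm], rule mult_right_mono[OF \<kappa>3(3) dm])
      hence ee: "exp (- (\<delta> * K * real m / 32)) \<le> exp (- e)" "exp (- (\<epsilon>\<^sup>2 * \<tau> * (\<delta> * K * real m / 32) / 4)) \<le> exp (- e)" "exp (- (\<delta> * K * \<epsilon> * real m / 2)) \<le> exp (- e)"
        by (auto simp: mult_ac)
      have "b \<le> 2 * exp (- e) + real J * (2 * exp (- e)) + exp (- e)"
        unfolding b_def using ee by (intro add_mono mult_left_mono) auto
      also have "... = (3 + 2 * real J) * exp (- e)" by (simp add: algebra_simps)
      also have "... \<le> exp (3 + 2 * real J) * exp (- e)"
      proof (rule mult_right_mono)
        show "3 + 2 * real J \<le> exp (3 + 2 * real J)" using exp_ge_add_one_self[of "3 + 2 * real J"] by linarith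
      qed simp
      finally have bb: "b \<le> exp (3 + 2 * real J) * exp (- e)" .
      have pw: "(real z * (4 * K)) ^ (2 * m) \<le> exp (real (2 * m) * ln y)" using y K1 by (intro power_le_exp_ln) auto
      have b0: "0 \<le> b" unfolding b_def by (intro add_nonneg_nonneg mult_nonneg_nonneg) auto
      have "real n ^ (2 * z + f) * (real z * (4 * K)) ^ (2 * m) * b \<le> exp (real (2 * z + f) * X) * exp (real (2 * m) * ln y) * (exp (3 + 2 * real J) * exp (- e))"
        unfolding nexp by (rule mult_mono[OF mult_mono[OF order_refl pw] bb]) (use b0 K1 in auto)
      also have "... = exp (real (2 * z + f) * X + (3 + 2 * real J) + real m * (2 * ln y - \<kappa> * \<delta> * K))"
        by (simp add: exp_add[symmetric] e_def algebra_simps)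
      also have "... \<le> exp (- (2 * K))"
      proof -
        have "real m * (2 * ln y - \<kappa> * \<delta> * K) \<le> real m * (- (\<kappa> * \<delta> * K / 2))" unfolding y_def by (rule mult_left_mono[OF N(7)]) simp
        moreover have "a3 * (\<kappa> * \<delta> * K / 2) \<le> real m * (\<kappa> * \<delta> * K / 2)" using m a0 pos by (intro mult_right_mono) (auto simp: \<kappa> mult.assoc)
        moreover have "real (2 * z + f) * X \<le> (2 * (a2 + 1) + (c * K\<^sup>2 + 1)) * K" using z f kK N(9) a0 by (intro mult_mono) auto
        moreover have "real J \<le> K / ln \<gamma> + 3"
        proof -
          have "X / ln \<gamma> \<le> K / ln \<gamma>" using kK \<gamma> by (intro divide_right_mono) auto
          thus ?thesis using J(2)[folded X] by linarith
        qed
        moreover have "K * (2 * (a2 + 1) + (c * K\<^sup>2 + 1)) - a3 * (\<kappa> * \<delta> * K / 2) + 3 + 2 * (K / ln \<gamma> + 3) \<le> - (2 * K)" using num2 by blast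
        moreover have "(2 * (a2 + 1) + (c * K\<^sup>2 + 1)) * K = K * (2 * (a2 + 1) + (c * K\<^sup>2 + 1))" by (rule mult.commute)
        moreover have "real m * (- (\<kappa> * \<delta> * K / 2)) = - (real m * (\<kappa> * \<delta> * K / 2))" by simp
        moreover have aux: "T3 + (3 + 2 * j) + T1 \<le> - (2 * k)" if "T1 \<le> T2'" "T5 \<le> T2" "T3 \<le> T4'" "j \<le> q + 3"
          "T4 - T5 + 3 + 2 * (q + 3) \<le> - (2 * k)" "T4' = T4" "T2' = - T2" for T1 T2 T2' T3 T4 T4' T5 q j k :: real
          using that unfolding distrib_left by linarith
        ultimately have "real (2 * z + f) * X + (3 + 2 * real J) + real m * (2 * ln y - \<kappa> * \<delta> * K) \<le> - (2 * K)"
          by (intro aux)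
        thus ?thesis by simp
      qed
      finally show ?thesis using fin by linarith
    qed
    ultimately show ?thesis by (meson order_trans)
  qed
  from Pr_conj3[OF 1 2 3] show ?thesis unfolding small_event_def Let_def K[unfolded X, symmetric] u_def z_def m_def f_def J_def by simp
qed

lemma ex_bad_ball:
  assumes "finite I" "\<And>i. i \<in> I \<Longrightarrow> fails_at_most (A i) b"
  shows "fails_at_most (\<lambda>x. \<forall>i\<in>I. A i x) (real (card I) * b)"
proof -
  obtain f where f: "\<And>i. i \<in> I \<Longrightarrow> adm E (f i) \<and> (\<forall>x. \<not> A i x \<longrightarrow> f i x) \<and> Pr (f i) \<le> b" using assms(2) by metis
  have "Pr (\<lambda>x. \<exists>i\<in>I. f i x) \<le> (\<Sum>i\<in>I. Pr (f i))" using f assms(1) by (intro Pr_bex) auto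
  also have "... \<le> real (card I) * b" using f by (intro sum_bounded_above) auto
  finally have "Pr (\<lambda>x. \<exists>i\<in>I. f i x) \<le> real (card I) * b" .
  thus ?thesis using f assms(1) by (intro exI[of _ "\<lambda>x. \<exists>i\<in>I. f i x"]) (auto intro!: adm_bex)
qed

end

context exp_graphs
begin

lemma whpI2:
  assumes "\<forall>\<^sub>F n in sequentially. \<exists>\<psi>. adm (complete_edges n) \<psi> \<and> (\<forall>x. \<not> \<Phi> n x \<longrightarrow> \<psi> x) \<and> PR n \<psi> \<le> b n"
    and "b \<longlonglongrightarrow> 0"
  shows "whp \<Phi>"
proof -
  define f where "f n = (SOME \<psi>. adm (complete_edges n) \<psi> \<and> (\<forall>x. \<not> \<Phi> n x \<longrightarrow> \<psi> x) \<and> PR n \<psi> \<le> b n)" for n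
  show ?thesis
  proof (rule whpI[OF _ assms(2)])
    show "\<forall>\<^sub>F n in sequentially. adm (complete_edges n) (f n) \<and> (\<forall>x. \<not> \<Phi> n x \<longrightarrow> f n x) \<and> PR n (f n) \<le> b n"
      using assms(1)
    proof eventually_elim
      case (elim n)
      show ?case unfolding f_def by (rule someI_ex[OF elim])
    qed
  qed
qed

lemma whp_small:
  assumes pos: "0 < \<zeta>" "0 < \<delta>" "0 < c" "0 < \<tau>" "\<tau> \<le> 1" "0 < \<epsilon>" "\<epsilon> \<le> 1/20"
    and \<gamma>: "1 < \<gamma>" "\<gamma> \<le> 2" "\<gamma>\<^sup>2 \<le> \<gamma> + (1 - 7 * \<epsilon>) * \<tau>"
  shows "whp (\<lambda>n w. \<forall>k\<in>{1..nat \<lfloor>(ln (real n))\<^sup>2\<rfloor>}. small_event \<zeta> \<delta> c \<tau> \<gamma> n k w)"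
proof (rule whpI2)
  define \<kappa> where "\<kappa> = min (1/32) (min (\<epsilon>\<^sup>2 * \<tau> / 128) (\<epsilon> / 2))"
  have \<kappa>0: "0 < \<kappa>" using pos by (simp add: \<kappa>_def)
  have lg: "0 < ln \<gamma>" using \<gamma> by simp
  have ln: "filterlim (\<lambda>n. ln (real n)) at_top sequentially" by real_asymp
  note ev = filterlim_iff[THEN iffD1, OF ln, rule_format, OF small_numeric[OF pos(1-4) lg pos(6) \<kappa>0]]
  show "\<forall>\<^sub>F n in sequentially. \<exists>\<psi>. adm (complete_edges n) \<psi> \<and> (\<forall>x. \<not> (\<forall>k\<in>{1..nat \<lfloor>(ln (real n))\<^sup>2\<rfloor>}. small_event \<zeta> \<delta> c \<tau> \<gamma> n k x) \<longrightarrow> \<psi> x) \<and>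
     PR n \<psi> \<le> real (nat \<lfloor>(ln (real n))\<^sup>2\<rfloor>) * (3 * real n powr (- 2))"
    using ev eventually_ge_at_top[of 3]
  proof eventually_elim
    case (elim n)
    interpret exp_graph "M n" n "W n" by (rule graphs)
    have "fails_at_most (\<lambda>x. \<forall>k\<in>{1..nat \<lfloor>(ln (real n))\<^sup>2\<rfloor>}. small_event \<zeta> \<delta> c \<tau> \<gamma> n k x) (real (card {1..nat \<lfloor>(ln (real n))\<^sup>2\<rfloor>}) * (3 * real n powr (- 2)))"
    proof (rule ex_bad_ball)
      fix k assume k: "k \<in> {1..nat \<lfloor>(ln (real n))\<^sup>2\<rfloor>}"
      define X K where "X = ln (real n)" and "K = real k + X"
      have "exp 1 \<le> real n" using elim(2) exp_le by linarith
      hence X1: "1 \<le> X" unfolding X_def using elim(2) by (subst ln_ge_iff) auto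
      have "real k \<le> X\<^sup>2" using k unfolding X_def[symmetric] by (simp; linarith)
      moreover have "X * 1 \<le> X * X" using X1 by (intro mult_left_mono) auto
      ultimately have kK: "X \<le> K \<and> K \<le> 2 * X\<^sup>2" by (simp add: K_def power2_eq_square)
      show "fails_at_most (small_event \<zeta> \<delta> c \<tau> \<gamma> n k) (3 * real n powr (- 2))"
        by (rule small_event_prob[OF pos \<gamma> \<kappa>_def _ X_def K_def kK elim(1)[folded X_def, rule_format, OF kK]]) (use elim(2) in simp)
    qed simp
    thus ?case by simp
  qed
  show "(\<lambda>n. real (nat \<lfloor>(ln (real n))\<^sup>2\<rfloor>) * (3 * real n powr (- 2))) \<longlonglongrightarrow> 0"
  proof (rule tendsto_sandwich[OF _ _ tendsto_const])
    show "(\<lambda>n. (ln (real n))\<^sup>2 * (3 * real n powr (- 2))) \<longlonglongrightarrow> 0" by real_asymp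
    show "\<forall>\<^sub>F n in sequentially. real (nat \<lfloor>(ln (real n))\<^sup>2\<rfloor>) * (3 * real n powr (- 2)) \<le> (ln (real n))\<^sup>2 * (3 * real n powr (- 2))"
      by (intro always_eventually allI mult_right_mono) auto
  qed auto
qed

text \<open>The scale 200 ln n serves the repeated cheap steps, the scale \<delta>k the single step
  that outgrows the used edges and the final connection.\<close>

definition large_event :: "real \<Rightarrow> real \<Rightarrow> nat \<Rightarrow> weights \<Rightarrow> bool" where
  "large_event \<delta> \<rho> n w \<longleftrightarrow> spread n (200 * ln (real n)) w \<and> (\<forall>k\<in>{nat \<lceil>(ln (real n))\<^sup>2\<rceil>..n}. spread n (\<delta> * real k) w) \<and>
     (\<forall>k\<in>{nat \<lceil>(ln (real n))\<^sup>2\<rceil>..n}. joined n \<rho> (\<delta> * real k) w)"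

lemma whp_large:
  assumes pos: "0 < \<delta>" "\<delta> \<le> 1/4" "0 < \<rho>"
  shows "whp (large_event \<delta> \<rho>)"
proof (rule whpI2)
  define b where "b n = 2 * real n powr (- 4) + (real n + 1) * (2 * real n powr (- 4)) + (real n + 1) * (2 * exp (- real n))" for n :: nat
  have ev: "\<forall>\<^sub>F n in sequentially. 800 * ln (real n) \<le> real n \<and> 200 * ln (real n) \<le> \<delta> * (ln (real n))\<^sup>2 \<and> 1 \<le> ln (real n) \<and> 24 \<le> \<rho>\<^sup>2 * (\<delta> * (ln (real n))\<^sup>2)"
    using pos by (intro eventually_conj; real_asymp)
  show "\<forall>\<^sub>F n in sequentially. \<exists>\<psi>. adm (complete_edges n) \<psi> \<and> (\<forall>x. \<not> large_event \<delta> \<rho> n x \<longrightarrow> \<psi> x) \<and> PR n \<psi> \<le> b n"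
    using ev eventually_ge_at_top[of 2]
  proof eventually_elim
    case (elim n)
    interpret exp_graph "M n" n "W n" by (rule graphs)
    let ?I = "{nat \<lceil>(ln (real n))\<^sup>2\<rceil>..n}"
    have kb: "200 * ln (real n) \<le> \<delta> * real k" "4 * (\<delta> * real k) \<le> real n" "2 \<le> \<delta> * real k" "24 \<le> \<rho>\<^sup>2 * (\<delta> * real k)" if k: "k \<in> ?I" for k
    proof -
      have "(ln (real n))\<^sup>2 \<le> real k" using k by (simp; linarith)
      hence d: "\<delta> * (ln (real n))\<^sup>2 \<le> \<delta> * real k" using pos by (intro mult_left_mono) auto
      thus a: "200 * ln (real n) \<le> \<delta> * real k" using elim by linarith
      show "2 \<le> \<delta> * real k" using a elim by linarith
      have "\<rho>\<^sup>2 * (\<delta> * (ln (real n))\<^sup>2) \<le> \<rho>\<^sup>2 * (\<delta> * real k)" by (rule mult_left_mono[OF d]) simp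
      thus "24 \<le> \<rho>\<^sup>2 * (\<delta> * real k)" using elim by linarith
      have "\<delta> * real k \<le> 1/4 * real n" using pos k by (intro mult_mono) auto
      thus "4 * (\<delta> * real k) \<le> real n" by simp
    qed
    have cI: "real (card ?I) \<le> real n + 1" by simp
    have 1: "fails_at_most (spread n (200 * ln (real n))) (2 * real n powr (- 4))"
      by (rule spread_prob) (use elim in auto)
    have "fails_at_most (\<lambda>x. \<forall>k\<in>?I. spread n (\<delta> * real k) x) (real (card ?I) * (2 * real n powr (- 4)))"
      by (rule ex_bad_ball, simp, rule spread_prob) (use kb elim in auto)
    moreover have "real (card ?I) * (2 * real n powr (- 4)) \<le> (real n + 1) * (2 * real n powr (- 4))" using cI by (intro mult_right_mono) auto
    ultimately have 2: "fails_at_most (\<lambda>x. \<forall>k\<in>?I. spread n (\<delta> * real k) x) ((real n + 1) * (2 * real n powr (- 4)))"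
      by (meson order_trans)
    have "fails_at_most (\<lambda>x. \<forall>k\<in>?I. joined n \<rho> (\<delta> * real k) x) (real (card ?I) * (2 * exp (- real n)))"
    proof (rule ex_bad_ball, simp, rule joined_prob)
      fix k assume "k \<in> ?I"
      from kb[OF this] show "24 \<le> \<rho>\<^sup>2 * (\<delta> * real k)" "4 * (\<delta> * real k) \<le> real n" "0 < \<delta> * real k" by auto
    qed (use pos elim in auto)
    moreover have "real (card ?I) * (2 * exp (- real n)) \<le> (real n + 1) * (2 * exp (- real n))" using cI by (intro mult_right_mono) auto
    ultimately have 3: "fails_at_most (\<lambda>x. \<forall>k\<in>?I. joined n \<rho> (\<delta> * real k) x) ((real n + 1) * (2 * exp (- real n)))"
      by (meson order_trans)
    from Pr_conj3[OF 1 2 3] show ?case unfolding large_event_def b_def .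
  qed
  show "b \<longlonglongrightarrow> 0" unfolding b_def by real_asymp
qed

lemma whp_deg: "whp deg_ok"
proof (rule whpI2)
  show "\<forall>\<^sub>F n in sequentially. \<exists>\<psi>. adm (complete_edges n) \<psi> \<and> (\<forall>x. \<not> deg_ok n x \<longrightarrow> \<psi> x) \<and> PR n \<psi> \<le> real n * exp (- (real n / 20))"
    using eventually_ge_at_top[of 1]
  proof eventually_elim
    case (elim n)
    interpret exp_graph "M n" n "W n" by (rule graphs)
    show ?case by (rule deg_prob[OF elim])
  qed
qed real_asymp

end

section \<open>Paths in the complete graph\<close>

lemma path_edges_Nil [simp]: "path_edges [] = {}" by (simp add: path_edges_def)
lemma path_edges_single [simp]: "path_edges [a] = {}" by (simp add: path_edges_def)

lemma path_edges_Cons: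
  assumes "p \<noteq> []" shows "path_edges (a # p) = insert {a, hd p} (path_edges p)"
proof
  show "path_edges (a # p) \<subseteq> insert {a, hd p} (path_edges p)"
  proof
    fix e assume "e \<in> path_edges (a # p)"
    then obtain i where i: "Suc i < length (a # p)" "e = {(a # p) ! i, (a # p) ! Suc i}" unfolding path_edges_def by blast
    show "e \<in> insert {a, hd p} (path_edges p)"
    proof (cases i)
      case 0 thus ?thesis using i assms by (simp add: hd_conv_nth)
    next
      case (Suc i') thus ?thesis using i by (auto simp: path_edges_def)
    qed
  qed
  show "insert {a, hd p} (path_edges p) \<subseteq> path_edges (a # p)"
  proof
    fix e assume "e \<in> insert {a, hd p} (path_edges p)"
    thus "e \<in> path_edges (a # p)"
    proof
      assume "e = {a, hd p}"
      thus ?thesis unfolding path_edges_def using assms by (intro CollectI exI[of _ 0]) (auto simp: hd_conv_nth)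
    next
      assume "e \<in> path_edges p"
      then obtain i where "Suc i < length p" "e = {p ! i, p ! Suc i}" unfolding path_edges_def by blast
      thus ?thesis unfolding path_edges_def by (intro CollectI exI[of _ "Suc i"]) auto
    qed
  qed
qed

lemma path_edges_append:
  assumes "p \<noteq> []" "q \<noteq> []"
  shows "path_edges (p @ q) = path_edges p \<union> {{last p, hd q}} \<union> path_edges q"
  using assms(1)
proof (induction p)
  case (Cons a p)
  show ?case
  proof (cases "p = []")
    case True thus ?thesis using assms(2) by (simp add: path_edges_Cons)
  next
    case False thus ?thesis using Cons by (simp add: path_edges_Cons) blast
  qed
qed simp

lemma path_edges_subset: "e \<in> path_edges p \<Longrightarrow> e \<subseteq> set p"
  unfolding path_edges_def by auto

lemma finite_path_edges [simp]: "finite (path_edges p)"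
proof -
  have "path_edges p = (\<lambda>i. {p ! i, p ! Suc i}) ` {i. Suc i < length p}" unfolding path_edges_def by blast
  moreover have "finite {i. Suc i < length p}" by (rule finite_subset[of _ "{..<length p}"]) auto
  ultimately show ?thesis by simp
qed

lemma card_path_edges: "distinct p \<Longrightarrow> card (path_edges p) = length p - 1"
proof (induction p)
  case (Cons a p)
  show ?case
  proof (cases "p = []")
    case False
    have "{a, hd p} \<notin> path_edges p" using path_edges_subset[of "{a, hd p}" p] Cons.prems by auto
    thus ?thesis using Cons False by (cases p) (simp_all add: path_edges_Cons)
  qed simp
qed simp

lemma path_edges_complete: "distinct q \<Longrightarrow> set q \<subseteq> {..<n} \<Longrightarrow> path_edges q \<subseteq> complete_edges n"
proof
  fix e assume q: "distinct q" "set q \<subseteq> {..<n}" and "e \<in> path_edges q"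
  then obtain i where i: "Suc i < length q" "e = {q ! i, q ! Suc i}" unfolding path_edges_def by blast
  hence "q ! i \<in> set q" "q ! Suc i \<in> set q" by auto
  hence "q ! i < n" "q ! Suc i < n" using q by auto
  thus "e \<in> complete_edges n" using i q by (simp add: complete_edges_doubleton nth_eq_iff_index_eq)
qed

lemma st_path_vertices:
  assumes "st_path (complete_edges n) s t p" "s < n" shows "set p \<subseteq> {..<n}"
proof
  fix v assume "v \<in> set p"
  then obtain i where i: "i < length p" "v = p ! i" by (auto simp: in_set_conv_nth)
  show "v \<in> {..<n}"
  proof (cases i)
    case 0
    thus ?thesis using assms i hd_conv_nth[of p] by (simp add: st_path_def)
  next
    case (Suc j)
    hence "{p ! j, p ! Suc j} \<in> complete_edges n" using assms i unfolding st_path_def path_edges_def by blast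
    thus ?thesis using Suc i by (simp add: complete_edges_doubleton)
  qed
qed

lemma finite_st_paths:
  assumes "s < n" shows "finite {p. st_path (complete_edges n) s t p}"
proof (rule finite_subset)
  show "{p. st_path (complete_edges n) s t p} \<subseteq> {p. set p \<subseteq> {..<n} \<and> length p \<le> n}"
  proof
    fix p assume p: "p \<in> {p. st_path (complete_edges n) s t p}"
    hence s: "set p \<subseteq> {..<n}" using st_path_vertices[OF _ assms] by blast
    have "length p = card (set p)" using p by (simp add: st_path_def distinct_card)
    also have "... \<le> n" using card_mono[OF _ s] by simp
    finally show "p \<in> {p. set p \<subseteq> {..<n} \<and> length p \<le> n}" using s by simp
  qed
  show "finite {p. set p \<subseteq> {..<n} \<and> length p \<le> n}" by (rule finite_lists_length_le) simp
qed

lemma st_path_cases: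
  assumes "st_path E s t p" "s \<noteq> t"
  obtains "p = [s, t]" | q where "q \<noteq> []" "p = s # q @ [t]" "distinct q" "s \<notin> set q" "t \<notin> set q"
proof -
  have p: "p \<noteq> []" "hd p = s" "last p = t" "distinct p" using assms by (auto simp: st_path_def)
  then obtain r where r: "p = s # r" by (cases p) auto
  have "r \<noteq> []" using p r assms by auto
  then obtain q where q: "r = q @ [t]" using p r by (cases r rule: rev_cases) auto
  show thesis
  proof (cases "q = []")
    case True thus thesis using r q that(1) by simp
  next
    case False thus thesis using r q p that(2)[of q] by simp
  qed
qed

lemma path_edges_st: "q \<noteq> [] \<Longrightarrow> path_edges (s # q @ [t]) = insert {s, hd q} (insert {last q, t} (path_edges q))"
  by (auto simp: path_edges_Cons path_edges_append)

lemma path_cost_st: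
  assumes "q \<noteq> []" "s \<notin> set q" "t \<notin> set q" "s \<noteq> t"
  shows "path_cost w (s # q @ [t]) = w {s, hd q} + path_cost w q + w {last q, t}"
proof -
  have "{s, hd q} \<noteq> {last q, t}" using assms by (auto simp: doubleton_eq_iff)
  moreover have "{s, hd q} \<notin> path_edges q" "{last q, t} \<notin> path_edges q" using assms path_edges_subset by blast+
  ultimately show ?thesis unfolding path_cost_def path_edges_st[OF assms(1)] by simp
qed

text \<open>Light edges to s and t at the two ends are part of the condition because cheap paths
  between arbitrary vertices abound: a single vertex is a path of cost 0. In the first moment they
  gain a factor y^2.\<close>

definition no_cheap :: "nat \<Rightarrow> nat \<Rightarrow> nat \<Rightarrow> real \<Rightarrow> real \<Rightarrow> weights \<Rightarrow> bool" where
  "no_cheap n s t y x w \<longleftrightarrow> y < w {s, t} \<and> (\<forall>q. q \<noteq> [] \<longrightarrow> distinct q \<longrightarrow> set q \<subseteq> {..<n} - {s, t} \<longrightarrow>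
     w {s, hd q} \<le> y \<longrightarrow> w {last q, t} \<le> y \<longrightarrow> x < path_cost w q)"

section \<open>First moment bound for cheap middle parts\<close>

context exp_graph
begin

lemma adm_sum_le:
  assumes "finite D" shows "adm D (\<lambda>w. (\<Sum>e\<in>D. w e) \<le> c)"
proof (rule admI)
  show "Measurable.pred (\<Pi>\<^sub>M e\<in>D. borel) (\<lambda>w. (\<Sum>e\<in>D. w e) \<le> (c::real))" by measurable
  show "(\<And>e. e \<in> D \<Longrightarrow> x e = y e) \<Longrightarrow> ((\<Sum>e\<in>D. x e) \<le> c) = ((\<Sum>e\<in>D. y e) \<le> c)" for x y
    by (simp cong: sum.cong)
qed

lemma nn_integral_laplace:
  assumes e: "e \<in> E" and l: "0 \<le> l"
  shows "(\<integral>\<^sup>+\<omega>. ennreal (exp (- (l * W e \<omega>))) \<partial>M) = ennreal (1 / (1 + l))"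
proof -
  interpret D: prob_space "density lborel (exponential_density (1 + l))"
    by (rule prob_space_exponential_density) (use l in simp)
  have one: "(\<integral>\<^sup>+x. ennreal (exponential_density (1 + l) x) \<partial>lborel) = 1"
    using D.emeasure_space_1 by (simp add: emeasure_density)
  have "(\<integral>\<^sup>+\<omega>. ennreal (exp (- (l * W e \<omega>))) \<partial>M) = (\<integral>\<^sup>+x. ennreal (exponential_density 1 x) * ennreal (exp (- (l * x))) \<partial>lborel)"
    by (rule distributed_nn_integral[OF dist[OF e], symmetric]) simp
  also have "... = (\<integral>\<^sup>+x. ennreal (1 / (1 + l)) * ennreal (exponential_density (1 + l) x) \<partial>lborel)"
  proof (intro nn_integral_cong)
    fix x :: real
    have "exponential_density 1 x * exp (- (l * x)) = 1 / (1 + l) * exponential_density (1 + l) x"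
    proof (cases "x < 0")
      case False
      have "exp (- x) * exp (- (l * x)) = exp (- x * (1 + l))" by (simp add: exp_add[symmetric] algebra_simps)
      thus ?thesis using False l by (simp add: exponential_density_def)
    qed (simp add: exponential_density_def)
    thus "ennreal (exponential_density 1 x) * ennreal (exp (- (l * x))) = ennreal (1 / (1 + l)) * ennreal (exponential_density (1 + l) x)"
      using l exponential_density_nonneg[of "1 + l" x] exponential_density_nonneg[of 1 x] by (simp add: ennreal_mult[symmetric])
  qed
  also have "... = ennreal (1 / (1 + l))" by (simp add: nn_integral_cmult one)
  finally show ?thesis .
qed

lemma Pr_sum_le:
  assumes D: "D \<subseteq> E" and l: "0 \<le> l"
  shows "Pr (\<lambda>w. (\<Sum>e\<in>D. w e) \<le> x) \<le> exp (l * x) * (1 / (1 + l)) ^ card D"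
proof -
  have fin: "finite D" using D finE finite_subset by blast
  let ?A = "Ev (\<lambda>w. (\<Sum>e\<in>D. w e) \<le> x)"
  have A: "?A \<in> sets M" by (rule Ev_sets[OF adm_sum_le[OF fin] D])
  have [measurable]: "W e \<in> borel_measurable M" if "e \<in> D" for e using W_measurable D that by blast
  have ind: "indep_vars (\<lambda>_. borel) (\<lambda>e \<omega>. ennreal (exp (- (l * W e \<omega>)))) D"
    using indep_vars_compose2[OF indep_vars_subset[OF indep D], of "\<lambda>_ x. ennreal (exp (- (l * x)))" "\<lambda>_. borel"] by simp
  have "emeasure M ?A = (\<integral>\<^sup>+\<omega>. indicator ?A \<omega> \<partial>M)" using A by simp
  also have "... \<le> (\<integral>\<^sup>+\<omega>. ennreal (exp (l * x)) * (\<Prod>e\<in>D. ennreal (exp (- (l * W e \<omega>)))) \<partial>M)"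
  proof (intro nn_integral_mono)
    fix \<omega>
    have "(1::ennreal) \<le> ennreal (exp (l * x)) * (\<Prod>e\<in>D. ennreal (exp (- (l * W e \<omega>))))" if "\<omega> \<in> ?A"
    proof -
      have "l * (\<Sum>e\<in>D. W e \<omega>) \<le> l * x" using that l by (intro mult_left_mono) (auto simp: Ev_def)
      hence "1 \<le> exp (l * x + (\<Sum>e\<in>D. - (l * W e \<omega>)))" by (simp add: sum_negf sum_distrib_left)
      also have "... = exp (l * x) * (\<Prod>e\<in>D. exp (- (l * W e \<omega>)))" by (simp only: exp_add exp_sum[OF fin])
      finally have "ennreal 1 \<le> ennreal (exp (l * x) * (\<Prod>e\<in>D. exp (- (l * W e \<omega>))))" by (rule ennreal_leI)
      thus ?thesis by (simp add: ennreal_mult prod_nonneg prod_ennreal)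
    qed
    thus "indicator ?A \<omega> \<le> ennreal (exp (l * x)) * (\<Prod>e\<in>D. ennreal (exp (- (l * W e \<omega>))))"
      by (auto split: split_indicator)
  qed
  also have "... = ennreal (exp (l * x)) * (\<integral>\<^sup>+\<omega>. (\<Prod>e\<in>D. ennreal (exp (- (l * W e \<omega>)))) \<partial>M)"
    by (rule nn_integral_cmult) measurable
  also have "(\<integral>\<^sup>+\<omega>. (\<Prod>e\<in>D. ennreal (exp (- (l * W e \<omega>)))) \<partial>M) = (\<Prod>e\<in>D. ennreal (1 / (1 + l)))"
    by (subst indep_vars_nn_integral[OF fin ind]) (simp, intro prod.cong refl nn_integral_laplace l, use D in blast)
  also have "... = ennreal ((1 / (1 + l)) ^ card D)" using l by (simp add: ennreal_power)
  also have "ennreal (exp (l * x)) * ... = ennreal (exp (l * x) * (1 / (1 + l)) ^ card D)" using l by (simp add: ennreal_mult)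
  finally show ?thesis unfolding Pr_def emeasure_eq_measure using l by (subst (asm) ennreal_le_iff) auto
qed

text \<open>First moment over the at most n^(i+1) vertex sequences with i edges. With l = (1 +
  \<beta>)n in \<open>Pr_sum_le\<close> the factor (n/(1 + l))^i is at most (1 + \<beta>)^(-i), so
  the sum over all lengths is geometric.\<close>

lemma no_cheap_prob:
  assumes st: "s < n" "t < n" "s \<noteq> t" and y: "0 \<le> y" and \<beta>: "0 < \<beta>"
  shows "fails_at_most (no_cheap n s t y x) (y + real n * y\<^sup>2 * exp ((1 + \<beta>) * real n * x) * (1 + 1 / \<beta>))"
proof -
  have n: "n > 0" using st by simp
  define l where "l = (1 + \<beta>) * real n"
  have l: "0 \<le> l" using \<beta> by (simp add: l_def)
  define Q where "Q = {q. set q \<subseteq> {..<n} - {s, t} \<and> distinct q \<and> q \<noteq> []}"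
  define bad where "bad q w \<longleftrightarrow> w {s, hd q} \<le> y \<and> (w {last q, t} \<le> y \<and> (\<Sum>e\<in>path_edges q. w e) \<le> x)" for q and w :: "nat set \<Rightarrow> real"
  define L where "L i = {q. set q \<subseteq> {..<n} \<and> length q = Suc i}" for i
  have Qlen: "length q \<le> n" if "q \<in> Q" for q
    using that distinct_card[of q] card_mono[of "{..<n}" "set q"] by (auto simp: Q_def)
  have QL: "Q \<subseteq> (\<Union>i\<in>{..<n}. L i)"
  proof
    fix q assume q: "q \<in> Q"
    hence "length q = Suc (length q - 1)" "length q - 1 < n" using Qlen[OF q] n by (auto simp: Q_def)
    thus "q \<in> (\<Union>i\<in>{..<n}. L i)" using q unfolding L_def Q_def by blast
  qed
  have finL: "finite (L i)" and cL: "card (L i) = n ^ Suc i" for i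
    unfolding L_def using finite_lists_length_eq[of "{..<n}" "Suc i"] card_lists_length_eq[of "{..<n}" "Suc i"] by auto
  have finQ: "finite Q" by (rule finite_subset[OF QL]) (use finL in auto)
  have facts: "{s, hd q} \<in> E" "{last q, t} \<in> E" "path_edges q \<subseteq> E" "{s, hd q} \<noteq> {last q, t}"
    "{s, hd q} \<notin> path_edges q" "{last q, t} \<notin> path_edges q" if q: "q \<in> Q" for q
  proof -
    have m: "hd q \<in> set q" "last q \<in> set q" "s \<notin> set q" "t \<notin> set q" "set q \<subseteq> {..<n}" "distinct q" using q by (auto simp: Q_def)
    hence "hd q < n" "last q < n" "hd q \<noteq> s" "last q \<noteq> t" "last q \<noteq> s" by auto
    thus "{s, hd q} \<in> E" "{last q, t} \<in> E" "{s, hd q} \<noteq> {last q, t}" using st by (auto simp: complete_edges_doubleton doubleton_eq_iff)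
    show "path_edges q \<subseteq> E" using m by (intro path_edges_complete)
    show "{s, hd q} \<notin> path_edges q" "{last q, t} \<notin> path_edges q" using path_edges_subset[of _ q] m by blast+
  qed
  have admb: "adm E (bad q)" if "q \<in> Q" for q
    unfolding bad_def using facts[OF that] by (intro adm_conj adm_le adm_mono[OF adm_sum_le]) auto
  have Ple: "Pr (\<lambda>w. w e \<le> y) \<le> y" if "e \<in> E" for e
    using Pr_le[OF that y] exp_ge_add_one_self[of "- y"] by linarith
  define B where "B i = y\<^sup>2 * (exp (l * x) * (1 / (1 + l)) ^ i)" for i
  have prb: "Pr (bad q) \<le> B (length q - 1)" if q: "q \<in> Q" for q
  proof -
    note f = facts[OF q]
    have "Pr (bad q) = Pr (\<lambda>w. w {s, hd q} \<le> y) * Pr (\<lambda>w. w {last q, t} \<le> y \<and> (\<Sum>e\<in>path_edges q. w e) \<le> x)"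
      unfolding bad_def
    proof (rule Pr_indep[where G = "{{s, hd q}}" and H = "insert {last q, t} (path_edges q)"])
      show "adm (insert {last q, t} (path_edges q)) (\<lambda>w. w {last q, t} \<le> y \<and> (\<Sum>e\<in>path_edges q. w e) \<le> x)"
        by (intro adm_conj adm_le adm_mono[OF adm_sum_le]) auto
    qed (use f in auto)
    also have "Pr (\<lambda>w. w {last q, t} \<le> y \<and> (\<Sum>e\<in>path_edges q. w e) \<le> x) = Pr (\<lambda>w. w {last q, t} \<le> y) * Pr (\<lambda>w. (\<Sum>e\<in>path_edges q. w e) \<le> x)"
      by (rule Pr_indep[where G = "{{last q, t}}", OF _ adm_sum_le]) (use f in auto)
    also have "Pr (\<lambda>w. w {s, hd q} \<le> y) * (Pr (\<lambda>w. w {last q, t} \<le> y) * Pr (\<lambda>w. (\<Sum>e\<in>path_edges q. w e) \<le> x)) \<le>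
      y * (y * (exp (l * x) * (1 / (1 + l)) ^ card (path_edges q)))"
      using f y by (intro mult_mono Ple Pr_sum_le l) auto
    also have "card (path_edges q) = length q - 1" using q by (intro card_path_edges) (auto simp: Q_def)
    finally show ?thesis by (simp add: B_def power2_eq_square mult.assoc)
  qed
  have B0: "0 \<le> B i" for i unfolding B_def using l by auto
  have "Pr (\<lambda>w. \<exists>q\<in>Q. bad q w) \<le> (\<Sum>q\<in>Q. Pr (bad q))" by (intro Pr_bex finQ admb)
  also have "... \<le> (\<Sum>q\<in>Q. B (length q - 1))" by (intro sum_mono prb)
  also have "... \<le> (\<Sum>q\<in>(\<Union>i\<in>{..<n}. L i). B (length q - 1))" using finL B0 by (intro sum_mono2 QL) auto
  also have "... = (\<Sum>i<n. \<Sum>q\<in>L i. B (length q - 1))" by (rule sum.UNION_disjoint) (use finL in \<open>auto simp: L_def\<close>)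
  also have "... = (\<Sum>i<n. \<Sum>q\<in>L i. B i)" by (intro sum.cong) (auto simp: L_def)
  also have "... = (\<Sum>i<n. real n ^ Suc i * B i)" by (simp only: sum_constant cL) simp
  also have "... \<le> (\<Sum>i<n. real n * y\<^sup>2 * exp (l * x) * (1 / (1 + \<beta>)) ^ i)"
  proof (intro sum_mono)
    fix i
    have l0: "0 < l" using n \<beta> by (simp add: l_def)
    have "real n / (1 + l) \<le> real n / l" using l0 by (intro divide_left_mono) auto
    also have "real n / l = 1 / (1 + \<beta>)" using n \<beta> by (simp add: l_def)
    finally have "real n * (1 / (1 + l)) \<le> 1 / (1 + \<beta>)" by simp
    hence "(real n * (1 / (1 + l))) ^ i \<le> (1 / (1 + \<beta>)) ^ i" using l by (intro power_mono) auto
    hence le: "(real n * y\<^sup>2 * exp (l * x)) * (real n * (1 / (1 + l))) ^ i \<le> (real n * y\<^sup>2 * exp (l * x)) * (1 / (1 + \<beta>)) ^ i" by (intro mult_left_mono) auto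
    have eq: "real n ^ Suc i * B i = (real n * y\<^sup>2 * exp (l * x)) * (real n * (1 / (1 + l))) ^ i"
      unfolding B_def power_mult_distrib by (simp only: power_Suc mult_ac)
    show "real n ^ Suc i * B i \<le> real n * y\<^sup>2 * exp (l * x) * (1 / (1 + \<beta>)) ^ i" unfolding eq by (rule le)
  qed
  also have "... = real n * y\<^sup>2 * exp (l * x) * (\<Sum>i<n. (1 / (1 + \<beta>)) ^ i)" by (simp add: sum_distrib_left)
  also have "... \<le> real n * y\<^sup>2 * exp (l * x) * (1 + 1 / \<beta>)"
  proof (intro mult_left_mono)
    have b1: "1 / (1 + \<beta>) < 1" "0 \<le> 1 / (1 + \<beta>)" using \<beta> by auto
    have "(\<Sum>i<n. r ^ i) = (1 - r ^ n) / (1 - r)" if "r < 1" for r :: real using that by (simp add: sum_gp_strict)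
    from this[OF b1(1)] have "(\<Sum>i<n. (1 / (1 + \<beta>)) ^ i) = (1 - (1 / (1 + \<beta>)) ^ n) / (1 - 1 / (1 + \<beta>))" .
    also have "... \<le> 1 / (1 - 1 / (1 + \<beta>))" using b1 by (intro divide_right_mono) (simp_all only: diff_ge_0_iff_ge le_diff_eq zero_le_power diff_le_eq le_add_same_cancel1 less_imp_le)
    also have "... = 1 + 1 / \<beta>" using \<beta> by (simp add: field_simps)
    finally show "(\<Sum>i<n. (1 / (1 + \<beta>)) ^ i) \<le> 1 + 1 / \<beta>" .
  qed auto
  finally have 1: "Pr (\<lambda>w. \<exists>q\<in>Q. bad q w) \<le> real n * y\<^sup>2 * exp (l * x) * (1 + 1 / \<beta>)" .
  have ste: "{s, t} \<in> E" using st by (simp add: complete_edges_doubleton)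
  have aQ: "adm E (\<lambda>w. \<exists>q\<in>Q. bad q w)" by (intro adm_bex finQ admb)
  have "Pr (\<lambda>w. w {s, t} \<le> y \<or> (\<exists>q\<in>Q. bad q w)) \<le> Pr (\<lambda>w. w {s, t} \<le> y) + Pr (\<lambda>w. \<exists>q\<in>Q. bad q w)" by (intro Pr_disj adm_le ste aQ)
  also have "... \<le> y + real n * y\<^sup>2 * exp (l * x) * (1 + 1 / \<beta>)" using Ple[OF ste] 1 by (intro add_mono)
  finally have "Pr (\<lambda>w. w {s, t} \<le> y \<or> (\<exists>q\<in>Q. bad q w)) \<le> y + real n * y\<^sup>2 * exp (l * x) * (1 + 1 / \<beta>)" .
  moreover have "adm E (\<lambda>w. w {s, t} \<le> y \<or> (\<exists>q\<in>Q. bad q w))" by (intro adm_disj adm_le ste aQ)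
  moreover have "w {s, t} \<le> y \<or> (\<exists>q\<in>Q. bad q w)" if "\<not> no_cheap n s t y x w" for w
    using that unfolding no_cheap_def Q_def bad_def path_cost_def by (auto simp: not_less)
  ultimately show ?thesis unfolding l_def by blast
qed

end

text \<open>With \<beta> = \<epsilon> the exponential factor is n^((1 + \<epsilon>)(1 - \<epsilon>))
  = n^(1 - \<epsilon>^2), and n y^2 is of order (ln n)^2/n; their product tends to 0.\<close>

lemma (in exp_graphs) whp_no_cheap:
  assumes C: "0 < C" and \<epsilon>: "0 < \<epsilon>" "\<epsilon> < 1"
  shows "whp (\<lambda>n. no_cheap n (s n) (t n) (C * ln (real n) / real n) ((1 - \<epsilon>) * ln (real n) / real n))"
proof -
  define y where "y n = C * ln (real n) / real n" for n :: nat
  define x where "x n = (1 - \<epsilon>) * ln (real n) / real n" for n :: nat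
  define b where "b n = y n + real n * (y n)\<^sup>2 * exp ((1 + \<epsilon>) * ((1 - \<epsilon>) * ln (real n))) * (1 + 1 / \<epsilon>)" for n :: nat
  define f where "f n = (SOME \<psi>. adm (complete_edges n) \<psi> \<and> (\<forall>w. \<not> no_cheap n (s n) (t n) (y n) (x n) w \<longrightarrow> \<psi> w) \<and> PR n \<psi> \<le> b n)" for n
  show ?thesis
  proof (rule whpI[where \<psi> = f and b = b])
    show "\<forall>\<^sub>F n in sequentially. adm (complete_edges n) (f n) \<and>
      (\<forall>w. \<not> no_cheap n (s n) (t n) (C * ln (real n) / real n) ((1 - \<epsilon>) * ln (real n) / real n) w \<longrightarrow> f n w) \<and> PR n (f n) \<le> b n"
      using eventually_ge_at_top[of 2]
    proof eventually_elim
      case (elim n)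
      interpret exp_graph "M n" n "W n" by (rule graphs)
      have "(1 + \<epsilon>) * real n * x n = (1 + \<epsilon>) * ((1 - \<epsilon>) * ln (real n))" using elim by (simp add: x_def)
      hence "\<exists>\<psi>. adm (complete_edges n) \<psi> \<and> (\<forall>w. \<not> no_cheap n (s n) (t n) (y n) (x n) w \<longrightarrow> \<psi> w) \<and> PR n \<psi> \<le> b n"
        using no_cheap_prob[of "s n" "t n" "y n" \<epsilon> "x n"] st[OF elim] elim C \<epsilon> unfolding b_def by (simp only:) (simp add: y_def)
      from someI_ex[OF this] show ?case unfolding f_def y_def x_def .
    qed
    define d where "d = \<epsilon>\<^sup>2"
    define D where "D = 1 + 1 / \<epsilon>"
    have d: "d > 0" "D > 0" using \<epsilon> by (auto simp: d_def D_def intro: add_pos_pos)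
    have "(\<lambda>n. C * ln (real n) / real n) \<longlonglongrightarrow> 0" using C by real_asymp
    moreover have "(\<lambda>n. (C * ln (real n))\<^sup>2 * real n powr (- d) * D) \<longlonglongrightarrow> 0" using C d by real_asymp
    ultimately have "(\<lambda>n. C * ln (real n) / real n + (C * ln (real n))\<^sup>2 * real n powr (- d) * D) \<longlonglongrightarrow> 0"
      by (rule tendsto_add_zero)
    moreover have "\<forall>\<^sub>F n in sequentially. C * ln (real n) / real n + (C * ln (real n))\<^sup>2 * real n powr (- d) * D = b n"
      using eventually_ge_at_top[of 1]
    proof eventually_elim
      case (elim n)
      have "exp ((1 + \<epsilon>) * ((1 - \<epsilon>) * ln (real n))) = exp (ln (real n) + - d * ln (real n))" by (simp add: d_def power2_eq_square algebra_simps)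
      also have "... = real n * real n powr (- d)" using elim by (simp only: exp_add) (simp add: powr_def)
      finally show ?case using elim by (simp add: b_def y_def D_def power_divide power2_eq_square)
    qed
    ultimately show "b \<longlonglongrightarrow> 0" by (rule Lim_transform_eventually)
  qed
qed

section \<open>Greedy sequences of paths\<close>

text \<open>Connections are built as walks, which can be concatenated and reversed freely;
  \<open>walk_imp_path\<close> removes loops afterwards, which never raises the cost when weights
  are nonnegative.\<close>

inductive walk :: "nat set set \<Rightarrow> weights \<Rightarrow> nat \<Rightarrow> nat \<Rightarrow> real \<Rightarrow> bool" for A w where
  walk_refl: "walk A w x x 0"
| walk_step: "walk A w x y c \<Longrightarrow> {y, z} \<in> A \<Longrightarrow> walk A w x z (c + w {y, z})"

lemma walk_trans: "walk A w y z d \<Longrightarrow> walk A w x y c \<Longrightarrow> walk A w x z (c + d)"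
  by (induction rule: walk.induct) (auto simp: add.assoc[symmetric] intro: walk_step)

lemma walk_edge: "{y, z} \<in> A \<Longrightarrow> walk A w y z (w {y, z})"
  using walk_step[OF walk_refl, of y z A w] by simp

lemma walk_sym: "walk A w x y c \<Longrightarrow> walk A w y x c"
proof (induction rule: walk.induct)
  case (walk_step x y c z)
  have "walk A w z y (w {y, z})" using walk_edge[of z y A w] walk_step.hyps by (simp add: insert_commute)
  from walk_trans[OF walk_step.IH this] show ?case by (simp add: add.commute)
qed (rule walk_refl)

lemma path_cost_mono: "path_edges p \<subseteq> path_edges q \<Longrightarrow> (\<And>e. e \<in> path_edges q \<Longrightarrow> 0 \<le> w e) \<Longrightarrow> path_cost w p \<le> path_cost w q"
  unfolding path_cost_def by (intro sum_mono2) auto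

lemma walk_imp_path:
  assumes "walk A w x y c" "\<And>e. e \<in> A \<Longrightarrow> 0 \<le> w e"
  shows "\<exists>p. st_path A x y p \<and> path_cost w p \<le> c"
  using assms
proof (induction rule: walk.induct)
  case (walk_refl x)
  show ?case by (intro exI[of _ "[x]"]) (simp add: st_path_def path_cost_def)
next
  case (walk_step x y c z)
  then obtain p where p: "st_path A x y p" "path_cost w p \<le> c" by blast
  have w0: "0 \<le> w {y, z}" using walk_step by auto
  have pe: "path_edges p \<subseteq> A" "p \<noteq> []" "hd p = x" "last p = y" "distinct p" using p by (auto simp: st_path_def)
  show ?case
  proof (cases "z \<in> set p")
    case True
    then obtain p1 p2 where sp: "p = p1 @ z # p2" by (meson split_list)
    define q where "q = p1 @ [z]"
    have sub: "path_edges q \<subseteq> path_edges p"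
    proof (cases "p2 = []")
      case False
      have "p = q @ p2" by (simp add: sp q_def)
      thus ?thesis using path_edges_append[of q p2] False by (auto simp: q_def)
    qed (simp add: sp q_def)
    have "hd q = x" using pe(3) by (cases p1) (auto simp: sp q_def)
    hence "st_path A x z q" unfolding st_path_def using sub pe by (auto simp: q_def sp)
    moreover have "path_cost w q \<le> path_cost w p" using sub pe walk_step.prems by (intro path_cost_mono) auto
    ultimately show ?thesis using p(2) w0 by (intro exI[of _ q]) auto
  next
    case False
    have e: "path_edges (p @ [z]) = insert {y, z} (path_edges p)" using pe by (simp add: path_edges_append)
    have "{y, z} \<notin> path_edges p" using path_edges_subset[of "{y, z}" p] False by auto
    hence "path_cost w (p @ [z]) = path_cost w p + w {y, z}" unfolding path_cost_def e by simp
    moreover have "st_path A x z (p @ [z])" unfolding st_path_def e using pe False walk_step.hyps by auto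
    ultimately show ?thesis using p(2) by (intro exI[of _ "p @ [z]"]) auto
  qed
qed

definition reach :: "nat set set \<Rightarrow> weights \<Rightarrow> nat \<Rightarrow> nat set \<Rightarrow> real \<Rightarrow> bool" where
  "reach A w x S c \<longleftrightarrow> (\<forall>v\<in>S. \<exists>c'\<le>c. walk A w x v c')"

lemma reach_mono: "reach A w x S c \<Longrightarrow> T \<subseteq> S \<Longrightarrow> c \<le> d \<Longrightarrow> reach A w x T d"
  unfolding reach_def by (meson order_trans subsetD)

lemma reach_join:
  assumes "reach A w x S c" "reach A w y T d" "a \<in> S" "b \<in> T" "{a, b} \<in> A" "w {a, b} \<le> h"
  shows "\<exists>c'\<le>c + h + d. walk A w x y c'"
proof -
  obtain c1 d1 where "c1 \<le> c" "walk A w x a c1" "d1 \<le> d" "walk A w y b d1" using assms unfolding reach_def by blast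
  hence "walk A w x y (c1 + w {a, b} + d1)" using walk_trans[OF walk_sym] walk_step assms(5) by blast
  thus ?thesis using \<open>c1 \<le> c\<close> \<open>d1 \<le> d\<close> assms(6) by (intro exI[of _ "c1 + w {a, b} + d1"]) auto
qed

lemma reach_meet:
  assumes "reach A w x S c" "reach A w y T d" "a \<in> S" "a \<in> T"
  shows "\<exists>c'\<le>c + d. walk A w x y c'"
proof -
  obtain c1 d1 where "c1 \<le> c" "walk A w x a c1" "d1 \<le> d" "walk A w y a d1" using assms unfolding reach_def by blast
  thus ?thesis using walk_trans[OF walk_sym] by (intro exI[of _ "c1 + d1"]) force
qed

text \<open>Deleting \<open>R\<close> loses at most one vertex per deleted edge above
  \<open>lo\<close>: a lost vertex owns the deleted window edge that hit it, and different lost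
  vertices own different edges because they lie outside \<open>S\<close>.\<close>

lemma reach_expand:
  assumes r: "reach (complete_edges n - R) w x S c" and S: "S \<subseteq> X" "S \<subseteq> {..<n}" and R: "finite R"
  shows "\<exists>S'. S' \<subseteq> hits n w lo hi S X \<and> reach (complete_edges n - R) w x S' (c + hi) \<and>
     real (card (hits n w lo hi S X)) \<le> real (card S') + real (card {e\<in>R. lo < w e})"
proof -
  let ?H = "hits n w lo hi S X"
  define S' where "S' = {v\<in>?H. \<exists>a\<in>S. {a, v} \<notin> R \<and> w {a, v} \<le> hi}"
  have finH: "finite ?H" by (simp add: hits_def)
  have "reach (complete_edges n - R) w x S' (c + hi)"
    unfolding reach_def
  proof
    fix v assume "v \<in> S'"
    then obtain a where a: "a \<in> S" "{a, v} \<notin> R" "w {a, v} \<le> hi" "v < n" "v \<notin> X" by (auto simp: S'_def hits_def)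
    obtain c1 where c1: "c1 \<le> c" "walk (complete_edges n - R) w x a c1" using r a(1) unfolding reach_def by blast
    have "{a, v} \<in> complete_edges n - R" using a S by (auto simp: complete_edges_doubleton)
    from walk_step[OF c1(2) this] show "\<exists>c'\<le>c + hi. walk (complete_edges n - R) w x v c'"
      using c1 a by (intro exI[of _ "c1 + w {a, v}"]) auto
  qed
  moreover have "card (?H - S') \<le> card {e\<in>R. lo < w e}"
  proof -
    define f where "f v = {SOME a. a \<in> S \<and> lo < w {a, v} \<and> w {a, v} \<le> hi, v}" for v
    have f: "\<exists>a\<in>S. f v = {a, v} \<and> lo < w {a, v} \<and> w {a, v} \<le> hi" if "v \<in> ?H" for v
      unfolding f_def using someI_ex[of "\<lambda>a. a \<in> S \<and> lo < w {a, v} \<and> w {a, v} \<le> hi"] that by (auto simp: hits_def)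
    have "inj_on f (?H - S')"
    proof (rule inj_onI)
      fix u v assume uv: "u \<in> ?H - S'" "v \<in> ?H - S'" "f u = f v"
      obtain a b where ab: "a \<in> S" "b \<in> S" "{a, u} = {b, v}" using f[of u] f[of v] uv by auto
      have "u \<notin> S" "v \<notin> S" using uv S by (auto simp: hits_def)
      thus "u = v" using ab by (auto simp: doubleton_eq_iff)
    qed
    moreover have "f ` (?H - S') \<subseteq> {e\<in>R. lo < w e}"
    proof
      fix e assume "e \<in> f ` (?H - S')"
      then obtain v where v: "v \<in> ?H" "v \<notin> S'" "e = f v" by blast
      thus "e \<in> {e\<in>R. lo < w e}" using f[of v] by (auto simp: S'_def)
    qed
    ultimately show ?thesis using R by (intro card_inj_on_le) auto
  qed
  moreover have "card ?H = card S' + card (?H - S')"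
  proof -
    have "S' \<subseteq> ?H" by (auto simp: S'_def)
    thus ?thesis using finH by (metis card_Diff_subset card_mono finite_subset le_add_diff_inverse)
  qed
  ultimately show ?thesis by (intro exI[of _ S']) (auto simp: S'_def)
qed

definition used :: "(nat \<Rightarrow> nat list) \<Rightarrow> nat \<Rightarrow> nat set set" where
  "used P k = (\<Union>i\<in>{1..<k}. path_edges (P i))"

lemma finite_used [simp]: "finite (used P k)" by (simp add: used_def)

lemma successive_paths_prefix: "successive_paths A w s t k P \<Longrightarrow> j \<le> k \<Longrightarrow> successive_paths A w s t j P"
  unfolding successive_paths_def by auto

lemma successive_paths_cong:
  assumes "\<And>i. i \<in> {1..k} \<Longrightarrow> P i = Q i"
  shows "successive_paths A w s t k P \<longleftrightarrow> successive_paths A w s t k Q"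
proof -
  have "(\<Union>i\<in>{1..<j}. path_edges (P i)) = (\<Union>i\<in>{1..<j}. path_edges (Q i))" if "j \<in> {1..k}" for j
    using assms that by auto
  thus ?thesis using assms unfolding successive_paths_def by simp
qed

definition first_v :: "nat list \<Rightarrow> nat" where "first_v p = hd (tl p)"
definition last_v :: "nat list \<Rightarrow> nat" where "last_v p = last (butlast p)"
definition mid_cost :: "weights \<Rightarrow> nat \<Rightarrow> nat \<Rightarrow> nat list \<Rightarrow> real" where
  "mid_cost w s t p = (\<Sum>e\<in>{e\<in>path_edges p. s \<notin> e \<and> t \<notin> e}. w e)"

lemma st_path_edges_at:
  assumes "st_path A s t p" "s \<noteq> t"
  shows "{v. {s, v} \<in> path_edges p} = {first_v p}" "{v. {t, v} \<in> path_edges p} = {last_v p}"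
proof -
  have "{v. {s, v} \<in> path_edges p} = {first_v p} \<and> {v. {t, v} \<in> path_edges p} = {last_v p}"
    using assms
  proof (cases rule: st_path_cases)
    case 1
    thus ?thesis using assms(2) by (auto simp: path_edges_Cons first_v_def last_v_def doubleton_eq_iff)
  next
    case (2 q)
    have e: "path_edges p = insert {s, hd q} (insert {last q, t} (path_edges q))" using path_edges_st[OF 2(1)] 2(2) by simp
    have "{s, v} \<notin> path_edges q" "{t, v} \<notin> path_edges q" for v using path_edges_subset[of _ q] 2 by blast+
    moreover have "hd q \<noteq> s" "last q \<noteq> s" "hd q \<noteq> t" "last q \<noteq> t" using 2 hd_in_set[of q] last_in_set[of q] by auto
    moreover have "first_v p = hd q" "last_v p = last q" using 2 by (auto simp: first_v_def last_v_def butlast_append)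
    ultimately show ?thesis unfolding e using assms(2) by (auto simp: doubleton_eq_iff)
  qed
  thus "{v. {s, v} \<in> path_edges p} = {first_v p}" "{v. {t, v} \<in> path_edges p} = {last_v p}" by auto
qed

lemma st_path_edge_first: "st_path A s t p \<Longrightarrow> s \<noteq> t \<Longrightarrow> {s, first_v p} \<in> path_edges p"
  using st_path_edges_at(1)[of A s t p] by blast

lemma st_path_edge_last: "st_path A s t p \<Longrightarrow> s \<noteq> t \<Longrightarrow> {t, last_v p} \<in> path_edges p"
  using st_path_edges_at(2)[of A s t p] by blast

text \<open>For the one-edge path the same edge would be counted at both ends, hence its
  exclusion.\<close>

lemma path_cost_decomp:
  assumes "st_path A s t p" "s \<noteq> t" "p \<noteq> [s, t]"
  shows "path_cost w p = w {s, first_v p} + w {t, last_v p} + mid_cost w s t p"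
  using assms(1,2)
proof (cases rule: st_path_cases)
  case (2 q)
  have e: "path_edges p = insert {s, hd q} (insert {last q, t} (path_edges q))" using path_edges_st[OF 2(1)] 2(2) by simp
  have "e' \<in> path_edges q \<Longrightarrow> s \<notin> e' \<and> t \<notin> e'" for e' using path_edges_subset[of e' q] 2 by blast
  hence "{e\<in>path_edges p. s \<notin> e \<and> t \<notin> e} = path_edges q" unfolding e by auto
  moreover have "first_v p = hd q" "last_v p = last q" using 2 by (auto simp: first_v_def last_v_def butlast_append)
  ultimately show ?thesis using path_cost_st[of q s t w] 2 assms(2) by (simp add: mid_cost_def path_cost_def[of w q] insert_commute)
qed (use assms in simp)

text \<open>The largest of the k values is at least \<open>lo k\<close>, since otherwise all k
  elements would lie below that threshold; remove it and induct.\<close>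

lemma sum_rank_lower:
  fixes g :: "'b \<Rightarrow> real"
  assumes "finite T" "card T = k" "\<And>i. i \<in> {1..k} \<Longrightarrow> card {v\<in>T. g v < lo i} < i"
  shows "(\<Sum>i=1..k. lo i) \<le> (\<Sum>v\<in>T. g v)"
  using assms
proof (induction k arbitrary: T)
  case (Suc k)
  have ne: "T \<noteq> {}" using Suc.prems by auto
  obtain v where v: "v \<in> T" "\<And>u. u \<in> T \<Longrightarrow> g u \<le> g v"
  proof -
    have "Max (g ` T) \<in> g ` T" using Suc.prems(1) ne by (intro Max_in) auto
    then obtain v where "v \<in> T" "g v = Max (g ` T)" by auto
    thus thesis using that[of v] Suc.prems(1) by simp
  qed
  have "lo (Suc k) \<le> g v"
  proof (rule ccontr)
    assume "\<not> lo (Suc k) \<le> g v"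
    hence "{u\<in>T. g u < lo (Suc k)} = T" using v by fastforce
    thus False using Suc.prems(2) Suc.prems(3)[of "Suc k"] by simp
  qed
  moreover have "(\<Sum>i=1..k. lo i) \<le> (\<Sum>v\<in>T - {v}. g v)"
  proof (rule Suc.IH)
    fix i assume i: "i \<in> {1..k}"
    have "card {u\<in>T - {v}. g u < lo i} \<le> card {u\<in>T. g u < lo i}" using Suc.prems by (intro card_mono) auto
    thus "card {u\<in>T - {v}. g u < lo i} < i" using Suc.prems(3)[of i] i by auto
  qed (use Suc.prems v in auto)
  ultimately show ?case using Suc.prems(1) v(1) by (simp add: sum.remove[of T v])
qed auto

text \<open>The situation in which P_k is about to be chosen: only the first k - 1 paths are assumed
  to be successive minimisers. Instantiated with \<open>Suc k\<close>, it covers P_k itself, as in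
  the lower bound.\<close>

locale greedy =
  fixes n :: nat and w :: "nat set \<Rightarrow> real" and s t k :: nat and P :: "nat \<Rightarrow> nat list"
  assumes s: "s < n" and t: "t < n" and neq: "s \<noteq> t" and k1: "1 \<le> k"
    and nonneg: "\<And>e. e \<in> complete_edges n \<Longrightarrow> 0 \<le> w e"
    and succ: "successive_paths (complete_edges n) w s t (k - 1) P"
begin

abbreviation "E \<equiv> complete_edges n"
abbreviation "R \<equiv> used P k"

lemma path:
  assumes "i \<in> {1..<k}"
  shows "st_path E s t (P i)" "path_edges (P i) \<inter> used P i = {}"
    "\<And>q. st_path E s t q \<Longrightarrow> path_edges q \<inter> used P i = {} \<Longrightarrow> path_cost w (P i) \<le> path_cost w q"
proof -
  have "i \<in> {1..k - 1}" using assms by auto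
  hence a: "is_arg_min (path_cost w) (\<lambda>p. st_path E s t p \<and> path_edges p \<inter> used P i = {}) (P i)"
    using succ unfolding successive_paths_def used_def by blast
  show "st_path E s t (P i)" "path_edges (P i) \<inter> used P i = {}"
    "\<And>q. st_path E s t q \<Longrightarrow> path_edges q \<inter> used P i = {} \<Longrightarrow> path_cost w (P i) \<le> path_cost w q"
    using a unfolding is_arg_min_linorder by blast+
qed

lemma path_sub: "i \<in> {1..<k} \<Longrightarrow> path_edges (P i) \<subseteq> E"
  using path(1) unfolding st_path_def by blast

lemma used_sub: "R \<subseteq> E" using path_sub unfolding used_def by blast

lemma path_disjoint:
  assumes "i \<in> {1..<k}" "j \<in> {1..<k}" "i \<noteq> j" shows "path_edges (P i) \<inter> path_edges (P j) = {}"
proof -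
  have "path_edges (P i) \<inter> path_edges (P j) = {}" if "i < j" "i \<in> {1..<k}" "j \<in> {1..<k}" for i j
  proof -
    have "path_edges (P i) \<subseteq> used P j" using that unfolding used_def by (intro UN_upper) auto
    thus ?thesis using path(2)[OF that(3)] by blast
  qed
  thus ?thesis using assms by (metis Int_commute linorder_neqE_nat)
qed

lemma cost_mono:
  assumes "i \<in> {1..<k}" "j \<in> {1..<k}" "i \<le> j" shows "path_cost w (P i) \<le> path_cost w (P j)"
proof (rule path(3)[OF assms(1) path(1)[OF assms(2)]])
  have "used P i \<subseteq> used P j" using assms unfolding used_def by (intro UN_mono) auto
  thus "path_edges (P j) \<inter> used P i = {}" using path(2)[OF assms(2)] by auto
qed

text \<open>Markov's inequality for the counting measure on the used edges; their total weight is
  the sum of the path costs because the paths are edge-disjoint.\<close>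

lemma heavy_used:
  assumes "\<And>i. i \<in> {1..<k} \<Longrightarrow> path_cost w (P i) \<le> x" "0 \<le> \<theta>"
  shows "real (card {e\<in>R. \<theta> < w e}) * \<theta> \<le> real (k - 1) * x"
proof -
  have "real (card {e\<in>R. \<theta> < w e}) * \<theta> \<le> (\<Sum>e\<in>{e\<in>R. \<theta> < w e}. w e)"
    using sum_mono[of "{e\<in>R. \<theta> < w e}" "\<lambda>_. \<theta>" w] by simp
  also have "... \<le> (\<Sum>e\<in>R. w e)" using used_sub nonneg by (intro sum_mono2) auto
  also have "... = (\<Sum>i\<in>{1..<k}. path_cost w (P i))" unfolding used_def path_cost_def
    by (rule sum.UNION_disjoint) (use path_disjoint in auto)
  also have "... \<le> real (card {1..<k}) * x" by (intro sum_bounded_above assms)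
  finally show ?thesis by simp
qed

lemma first_inj: "inj_on (\<lambda>i. first_v (P i)) {1..<k}" and last_inj: "inj_on (\<lambda>i. last_v (P i)) {1..<k}"
proof -
  have e: "{s, first_v (P i)} \<in> path_edges (P i)" "{t, last_v (P i)} \<in> path_edges (P i)" if "i \<in> {1..<k}" for i
    using st_path_edge_first[OF path(1)[OF that] neq] st_path_edge_last[OF path(1)[OF that] neq] by auto
  show "inj_on (\<lambda>i. first_v (P i)) {1..<k}"
  proof (rule inj_onI, rule ccontr)
    fix i j assume ij: "i \<in> {1..<k}" "j \<in> {1..<k}" "first_v (P i) = first_v (P j)" "i \<noteq> j"
    thus False using e(1)[of i] e(1)[of j] path_disjoint[of i j] by auto
  qed
  show "inj_on (\<lambda>i. last_v (P i)) {1..<k}"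
  proof (rule inj_onI, rule ccontr)
    fix i j assume ij: "i \<in> {1..<k}" "j \<in> {1..<k}" "last_v (P i) = last_v (P j)" "i \<noteq> j"
    thus False using e(2)[of i] e(2)[of j] path_disjoint[of i j] by auto
  qed
qed

lemma used_at:
  assumes "x = s \<or> x = t" shows "finite {v. {x, v} \<in> R}" "card {v. {x, v} \<in> R} \<le> k - 1"
proof -
  have sub: "{v. {x, v} \<in> R} \<subseteq> (\<lambda>i. if x = s then first_v (P i) else last_v (P i)) ` {1..<k}"
  proof
    fix v assume "v \<in> {v. {x, v} \<in> R}"
    then obtain i where i: "i \<in> {1..<k}" "{x, v} \<in> path_edges (P i)" by (auto simp: used_def)
    thus "v \<in> (\<lambda>i. if x = s then first_v (P i) else last_v (P i)) ` {1..<k}"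
      using st_path_edges_at[OF path(1)[OF i(1)] neq] assms by (intro image_eqI[OF _ i(1)]) auto
  qed
  show "finite {v. {x, v} \<in> R}" by (rule finite_subset[OF sub]) simp
  have "card {v. {x, v} \<in> R} \<le> card {1..<k}" by (rule surj_card_le[OF _ sub]) simp
  thus "card {v. {x, v} \<in> R} \<le> k - 1" by simp
qed

lemma unused_star:
  assumes x: "x = s \<or> x = t" and c: "k' \<le> card {v\<in>{..<n} - {x}. w {x, v} \<le> y}"
  shows "\<exists>U. U \<subseteq> {..<n} - {x} \<and> k' \<le> card U + (k - 1) \<and> (\<forall>v\<in>U. {x, v} \<in> E - R \<and> w {x, v} \<le> y) \<and> reach (E - R) w x U y"
proof -
  define V where "V = {v\<in>{..<n} - {x}. w {x, v} \<le> y}"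
  define U where "U = V - {v. {x, v} \<in> R}"
  have xn: "x < n" using x s t by auto
  have "card V \<le> card U + card {v. {x, v} \<in> R}"
  proof -
    have "finite (U \<union> {v. {x, v} \<in> R})" using used_at(1)[OF x] by (auto simp: U_def V_def)
    hence "card V \<le> card (U \<union> {v. {x, v} \<in> R})" by (rule card_mono) (auto simp: U_def)
    thus ?thesis using card_Un_le[of U "{v. {x, v} \<in> R}"] by linarith
  qed
  hence k': "k' \<le> card U + (k - 1)" using c used_at(2)[OF x] unfolding V_def by linarith
  have U: "{x, v} \<in> E - R \<and> w {x, v} \<le> y" if "v \<in> U" for v
    using that xn by (auto simp: U_def V_def complete_edges_doubleton)
  have "reach (E - R) w x U y" unfolding reach_def using U walk_edge by blast
  moreover have "U \<subseteq> {..<n} - {x}" by (auto simp: U_def V_def)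
  ultimately show ?thesis using k' U by blast
qed

lemma walk_gives_path:
  assumes "walk (E - R) w s t c"
  shows "\<exists>p. st_path E s t p \<and> path_edges p \<inter> R = {} \<and> path_cost w p \<le> c"
proof -
  obtain p where p: "st_path (E - R) s t p" "path_cost w p \<le> c" using walk_imp_path[OF assms] nonneg by auto
  have "st_path E s t p" "path_edges p \<inter> R = {}" using p(1) unfolding st_path_def by auto
  thus ?thesis using p(2) by blast
qed

end

lemma greedy_upper:
  assumes s: "s < n" and t: "t < n" and neq: "s \<noteq> t" and nonneg: "\<And>e. e \<in> complete_edges n \<Longrightarrow> 0 \<le> w e"
    and step: "\<And>k P. k \<in> {1..N} \<Longrightarrow> greedy n w s t k P \<Longrightarrow> (\<And>i. i \<in> {1..<k} \<Longrightarrow> path_cost w (P i) \<le> u i) \<Longrightarrow>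
       \<exists>c\<le>u k. walk (complete_edges n - used P k) w s t c"
  shows "(\<exists>P. successive_paths (complete_edges n) w s t N P) \<and>
     (\<forall>k\<in>{1..N}. \<forall>P. successive_paths (complete_edges n) w s t k P \<longrightarrow> path_cost w (P k) \<le> u k)"
  using step
proof (induction N)
  case 0
  show ?case by (auto simp: successive_paths_def)
next
  case (Suc N)
  have IH: "(\<exists>P. successive_paths (complete_edges n) w s t N P) \<and>
     (\<forall>k\<in>{1..N}. \<forall>P. successive_paths (complete_edges n) w s t k P \<longrightarrow> path_cost w (P k) \<le> u k)"
  proof (rule Suc.IH)
    fix k P assume k: "k \<in> {1..N}" and a: "greedy n w s t k P" "\<And>i. i \<in> {1..<k} \<Longrightarrow> path_cost w (P i) \<le> u i"
    show "\<exists>c\<le>u k. walk (complete_edges n - used P k) w s t c" by (rule Suc.prems[OF _ a]) (use k in auto)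
  qed
  have IH1: "\<exists>P. successive_paths (complete_edges n) w s t N P"
    and IH2: "\<And>k P. k \<in> {1..N} \<Longrightarrow> successive_paths (complete_edges n) w s t k P \<Longrightarrow> path_cost w (P k) \<le> u k"
    using IH by blast+
  have next_path: "\<exists>p. st_path (complete_edges n) s t p \<and> path_edges p \<inter> used P (Suc N) = {} \<and> path_cost w p \<le> u (Suc N)"
    if P: "successive_paths (complete_edges n) w s t N P" for P
  proof -
    interpret g: greedy n w s t "Suc N" P by unfold_locales (use s t neq nonneg P in auto)
    have "\<exists>c\<le>u (Suc N). walk (complete_edges n - used P (Suc N)) w s t c"
    proof (rule Suc.prems)
      show "greedy n w s t (Suc N) P" by (rule g.greedy_axioms)
      fix i assume "i \<in> {1..<Suc N}"
      thus "path_cost w (P i) \<le> u i" using IH2[of i P] successive_paths_prefix[OF P, of i] by auto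
    qed simp
    then obtain c where c: "c \<le> u (Suc N)" "walk (complete_edges n - used P (Suc N)) w s t c" by blast
    from g.walk_gives_path[OF c(2)] c(1) show ?thesis by (meson order_trans)
  qed
  have "\<exists>P. successive_paths (complete_edges n) w s t (Suc N) P"
  proof -
    obtain P where P: "successive_paths (complete_edges n) w s t N P" using IH1 by blast
    define Q where "Q = {p. st_path (complete_edges n) s t p \<and> path_edges p \<inter> used P (Suc N) = {}}"
    have "finite Q" using finite_subset[OF _ finite_st_paths[OF s, of t], of Q] by (auto simp: Q_def)
    moreover have "Q \<noteq> {}" using next_path[OF P] by (auto simp: Q_def)
    ultimately obtain p where p: "is_arg_min (path_cost w) (\<lambda>p. p \<in> Q) p" using ex_is_arg_min_if_finite by blast
    define P' where "P' = P(Suc N := p)"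
    have "successive_paths (complete_edges n) w s t N P'" using P successive_paths_cong[of N P P'] by (auto simp: P'_def)
    moreover have "(\<Union>i\<in>{1..<Suc N}. path_edges (P' i)) = used P (Suc N)" by (auto simp: P'_def used_def)
    ultimately have "successive_paths (complete_edges n) w s t (Suc N) P'"
      using p unfolding successive_paths_def Q_def by (auto simp: le_Suc_eq P'_def)
    thus ?thesis by blast
  qed
  moreover have "path_cost w (P k) \<le> u k" if k: "k \<in> {1..Suc N}" and P: "successive_paths (complete_edges n) w s t k P" for k P
  proof (cases "k = Suc N")
    case False thus ?thesis using IH2[of k P] k P by auto
  next
    case True
    obtain p where p: "st_path (complete_edges n) s t p" "path_edges p \<inter> used P (Suc N) = {}" "path_cost w p \<le> u (Suc N)"
      using next_path[of P] successive_paths_prefix[OF P, of N] True by auto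
    have "is_arg_min (path_cost w) (\<lambda>p. st_path (complete_edges n) s t p \<and> path_edges p \<inter> used P k = {}) (P k)"
      using P k unfolding successive_paths_def used_def by auto
    thus ?thesis using p True unfolding is_arg_min_linorder by force
  qed
  ultimately show ?case by blast
qed

text \<open>A vertex of level i was hit from some level i' through an edge of weight at most tm i -
  tm i', so the times telescope along the exploration.\<close>

lemma reach_hist:
  assumes "reach A w x S (c + tm 0)" and edge: "\<And>a v. a \<in> S \<union> V \<Longrightarrow> v \<in> V \<Longrightarrow> a \<noteq> v \<Longrightarrow> \<theta> < w {a, v} \<Longrightarrow> {a, v} \<in> A"
  shows "i \<le> j \<Longrightarrow> reach A w x (hist tm \<theta> V S j w ! i) (c + tm i)"
proof (induction j arbitrary: i)
  case 0
  thus ?case using assms(1) by simp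
next
  case (Suc j)
  let ?h = "hist tm \<theta> V S j w"
  show ?case
  proof (cases "i \<le> j")
    case True thus ?thesis using Suc.IH[of i] by (simp add: nth_append)
  next
    case False
    hence i: "i = Suc j" using Suc.prems by simp
    have "hist tm \<theta> V S (Suc j) w ! i = nxt tm \<theta> V w ?h" by (simp add: i nth_append)
    moreover have "reach A w x (nxt tm \<theta> V w ?h) (c + tm i)"
      unfolding reach_def
    proof
      fix v assume v: "v \<in> nxt tm \<theta> V w ?h"
      hence "hit tm \<theta> w ?h (length ?h) v" by (simp add: nxt_def)
      then obtain i' a where "i' < length ?h" and a: "a \<in> ?h ! i'" "\<theta> < w {a, v}" "w {a, v} \<le> tm (length ?h) - tm i'"
        unfolding hit_def by blast
      hence a: "i' \<le> j" "a \<in> ?h ! i'" "\<theta> < w {a, v}" "w {a, v} \<le> tm i - tm i'" by (simp_all add: i less_Suc_eq_le)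
      have m: "?h ! i' \<in> set ?h" using a by simp
      hence "a \<in> S \<union> V" using hist_subset[of tm \<theta> V S j w] a by blast
      moreover have "v \<in> V" "v \<notin> \<Union>(set ?h)" using v by (simp_all add: nxt_def)
      moreover from this have "a \<noteq> v" using a(2) m by blast
      ultimately have e: "{a, v} \<in> A" using edge a by blast
      obtain c1 where c1: "c1 \<le> c + tm i'" "walk A w x a c1" using Suc.IH[OF a(1)] a(2) unfolding reach_def by blast
      show "\<exists>c'\<le>c + tm i. walk A w x v c'" using walk_step[OF c1(2) e] c1 a by (intro exI[of _ "c1 + w {a, v}"]) auto
    qed
    ultimately show ?thesis by simp
  qed
qed

lemma reach_grown:
  assumes S: "reach A w x S c" and T: "reach A w y T d" and g: "grown n g \<tau> V S T J w" and g0: "0 \<le> g" "0 \<le> \<tau>"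
    and edge: "\<And>a v. a \<in> S \<union> V \<Longrightarrow> v \<in> V \<union> T \<Longrightarrow> a \<noteq> v \<Longrightarrow> \<tau> / real n < w {a, v} \<Longrightarrow> {a, v} \<in> A" and disj: "(S \<union> V) \<inter> T = {}"
  shows "\<exists>c'\<le>c + (4 * g + real J * \<tau>) / real n + d. walk A w x y c'"
proof -
  let ?h = "hist (grow_time n g \<tau>) (\<tau> / real n) V S J w"
  obtain a b where ab: "a \<in> \<Union>(set ?h)" "b \<in> T" "\<tau> / real n < w {a, b}" "w {a, b} \<le> 2 * g / real n"
    using g unfolding grown_def by blast
  then obtain i where i: "i \<le> J" "a \<in> ?h ! i" by (auto simp: in_set_conv_nth less_Suc_eq_le)
  have r: "reach A w x (?h ! i) (c + grow_time n g \<tau> i)" by (rule reach_hist) (use S edge i in auto)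
  have "a \<in> S \<union> V" using hist_subset[of "grow_time n g \<tau>" "\<tau> / real n" V S J w] ab(1) by blast
  hence "{a, b} \<in> A" using edge ab disj by blast
  from reach_join[OF r T i(2) ab(2) this ab(4)] obtain c' where
    c': "c' \<le> c + grow_time n g \<tau> i + 2 * g / real n + d" "walk A w x y c'" by blast
  have "grow_time n g \<tau> i \<le> (2 * g + real J * \<tau>) / real n"
    using incseq_grow_time[OF g0, of n] i(1) grow_time_le[OF g0(2,1), of n J] by (meson incseqD order_trans)
  hence "c' \<le> c + ((2 * g + real J * \<tau>) / real n + 2 * g / real n) + d" using c' by linarith
  also have "(2 * g + real J * \<tau>) / real n + 2 * g / real n = (4 * g + real J * \<tau>) / real n" by (simp add: add_divide_distrib[symmetric])
  finally show ?thesis using c'(2) by blast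
qed

context greedy
begin

lemma n_pos: "0 < real n" using s by simp

text \<open>\<open>D\<close> bounds the loss: fewer than k paths of cost at most C/n have together
  at most kC/g edges heavier than g/n.\<close>

lemma reach_expand_card:
  assumes r: "reach (E - R) w x S c" and S: "S \<subseteq> X" "S \<subseteq> {..<n}" and g: "0 < g"
    and cost: "\<And>i. i \<in> {1..<k} \<Longrightarrow> path_cost w (P i) \<le> C / real n" and D: "real k * C \<le> D * g" and C: "0 \<le> C"
  shows "\<exists>S'. S' \<subseteq> hits n w (g / real n) (2 * g / real n) S X \<and> reach (E - R) w x S' (c + 2 * g / real n) \<and>
     real (card (hits n w (g / real n) (2 * g / real n) S X)) \<le> real (card S') + D"
proof -
  obtain S' where S': "S' \<subseteq> hits n w (g / real n) (2 * g / real n) S X" "reach (E - R) w x S' (c + 2 * g / real n)"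
     "real (card (hits n w (g / real n) (2 * g / real n) S X)) \<le> real (card S') + real (card {e\<in>R. g / real n < w e})"
    using reach_expand[OF r S finite_used] by blast
  have "real (card {e\<in>R. g / real n < w e}) * (g / real n) \<le> real (k - 1) * (C / real n)"
    by (rule heavy_used) (use cost g n_pos in auto)
  hence "real (card {e\<in>R. g / real n < w e}) * g \<le> real (k - 1) * C" using n_pos by (simp add: field_simps)
  also have "... \<le> real k * C" using C by (intro mult_right_mono) auto
  also note D
  finally have "real (card {e\<in>R. g / real n < w e}) \<le> D" using g by simp
  thus ?thesis using S' by (intro exI[of _ S']) auto
qed

lemma small_side:
  assumes x: "x < n" and U: "U \<subseteq> {..<n} - {x}" "card U = m1" "\<forall>v\<in>U. w {x, v} \<le> L / real n" "reach (E - R) w x U y"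
    and g: "0 < g" "2 * g \<le> L"
    and ls: "local_spread n L g 1 m1 w" "local_spread n L g m1 m2 w"
    and cost: "\<And>i. i \<in> {1..<k} \<Longrightarrow> path_cost w (P i) \<le> C / real n" and D: "real k * C \<le> D * g" and C: "0 \<le> C"
    and Fb: "Fb \<subseteq> {..<n}" and m: "real m2 + D \<le> g * real m1 / 32" "real m3 + D + real (card Fb) \<le> g * real m2 / 32"
  shows "\<exists>S1 S2. S1 \<subseteq> {..<n} \<and> S2 \<subseteq> {..<n} \<and> card S1 = m2 \<and> card S2 = m3 \<and> S1 \<inter> S2 = {} \<and> attached n L S1 S2 w \<and> S2 \<inter> Fb = {} \<and>
     reach (E - R) w x S1 (y + 4 * g / real n) \<and> reach (E - R) w x S2 (y + 4 * g / real n)"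
proof -
  let ?H = "\<lambda>Y X. hits n w (g / real n) (2 * g / real n) Y X"
  have le: "2 * g / real n \<le> L / real n" using g by (intro divide_right_mono) auto
  have att: "attached n L Y S w" if SH: "S \<subseteq> ?H Y X" for Y S X
    unfolding attached_def
  proof
    fix v assume "v \<in> S"
    then obtain a where "a \<in> Y" "w {a, v} \<le> 2 * g / real n" using SH unfolding hits_def by blast
    thus "\<exists>z\<in>Y. w {z, v} \<le> L / real n" using le by (meson order_trans)
  qed
  have h1: "g * real m1 / 32 \<le> real (card (?H U ({x} \<union> U)))"
  proof -
    have "{x} \<subseteq> {..<n}" "U \<subseteq> {..<n}" "card {x} = 1" "{x} \<inter> U = {}" using x U(1) by auto
    moreover have "attached n L {x} U w" using U(3) unfolding attached_def by blast
    ultimately show ?thesis using ls(1) U(2) unfolding local_spread_def by blast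
  qed
  have UX: "U \<subseteq> {x} \<union> U" "U \<subseteq> {..<n}" using U by auto
  obtain S1' where S1': "S1' \<subseteq> ?H U ({x} \<union> U)" "reach (E - R) w x S1' (y + 2 * g / real n)" "real (card (?H U ({x} \<union> U))) \<le> real (card S1') + D"
    using reach_expand_card[OF U(4) UX g(1) cost D C] by blast
  have "real m2 \<le> real (card S1')" using h1 S1' m by linarith
  then obtain S1 where S1: "S1 \<subseteq> S1'" "card S1 = m2" by (metis obtain_subset_with_card_n of_nat_le_iff)
  have r1: "reach (E - R) w x S1 (y + 2 * g / real n)" using S1' S1 reach_mono by blast
  have s1: "S1 \<subseteq> {..<n}" "U \<inter> S1 = {}" "attached n L U S1 w" using S1 S1' att[of S1 U "{x} \<union> U"] by (auto simp: hits_def)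
  have h2: "g * real m2 / 32 \<le> real (card (?H S1 (U \<union> S1)))"
    using ls(2) UX(2) U(2) S1(2) s1 unfolding local_spread_def by blast
  have S1X: "S1 \<subseteq> U \<union> S1" by auto
  obtain S2' where S2': "S2' \<subseteq> ?H S1 (U \<union> S1)" "reach (E - R) w x S2' (y + 2 * g / real n + 2 * g / real n)" "real (card (?H S1 (U \<union> S1))) \<le> real (card S2') + D"
    using reach_expand_card[OF r1 S1X s1(1) g(1) cost D C] by blast
  have "card S2' \<le> card (S2' - Fb) + card Fb"
  proof -
    have "finite S2'" "finite Fb" using S2'(1) Fb by (auto simp: hits_def intro: finite_subset)
    thus ?thesis using diff_card_le_card_Diff[of Fb S2'] by linarith
  qed
  hence "real (card S2') \<le> real (card (S2' - Fb)) + real (card Fb)" by linarith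
  hence "real m3 \<le> real (card (S2' - Fb))" using h2 S2' m by linarith
  then obtain S2 where S2: "S2 \<subseteq> S2' - Fb" "card S2 = m3" by (metis obtain_subset_with_card_n of_nat_le_iff)
  have e: "y + 2 * g / real n + 2 * g / real n = y + 4 * g / real n" by (simp add: add_divide_distrib[symmetric])
  have "reach (E - R) w x S2 (y + 4 * g / real n)" using reach_mono[OF S2'(2), of S2 "y + 4 * g / real n"] S2(1) unfolding e by auto
  moreover have "reach (E - R) w x S1 (y + 4 * g / real n)" using reach_mono[OF r1, of S1 "y + 4 * g / real n"] g n_pos by (auto simp: divide_right_mono)
  moreover have "S2 \<subseteq> {..<n}" "S1 \<inter> S2 = {}" "S2 \<inter> Fb = {}" using S2 S2'(1) by (auto simp: hits_def)
  moreover have "attached n L S1 S2 w" using att[of S2 S1 "U \<union> S1"] S2 S2' by auto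
  ultimately show ?thesis using s1 S1 S2 by blast
qed

text \<open>Every used edge heavier than \<open>\<tau>/n\<close> has both endpoints in \<open>Fb\<close>, so a growth process that
  avoids \<open>Fb\<close> and only uses edges heavier than \<open>\<tau>/n\<close> never meets a used edge.\<close>

lemma small_step:
  assumes U: "U \<subseteq> {..<n} - {s}" "card U = m1" "\<forall>v\<in>U. w {s, v} \<le> L / real n" "reach (E - R) w s U y"
    and V: "V \<subseteq> {..<n} - {t}" "card V = m1" "\<forall>v\<in>V. w {t, v} \<le> L / real n" "reach (E - R) w t V y"
    and g: "0 < g" "2 * g \<le> L" and \<tau>: "0 < \<tau>"
    and ls: "local_spread n L g 1 m1 w" "local_spread n L g m1 m2 w" "grow_all n L g \<tau> m2 m3 f J w"
    and cost: "\<And>i. i \<in> {1..<k} \<Longrightarrow> path_cost w (P i) \<le> C / real n" and D: "real k * C \<le> D * g" and C: "0 \<le> C"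
    and f: "2 * real k * C \<le> real f * \<tau>" "f \<le> n"
    and m: "real m2 + D \<le> g * real m1 / 32" "real m3 + D + real f \<le> g * real m2 / 32"
  shows "\<exists>c\<le>2 * y + (12 * g + real J * \<tau>) / real n. walk (E - R) w s t c"
proof -
  define Hv where "Hv = {e\<in>R. \<tau> / real n < w e}"
  have fin: "finite Hv" by (simp add: Hv_def)
  have HvE: "e \<in> Hv \<Longrightarrow> e \<subseteq> {..<n} \<and> card e = 2" for e using used_sub by (auto simp: Hv_def complete_edges_def)
  have "real (card Hv) * (\<tau> / real n) \<le> real (k - 1) * (C / real n)"
    unfolding Hv_def by (rule heavy_used) (use cost \<tau> n_pos in auto)
  hence "real (card Hv) * \<tau> \<le> real (k - 1) * C" using n_pos by (simp add: field_simps)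
  also have "... \<le> real k * C" using C by (intro mult_right_mono) auto
  finally have "(2 * real (card Hv)) * \<tau> \<le> real f * \<tau>" using f by linarith
  hence c2: "2 * card Hv \<le> f" using \<tau> by simp
  have "card (\<Union>Hv) \<le> (\<Sum>e\<in>Hv. card e)" by (rule card_Union_le_sum_card)
  also have "... = 2 * card Hv" using HvE by simp
  finally have "card (\<Union>Hv) \<le> f" using c2 by linarith
  moreover have "\<Union>Hv \<subseteq> {..<n}" using HvE by blast
  \<comment> \<open>The set is padded to exactly \<open>f\<close> vertices, the size for which
    \<open>grow_all\<close> is stated.\<close>
  ultimately obtain Fb where Fb: "\<Union>Hv \<subseteq> Fb" "Fb \<subseteq> {..<n}" "card Fb = f"
    using exists_subset_between[of "\<Union>Hv" f "{..<n}"] f by auto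
  obtain S1 S2 where S: "S1 \<subseteq> {..<n}" "S2 \<subseteq> {..<n}" "card S1 = m2" "card S2 = m3" "S1 \<inter> S2 = {}" "attached n L S1 S2 w" "S2 \<inter> Fb = {}"
     "reach (E - R) w s S1 (y + 4 * g / real n)" "reach (E - R) w s S2 (y + 4 * g / real n)"
    using small_side[OF s U g ls(1,2) cost D C Fb(2) m(1), of m3] m(2) Fb(3) by blast
  obtain T1 T2 where T: "T1 \<subseteq> {..<n}" "T2 \<subseteq> {..<n}" "card T1 = m2" "card T2 = m3" "T1 \<inter> T2 = {}" "attached n L T1 T2 w" "T2 \<inter> Fb = {}"
     "reach (E - R) w t T1 (y + 4 * g / real n)" "reach (E - R) w t T2 (y + 4 * g / real n)"
    using small_side[OF t V g ls(1,2) cost D C Fb(2) m(1), of m3] m(2) Fb(3) by blast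
  have e: "y + 4 * g / real n + (4 * g + real J * \<tau>) / real n + (y + 4 * g / real n) = 2 * y + (12 * g + real J * \<tau>) / real n"
    by (simp add: add_divide_distrib)
  have p: "0 \<le> (4 * g + real J * \<tau>) / real n" using g \<tau> by simp
  show ?thesis
  \<comment> \<open>If the neighbourhoods of s and t already meet, they are joined directly; the
    growth event presupposes disjoint sets.\<close>
  proof (cases "(S1 \<union> S2) \<inter> (T1 \<union> T2) = {}")
    case False
    then obtain a where a: "a \<in> S1 \<union> S2" "a \<in> T1 \<union> T2" by blast
    have "reach (E - R) w s (S1 \<union> S2) (y + 4 * g / real n)" "reach (E - R) w t (T1 \<union> T2) (y + 4 * g / real n)"
      using S(8,9) T(8,9) unfolding reach_def by blast+
    from reach_meet[OF this a] obtain c' where "c' \<le> y + 4 * g / real n + (y + 4 * g / real n)" "walk (E - R) w s t c'" by blast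
    thus ?thesis using e p by (intro exI[of _ c']) auto
  next
    case True
    let ?V = "{..<n} - (S1 \<union> S2 \<union> T1 \<union> T2 \<union> Fb)"
    have gr: "grown n g \<tau> ?V S2 T2 J w"
      using ls(3) S T Fb True unfolding grow_all_def by blast
    have "\<exists>c'\<le>y + 4 * g / real n + (4 * g + real J * \<tau>) / real n + (y + 4 * g / real n). walk (E - R) w s t c'"
    proof (rule reach_grown[OF S(9) T(9) gr])
      fix a v assume av: "a \<in> S2 \<union> ?V" "v \<in> ?V \<union> T2" "a \<noteq> v" "\<tau> / real n < w {a, v}"
      have "{a, v} \<in> E" using av S(2) T(2) by (auto simp: complete_edges_doubleton)
      moreover have "v \<notin> Fb" using av T(7) by blast
      hence "{a, v} \<notin> R" using Fb(1) av(4) by (auto simp: Hv_def)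
      ultimately show "{a, v} \<in> E - R" by blast
    qed (use g \<tau> True in auto)
    thus ?thesis unfolding e .
  qed
qed

text \<open>A set too large for \<open>spread\<close> is replaced by a subset of about n/g vertices,
  which has at least n/64 hits; losing at most n/128 of them to used edges leaves n/128. For smaller
  sets half of the hits survive likewise.\<close>

lemma spread_step:
  assumes sp: "spread n g w" and g: "0 < g" "g \<le> real n" and r: "reach (E - R) w x S c" and S: "S \<subseteq> {..<n}" "a \<le> real (card S)" "0 < a"
    and cost: "\<And>i. i \<in> {1..<k} \<Longrightarrow> path_cost w (P i) \<le> C / real n" and D: "real k * C \<le> D * g" and C: "0 \<le> C"
    and Dle: "D \<le> g * a / 64" "D \<le> real n / 128"
  shows "\<exists>S'. S' \<subseteq> {..<n} \<and> reach (E - R) w x S' (c + 2 * g / real n) \<and> min (real n / 128) (g * a / 64) \<le> real (card S')"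
proof -
  have "\<exists>Y\<subseteq>S. Y \<noteq> {} \<and> g * real (card Y) \<le> real n \<and> min (real n / 2) (g * a) \<le> g * real (card Y)"
  proof (cases "g * real (card S) \<le> real n")
    case True
    have "g * a \<le> g * real (card S)" using g S by (intro mult_left_mono) auto
    thus ?thesis using True S by (intro exI[of _ S]) auto
  next
    case False
    define m where "m = nat \<lfloor>real n / g\<rfloor>"
    have x1: "1 \<le> real n / g" using g by simp
    hence fl: "1 \<le> \<lfloor>real n / g\<rfloor>" by (metis le_floor_iff of_int_1)
    have m: "real m \<le> real n / g" "real n / g < real m + 1" "1 \<le> m" using fl unfolding m_def by (auto simp: nat_le_eq_zle[symmetric]) linarith
    hence gm: "g * real m \<le> real n" "real n < g * real m + g" using g by (auto simp: field_simps)
    have "g \<le> g * real m" using m g by simp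
    hence half: "real n / 2 \<le> g * real m" using gm by linarith
    have "g * real m \<le> g * real (card S)" using gm False by linarith
    hence "m \<le> card S" using g by simp
    then obtain Y where "Y \<subseteq> S" "card Y = m" by (metis obtain_subset_with_card_n)
    thus ?thesis using gm half m by (intro exI[of _ Y]) auto
  qed
  then obtain Y where Y: "Y \<subseteq> S" "Y \<noteq> {}" "g * real (card Y) \<le> real n" "min (real n / 2) (g * a) \<le> g * real (card Y)" by blast
  have YS: "Y \<subseteq> Y" "Y \<subseteq> {..<n}" using Y S by auto
  have h: "g * real (card Y) / 32 \<le> real (card (hits n w (g / real n) (2 * g / real n) Y Y))"
    using sp Y YS unfolding spread_def by blast
  have rY: "reach (E - R) w x Y c" using r Y reach_mono by blast
  obtain S' where S': "S' \<subseteq> hits n w (g / real n) (2 * g / real n) Y Y" "reach (E - R) w x S' (c + 2 * g / real n)"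
    "real (card (hits n w (g / real n) (2 * g / real n) Y Y)) \<le> real (card S') + D"
    using reach_expand_card[OF rY YS g(1) cost D C] by blast
  have "min (real n / 128) (g * a / 64) \<le> real (card S')" using h S'(3) Y(4) Dle by (auto simp: min_def split: if_splits)
  thus ?thesis using S' by (intro exI[of _ S']) (auto simp: hits_def)
qed

end

context greedy
begin

text \<open>One step at scale \<delta>k turns order k vertices into a0 of order k^2, which exceeds
  by a factor 64 the possible number C k^2/\<mu> of used edges heavier than \<mu>/n. After that the
  much smaller scale \<mu> suffices: each step multiplies the size by \<mu>/64, and J steps reach
  n/128 at cost 2J\<mu>/n.\<close>

lemma large_side:
  assumes sp: "spread n (\<delta> * real k) w" "spread n \<mu> w" and r: "reach (E - R) w x U y" and U: "U \<subseteq> {..<n}" "\<zeta> * real k \<le> real (card U)"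
    and cost: "\<And>i. i \<in> {1..<k} \<Longrightarrow> path_cost w (P i) \<le> C * real k / real n"
    and pos: "0 < \<delta>" "\<delta> \<le> 1" "0 < \<zeta>" "0 < C" "k \<le> n" and \<rho>: "\<rho> \<le> 1 / 128" and \<mu>: "64 \<le> \<mu>" "\<mu> \<le> real n"
    and alt: "128 * C * real k \<le> \<delta> * real n \<or> \<rho> * real n \<le> real (card U)"
    and N: "64 * C \<le> \<zeta> * \<delta>\<^sup>2 * real k" "4096 * C \<le> \<zeta> * \<delta> * \<mu>" "real n \<le> (\<mu> / 64) ^ J" "64 \<le> \<zeta> * \<delta> * (real k)\<^sup>2"
  shows "\<exists>S\<subseteq>{..<n}. reach (E - R) w x S (y + (2 * \<delta> * real k + 2 * real J * \<mu>) / real n) \<and> \<rho> * real n \<le> real (card S)"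
proof -
  define g where "g = \<delta> * real k"
  define a0 where "a0 = g * (\<zeta> * real k) / 64"
  have K: "0 < real k" using k1 by simp
  have g: "0 < g" "g \<le> real n"
  proof -
    show "0 < g" using pos K by (simp add: g_def)
    have "\<delta> * real k \<le> 1 * real n" using pos by (intro mult_mono) auto
    thus "g \<le> real n" by (simp add: g_def)
  qed
  have a0: "1 \<le> a0" using N(4) by (simp add: a0_def g_def power2_eq_square algebra_simps)
  have fin: ?thesis if A: "S \<subseteq> {..<n}" "reach (E - R) w x S c" "\<rho> * real n \<le> real (card S)" "c \<le> y + (2 * g + 2 * real J * \<mu>) / real n" for S c
    using reach_mono[OF A(2) order_refl A(4)] A(1,3) by (auto simp: g_def mult.assoc)
  have \<mu>J: "0 \<le> 2 * real J * \<mu> / real n" using \<mu> by simp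
  have sum: "(2 * g + 2 * real J * \<mu>) / real n = 2 * g / real n + 2 * real J * \<mu> / real n" by (simp add: add_divide_distrib)
  have g2: "0 \<le> 2 * g / real n" using g by simp
  have \<rho>n: "\<rho> * real n \<le> real n / 128" using \<rho> n_pos by simp
  show ?thesis
  proof (cases "\<rho> * real n \<le> real (card U)")
    case True
    show ?thesis using \<mu>J g2 sum by (intro fin[OF U(1) r True]) linarith
  next
    case False
    hence k2: "128 * C * real k \<le> \<delta> * real n" using alt by blast
    have "\<exists>S'. S' \<subseteq> {..<n} \<and> reach (E - R) w x S' (y + 2 * g / real n) \<and> min (real n / 128) (g * (\<zeta> * real k) / 64) \<le> real (card S')"
    proof (rule spread_step[where C = "C * real k" and D = "C * real k / \<delta>"])
      show "real k * (C * real k) \<le> C * real k / \<delta> * g" using pos by (simp add: g_def)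
      have "64 * C * real k \<le> \<zeta> * \<delta>\<^sup>2 * real k * real k" using N(1) K by (intro mult_right_mono) auto
      thus "C * real k / \<delta> \<le> g * (\<zeta> * real k) / 64" using pos by (simp add: g_def field_simps power2_eq_square)
      show "C * real k / \<delta> \<le> real n / 128" using k2 pos by (simp add: field_simps)
    qed (use sp r U cost pos K g in \<open>auto simp: g_def\<close>)
    then obtain S1 where S1: "S1 \<subseteq> {..<n}" "reach (E - R) w x S1 (y + 2 * g / real n)" "min (real n / 128) a0 \<le> real (card S1)"
      unfolding a0_def by blast
    show ?thesis
    proof (cases "real n / 128 \<le> a0")
      case True
      show ?thesis using \<mu>J sum S1(3) True \<rho>n by (intro fin[OF S1(1,2)]) auto
    next
      case False
      have Da: "C * real k * real k / \<mu> \<le> a0 / 64"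
      proof -
        have "4096 * C * (real k)\<^sup>2 \<le> \<zeta> * \<delta> * \<mu> * (real k)\<^sup>2" using N(2) by (intro mult_right_mono) auto
        thus ?thesis using \<mu> by (simp add: a0_def g_def field_simps power2_eq_square)
      qed
      have "\<exists>S\<subseteq>{..<n}. reach (E - R) w x S (y + 2 * g / real n + real j * (2 * \<mu> / real n)) \<and>
         min (real n / 128) ((\<mu> / 64) ^ j * a0) \<le> real (card S)" for j
      proof (induction j)
        case 0 thus ?case using S1 by auto
      next
        case (Suc j)
        then obtain S where S: "S\<subseteq>{..<n}" "reach (E - R) w x S (y + 2 * g / real n + real j * (2 * \<mu> / real n))"
         "min (real n / 128) ((\<mu> / 64) ^ j * a0) \<le> real (card S)" by blast
        define q where "q = (\<mu> / 64) ^ j * a0"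
        define a where "a = min (real n / 128) q"
        have "1 \<le> (\<mu> / 64) ^ j" using \<mu> by (intro one_le_power) auto
        hence q: "a0 \<le> q" using a0 by (simp add: q_def)
        have a: "a0 \<le> a" using q False by (simp add: a_def)
        have "\<exists>S'. S' \<subseteq> {..<n} \<and> reach (E - R) w x S' (y + 2 * g / real n + real j * (2 * \<mu> / real n) + 2 * \<mu> / real n) \<and>
          min (real n / 128) (\<mu> * a / 64) \<le> real (card S')"
        proof (rule spread_step[where C = "C * real k" and D = "C * real k * real k / \<mu>"])
          show "real k * (C * real k) \<le> C * real k * real k / \<mu> * \<mu>" using \<mu> by simp
          have "1 * a0 \<le> \<mu> * a" using \<mu> a a0 by (intro mult_mono) auto
          thus "C * real k * real k / \<mu> \<le> \<mu> * a / 64" using Da by simp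
          show "C * real k * real k / \<mu> \<le> real n / 128" using Da False a0 by linarith
        qed (use sp S cost pos K \<mu> a a0 in \<open>auto simp: a_def q_def\<close>)
        then obtain S' where S': "S' \<subseteq> {..<n}" "reach (E - R) w x S' (y + 2 * g / real n + real j * (2 * \<mu> / real n) + 2 * \<mu> / real n)"
          "min (real n / 128) (\<mu> * a / 64) \<le> real (card S')" by blast
        have mn: "min (real n / 128) ((\<mu> / 64) ^ Suc j * a0) \<le> min (real n / 128) (\<mu> * a / 64)"
        proof (cases "q \<le> real n / 128")
          case True thus ?thesis by (simp add: a_def q_def mult.assoc)
        next
          case False
          have "1 * (real n / 128) \<le> \<mu> / 64 * (real n / 128)" using \<mu> by (intro mult_right_mono) auto
          thus ?thesis using False by (simp add: a_def)
        qed
        have eq: "y + 2 * g / real n + real j * (2 * \<mu> / real n) + 2 * \<mu> / real n = y + 2 * g / real n + real (Suc j) * (2 * \<mu> / real n)"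
          by (simp add: algebra_simps add_divide_distrib)
        show ?case using S'(1) S'(2)[unfolded eq] order_trans[OF mn S'(3)] by blast
      qed
      then obtain S where S: "S\<subseteq>{..<n}" "reach (E - R) w x S (y + 2 * g / real n + real J * (2 * \<mu> / real n))"
         "min (real n / 128) ((\<mu> / 64) ^ J * a0) \<le> real (card S)" by blast
      have "real n * 1 \<le> (\<mu> / 64) ^ J * a0" using N(3) a0 n_pos by (intro mult_mono) auto
      hence "min (real n / 128) ((\<mu> / 64) ^ J * a0) = real n / 128" using n_pos by (intro min_absorb1) linarith
      hence "\<rho> * real n \<le> real (card S)" using S(3) \<rho>n by linarith
      thus ?thesis using sum by (intro fin[OF S(1,2)]) (auto simp: mult_ac)
    qed
  qed
qed

lemma large_step:
  assumes sp: "spread n (\<delta> * real k) w" "spread n \<mu> w" "joined n \<rho> (\<delta> * real k) w"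
    and U: "U \<subseteq> {..<n}" "\<zeta> * real k \<le> real (card U)" "reach (E - R) w s U y"
    and V: "V \<subseteq> {..<n}" "\<zeta> * real k \<le> real (card V)" "reach (E - R) w t V y"
    and cost: "\<And>i. i \<in> {1..<k} \<Longrightarrow> path_cost w (P i) \<le> C * real k / real n"
    and pos: "0 < \<delta>" "\<delta> \<le> 1" "0 < \<zeta>" "0 < C" "k \<le> n" and \<rho>: "\<rho> \<le> 1 / 128" and \<mu>: "64 \<le> \<mu>" "\<mu> \<le> real n"
    and alt: "128 * C * real k \<le> \<delta> * real n \<or> \<rho> * real n \<le> \<zeta> * real k"
    and N: "64 * C \<le> \<zeta> * \<delta>\<^sup>2 * real k" "4096 * C \<le> \<zeta> * \<delta> * \<mu>" "real n \<le> (\<mu> / 64) ^ J" "64 \<le> \<zeta> * \<delta> * (real k)\<^sup>2" "8 * C < \<rho>\<^sup>2 * \<delta>\<^sup>2 * real n"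
  shows "\<exists>c\<le>2 * y + (6 * \<delta> * real k + 4 * real J * \<mu>) / real n. walk (E - R) w s t c"
proof -
  define h where "h = (2 * \<delta> * real k + 2 * real J * \<mu>) / real n"
  define g where "g = \<delta> * real k"
  have g: "0 < g" using pos k1 by (simp add: g_def)
  obtain S where S: "S\<subseteq>{..<n}" "reach (E - R) w s S (y + h)" "\<rho> * real n \<le> real (card S)"
    unfolding h_def using large_side[OF sp(1,2) U(3,1,2) cost pos \<rho> \<mu> _ N(1-4)] alt U(2) by fastforce
  obtain T where T: "T\<subseteq>{..<n}" "reach (E - R) w t T (y + h)" "\<rho> * real n \<le> real (card T)"
    unfolding h_def using large_side[OF sp(1,2) V(3,1,2) cost pos \<rho> \<mu> _ N(1-4)] alt V(2) by fastforce
  have tot: "y + h + 2 * g / real n + (y + h) = 2 * y + (6 * \<delta> * real k + 4 * real J * \<mu>) / real n"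
    by (simp add: h_def g_def add_divide_distrib mult_ac)
  show ?thesis
  proof (cases "S \<inter> T = {}")
    case False
    then obtain a where "a \<in> S" "a \<in> T" by blast
    from reach_meet[OF S(2) T(2) this] obtain c' where "c' \<le> y + h + (y + h)" "walk (E - R) w s t c'" by blast
    moreover have "0 \<le> 2 * g / real n" using g by simp
    ultimately show ?thesis using tot by (intro exI[of _ c']) auto
  next
    case True
    let ?Q = "{p\<in>S \<times> T. g / real n < w {fst p, snd p} \<and> w {fst p, snd p} \<le> 2 * g / real n}"
    have q: "\<rho>\<^sup>2 * real n * g / 8 \<le> real (card ?Q)"
      using sp(3) S T True unfolding joined_def g_def by blast
    have "\<exists>p\<in>?Q. {fst p, snd p} \<notin> R"
    proof (rule ccontr)
      assume c: "\<not> (\<exists>p\<in>?Q. {fst p, snd p} \<notin> R)"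
      have "card ?Q \<le> card {e\<in>R. g / real n < w e}"
      proof (rule card_inj_on_le)
        show "inj_on (\<lambda>p. {fst p, snd p}) ?Q" using True by (auto simp: inj_on_def doubleton_eq_iff)
        show "(\<lambda>p. {fst p, snd p}) ` ?Q \<subseteq> {e\<in>R. g / real n < w e}" using c by auto
      qed simp
      moreover have "real (card {e\<in>R. g / real n < w e}) * (g / real n) \<le> real (k - 1) * (C * real k / real n)"
        by (rule heavy_used) (use cost g n_pos in auto)
      hence "real (card {e\<in>R. g / real n < w e}) * g \<le> real (k - 1) * (C * real k)" using n_pos by (simp add: field_simps)
      moreover have "real (k - 1) * (C * real k) \<le> real k * (C * real k)" using pos by (intro mult_right_mono) auto
      moreover have "real (card ?Q) * g \<le> real (card {e\<in>R. g / real n < w e}) * g" using calculation(1) g by (intro mult_right_mono) auto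
      moreover have "\<rho>\<^sup>2 * real n * g / 8 * g \<le> real (card ?Q) * g" using q g by (intro mult_right_mono) auto
      ultimately have "\<rho>\<^sup>2 * real n * g / 8 * g \<le> real k * (C * real k)" by linarith
      hence "\<rho>\<^sup>2 * \<delta>\<^sup>2 * real n * (real k)\<^sup>2 \<le> 8 * C * (real k)\<^sup>2" by (simp add: g_def power2_eq_square algebra_simps)
      hence "\<rho>\<^sup>2 * \<delta>\<^sup>2 * real n \<le> 8 * C" using k1 by simp
      thus False using N(5) by linarith
    qed
    then obtain a b where ab: "a \<in> S" "b \<in> T" "w {a, b} \<le> 2 * g / real n" "{a, b} \<notin> R" by auto
    have "{a, b} \<in> E - R" using ab S T True by (auto simp: complete_edges_doubleton)
    from reach_join[OF S(2) T(2) ab(1,2) this ab(3)] show ?thesis unfolding tot .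
  qed
qed

text \<open>At each of u and v fewer than n/4 neighbours have unsuitable weight, and at most 16n/100
  are lost to used edges heavier than 1/16, whose total weight away from s and t is at most n/100.
  Twice 41n/100 plus the four special vertices is less than n, so a common neighbour
  remains.\<close>

lemma bridge:
  assumes deg: "deg_ok n w" and mid: "(\<Sum>e\<in>{e\<in>R. s \<notin> e \<and> t \<notin> e}. w e) \<le> real n / 100" and n: "40 \<le> n"
    and uv: "u < n" "v < n" "u \<noteq> s" "u \<noteq> t" "v \<noteq> s" "v \<noteq> t"
  shows "\<exists>x. {u, x} \<in> E - R \<and> {x, v} \<in> E - R \<and> w {u, x} \<le> 3 \<and> w {x, v} \<le> 3 \<and> x \<noteq> s \<and> x \<noteq> t \<and> x \<noteq> u \<and> x \<noteq> v"
proof -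
  define bad where "bad u = {x\<in>{..<n} - {u}. \<not> (1 / 16 < w {u, x} \<and> w {u, x} \<le> 3)} \<union> {x\<in>{..<n} - {s, t}. {u, x} \<in> R \<and> 1 / 16 < w {u, x}}" for u
  have bad: "finite (bad u)" "real (card (bad u)) < 41 / 100 * real n" if u: "u < n" "u \<noteq> s" "u \<noteq> t" for u
  proof -
    let ?A = "{x\<in>{..<n} - {u}. \<not> (1 / 16 < w {u, x} \<and> w {u, x} \<le> 3)}" and ?B = "{x\<in>{..<n} - {s, t}. {u, x} \<in> R \<and> 1 / 16 < w {u, x}}"
    show "finite (bad u)" by (simp add: bad_def)
    have "real (card ?B) / 16 = (\<Sum>x\<in>?B. 1 / 16)" by simp
    also have "... \<le> (\<Sum>x\<in>?B. w {u, x})" by (intro sum_mono) auto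
    also have "... = (\<Sum>e\<in>(\<lambda>x. {u, x}) ` ?B. w e)" by (subst sum.reindex) (auto simp: inj_on_def doubleton_eq_iff)
    also have "... \<le> (\<Sum>e\<in>{e\<in>R. s \<notin> e \<and> t \<notin> e}. w e)" using u used_sub nonneg by (intro sum_mono2) auto
    finally have "real (card ?B) \<le> 16 * (real n / 100)" using mid by linarith
    moreover have "real (card ?A) < real n / 4" using deg u unfolding deg_ok_def by blast
    moreover have "card (bad u) \<le> card ?A + card ?B" unfolding bad_def by (rule card_Un_le)
    ultimately show "real (card (bad u)) < 41 / 100 * real n" by linarith
  qed
  have "card (bad u \<union> bad v \<union> {s, t, u, v}) \<le> card (bad u) + card (bad v) + card {s, t, u, v}"
    using card_Un_le[of "bad u \<union> bad v" "{s, t, u, v}"] card_Un_le[of "bad u" "bad v"] by linarith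
  moreover have "card {s, t, u, v} \<le> 4" using card_insert_le_m1[of 4 "{t,u,v}" s] by (simp add: card_insert_if)
  ultimately have "real (card (bad u \<union> bad v \<union> {s, t, u, v})) \<le> real (card (bad u)) + real (card (bad v)) + 4" by linarith
  also have "... < real n" using bad(2)[of u] bad(2)[of v] uv n by linarith
  finally have "card (bad u \<union> bad v \<union> {s, t, u, v}) < card {..<n}" by simp
  moreover have "finite (bad u \<union> bad v \<union> {s, t, u, v})" using bad(1) uv by auto
  ultimately obtain x where x: "x < n" "x \<notin> bad u" "x \<notin> bad v" "x \<notin> {s, t, u, v}"
    by (metis UnCI card_mono lessThan_iff not_le subsetI)
  have c: "{x, v} = {v, x}" by auto
  show ?thesis
  proof (intro exI[of _ x] conjI)
    show "{u, x} \<in> E - R" "w {u, x} \<le> 3" using x uv by (auto simp: bad_def complete_edges_doubleton)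
    show "{x, v} \<in> E - R" "w {x, v} \<le> 3" unfolding c using x uv by (auto simp: bad_def complete_edges_doubleton)
  qed (use x in auto)
qed

lemma bridge_walk:
  assumes deg: "deg_ok n w" and mid: "(\<Sum>e\<in>{e\<in>R. s \<notin> e \<and> t \<notin> e}. w e) \<le> real n / 100" and n: "40 \<le> n"
    and u: "{s, u} \<in> E - R" and v: "{t, v} \<in> E - R"
  shows "\<exists>c\<le>w {s, u} + w {t, v} + 6. walk (E - R) w s t c"
proof -
  have pos: "0 \<le> w {s, u}" "0 \<le> w {t, v}" using u v nonneg by auto
  show ?thesis
  proof (cases "u = t \<or> v = s")
    case True
    hence "{s, t} \<in> E - R" "w {s, t} \<le> w {s, u} + w {t, v}" using u v pos by (auto simp: insert_commute)
    thus ?thesis using walk_edge[of s t "E - R" w] by (intro exI[of _ "w {s, t}"]) auto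
  next
    case False
    have "u < n" "v < n" "u \<noteq> s" "v \<noteq> t" using u v by (auto simp: complete_edges_doubleton)
    then obtain x where x: "{u, x} \<in> E - R" "{x, v} \<in> E - R" "w {u, x} \<le> 3" "w {x, v} \<le> 3"
      using bridge[OF deg mid n, of u v] False by blast
    have "walk (E - R) w s v (w {s, u} + w {u, x} + w {x, v})" by (intro walk_step walk_edge u x)
    moreover have "{v, t} \<in> E - R" using v by (simp add: insert_commute)
    ultimately have "walk (E - R) w s t (w {s, u} + w {u, x} + w {x, v} + w {v, t})" by (rule walk_step)
    moreover have "w {v, t} = w {t, v}" by (simp add: insert_commute)
    ultimately show ?thesis using x by (intro exI[of _ "w {s, u} + w {u, x} + w {x, v} + w {v, t}"]) auto
  qed
qed

lemma direct_unique: "i \<in> {1..<k} \<Longrightarrow> j \<in> {1..<k} \<Longrightarrow> P i = [s, t] \<Longrightarrow> P j = [s, t] \<Longrightarrow> i = j"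
  using path_disjoint[of i j] by (auto simp: path_edges_Cons)

lemma star_sum_lower:
  assumes x: "\<And>i. i \<in> {1..k - 1} \<Longrightarrow> card {v\<in>{..<n} - {x}. w {x, v} < lo i} < i"
    and f: "inj_on f {1..<k}" "\<And>i. i \<in> {1..<k} \<Longrightarrow> {x, f i} \<in> E"
  shows "(\<Sum>i=1..k - 1. lo i) \<le> (\<Sum>i\<in>{1..<k}. w {x, f i})"
proof -
  have "(\<Sum>i=1..k - 1. lo i) \<le> (\<Sum>v\<in>f ` {1..<k}. w {x, v})"
  proof (rule sum_rank_lower)
    fix i assume i: "i \<in> {1..k - 1}"
    have "card {v\<in>f ` {1..<k}. w {x, v} < lo i} \<le> card {v\<in>{..<n} - {x}. w {x, v} < lo i}"
    proof (intro card_mono subsetI)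
      fix v assume v: "v \<in> {v\<in>f ` {1..<k}. w {x, v} < lo i}"
      then obtain j where "v = f j" "j \<in> {1..<k}" by blast
      hence "{x, v} \<in> E" using f(2) by blast
      thus "v \<in> {v\<in>{..<n} - {x}. w {x, v} < lo i}" using v by (auto simp: complete_edges_doubleton)
    qed simp
    thus "card {v\<in>f ` {1..<k}. w {x, v} < lo i} < i" using x[OF i] by linarith
  qed (use f in \<open>auto simp: card_image\<close>)
  also have "... = (\<Sum>i\<in>{1..<k}. w {x, f i})" by (rule sum.reindex_cong[OF f(1)]) auto
  finally show ?thesis .
qed

lemma mid_used: "(\<Sum>e\<in>{e\<in>R. s \<notin> e \<and> t \<notin> e}. w e) = (\<Sum>i\<in>{1..<k}. mid_cost w s t (P i))"
proof -
  let ?p = "\<lambda>i. {e\<in>path_edges (P i). s \<notin> e \<and> t \<notin> e}"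
  have e: "{e\<in>R. s \<notin> e \<and> t \<notin> e} = (\<Union>i\<in>{1..<k}. ?p i)" unfolding used_def by blast
  show ?thesis unfolding e mid_cost_def
  proof (rule sum.UNION_disjoint)
    show "\<forall>i\<in>{1..<k}. \<forall>j\<in>{1..<k}. i \<noteq> j \<longrightarrow> ?p i \<inter> ?p j = {}" using path_disjoint by blast
  qed simp_all
qed

text \<open>The first edges of the paths are distinct edges at s, so their total is at least that of
  the k - 1 lightest ones; likewise at t. The extra term repairs the path \<open>[s, t]\<close>,
  whose edge is counted at both ends.\<close>

lemma mid_sum:
  assumes s': "\<And>i. i \<in> {1..k - 1} \<Longrightarrow> card {v\<in>{..<n} - {s}. w {s, v} < lo i} < i"
    and t': "\<And>i. i \<in> {1..k - 1} \<Longrightarrow> card {v\<in>{..<n} - {t}. w {t, v} < lo i} < i"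
  shows "(\<Sum>i\<in>{1..<k}. mid_cost w s t (P i)) + 2 * (\<Sum>i=1..k - 1. lo i) \<le> (\<Sum>i\<in>{1..<k}. path_cost w (P i)) + (if [s, t] \<in> P ` {1..<k} then w {s, t} else 0)"
proof -
  let ?I = "{1..<k}"
  have E: "{s, first_v (P i)} \<in> E" "{t, last_v (P i)} \<in> E" if "i \<in> ?I" for i
    using st_path_edge_first[OF path(1)[OF that] neq] st_path_edge_last[OF path(1)[OF that] neq] path_sub[OF that] by auto
  have st0: "0 \<le> w {s, t}" using s t neq nonneg by (auto simp: complete_edges_doubleton)
  have dec: "mid_cost w s t (P i) + w {s, first_v (P i)} + w {t, last_v (P i)} = path_cost w (P i) + (if P i = [s, t] then w {s, t} else 0)"
    if "i \<in> ?I" for i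
  proof (cases "P i = [s, t]")
    case True
    have "mid_cost w s t [s, t] = 0" by (auto simp: mid_cost_def path_edges_Cons intro!: sum.neutral)
    thus ?thesis using True by (simp add: path_cost_def path_edges_Cons first_v_def last_v_def insert_commute)
  next
    case False thus ?thesis using path_cost_decomp[OF path(1)[OF that] neq, of w] by simp
  qed
  have "(\<Sum>i\<in>?I. mid_cost w s t (P i)) + (\<Sum>i\<in>?I. w {s, first_v (P i)}) + (\<Sum>i\<in>?I. w {t, last_v (P i)}) =
    (\<Sum>i\<in>?I. path_cost w (P i)) + (\<Sum>i\<in>?I. if P i = [s, t] then w {s, t} else 0)"
    unfolding sum.distrib[symmetric] by (intro sum.cong refl dec)
  moreover have "(\<Sum>i\<in>?I. if P i = [s, t] then w {s, t} else 0) \<le> (if [s, t] \<in> P ` ?I then w {s, t} else 0)"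
  proof (cases "[s, t] \<in> P ` ?I")
    case False
    hence "(\<Sum>i\<in>?I. if P i = [s, t] then w {s, t} else 0) = 0"
      by (intro sum.neutral ballI) (metis image_eqI)
    thus ?thesis using False by simp
  next
    case True
    have "card {i\<in>?I. P i = [s, t]} \<le> 1" using direct_unique by (auto simp: card_le_Suc0_iff_eq)
    hence "real (card {i\<in>?I. P i = [s, t]}) * w {s, t} \<le> 1 * w {s, t}" using st0 by (intro mult_right_mono) auto
    moreover have "(\<Sum>i\<in>?I. if P i = [s, t] then w {s, t} else 0) = real (card {i\<in>?I. P i = [s, t]}) * w {s, t}"
      by (simp add: sum.If_cases Int_def)
    ultimately show ?thesis using True by simp
  qed
  moreover have "(\<Sum>i=1..k - 1. lo i) \<le> (\<Sum>i\<in>?I. w {s, first_v (P i)})" by (rule star_sum_lower[OF s' first_inj E(1)])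
  moreover have "(\<Sum>i=1..k - 1. lo i) \<le> (\<Sum>i\<in>?I. w {t, last_v (P i)})" by (rule star_sum_lower[OF t' last_inj E(2)])
  ultimately show ?thesis by linarith
qed

end

text \<open>Summation by parts. Although \<open>hsum n m\<close> grows logarithmically as m
  approaches n, the sum stays at most m; this is what makes the total weight of middle parts a small
  fraction of n.\<close>

lemma sum_hsum_le: "m < n \<Longrightarrow> (\<Sum>k=1..m. hsum n k) = real m - (real n - real m - 1) * hsum n m"
proof (induction m)
  case (Suc m)
  define x where "x = real n - real m - 1"
  have "x > 0" using Suc.prems unfolding x_def by linarith
  have h: "hsum n (Suc m) = hsum n m + 1 / x"
  proof -
    have "real n - real (Suc m) = x" by (simp add: x_def)
    thus ?thesis by (simp only: hsum_Suc)
  qed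
  have "(\<Sum>k=1..Suc m. hsum n k) = real m - x * hsum n m + (hsum n m + 1 / x)" using Suc by (simp add: h x_def)
  also have "... = real m + 1 - (x - 1) * (hsum n m + 1 / x)" using \<open>x > 0\<close> by (simp add: field_simps)
  finally show ?case unfolding h by (simp add: x_def algebra_simps)
qed simp

section \<open>The upper bound\<close>

definition typical :: "nat \<Rightarrow> nat \<Rightarrow> real" where
  "typical n k = 2 * hsum n k + ln (real n) / real n"

lemma hsum_le: "k < n \<Longrightarrow> hsum n k \<le> real k / (real n - real k)"
  using hsum_diff_le[of 0 k n] by simp

lemma hsum_le_ln:
  assumes "k < n" shows "hsum n k \<le> ln (real n) - ln (real n - real k) + 1 / (real n - real k)"
proof -
  \<comment> \<open>The correction -1/n makes both sides vanish at k = 0, so the induction starts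
    with equality.\<close>
  have "hsum n k \<le> ln (real n) - ln (real n - real k) + 1 / (real n - real k) - 1 / real n" using assms
  proof (induction k)
    case (Suc k)
    define x where "x = real n - real (Suc k)"
    have x: "0 < x" "real n - real k = x + 1" using Suc.prems unfolding x_def by linarith+
    have "ln (x / (x + 1)) \<le> x / (x + 1) - 1" using x by (intro ln_le_minus_one) simp
    also have "x / (x + 1) - 1 = - (1 / (x + 1))" using x by (simp add: field_simps)
    finally have "1 / (x + 1) \<le> ln (x + 1) - ln x" using x by (simp add: ln_div)
    moreover have "hsum n (Suc k) = hsum n k + 1 / x" unfolding hsum_Suc x_def ..
    moreover have "hsum n k \<le> ln (real n) - ln (x + 1) + 1 / (x + 1) - 1 / real n" using Suc x by simp
    ultimately show ?case unfolding x_def[symmetric] by linarith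
  qed simp
  moreover have "0 \<le> 1 / real n" by simp
  ultimately show ?thesis by linarith
qed

lemma typical_mono: "j \<le> k \<Longrightarrow> k < n \<Longrightarrow> typical n j \<le> typical n k"
  unfolding typical_def using hsum_mono by simp

lemma star_ok_hi: "star_ok \<epsilon> n x w \<Longrightarrow> 1 \<le> k \<Longrightarrow> k < n \<Longrightarrow> k \<le> card {v\<in>{..<n} - {x}. w {x, v} \<le> star_hi n \<epsilon> k}"
  unfolding star_ok_def by auto

lemma nat_ceiling_bounds: "0 \<le> x \<Longrightarrow> x \<le> real (nat \<lceil>x\<rceil>) \<and> real (nat \<lceil>x\<rceil>) \<le> x + 1"
  by (simp add: real_nat_ceiling_ge)

context greedy
begin

lemma star_side:
  assumes x: "x = s \<or> x = t" and ok: "star_ok \<epsilon> n x w" and m: "1 \<le> m" "k - 1 + m < n"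
  shows "\<exists>U. U \<subseteq> {..<n} - {x} \<and> card U = m \<and> (\<forall>v\<in>U. {x, v} \<in> E - R \<and> w {x, v} \<le> star_hi n \<epsilon> (k - 1 + m)) \<and>
    reach (E - R) w x U (star_hi n \<epsilon> (k - 1 + m))"
proof -
  have "k - 1 + m \<le> card {v\<in>{..<n} - {x}. w {x, v} \<le> star_hi n \<epsilon> (k - 1 + m)}"
    using m by (intro star_ok_hi[OF ok]) auto
  from unused_star[OF x this] obtain U where U: "U \<subseteq> {..<n} - {x}" "k - 1 + m \<le> card U + (k - 1)"
    "\<forall>v\<in>U. {x, v} \<in> E - R \<and> w {x, v} \<le> star_hi n \<epsilon> (k - 1 + m)" "reach (E - R) w x U (star_hi n \<epsilon> (k - 1 + m))" by blast
  hence "m \<le> card U" by simp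
  then obtain U' where "U' \<subseteq> U" "card U' = m" by (metis obtain_subset_with_card_n)
  thus ?thesis using U reach_mono[OF U(4), of U'] by (intro exI[of _ U']) auto
qed

text \<open>With q = K/n the typical value is at most 4q, so earlier paths cost at most 8K/n. Hence
  at most 8K/e used edges are heavier than eK/n, and at most 8K^2/\<tau> are heavier than \<tau>/n,
  with end points fitting into \<open>blocked (16 / \<tau>) K\<close>. The growth phase costs about
  \<tau>/(n ln \<gamma>) times ln n, that is (1 + O(e)) ln n / n, and all else is O(e q).\<close>

lemma small_upper:
  assumes \<epsilon>: "0 < e" "32 * e \<le> 1" and \<tau>: "0 < \<tau>" "\<tau> \<le> 1" and \<gamma>: "1 < \<gamma>" "\<tau> \<le> (1 + e) * ln \<gamma>"
    and ok: "star_ok e n s w" "star_ok e n t w" "small_event e e (16 / \<tau>) \<tau> \<gamma> n k w"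
    and K: "K = real k + ln (real n)" "1 \<le> K" "64 * (1 + 8 / e) \<le> e\<^sup>2 * K" "4096 * (2 + 8 / e + 16 / \<tau>) \<le> e ^ 3 * K"
    and n: "16 / \<tau> * K\<^sup>2 + 1 \<le> real n" "100 * K \<le> real n" "3 \<le> e * ln (real n)" "2 \<le> n"
    and cost: "\<And>i. i \<in> {1..<k} \<Longrightarrow> path_cost w (P i) \<le> (1 + 32 * e) * typical n i"
  shows "\<exists>c\<le>(1 + 32 * e) * typical n k. walk (E - R) w s t c"
proof -
  define h where "h = hsum n k"
  define l where "l = ln (real n) / real n"
  define q where "q = K / real n"
  define T where "T = 2 * h + l"
  have T: "typical n k = T" by (simp add: T_def typical_def h_def l_def)
  have L: "0 < ln (real n)" using n(4) by simp
  have l0: "0 \<le> l" using L by (simp add: l_def)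
  have kK: "real k \<le> K" using K L by simp
  have kn: "100 * real k \<le> real n" using kK n by linarith
  hence kn': "k < n" using n_pos by simp
  have q: "q = real k / real n + l" by (simp add: q_def K l_def add_divide_distrib)
  have hk: "real k / real n \<le> h" unfolding h_def by (rule hsum_ge[OF kn'])
  have h0: "0 \<le> h" unfolding h_def using kn' by (intro hsum_nonneg) simp
  have qT: "q \<le> T" using q hk h0 by (simp add: T_def)
  have q0: "0 \<le> q" using K n_pos by (simp add: q_def)
  have hq: "h \<le> 2 * (real k / real n)"
  proof -
    have "h \<le> real k / (real n - real k)" unfolding h_def by (rule hsum_le[OF kn'])
    also have "... \<le> real k / (real n / 2)" using kn n_pos by (intro divide_left_mono) auto
    finally show ?thesis by (simp add: mult.commute)
  qed
  have T4: "T \<le> 4 * q" using hq l0 by (simp add: T_def q)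
  define m1 where "m1 = level1 e K"
  have eK: "0 < e * K" using K \<epsilon> by simp
  have m1': "e * K \<le> real m1" "real m1 \<le> e * K + 1"
    using nat_ceiling_bounds[of "e * K"] eK by (auto simp: m1_def level1_def)
  hence "0 < real m1" using eK by linarith
  with m1' have m1: "e * K \<le> real m1" "real m1 \<le> e * K + 1" "1 \<le> m1" by simp_all
  define k' where "k' = k - 1 + m1"
  have k': "real k' \<le> real k + e * K" using m1 k1 by (simp add: k'_def of_nat_diff)
  have eK': "e * K \<le> K" using \<epsilon> K by simp
  have k'n: "50 * real k' \<le> real n" using k' eK' kK n by linarith
  hence k'n': "k' < n" using n_pos by simp
  have kk': "k \<le> k'" using k1 m1 by (simp add: k'_def)
  have hk': "hsum n k' \<le> h + 2 * e * q"
  proof -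
    have "hsum n k' - h \<le> (real k' - real k) / (real n - real k')" unfolding h_def by (rule hsum_diff_le[OF kk' k'n'])
    also have "... \<le> (e * K) / (real n / 2)" using k' k'n kk' eK n_pos by (intro frac_le) auto
    finally show ?thesis by (simp add: q_def mult.commute mult.left_commute)
  qed
  define y where "y = star_hi n e k'"
  have y: "y \<le> h + e * h + 4 * e * q + e * l"
  proof -
    have "(1 + e) * hsum n k' \<le> (1 + e) * (h + 2 * e * q)" using hk' \<epsilon> by (intro mult_left_mono) auto
    also have "... = h + e * h + 2 * e * q + e * (2 * e * q)" by (simp add: algebra_simps)
    also have "e * (2 * e * q) \<le> 1 * (2 * e * q)" using \<epsilon> q0 by (intro mult_right_mono) auto
    finally show ?thesis by (simp add: y_def star_hi_def l_def)
  qed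
  have eh: "2 * (e * h) \<le> e * T" "e * q \<le> e * T" "e * l \<le> e * T" "0 \<le> e * q"
  proof -
    have b: "2 * h \<le> T" "l \<le> T" using h0 l0 by (auto simp: T_def)
    show "2 * (e * h) \<le> e * T" "e * q \<le> e * T" "e * l \<le> e * T" "0 \<le> e * q"
      using mult_left_mono[OF b(1), of e] mult_left_mono[OF qT, of e] mult_left_mono[OF b(2), of e] \<epsilon> q0 by auto
  qed
  have e32: "32 * (e * q) \<le> q" using mult_right_mono[OF \<epsilon>(2) q0] by simp
  have e4: "e * T \<le> 4 * (e * q)" using mult_left_mono[OF T4, of e] \<epsilon> by simp
  have y4: "y \<le> 4 * K / real n"
  proof -
    have "y \<le> T + (e * T + 4 * (e * q) + e * T)" using y eh h0 l0 by (simp add: T_def mult.assoc)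
    hence "y \<le> 4 * q" using e4 e32 hq q l0 y eh q0 by (simp add: T_def)
    thus ?thesis by (simp add: q_def)
  qed
  have y2: "2 * y \<le> 2 * h + 11 * (e * T)" using y eh by (simp add: algebra_simps)
  have side: "\<exists>U. U \<subseteq> {..<n} - {x} \<and> card U = m1 \<and> (\<forall>v\<in>U. w {x, v} \<le> 4 * K / real n) \<and> reach (E - R) w x U y"
    if xx: "x = s \<or> x = t" "star_ok e n x w" for x
  proof -
    obtain U where "U \<subseteq> {..<n} - {x}" "card U = m1" "\<forall>v\<in>U. {x, v} \<in> E - R \<and> w {x, v} \<le> y" "reach (E - R) w x U y"
      using star_side[OF xx m1(3)] k'n' unfolding y_def k'_def by blast
    thus ?thesis using y4 by (intro exI[of _ U]) force
  qed
  obtain U where U: "U \<subseteq> {..<n} - {s}" "card U = m1" "\<forall>v\<in>U. w {s, v} \<le> 4 * K / real n" "reach (E - R) w s U y"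
    using side[of s] ok by blast
  obtain V where V: "V \<subseteq> {..<n} - {t}" "card V = m1" "\<forall>v\<in>V. w {t, v} \<le> 4 * K / real n" "reach (E - R) w t V y"
    using side[of t] ok by blast
  define m2 where "m2 = level2 e e K"
  define m3 where "m3 = level3 e e K"
  define f where "f = blocked (16 / \<tau>) K"
  have m2: "e\<^sup>2 * K\<^sup>2 / 64 \<le> real m2" "real m2 \<le> e\<^sup>2 * K\<^sup>2 / 64 + 1"
    using nat_ceiling_bounds[of "e\<^sup>2 * K\<^sup>2 / 64"] by (auto simp: m2_def level2_def power2_eq_square)
  have m3: "real m3 \<le> e ^ 3 * K ^ 3 / 4096 + 1"
    using nat_ceiling_bounds[of "e ^ 3 * K ^ 3 / 4096"] \<epsilon> K by (auto simp: m3_def level3_def power2_eq_square power3_eq_cube mult.assoc)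
  have f: "16 / \<tau> * K\<^sup>2 \<le> real f" "real f \<le> 16 / \<tau> * K\<^sup>2 + 1"
    using nat_ceiling_bounds[of "16 / \<tau> * K\<^sup>2"] \<tau> by (auto simp: f_def blocked_def)
  have KK: "1 \<le> K\<^sup>2" "K \<le> K\<^sup>2" using one_le_power[OF K(2), of 2] mult_left_mono[OF K(2), of K] K(2) by (simp_all add: power2_eq_square)
  have ls: "local_spread n (4 * K) (e * K) 1 m1 w" "local_spread n (4 * K) (e * K) m1 m2 w" "grow_all n (4 * K) (e * K) \<tau> m2 m3 f (steps \<gamma> n) w"
    using ok(3) unfolding small_event_def Let_def K(1)[symmetric] m1_def m2_def m3_def f_def by blast+
  have "\<exists>c\<le>2 * y + (12 * (e * K) + real (steps \<gamma> n) * \<tau>) / real n. walk (E - R) w s t c"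
  proof (rule small_step[OF U V _ _ \<tau>(1) ls, where C = "8 * K" and D = "8 * K / e"])
    show "0 < e * K" by (rule eK)
    show "2 * (e * K) \<le> 4 * K" using eK' K by linarith
    show "0 \<le> 8 * K" using K by simp
    have k8: "real k * (8 * K) \<le> K * (8 * K)" using kK K(2) by (intro mult_right_mono) auto
    thus "real k * (8 * K) \<le> 8 * K / e * (e * K)" using \<epsilon> by (simp add: mult_ac)
    show "path_cost w (P i) \<le> 8 * K / real n" if i: "i \<in> {1..<k}" for i
    proof -
      have "path_cost w (P i) \<le> (1 + 32 * e) * typical n i" by (rule cost[OF i])
      also have "... \<le> 2 * T" unfolding T[symmetric]
        using typical_mono[of i k n] i kn' \<epsilon> hsum_nonneg[of i n] L by (intro mult_mono) (auto simp: typical_def)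
      also have "... \<le> 8 * q" using T4 by simp
      finally show ?thesis by (simp add: q_def)
    qed
    have "2 * real k * (8 * K) \<le> 16 * K\<^sup>2" using k8 by (simp add: power2_eq_square)
    also have "... \<le> real f * \<tau>" using mult_right_mono[OF f(1), of \<tau>] \<tau> by simp
    finally show "2 * real k * (8 * K) \<le> real f * \<tau>" .
    have "real f \<le> real n" using f n by linarith
    thus "f \<le> n" by simp
    have "64 * (1 + 8 / e) * K \<le> e\<^sup>2 * K * K" using K by (intro mult_right_mono) auto
    hence a: "64 * K + 64 * (8 * K / e) \<le> e\<^sup>2 * K\<^sup>2" by (simp add: power2_eq_square algebra_simps)
    have "e * K * (e * K) \<le> e * K * real m1" using m1 eK by (intro mult_left_mono) auto
    hence "e\<^sup>2 * K\<^sup>2 \<le> e * K * real m1" by (simp add: power2_eq_square mult_ac)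
    thus "real m2 + 8 * K / e \<le> e * K * real m1 / 32" using m2(2) a K(2) by linarith
    have "4096 * (2 + 8 / e + 16 / \<tau>) * K\<^sup>2 \<le> e ^ 3 * K * K\<^sup>2" using K by (intro mult_right_mono) auto
    hence b: "8192 * K\<^sup>2 + 4096 * (8 * K\<^sup>2 / e) + 4096 * (16 / \<tau> * K\<^sup>2) \<le> e ^ 3 * K ^ 3"
      by (simp add: power2_eq_square power3_eq_cube algebra_simps)
    have "8 * K / e \<le> 8 * K\<^sup>2 / e" using KK \<epsilon> by (intro divide_right_mono) auto
    moreover have "e * K * (e\<^sup>2 * K\<^sup>2 / 64) \<le> e * K * real m2" using m2 eK by (intro mult_left_mono) auto
    hence "e ^ 3 * K ^ 3 / 64 \<le> e * K * real m2" by (simp add: power2_eq_square power3_eq_cube mult_ac)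
    ultimately show "real m3 + 8 * K / e + real f \<le> e * K * real m2 / 32" using m3 f(2) b KK(1) by linarith
  qed
  then obtain c where c: "c \<le> 2 * y + (12 * (e * K) + real (steps \<gamma> n) * \<tau>) / real n" "walk (E - R) w s t c" by blast
  have "real (steps \<gamma> n) * \<tau> \<le> (1 + 2 * e) * ln (real n)"
  proof -
    have "real (steps \<gamma> n) * \<tau> \<le> (ln (real n) / ln \<gamma> + 3) * \<tau>" using steps_bound[OF n(4) \<gamma>(1)] \<tau> by (intro mult_right_mono) auto
    also have "... = \<tau> / ln \<gamma> * ln (real n) + 3 * \<tau>" by (simp add: algebra_simps)
    also have "\<tau> / ln \<gamma> * ln (real n) \<le> (1 + e) * ln (real n)" using \<gamma> L by (intro mult_right_mono) (auto simp: field_simps)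
    finally show ?thesis using \<tau> n(3) by (simp add: algebra_simps)
  qed
  hence "(12 * (e * K) + real (steps \<gamma> n) * \<tau>) / real n \<le> (12 * (e * K) + (1 + 2 * e) * ln (real n)) / real n"
    by (intro divide_right_mono) auto
  also have "... = 12 * (e * q) + l + 2 * (e * l)" by (simp add: q_def l_def add_divide_distrib distrib_right)
  finally have "c \<le> 2 * h + l + 25 * (e * T)" using c(1) y2 eh by linarith
  also have "... \<le> (1 + 32 * e) * T" using eh(4,2) by (simp add: T_def distrib_right)
  finally show ?thesis using c(2) unfolding T by blast
qed

text \<open>Here ln n \<le> k, so a connection of cost O(e k/n) is negligible.
  \<open>\<zeta>\<close> is chosen so that the rank shift costs at most e k/n, using n - k' \<ge>
  \<eta> n/2; \<open>C\<close> comes from h_k \<le> k/(\<eta> n). The condition on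
  \<open>\<rho>\<close> ensures that either k is small enough for expansion past the used edges, or
  \<zeta> k neighbours already number at least \<rho> n.\<close>

lemma large_upper:
  assumes e: "0 < e" "32 * e \<le> 1" and \<eta>: "0 < \<eta>" "\<eta> \<le> 1" and \<zeta>: "\<zeta> = e * \<eta> / 2" and C: "C = 4 / \<eta> + 2" and \<rho>: "\<rho> \<le> 1 / 128" "128 * C * \<rho> \<le> \<zeta> * e"
    and ok: "star_ok e n s w" "star_ok e n t w" "spread n (e * real k) w" "spread n \<mu> w" "joined n \<rho> (e * real k) w"
    and k: "ln (real n) \<le> real k" "real k \<le> (1 - \<eta>) * real n"
    and N: "64 \<le> \<mu>" "\<mu> \<le> real n" "64 * C \<le> \<zeta> * e\<^sup>2 * real k" "4096 * C \<le> \<zeta> * e * \<mu>" "real n \<le> (\<mu> / 64) ^ J" "64 \<le> \<zeta> * e * (real k)\<^sup>2" "8 * C < \<rho>\<^sup>2 * e\<^sup>2 * real n"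
      "4 * real J * \<mu> \<le> e * real k" "2 \<le> n"
    and cost: "\<And>i. i \<in> {1..<k} \<Longrightarrow> path_cost w (P i) \<le> (1 + 32 * e) * typical n i"
  shows "\<exists>c\<le>(1 + 32 * e) * typical n k. walk (E - R) w s t c"
proof -
  define h where "h = hsum n k"
  define l where "l = ln (real n) / real n"
  define q where "q = real k / real n"
  define T where "T = 2 * h + l"
  have T: "typical n k = T" by (simp add: T_def typical_def h_def l_def)
  have L: "0 < ln (real n)" using N(9) by simp
  have l0: "0 \<le> l" using L by (simp add: l_def)
  have lq: "l \<le> q" unfolding l_def q_def using k by (intro divide_right_mono) auto
  have nk: "\<eta> * real n \<le> real n - real k" using k by (simp add: algebra_simps)
  have \<eta>n: "0 < \<eta> * real n" using \<eta> n_pos by simp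
  hence "real k < real n" using nk by linarith
  hence kn': "k < n" by simp
  have hk: "q \<le> h" unfolding h_def q_def by (rule hsum_ge[OF kn'])
  have q0: "0 < q" using k1 n_pos by (simp add: q_def)
  have hq: "h \<le> q / \<eta>"
  proof -
    have "h \<le> real k / (real n - real k)" unfolding h_def by (rule hsum_le[OF kn'])
    also have "... \<le> real k / (\<eta> * real n)" using nk \<eta>n by (intro divide_left_mono) auto
    finally show ?thesis by (simp add: q_def mult.commute)
  qed
  have T2: "2 * T \<le> C * q" using hq lq by (simp add: T_def C distrib_right)
  have \<zeta>0: "0 < \<zeta>" "\<zeta> \<le> \<eta> / 2" using e \<eta> by (auto simp: \<zeta>)
  define m1 where "m1 = nat \<lceil>\<zeta> * real k\<rceil>"
  have "0 < \<zeta> * real k" using \<zeta>0 k1 by simp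
  moreover from this have "\<zeta> * real k \<le> real m1" "real m1 \<le> \<zeta> * real k + 1"
    using nat_ceiling_bounds[of "\<zeta> * real k"] by (auto simp: m1_def)
  moreover from calculation have "0 < real m1" by linarith
  ultimately have m1: "\<zeta> * real k \<le> real m1" "real m1 \<le> \<zeta> * real k + 1" "1 \<le> m1" by simp_all
  define k' where "k' = k - 1 + m1"
  have k': "real k' \<le> real k + \<zeta> * real k" using m1 k1 by (simp add: k'_def of_nat_diff)
  have "\<zeta> * real k \<le> \<eta> / 2 * real n" using \<zeta>0 kn' \<eta> by (intro mult_mono) auto
  hence nk': "\<eta> * real n / 2 \<le> real n - real k'" using k' nk by linarith
  hence "real k' < real n" using \<eta>n by linarith
  hence k'n': "k' < n" by simp
  have kk': "k \<le> k'" using k1 m1 by (simp add: k'_def)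
  have hk': "hsum n k' \<le> h + e * q"
  proof -
    have "hsum n k' - h \<le> (real k' - real k) / (real n - real k')" unfolding h_def by (rule hsum_diff_le[OF kk' k'n'])
    also have "... \<le> (\<zeta> * real k) / (\<eta> * real n / 2)" using k' nk' kk' \<eta>n \<zeta>0 by (intro frac_le) auto
    also have "... = e * q" using \<eta> by (simp add: \<zeta> q_def)
    finally show ?thesis by simp
  qed
  define y where "y = star_hi n e k'"
  have y: "y \<le> h + e * h + 2 * (e * q) + e * l"
  proof -
    have "(1 + e) * hsum n k' \<le> (1 + e) * (h + e * q)" using hk' e by (intro mult_left_mono) auto
    also have "... = h + e * h + e * q + e * (e * q)" by (simp add: algebra_simps)
    also have "e * (e * q) \<le> 1 * (e * q)" using e q0 by (intro mult_right_mono) auto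
    finally show ?thesis by (simp add: y_def star_hi_def l_def)
  qed
  have eh: "2 * (e * h) \<le> e * T" "2 * (e * q) \<le> e * T" "e * l \<le> e * T" "0 \<le> e * T"
  proof -
    have hl: "2 * h \<le> T" "2 * q \<le> T" "l \<le> T" "0 \<le> T" using hk q0 l0 by (auto simp: T_def)
    show "2 * (e * h) \<le> e * T" "2 * (e * q) \<le> e * T" "e * l \<le> e * T" "0 \<le> e * T"
      using mult_left_mono[OF hl(1), of e] mult_left_mono[OF hl(2), of e] mult_left_mono[OF hl(3), of e] mult_left_mono[OF hl(4), of e] e by auto
  qed
  have y2: "2 * y \<le> 2 * h + 5 * (e * T)" using y eh by linarith
  have side: "\<exists>U\<subseteq>{..<n}. \<zeta> * real k \<le> real (card U) \<and> reach (E - R) w x U y" if xx: "x = s \<or> x = t" "star_ok e n x w" for x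
  proof -
    obtain U where "U \<subseteq> {..<n} - {x}" "card U = m1" "reach (E - R) w x U y"
      using star_side[OF xx m1(3)] k'n' unfolding y_def k'_def by blast
    thus ?thesis using m1 by (intro exI[of _ U]) auto
  qed
  obtain U where U: "U \<subseteq> {..<n}" "\<zeta> * real k \<le> real (card U)" "reach (E - R) w s U y" using side[of s] ok by blast
  obtain V where V: "V \<subseteq> {..<n}" "\<zeta> * real k \<le> real (card V)" "reach (E - R) w t V y" using side[of t] ok by blast
  have C0: "0 < C" using \<eta> by (simp add: C add_pos_pos)
  have "\<exists>c\<le>2 * y + (6 * e * real k + 4 * real J * \<mu>) / real n. walk (E - R) w s t c"
  proof (rule large_step[OF ok(3,4,5) U V])
    show "path_cost w (P i) \<le> C * real k / real n" if i: "i \<in> {1..<k}" for i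
    proof -
      have "path_cost w (P i) \<le> (1 + 32 * e) * typical n i" by (rule cost[OF i])
      also have "... \<le> 2 * T" unfolding T[symmetric]
        using typical_mono[of i k n] i kn' e hsum_nonneg[of i n] L by (intro mult_mono) (auto simp: typical_def)
      also have "... \<le> C * q" by (rule T2)
      finally show ?thesis by (simp add: q_def)
    qed
    show "128 * C * real k \<le> e * real n \<or> \<rho> * real n \<le> \<zeta> * real k"
    proof (rule disjCI)
      assume "\<not> \<rho> * real n \<le> \<zeta> * real k"
      hence "128 * C * (\<zeta> * real k) \<le> 128 * C * (\<rho> * real n)" using C0 by (intro mult_left_mono) auto
      also have "... = 128 * C * \<rho> * real n" by simp
      also have "... \<le> \<zeta> * e * real n" using \<rho> by (intro mult_right_mono) auto
      finally have "\<zeta> * (128 * C * real k) \<le> \<zeta> * (e * real n)" by (simp add: mult_ac)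
      thus "128 * C * real k \<le> e * real n" using \<zeta>0 by simp
    qed
  qed (use N e \<zeta>0 C0 kn' \<rho> in auto)
  then obtain c where c: "c \<le> 2 * y + (6 * e * real k + 4 * real J * \<mu>) / real n" "walk (E - R) w s t c" by blast
  have "(6 * e * real k + 4 * real J * \<mu>) / real n \<le> (7 * e * real k) / real n" using N(8) by (intro divide_right_mono) auto
  also have "... = 7 * (e * q)" by (simp add: q_def)
  finally have "c \<le> 2 * h + 12 * (e * T)" using c(1) y2 eh by linarith
  also have "... \<le> (1 + 32 * e) * T" using eh(4) l0 by (simp add: T_def distrib_right)
  finally show ?thesis using c(2) unfolding T by blast
qed

text \<open>For a negative threshold, where \<open>star_ok\<close> is silent, nonnegativity of the
  weights makes the count 0.\<close>

lemma star_lo_count: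
  assumes x: "x < n" and ok: "star_ok e n x w" and i: "1 \<le> i" "i < n"
  shows "card {v\<in>{..<n} - {x}. w {x, v} < star_lo n e i} < i"
proof (cases "0 \<le> star_lo n e i")
  case True
  have "card {v\<in>{..<n} - {x}. w {x, v} < star_lo n e i} \<le> card {v\<in>{..<n} - {x}. w {x, v} \<le> star_lo n e i}"
    by (intro card_mono) auto
  thus ?thesis using ok i True unfolding star_ok_def by (auto simp: Suc_le_eq dest!: bspec[of _ _ i])
next
  case False
  have e0: "{v\<in>{..<n} - {x}. w {x, v} < star_lo n e i} = {}"
  proof (rule ccontr)
    assume "\<not> ?thesis"
    then obtain v where "v < n" "v \<noteq> x" "w {x, v} < star_lo n e i" by blast
    thus False using nonneg[of "{x, v}"] x False by (auto simp: complete_edges_doubleton)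
  qed
  show ?thesis unfolding e0 using i by simp
qed

text \<open>The path costs are bounded above by nearly typical values and the end edges below by
  their order statistics. The main terms 2 h_i cancel; what remains is (2e + 2d) times a sum bounded
  by n, plus terms of order ln n, so tolerances of 1/1000 leave room below n/100.\<close>

lemma mid_used_le:
  assumes e: "0 \<le> e" "e \<le> 1/1000" "0 \<le> d" "d \<le> 1/1000" and ok: "star_ok d n s w" "star_ok d n t w" and kn: "k < n"
    and cost: "\<And>i. i \<in> {1..<k} \<Longrightarrow> path_cost w (P i) \<le> (1 + e) * typical n i"
    and n: "1000 + 1000 * ln (real n) \<le> real n"
  shows "(\<Sum>e\<in>{e\<in>R. s \<notin> e \<and> t \<notin> e}. w e) \<le> real n / 100"
proof -
  define l where "l = ln (real n) / real n"
  have L: "0 \<le> ln (real n)" using n_pos by simp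
  have l: "0 \<le> l" "real n * l = ln (real n)" using L n_pos by (auto simp: l_def)
  have n1: "1 \<le> n - 1" "n - 1 < n" using kn k1 by auto
  \<comment> \<open>At rank n - 1 every edge at s is counted, in particular the one to t.\<close>
  have "w {s, t} \<le> star_hi n d (n - 1)"
  proof -
    have "n - 1 \<le> card {v\<in>{..<n} - {s}. w {s, v} \<le> star_hi n d (n - 1)}" by (rule star_ok_hi[OF ok(1) n1])
    hence "{v\<in>{..<n} - {s}. w {s, v} \<le> star_hi n d (n - 1)} = {..<n} - {s}" using s by (intro card_seteq) auto
    thus ?thesis using t neq by blast
  qed
  also have "... \<le> 2 * hsum n (n - 1) + l"
  proof -
    have "(1 + d) * hsum n (n - 1) \<le> 2 * hsum n (n - 1)" using e hsum_nonneg[of "n - 1" n] by (intro mult_right_mono) auto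
    moreover have "d * l \<le> 1 * l" using e l by (intro mult_right_mono) auto
    ultimately show ?thesis by (simp add: star_hi_def l_def)
  qed
  also have "... \<le> 2 * ln (real n) + 2 + l" using hsum_le_ln[OF n1(2)] n1 by (simp add: of_nat_diff)
  finally have wst: "w {s, t} \<le> 2 * ln (real n) + 2 + l" .
  have nl: "l \<le> ln (real n)"
  proof -
    have "1 * l \<le> real n * l" using l(1) n_pos by (intro mult_right_mono) auto
    thus ?thesis using l(2) by simp
  qed
  have st: "s < n" "t < n" by (rule s, rule t)
  have "(\<Sum>i\<in>{1..<k}. mid_cost w s t (P i)) + 2 * (\<Sum>i=1..k - 1. star_lo n d i) \<le> (\<Sum>i\<in>{1..<k}. path_cost w (P i)) + (if [s, t] \<in> P ` {1..<k} then w {s, t} else 0)"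
    by (rule mid_sum) (use star_lo_count[OF st(1) ok(1)] star_lo_count[OF st(2) ok(2)] kn in auto)
  also have "(\<Sum>i\<in>{1..<k}. path_cost w (P i)) \<le> (\<Sum>i\<in>{1..<k}. (1 + e) * typical n i)" by (intro sum_mono cost)
  also have "(if [s, t] \<in> P ` {1..<k} then w {s, t} else 0) \<le> w {s, t}" using s t neq nonneg by (auto simp: complete_edges_doubleton)
  also have "{1..<k} = {1..k - 1}" using k1 by auto
  finally have m: "(\<Sum>i\<in>{1..k - 1}. mid_cost w s t (P i)) \<le> (\<Sum>i=1..k - 1. (1 + e) * typical n i) - 2 * (\<Sum>i=1..k - 1. star_lo n d i) + w {s, t}"
    by linarith
  have "(\<Sum>i=1..k - 1. (1 + e) * typical n i) - 2 * (\<Sum>i=1..k - 1. star_lo n d i) = (\<Sum>i=1..k - 1. (2 * e + 2 * d) * hsum n i + (1 + e + 2 * d) * l)"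
    unfolding sum_distrib_left sum_subtractf[symmetric] by (intro sum.cong refl) (simp add: typical_def star_lo_def l_def algebra_simps add_divide_distrib)
  also have "... = (2 * e + 2 * d) * (\<Sum>i=1..k - 1. hsum n i) + real (k - 1) * ((1 + e + 2 * d) * l)"
    by (simp add: sum.distrib sum_distrib_left)
  also have "... \<le> (4 / 1000) * real n + real n * (2 * l)"
  proof (intro add_mono mult_mono)
    have k1n: "k - 1 < n" using kn by simp
    have p: "0 \<le> (real n - real (k - 1) - 1) * hsum n (k - 1)" using kn k1 hsum_nonneg[of "k - 1" n] by (intro mult_nonneg_nonneg) auto
    show "(\<Sum>i=1..k - 1. hsum n i) \<le> real n" unfolding sum_hsum_le[OF k1n] using p kn by simp
    show "0 \<le> (\<Sum>i=1..k - 1. hsum n i)" using kn by (intro sum_nonneg hsum_nonneg) auto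
  qed (use e kn l in auto)
  finally have "(\<Sum>i\<in>{1..k - 1}. mid_cost w s t (P i)) \<le> (4 / 1000) * real n + 2 * ln (real n) + w {s, t}" using m l(2) by simp
  also have "... \<le> real n / 100" using wst nl n L by linarith
  finally show ?thesis unfolding mid_used using \<open>{1..<k} = {1..k - 1}\<close> by simp
qed

text \<open>The two bridging edges cost at most 3 each, and this constant 6 is absorbed because h_k
  is at least 6/e so close to the last index.\<close>

lemma end_upper:
  assumes e: "0 < e" "e \<le> 1/1000" "d = e / 4" and ok: "star_ok d n s w" "star_ok d n t w" "deg_ok n w" and kn: "k < n"
    and \<eta>: "6 / e \<le> ln (real n / real (n - k))"
    and cost: "\<And>i. i \<in> {1..<k} \<Longrightarrow> path_cost w (P i) \<le> (1 + e) * typical n i"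
    and n: "1000 + 1000 * ln (real n) \<le> real n"
  shows "\<exists>c\<le>(1 + e) * typical n k. walk (E - R) w s t c"
proof -
  have L: "0 \<le> ln (real n)" using n_pos by simp
  have "40 \<le> real n" using n L by linarith
  hence n40: "40 \<le> n" by simp
  have mid: "(\<Sum>e\<in>{e\<in>R. s \<notin> e \<and> t \<notin> e}. w e) \<le> real n / 100"
    by (rule mid_used_le[OF _ _ _ _ ok(1,2) kn cost n]) (use e in auto)
  have ex: "\<exists>v. {x, v} \<in> E - R \<and> w {x, v} \<le> star_hi n d k" if xx: "x = s \<or> x = t" "star_ok d n x w" for x
  proof -
    obtain U where U: "card U = 1" "\<forall>v\<in>U. {x, v} \<in> E - R \<and> w {x, v} \<le> star_hi n d (k - 1 + 1)" using star_side[OF xx, of 1] kn k1 by auto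
    then obtain v where "v \<in> U" by (metis card.empty equals0I zero_neq_one)
    thus ?thesis using U(2) k1 by auto
  qed
  obtain u where u: "{s, u} \<in> E - R" "w {s, u} \<le> star_hi n d k" using ex[of s] ok by blast
  obtain v where v: "{t, v} \<in> E - R" "w {t, v} \<le> star_hi n d k" using ex[of t] ok by blast
  obtain c where c: "c \<le> w {s, u} + w {t, v} + 6" "walk (E - R) w s t c" using bridge_walk[OF ok(3) mid n40 u(1) v(1)] by blast
  define l where "l = ln (real n) / real n"
  define h where "h = hsum n k"
  have l0: "0 \<le> l" using L by (simp add: l_def)
  have T: "typical n k = 2 * h + l" by (simp add: typical_def h_def l_def)
  have "6 / e \<le> h" using \<eta> hsum_ge_ln[OF kn] by (simp add: h_def)
  hence "6 \<le> e * h" using e by (simp add: field_simps)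
  moreover have "star_hi n d k = h + e * h / 4 + e * l / 4" by (simp add: star_hi_def h_def l_def e(3) distrib_right)
  hence "c \<le> 2 * h + e * h / 2 + e * l / 2 + 6" using c(1) u v by linarith
  moreover have "0 \<le> e * h" "0 \<le> e * l" using calculation(1) e l0 by auto
  ultimately have "c \<le> 2 * h + l + 2 * (e * h) + e * l" using l0 by linarith
  also have "... = (1 + e) * typical n k" unfolding T by (simp add: algebra_simps)
  finally show ?thesis using c(2) by blast
qed

end

section \<open>Assembling the three regimes of the upper bound\<close>

definition upper_ok :: "real \<Rightarrow> nat \<Rightarrow> nat \<Rightarrow> nat \<Rightarrow> weights \<Rightarrow> bool" where
  "upper_ok \<epsilon> n s t w \<longleftrightarrow> (\<exists>P. successive_paths (complete_edges n) w s t (n - 1) P) \<and>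
     (\<forall>k\<in>{1..n-1}. \<forall>P. successive_paths (complete_edges n) w s t k P \<longrightarrow> path_cost w (P k) \<le> (1 + \<epsilon>) * typical n k)"

definition small_numeric_ok :: "real \<Rightarrow> real \<Rightarrow> nat \<Rightarrow> bool" where
  "small_numeric_ok e \<tau> n \<longleftrightarrow> (let L = ln (real n) in 1 \<le> L \<and> 64 * (1 + 8 / e) \<le> e\<^sup>2 * L \<and> 4096 * (2 + 8 / e + 16 / \<tau>) \<le> e ^ 3 * L \<and>
     16 / \<tau> * (L\<^sup>2 + L)\<^sup>2 + 1 \<le> real n \<and> 100 * (L\<^sup>2 + L) \<le> real n \<and> 3 \<le> e * L \<and> 2 \<le> n)"

lemma eventually_small_numeric_ok:
  assumes "0 < e" "0 < \<tau>" shows "\<forall>\<^sub>F n in sequentially. small_numeric_ok e \<tau> n"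
proof -
  define a b c where "a = 64 * (1 + 8 / e)" and "b = 4096 * (2 + 8 / e + 16 / \<tau>)" and "c = 16 / \<tau>"
  show ?thesis unfolding small_numeric_ok_def Let_def a_def[symmetric] b_def[symmetric] c_def[symmetric]
    using assms by (intro eventually_conj eventually_ge_at_top; real_asymp)
qed

definition large_numeric_ok :: "real \<Rightarrow> real \<Rightarrow> real \<Rightarrow> real \<Rightarrow> nat \<Rightarrow> bool" where
  "large_numeric_ok e \<zeta> \<rho> C n \<longleftrightarrow> (let L = ln (real n) in 1 \<le> L \<and> 200 * L \<le> real n \<and> 64 * C \<le> \<zeta> * e\<^sup>2 * L\<^sup>2 \<and>
     4096 * C \<le> \<zeta> * e * (200 * L) \<and> 64 \<le> \<zeta> * e * (L\<^sup>2)\<^sup>2 \<and> 8 * C < \<rho>\<^sup>2 * e\<^sup>2 * real n \<and>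
     4 * (L / ln (200 * L / 64) + 1) * (200 * L) \<le> e * L\<^sup>2 \<and> 2 \<le> n)"

lemma eventually_large_numeric_ok:
  assumes "0 < e" "0 < \<zeta>" "0 < \<rho>" shows "\<forall>\<^sub>F n in sequentially. large_numeric_ok e \<zeta> \<rho> C n"
proof -
  define a b c where "a = \<zeta> * e\<^sup>2" and "b = \<zeta> * e" and "c = \<rho>\<^sup>2 * e\<^sup>2"
  have "0 < a" "0 < b" "0 < c" using assms by (auto simp: a_def b_def c_def)
  thus ?thesis unfolding large_numeric_ok_def Let_def a_def[symmetric] b_def[symmetric] c_def[symmetric]
    using assms by (intro eventually_conj eventually_ge_at_top; real_asymp)
qed

lemma (in exp_graphs) whp_upper:
  assumes \<epsilon>: "0 < \<epsilon>" "\<epsilon> \<le> 1/1000"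
  shows "whp (\<lambda>n. upper_ok \<epsilon> n (s n) (t n))"
proof -
  \<comment> \<open>\<open>small_upper\<close> and \<open>large_upper\<close> lose a factor 1 +
    32e.\<close>
  define e where "e = \<epsilon> / 32"
  define d where "d = \<epsilon> / 4"
  \<comment> \<open>For k > (1 - \<eta>)n this forces ln(n/(n - k)) \<ge> 6/\<epsilon>, as
    \<open>end_upper\<close> requires.\<close>
  define \<eta> where "\<eta> = exp (- (6 / \<epsilon>))"
  define \<zeta> where "\<zeta> = e * \<eta> / 2"
  define C where "C = 4 / \<eta> + 2"
  define \<rho> where "\<rho> = min (1 / 128) (\<zeta> * e / (128 * C))"
  have e: "0 < e" "32 * e \<le> 1" "32 * e = \<epsilon>" "e \<le> 1" "e \<le> 1/4" using \<epsilon> by (auto simp: e_def)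
  have d: "0 < d" "d \<le> 1" "d = \<epsilon> / 4" using \<epsilon> by (auto simp: d_def)
  have "6 / \<epsilon> \<ge> 0" using \<epsilon> by simp
  hence \<eta>: "0 < \<eta>" "\<eta> \<le> 1" by (auto simp: \<eta>_def)
  have C: "0 < C" using \<eta> by (simp add: C_def add_pos_pos)
  have \<zeta>: "0 < \<zeta>" using e \<eta> by (simp add: \<zeta>_def)
  have \<rho>: "0 < \<rho>" "\<rho> \<le> 1 / 128" using \<zeta> e C by (auto simp: \<rho>_def)
  have "\<rho> \<le> \<zeta> * e / (128 * C)" by (simp add: \<rho>_def)
  hence \<rho>C: "128 * C * \<rho> \<le> \<zeta> * e" using C by (simp add: field_simps)
  obtain g \<tau> \<gamma> where g: "0 < g" "g \<le> 1/20" "0 < \<tau>" "\<tau> \<le> 1" "1 < \<gamma>" "\<gamma> \<le> 2" "\<gamma>\<^sup>2 \<le> \<gamma> + (1 - 7 * g) * \<tau>" "\<tau> \<le> (1 + e) * ln \<gamma>"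
    using growth_rate_exists[OF e(1)] by blast
  have c: "0 < 16 / \<tau>" using g by simp
  define G where "G n w \<longleftrightarrow> star_ok e n (s n) w \<and> star_ok e n (t n) w \<and> star_ok d n (s n) w \<and> star_ok d n (t n) w \<and>
     (\<forall>k\<in>{1..nat \<lfloor>(ln (real n))\<^sup>2\<rfloor>}. small_event e e (16 / \<tau>) \<tau> \<gamma> n k w) \<and> large_event e \<rho> n w \<and> deg_ok n w \<and> (\<forall>e\<in>complete_edges n. 0 \<le> w e)" for n w
  have sn: "\<And>n. n \<ge> 2 \<Longrightarrow> s n < n" and tn: "\<And>n. n \<ge> 2 \<Longrightarrow> t n < n" using st by blast+
  have "whp G" unfolding G_def
    by (intro whp_conj whp_star whp_small[OF e(1,1) c g(3,4,1,2,5,6,7)] whp_large whp_deg whp_nonneg) (use e d \<rho> sn tn in auto)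
  moreover have "\<forall>\<^sub>F n in sequentially. \<forall>w. G n w \<longrightarrow> upper_ok \<epsilon> n (s n) (t n) w"
  proof -
    have "\<forall>\<^sub>F n in sequentially. 1000 + 1000 * ln (real n) \<le> real n" by real_asymp
    thus ?thesis using eventually_small_numeric_ok[OF e(1) g(3)] eventually_large_numeric_ok[OF e(1) \<zeta> \<rho>(1), of C]
    proof eventually_elim
      case (elim n)
      define L where "L = ln (real n)"
      have n2: "2 \<le> n" and L1: "1 \<le> L" using elim(2) by (auto simp: small_numeric_ok_def Let_def L_def)
      show ?case
      proof (intro allI impI)
        fix w assume w: "G n w"
        have st': "s n < n" "t n < n" "s n \<noteq> t n" using st[OF n2] by auto
        show "upper_ok \<epsilon> n (s n) (t n) w" unfolding upper_ok_def
        proof (rule greedy_upper[OF st'])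
          show "0 \<le> w e'" if "e' \<in> complete_edges n" for e' using w that by (auto simp: G_def)
          fix k P assume k: "k \<in> {1..n-1}" and gr: "greedy n w (s n) (t n) k P"
            and cost: "\<And>i. i \<in> {1..<k} \<Longrightarrow> path_cost w (P i) \<le> (1 + \<epsilon>) * typical n i"
          interpret greedy n w "s n" "t n" k P by (rule gr)
          have kn: "1 \<le> k" "k < n" using k n2 by auto
          have cost': "path_cost w (P i) \<le> (1 + 32 * e) * typical n i" if "i \<in> {1..<k}" for i using cost[OF that] e by simp
          consider "k \<le> nat \<lfloor>L\<^sup>2\<rfloor>" | "nat \<lfloor>L\<^sup>2\<rfloor> < k" "real k \<le> (1 - \<eta>) * real n" | "(1 - \<eta>) * real n < real k" by linarith
          thus "\<exists>c\<le>(1 + \<epsilon>) * typical n k. walk (complete_edges n - used P k) w (s n) (t n) c"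
          proof cases
            case 1
            have "real k \<le> L\<^sup>2" using 1 by (simp add: nat_le_iff le_nat_iff le_floor_iff)
            hence K: "L \<le> real k + L" "real k + L \<le> L\<^sup>2 + L" "0 \<le> real k + L" using L1 by auto
            have N: "64 * (1 + 8 / e) \<le> e\<^sup>2 * L" "4096 * (2 + 8 / e + 16 / \<tau>) \<le> e ^ 3 * L"
              "16 / \<tau> * (L\<^sup>2 + L)\<^sup>2 + 1 \<le> real n" "100 * (L\<^sup>2 + L) \<le> real n" "3 \<le> e * L"
              using elim(2) by (auto simp: small_numeric_ok_def Let_def L_def)
            have m: "e\<^sup>2 * L \<le> e\<^sup>2 * (real k + L)" "e ^ 3 * L \<le> e ^ 3 * (real k + L)" using K(1) e by (auto intro!: mult_left_mono)
            have "16 / \<tau> * (real k + L)\<^sup>2 \<le> 16 / \<tau> * (L\<^sup>2 + L)\<^sup>2" using K c by (intro mult_left_mono power_mono) auto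
            hence N3: "16 / \<tau> * (real k + L)\<^sup>2 + 1 \<le> real n" using N(3) by linarith
            have "\<exists>c\<le>(1 + 32 * e) * typical n k. walk (complete_edges n - used P k) w (s n) (t n) c"
            proof (rule small_upper[OF e(1,2) g(3,4,5,8)])
              show "star_ok e n (s n) w" "star_ok e n (t n) w" using w by (auto simp: G_def)
              show "small_event e e (16 / \<tau>) \<tau> \<gamma> n k w" using w 1 kn by (auto simp: G_def L_def)
              show "real k + L = real k + ln (real n)" by (simp add: L_def)
              show "1 \<le> real k + L" using L1 by simp
              show "64 * (1 + 8 / e) \<le> e\<^sup>2 * (real k + L)" using N(1) m(1) by linarith
              show "4096 * (2 + 8 / e + 16 / \<tau>) \<le> e ^ 3 * (real k + L)" using N(2) m(2) by linarith
              show "16 / \<tau> * (real k + L)\<^sup>2 + 1 \<le> real n" by (rule N3)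
              show "100 * (real k + L) \<le> real n" using order_trans[OF mult_left_mono[OF K(2), of 100] N(4)] by simp
              show "3 \<le> e * ln (real n)" using N(5) by (simp add: L_def)
            qed (use n2 cost' in auto)
            thus ?thesis using e(3) by simp
          next
            case 2
            have kL: "L\<^sup>2 \<le> real k" using 2(1) by linarith
            have LL: "L \<le> L\<^sup>2" using L1 mult_left_mono[of 1 L L] by (simp add: power2_eq_square)
            define \<mu> where "\<mu> = 200 * L"
            have N: "\<mu> \<le> real n" "64 * C \<le> \<zeta> * e\<^sup>2 * L\<^sup>2" "4096 * C \<le> \<zeta> * e * \<mu>" "64 \<le> \<zeta> * e * (L\<^sup>2)\<^sup>2" "8 * C < \<rho>\<^sup>2 * e\<^sup>2 * real n"
               "4 * (L / ln (\<mu> / 64) + 1) * \<mu> \<le> e * L\<^sup>2"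
              using elim(3) unfolding large_numeric_ok_def Let_def L_def[symmetric] \<mu>_def by blast+
            have \<mu>: "64 \<le> \<mu>" "1 < \<mu> / 64" using L1 by (auto simp: \<mu>_def)
            hence ln\<mu>: "0 < ln (\<mu> / 64)" by simp
            \<comment> \<open>J is about ln n / ln ln n, so J \<mu> is of order (ln n)^2 / ln ln n
              and negligible against k \<ge> (ln n)^2.\<close>
            define J where "J = nat \<lceil>L / ln (\<mu> / 64)\<rceil>"
            have J: "L / ln (\<mu> / 64) \<le> real J" "real J \<le> L / ln (\<mu> / 64) + 1"
              using nat_ceiling_bounds[of "L / ln (\<mu> / 64)"] L1 ln\<mu> by (auto simp: J_def)
            have NJ: "real n \<le> (\<mu> / 64) ^ J"
            proof -
              have "ln (real n) \<le> real J * ln (\<mu> / 64)" using J(1) ln\<mu> by (simp add: field_simps L_def)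
              also have "... = ln ((\<mu> / 64) ^ J)" using \<mu> by (simp add: ln_realpow)
              finally show ?thesis using n2 \<mu> by simp
            qed
            have "4 * real J * \<mu> \<le> 4 * (L / ln (\<mu> / 64) + 1) * \<mu>" using J(2) \<mu> by (intro mult_right_mono) auto
            also note N(6)
            also have "e * L\<^sup>2 \<le> e * real k" using kL e by (intro mult_left_mono) auto
            finally have N8: "4 * real J * \<mu> \<le> e * real k" .
            have le: "large_event e \<rho> n w" using w by (simp add: G_def)
            have km: "k \<in> {nat \<lceil>(ln (real n))\<^sup>2\<rceil>..n}" using kL kn unfolding L_def by (simp add: ceiling_le_iff nat_le_iff)
            have "\<exists>c\<le>(1 + 32 * e) * typical n k. walk (complete_edges n - used P k) w (s n) (t n) c"
            proof (rule large_upper[OF e(1,2) \<eta> \<zeta>_def C_def \<rho>(2) \<rho>C])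
              show "star_ok e n (s n) w" "star_ok e n (t n) w" using w by (auto simp: G_def)
              show "spread n (e * real k) w" "joined n \<rho> (e * real k) w" "spread n \<mu> w"
                using le km unfolding large_event_def \<mu>_def L_def by auto
              show "ln (real n) \<le> real k" using kL LL by (simp add: L_def)
              show "64 * C \<le> \<zeta> * e\<^sup>2 * real k" using \<zeta> by (intro order_trans[OF N(2)] mult_left_mono kL) auto
              have "(L\<^sup>2)\<^sup>2 \<le> (real k)\<^sup>2" using kL by (intro power_mono) auto
              thus "64 \<le> \<zeta> * e * (real k)\<^sup>2" using \<zeta> e by (intro order_trans[OF N(4)] mult_left_mono) auto
            qed (use N NJ N8 n2 cost' 2 \<mu> in auto)
            thus ?thesis using e(3) by simp
          next
            case 3
            have nk: "real (n - k) < \<eta> * real n" using 3 kn by (simp add: of_nat_diff algebra_simps)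
            have "1 / \<eta> \<le> real n / real (n - k)" using nk \<eta> kn by (simp add: field_simps)
            hence "ln (1 / \<eta>) \<le> ln (real n / real (n - k))" using \<eta> kn n2 by (subst ln_le_cancel_iff) auto
            hence "6 / \<epsilon> \<le> ln (real n / real (n - k))" by (simp add: \<eta>_def ln_div)
            thus ?thesis using w by (intro end_upper[OF \<epsilon> d(3) _ _ _ kn(2) _ cost elim(1)]) (auto simp: G_def)
          qed
        qed
      qed
    qed
  qed
  ultimately show ?thesis by (rule whp_mono)
qed

section \<open>The lower bound\<close>

lemma mid_cost_st:
  assumes "st_path A s t p" "s \<noteq> t" "p = s # q @ [t]" "q \<noteq> []" "s \<notin> set q" "t \<notin> set q"
  shows "mid_cost w s t p = path_cost w q" "first_v p = hd q" "last_v p = last q"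
proof -
  show v: "first_v p = hd q" "last_v p = last q" using assms by (auto simp: first_v_def last_v_def butlast_append)
  have "p \<noteq> [s, t]" using assms by auto
  from path_cost_decomp[OF assms(1,2) this, of w] show "mid_cost w s t p = path_cost w q"
    using path_cost_st[OF assms(4,5,6,2), of w] v assms(3) by (simp add: insert_commute)
qed

lemma mid_cost_nonneg: "st_path A s t p \<Longrightarrow> (\<And>e. e \<in> A \<Longrightarrow> 0 \<le> w e) \<Longrightarrow> 0 \<le> mid_cost w s t p"
  unfolding mid_cost_def st_path_def by (intro sum_nonneg) auto

lemma typical_nonneg: "k < n \<Longrightarrow> 0 \<le> typical n k"
  unfolding typical_def using hsum_nonneg[of k n] by simp

section \<open>Lower bounds for sums of costs, and from sums to single costs\<close>

context greedy
begin

text \<open>For m = k - 1 up to A ln n all costs are at most (8A + 2) ln n / n, so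
  \<open>no_cheap\<close> excludes the direct edge and forces each middle part above (1 - d) ln n /
  n. For larger m the term ln n / n is at most a fraction 1/(2A) of \<open>typical n m\<close>, so
  the middle parts may be dropped, and the edge between s and t is negligible when spread over m
  indices.\<close>

lemma cost_sum_lower:
  assumes d: "0 < d" "d \<le> 1" and ok: "star_ok d n s w" "star_ok d n t w" and kn: "1 < k" "k \<le> n"
    and nc: "no_cheap n s t ((8 * A + 2) * ln (real n) / real n) ((1 - d) * ln (real n) / real n) w"
    and A: "1 \<le> A" "2 * A * ln (real n) \<le> real n" "2 \<le> ln (real n)"
    and cost: "\<And>i. i \<in> {1..<k} \<Longrightarrow> path_cost w (P i) \<le> 2 * typical n i"
  shows "(\<Sum>i=1..k - 1. typical n i) - (4 * d + 4 / A) * real (k - 1) * typical n (k - 1) \<le> (\<Sum>i=1..k - 1. path_cost w (P i))"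
proof -
  define m where "m = k - 1"
  define T where "T = typical n m"
  define l where "l = ln (real n) / real n"
  have m: "1 \<le> m" "m < n" "{1..<k} = {1..m}" using kn by (auto simp: m_def)
  have mk: "i \<in> {1..<k}" if "i \<in> {1..m}" for i using that unfolding m(3) .
  have l0: "0 \<le> l" using A(3) n_pos by (simp add: l_def)
  have hm: "0 \<le> hsum n m" using m by (intro hsum_nonneg) simp
  have lT: "l \<le> T" "2 * hsum n m \<le> T" using hm l0 by (auto simp: T_def typical_def l_def)
  have T0: "0 \<le> T" using lT l0 by linarith
  have hi: "0 \<le> hsum n i" "2 * hsum n i \<le> T" "typical n i \<le> T" if "i \<in> {1..m}" for i
  proof -
    have "typical n i \<le> T" using that m typical_mono[of i m n] by (simp add: T_def)
    moreover show "0 \<le> hsum n i" using that m by (intro hsum_nonneg) auto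
    ultimately show "2 * hsum n i \<le> T" "typical n i \<le> T" using l0 by (auto simp: typical_def l_def)
  qed
  have lo: "card {v\<in>{..<n} - {x}. w {x, v} < star_lo n d i} < i" if "x = s \<or> x = t" "i \<in> {1..k - 1}" for x i
    using star_lo_count[of x d i] that ok s t kn by auto
  have ms: "(\<Sum>i\<in>{1..m}. mid_cost w s t (P i)) + 2 * (\<Sum>i=1..m. star_lo n d i) \<le> (\<Sum>i\<in>{1..m}. path_cost w (P i)) + (if [s, t] \<in> P ` {1..m} then w {s, t} else 0)"
    using mid_sum[of "star_lo n d", OF lo lo] unfolding m(3) m_def[symmetric] by blast
  have lol: "2 * star_lo n d i = 2 * hsum n i - d * (2 * hsum n i) - 2 * (d * l)" for i
    by (simp add: star_lo_def l_def algebra_simps)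
  have dT: "d * (2 * hsum n i) \<le> d * T" if "i \<in> {1..m}" for i using hi[OF that] d by (intro mult_left_mono) auto
  have dl: "d * l \<le> d * T" using lT d by (intro mult_left_mono) auto
  have fin: "(\<Sum>i=1..m. typical n i) - a * real m * T \<le> (\<Sum>i=1..m. path_cost w (P i))"
    if a: "\<And>i. i \<in> {1..m} \<Longrightarrow> typical n i - a' * T \<le> mid_cost w s t (P i) + 2 * star_lo n d i"
      "(if [s, t] \<in> P ` {1..m} then w {s, t} else 0) \<le> (a - a') * real m * T" for a a'
  proof -
    have "(\<Sum>i=1..m. typical n i) - a' * real m * T = (\<Sum>i=1..m. typical n i - a' * T)" by (simp add: sum_subtractf)
    also have "... \<le> (\<Sum>i=1..m. mid_cost w s t (P i) + 2 * star_lo n d i)" by (intro sum_mono a)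
    also have "... = (\<Sum>i=1..m. mid_cost w s t (P i)) + 2 * (\<Sum>i=1..m. star_lo n d i)" by (simp add: sum.distrib sum_distrib_left)
    also note ms
    finally have "(\<Sum>i=1..m. typical n i) - a' * real m * T \<le> (\<Sum>i=1..m. path_cost w (P i)) + (a - a') * real m * T" using a(2) by linarith
    thus ?thesis by (simp add: algebra_simps)
  qed
  have "(\<Sum>i=1..m. typical n i) - (4 * d + 4 / A) * real m * T \<le> (\<Sum>i=1..m. path_cost w (P i))"
  proof (cases "real m \<le> A * ln (real n)")
    case True
    define y where "y = (8 * A + 2) * l"
    have "T \<le> y / 2"
    proof -
      have "2 * real m \<le> real n" using True A by linarith
      moreover have "hsum n m \<le> real m / (real n - real m)" by (rule hsum_le[OF m(2)])
      moreover have "real m / (real n - real m) \<le> real m / (real n / 2)" using calculation(1) n_pos by (intro divide_left_mono) auto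
      moreover have "real m / (real n / 2) \<le> A * ln (real n) / (real n / 2)" using True by (intro divide_right_mono) auto
      moreover have "A * ln (real n) / (real n / 2) = 2 * (A * l)" by (simp add: l_def)
      ultimately have "hsum n m \<le> 2 * (A * l)" by linarith
      thus ?thesis by (simp add: T_def typical_def y_def l_def[symmetric] algebra_simps)
    qed
    hence Xy: "path_cost w (P i) \<le> y" if "i \<in> {1..m}" for i using cost[OF mk[OF that]] hi(3)[OF that] by linarith
    have nc': "y < w {s, t}" "\<And>q. q \<noteq> [] \<Longrightarrow> distinct q \<Longrightarrow> set q \<subseteq> {..<n} - {s, t} \<Longrightarrow> w {s, hd q} \<le> y \<Longrightarrow> w {last q, t} \<le> y \<Longrightarrow> (1 - d) * l < path_cost w q"
      using nc unfolding no_cheap_def y_def l_def by auto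
    have nd: "P i \<noteq> [s, t]" if "i \<in> {1..m}" for i
    proof
      assume "P i = [s, t]"
      hence "path_cost w (P i) = w {s, t}" by (simp add: path_cost_def path_edges_Cons)
      thus False using Xy[OF that] nc'(1) by simp
    qed
    show ?thesis
    proof (rule fin[where a' = "4 * d"])
      fix i assume i: "i \<in> {1..m}"
      have p: "st_path E s t (P i)" by (rule path(1)[OF mk[OF i]])
      obtain q where q: "q \<noteq> []" "P i = s # q @ [t]" "distinct q" "s \<notin> set q" "t \<notin> set q"
        using st_path_cases[OF p neq] nd[OF i] by metis
      note mc = mid_cost_st[OF p neq q(2,1,4,5)]
      have c: "path_cost w (P i) = w {s, hd q} + path_cost w q + w {last q, t}" using path_cost_st[OF q(1,4,5) neq] q(2) by simp
      have "0 \<le> path_cost w q" unfolding mc(1)[symmetric] by (rule mid_cost_nonneg[OF p nonneg])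
      moreover have "{s, first_v (P i)} \<in> E" "{t, last_v (P i)} \<in> E"
        using st_path_edge_first[OF p neq] st_path_edge_last[OF p neq] path_sub[OF mk[OF i]] by auto
      hence "0 \<le> w {s, hd q}" "0 \<le> w {last q, t}" using nonneg mc by (auto simp: insert_commute)
      ultimately have "w {s, hd q} \<le> y" "w {last q, t} \<le> y" using Xy[OF i] c by auto
      moreover have "set q \<subseteq> {..<n} - {s, t}" using st_path_vertices[OF p s] q by auto
      ultimately have "(1 - d) * l < mid_cost w s t (P i)" using nc'(2)[OF q(1,3)] mc(1) by simp
      hence "l - d * l < mid_cost w s t (P i)" by (simp add: algebra_simps)
      thus "typical n i - 4 * d * T \<le> mid_cost w s t (P i) + 2 * star_lo n d i"
        using lol[of i] dT[OF i] dl by (simp add: typical_def l_def[symmetric])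
    next
      have "[s, t] \<notin> P ` {1..m}" using nd by (metis imageE)
      thus "(if [s, t] \<in> P ` {1..m} then w {s, t} else 0) \<le> (4 * d + 4 / A - 4 * d) * real m * T" using A T0 by simp
    qed
  next
    case False
    have Am: "A * ln (real n) \<le> real m" using False by simp
    have "A * l \<le> real m / real n" using Am n_pos by (simp add: l_def divide_right_mono)
    also have "... \<le> hsum n m" by (rule hsum_ge[OF m(2)])
    finally have "2 * (A * l) \<le> T" using lT by linarith
    hence lA: "2 * l \<le> T / A" using A(1) by (simp add: field_simps)
    have "A * 2 \<le> real m" using Am mult_left_mono[OF A(3), of A] A(1) by linarith
    hence "2 * T * A \<le> real m * T" using mult_right_mono[of "A * 2" "real m" T] T0 by (simp add: mult_ac)
    moreover have "0 \<le> real m * T" using T0 by simp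
    ultimately have "2 * T * A \<le> 3 * (real m * T)" by linarith
    hence TA: "2 * T \<le> (3 / A) * real m * T" using A(1) by (simp add: field_simps)
    show ?thesis
    proof (rule fin[where a' = "4 * d + 1 / A"])
      fix i assume i: "i \<in> {1..m}"
      have "0 \<le> mid_cost w s t (P i)" using mid_cost_nonneg[OF path(1)[OF mk[OF i]] nonneg] by simp
      moreover have "d * T \<ge> 0" "T / A \<ge> 0" using d T0 A by auto
      ultimately show "typical n i - (4 * d + 1 / A) * T \<le> mid_cost w s t (P i) + 2 * star_lo n d i"
        using lol[of i] dT[OF i] dl lA l0 by (simp add: typical_def l_def[symmetric] distrib_right)
    next
      have "(if [s, t] \<in> P ` {1..m} then w {s, t} else 0) \<le> 2 * T"
      proof (cases "[s, t] \<in> P ` {1..m}")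
        case True
        then obtain i where i: "i \<in> {1..m}" "P i = [s, t]" by (metis imageE)
        hence "path_cost w (P i) = w {s, t}" by (simp add: path_cost_def path_edges_Cons)
        thus ?thesis using True cost[OF mk[OF i(1)]] hi(3)[OF i(1)] by auto
      qed (use T0 in auto)
      thus "(if [s, t] \<in> P ` {1..m} then w {s, t} else 0) \<le> (4 * d + 4 / A - (4 * d + 1 / A)) * real m * T" using TA by simp
    qed
  qed
  thus ?thesis unfolding m_def T_def by simp
qed

text \<open>Subtract from the bound for the whole sum the upper bounds for all indices before a
  window of h, about \<beta> m, indices ending at m = k - 1. This bounds the sum over the window
  from below, and by monotonicity that sum is at most h times the last cost. The error (a +
  e)/\<beta> is a total error of order m spread over h indices; \<beta>/\<eta> is the relative
  variation of \<open>typical\<close> within the window.\<close>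

lemma window_lower:
  assumes kn: "1 < k" "k \<le> n" and \<eta>: "0 < \<eta>" "real (k - 1) \<le> (1 - \<eta>) * real n" and \<beta>: "0 < \<beta>" "\<beta> \<le> 1" and e: "0 \<le> e"
    and sum: "(\<Sum>i=1..k - 1. typical n i) - a * real (k - 1) * typical n (k - 1) \<le> (\<Sum>i=1..k - 1. path_cost w (P i))"
    and cost: "\<And>i. i \<in> {1..<k} \<Longrightarrow> path_cost w (P i) \<le> (1 + e) * typical n i" and a: "0 \<le> a"
  shows "(1 - \<beta> / \<eta> - (a + e) / \<beta>) * typical n (k - 1) \<le> path_cost w (P (k - 1))"
proof -
  define m where "m = k - 1"
  define T where "T = typical n m"
  have m: "1 \<le> m" "m < n" "{1..<k} = {1..m}" using kn by (auto simp: m_def)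
  define h where "h = nat \<lceil>\<beta> * real m\<rceil>"
  have bm: "0 < \<beta> * real m" "\<beta> * real m \<le> real m" using \<beta> m by auto
  have h': "\<beta> * real m \<le> real h" "real h \<le> \<beta> * real m + 1" using nat_ceiling_bounds[of "\<beta> * real m"] bm by (auto simp: h_def)
  hence "0 < real h" using bm by linarith
  hence h1: "1 \<le> h" by simp
  have hm: "h \<le> m" unfolding h_def using bm by (simp add: nat_le_iff ceiling_le_iff)
  define j where "j = m - h"
  have j: "j + h = m" "j < m" using hm h1 by (auto simp: j_def)
  have T0: "0 \<le> T" unfolding T_def by (rule typical_nonneg[OF m(2)])
  have split: "{1..m} = {1..j} \<union> {j+1..m}" "{1..j} \<inter> {j+1..m} = {}" using j by auto
  have sp: "(\<Sum>i=1..m. f i) = (\<Sum>i=1..j. f i) + (\<Sum>i=j+1..m. f i)" for f :: "nat \<Rightarrow> real"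
    unfolding split(1) by (rule sum.union_disjoint) (use split in auto)
  have Tj: "T - \<beta> / \<eta> * T \<le> typical n (j + 1)"
  proof -
    have nm: "\<eta> * real n \<le> real n - real m" using \<eta> by (simp add: m_def algebra_simps)
    have "hsum n m - hsum n (j + 1) \<le> (real m - real (j + 1)) / (real n - real m)" using j m by (intro hsum_diff_le) auto
    also have "... \<le> (\<beta> * real m) / (\<eta> * real n)"
    proof (intro frac_le)
      have "real j + real h = real m" using j(1) by linarith
      thus "real m - real (j + 1) \<le> \<beta> * real m" using h'(2) by simp
    qed (use bm nm \<eta> n_pos in auto)
    also have "... = \<beta> / \<eta> * (real m / real n)" by simp
    also have "... \<le> \<beta> / \<eta> * hsum n m" using hsum_ge[OF m(2)] \<beta> \<eta> by (intro mult_left_mono) auto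
    finally have hh: "hsum n m - hsum n (j + 1) \<le> \<beta> / \<eta> * hsum n m" .
    have "2 * hsum n m - 2 * hsum n (j + 1) = 2 * (hsum n m - hsum n (j + 1))" by simp
    also have "... \<le> 2 * (\<beta> / \<eta> * hsum n m)" by (rule mult_left_mono[OF hh]) simp
    also have "... = \<beta> / \<eta> * (2 * hsum n m)" by simp
    also have "... \<le> \<beta> / \<eta> * T" using \<beta> \<eta> n_pos by (intro mult_left_mono) (auto simp: T_def typical_def)
    finally show ?thesis by (simp add: T_def typical_def)
  qed
  have X: "(\<Sum>i=j+1..m. path_cost w (P i)) \<le> real h * path_cost w (P m)"
  proof -
    have "(\<Sum>i=j+1..m. path_cost w (P i)) \<le> (\<Sum>i=j+1..m. path_cost w (P m))" using m(3) by (intro sum_mono cost_mono) auto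
    also have "... = real h * path_cost w (P m)" using j by (simp add: j(1)[symmetric])
    finally show ?thesis .
  qed
  have "real h * typical n (j + 1) = (\<Sum>i=j+1..m. typical n (j + 1))" using j by (simp add: j(1)[symmetric])
  also have "... \<le> (\<Sum>i=j+1..m. typical n i)" using m by (intro sum_mono typical_mono) auto
  finally have Y: "real h * typical n (j + 1) \<le> (\<Sum>i=j+1..m. typical n i)" .
  have Z: "(\<Sum>i=1..j. path_cost w (P i)) \<le> (\<Sum>i=1..j. typical n i) + e * real m * T"
  proof -
    have "(\<Sum>i=1..j. path_cost w (P i)) \<le> (\<Sum>i=1..j. typical n i + e * T)"
    proof (rule sum_mono)
      fix i assume i: "i \<in> {1..j}"
      have "i \<in> {1..m}" using i j by auto
      hence "i \<in> {1..<k}" unfolding m(3) .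
      hence "path_cost w (P i) \<le> typical n i + e * typical n i" using cost[of i] by (simp add: distrib_right)
      moreover have "e * typical n i \<le> e * T" using i j m typical_mono[of i m n] e by (auto simp: T_def intro!: mult_left_mono)
      ultimately show "path_cost w (P i) \<le> typical n i + e * T" by linarith
    qed
    also have "... = (\<Sum>i=1..j. typical n i) + real j * (e * T)" by (simp add: sum.distrib)
    also have "real j * (e * T) \<le> real m * (e * T)" using j e T0 by (intro mult_right_mono) auto
    finally show ?thesis by (simp add: mult_ac)
  qed
  have "real h * typical n (j + 1) \<le> real h * path_cost w (P m) + (a + e) * (real m * T)"
    using sum[folded m_def] X Y Z sp[of "typical n"] sp[of "\<lambda>i. path_cost w (P i)"] by (simp add: T_def[symmetric] distrib_right mult.assoc)
  also have "(a + e) * (real m * T) \<le> real h * ((a + e) / \<beta> * T)"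
  proof -
    have "\<beta> * real m * ((a + e) / \<beta> * T) \<le> real h * ((a + e) / \<beta> * T)" using h'(1) a e \<beta> T0 by (intro mult_right_mono) auto
    moreover have "\<beta> * real m * ((a + e) / \<beta> * T) = (a + e) * (real m * T)" using \<beta> by simp
    ultimately show ?thesis by simp
  qed
  finally have "real h * typical n (j + 1) \<le> real h * (path_cost w (P m) + (a + e) / \<beta> * T)" by (simp add: distrib_left)
  hence "typical n (j + 1) \<le> path_cost w (P m) + (a + e) / \<beta> * T" using \<open>0 < real h\<close> by simp
  hence "T - \<beta> / \<eta> * T - (a + e) / \<beta> * T \<le> path_cost w (P m)" using Tj by linarith
  thus ?thesis unfolding T_def m_def by (simp add: left_diff_distrib)
qed

end

text \<open>Rerouting \<open>P\<^sub>i\<close> through the first edge of a later path \<open>P\<^sub>j\<close> shows that no earlier path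
  can use a much heavier first edge; but one of the paths must use a heavy one.\<close>

lemma (in greedy) end_lower:
  assumes e: "0 \<le> e" "e \<le> 1/1000" and d: "0 \<le> d" "d \<le> 1/1000" and ok: "star_ok d n s w" "star_ok d n t w" "deg_ok n w" and kn: "k \<le> n"
    and cost: "\<And>i. i \<in> {1..<k} \<Longrightarrow> path_cost w (P i) \<le> (1 + e) * typical n i"
    and n: "1000 + 1000 * ln (real n) \<le> real n" and j: "j \<in> {2..<k}" "P j \<noteq> [s, t]"
  shows "2 * star_lo n d (j - 1) - 12 \<le> path_cost w (P j)"
proof -
  have L: "0 \<le> ln (real n)" using n_pos by simp
  have "40 \<le> real n" using n L by linarith
  hence n40: "40 \<le> n" by simp
  let ?O = "{i\<in>{1..j}. P i \<noteq> [s, t]}"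
  have jk: "{1..j} \<subseteq> {1..<k}" using j by auto
  have P: "st_path E s t (P i)" if "i \<in> {1..j}" for i using path(1)[of i] that jk by auto
  have mid_nn: "0 \<le> mid_cost w s t (P i)" if "i \<in> {1..j}" for i using mid_cost_nonneg[OF P[OF that]] nonneg by blast
  have Oc: "j - 1 \<le> card ?O"
  proof -
    have "card {i\<in>{1..j}. P i = [s, t]} \<le> 1" using direct_unique jk by (auto simp: card_le_Suc0_iff_eq subset_iff)
    moreover have "card {1..j} = card ?O + card {i\<in>{1..j}. P i = [s, t]}"
    proof -
      have "{1..j} = ?O \<union> {i\<in>{1..j}. P i = [s, t]}" by auto
      hence "card {1..j} = card (?O \<union> {i\<in>{1..j}. P i = [s, t]})" by (rule arg_cong)
      also have "... = card ?O + card {i\<in>{1..j}. P i = [s, t]}" by (intro card_Un_disjoint) auto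
      finally show ?thesis .
    qed
    ultimately show ?thesis by simp
  qed
  have route: "path_cost w (P i) \<le> w {s, first_v (P u)} + w {t, last_v (P v)} + 6" if i: "i \<le> u" "i \<le> v" "1 \<le> i" "u \<in> {1..j}" "v \<in> {1..j}" for i u v
  proof -
    have ij: "i \<in> {1..<k}" using i j by auto
    interpret g: greedy n w s t i P
      by unfold_locales (use s t neq nonneg i ij successive_paths_prefix[OF succ, of "i - 1"] in auto)
    have "(\<Sum>e\<in>{e\<in>g.R. s \<notin> e \<and> t \<notin> e}. w e) \<le> real n / 100"
      by (rule g.mid_used_le[OF e d ok(1,2) _ _ n]) (use ij kn cost in auto)
    moreover have "path_edges (P u') \<inter> g.R = {}" if "i \<le> u'" "u' \<in> {1..j}" for u'
    proof -
      have u': "u' \<in> {1..<k}" using that jk by auto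
      have "path_edges (P u') \<inter> path_edges (P i') = {}" if "i' \<in> {1..<i}" for i'
        using path_disjoint[OF u', of i'] that \<open>i \<le> u'\<close> ij by auto
      thus ?thesis unfolding used_def by blast
    qed
    hence "{s, first_v (P u)} \<in> g.E - g.R" "{t, last_v (P v)} \<in> g.E - g.R"
      using i st_path_edge_first[OF P neq, of u] st_path_edge_last[OF P neq, of v] path_sub[of u] path_sub[of v] jk by blast+
    ultimately obtain c where c: "c \<le> w {s, first_v (P u)} + w {t, last_v (P v)} + 6" "walk (g.E - g.R) w s t c"
      using g.bridge_walk[OF ok(3) _ n40] by blast
    obtain p where "st_path E s t p" "path_edges p \<inter> g.R = {}" "path_cost w p \<le> c" using g.walk_gives_path[OF c(2)] by blast
    thus ?thesis using path(3)[OF ij] c(1) by (meson order_trans)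
  qed
  \<comment> \<open>Pigeonhole: at least j - 1 of the first j paths differ from
    \<open>[s, t]\<close>, but fewer than j - 1 edges at \<open>x\<close> lie below the
    threshold.\<close>
  have heavy: "\<exists>i\<in>?O. star_lo n d (j - 1) \<le> w {x, f i}"
    if x: "x = s \<or> x = t" "inj_on f {1..<k}" "\<And>i. i \<in> {1..j} \<Longrightarrow> {x, f i} \<in> E" for x f
  proof (rule ccontr)
    assume c: "\<not> ?thesis"
    have "card ?O = card (f ` ?O)"
    proof (rule card_image[symmetric], rule inj_on_subset[OF x(2)])
      show "?O \<subseteq> {1..<k}" using jk by blast
    qed
    also have "... \<le> card {v\<in>{..<n} - {x}. w {x, v} < star_lo n d (j - 1)}"
    proof (intro card_mono subsetI)
      fix v assume "v \<in> f ` ?O"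
      then obtain i where i: "i \<in> ?O" "v = f i" by blast
      have "{x, v} \<in> E" "w {x, v} < star_lo n d (j - 1)" using x(3)[of i] c i by auto
      thus "v \<in> {v\<in>{..<n} - {x}. w {x, v} < star_lo n d (j - 1)}" by (auto simp: complete_edges_doubleton)
    qed simp
    also have "... < j - 1" using x(1) ok s t j kn by (intro star_lo_count) auto
    finally show False using Oc by simp
  qed
  have E: "{s, first_v (P i)} \<in> E" "{t, last_v (P i)} \<in> E" if "i \<in> {1..j}" for i
    using st_path_edge_first[OF P[OF that] neq] st_path_edge_last[OF P[OF that] neq] path_sub[of i] that jk by blast+
  have jj: "j \<in> {1..j}" using j by auto
  obtain i where i: "i \<in> ?O" "star_lo n d (j - 1) \<le> w {s, first_v (P i)}" using heavy[OF _ first_inj E(1)] by blast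
  obtain i' where i': "i' \<in> ?O" "star_lo n d (j - 1) \<le> w {t, last_v (P i')}" using heavy[OF _ last_inj E(2)] by blast
  have dec: "w {s, first_v (P u)} + w {t, last_v (P u)} \<le> path_cost w (P u)" if "u \<in> ?O" for u
    using path_cost_decomp[OF P[of u] neq, of w] mid_nn[of u] that by auto
  \<comment> \<open>Keeping the last edge of P_i itself in the competitor cancels it on both sides;
    the next step does the same at t.\<close>
  have "w {s, first_v (P i)} \<le> w {s, first_v (P j)} + 6" using route[of i j i] dec[OF i(1)] i jj by auto
  moreover have "w {t, last_v (P i')} \<le> w {t, last_v (P j)} + 6" using route[of i' i' j] dec[OF i'(1)] i' jj by auto
  moreover have "j \<in> ?O" using j jj by auto
  ultimately show ?thesis using dec[of j] i i' by auto
qed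

definition lower_ok :: "real \<Rightarrow> nat \<Rightarrow> nat \<Rightarrow> nat \<Rightarrow> weights \<Rightarrow> bool" where
  "lower_ok \<epsilon> n s t w \<longleftrightarrow>
     (\<forall>k\<in>{1..n-1}. \<forall>P. successive_paths (complete_edges n) w s t k P \<longrightarrow> (1 - \<epsilon>) * typical n k \<le> path_cost w (P k))"

text \<open>\<open>end_lower\<close> loses one rank, and a second one is lost when P_k is the direct
  edge and P_(k-1) is examined instead. This changes h_k by at most 2, and such constants are
  negligible once h_k \<ge> 40/\<epsilon>.\<close>

lemma star_lo_near_end:
  assumes k: "k < n" "k \<le> j + 2" "j \<le> k" and x: "0 < x" "x \<le> \<epsilon> / 16" "\<epsilon> \<le> 1" and h: "40 / \<epsilon> \<le> hsum n k" and l: "ln (real n) \<le> real n"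
  shows "(1 - \<epsilon>) * typical n k \<le> 2 * star_lo n x j - 12"
proof -
  define H where "H = hsum n k"
  define b where "b = ln (real n) / real n"
  have \<epsilon>: "0 < \<epsilon>" using x by linarith
  have b: "0 \<le> b" "b \<le> 1" using k l by (auto simp: b_def divide_le_eq)
  have "H - hsum n j \<le> (real k - real j) / (real n - real k)" unfolding H_def by (rule hsum_diff_le[OF k(3,1)])
  also have "... \<le> 2 / 1" using k by (intro frac_le) auto
  finally have "H - 2 \<le> hsum n j" by simp
  hence "(1 - x) * (H - 2) \<le> (1 - x) * hsum n j" using x by (intro mult_left_mono) auto
  hence 1: "H - 2 - x * H \<le> (1 - x) * hsum n j" using x by (simp add: algebra_simps)
  have \<epsilon>H: "40 \<le> \<epsilon> * H" using h \<epsilon> by (simp add: H_def field_simps)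
  hence "0 < H" using \<epsilon> by (smt (verit) zero_less_mult_iff)
  hence xH: "x * H \<le> \<epsilon> / 16 * H" using x by (intro mult_right_mono) auto
  have xb: "x * b \<le> 1 * 1" using x b by (intro mult_mono) auto
  have "star_lo n x j = (1 - x) * hsum n j - x * b" by (simp add: star_lo_def b_def)
  hence "H - 2 - \<epsilon> * H / 16 - 1 \<le> star_lo n x j" using 1 xH xb by simp
  moreover have "(1 - \<epsilon>) * typical n k = 2 * H + b - 2 * (\<epsilon> * H) - \<epsilon> * b" by (simp add: typical_def H_def b_def[symmetric] algebra_simps)
  moreover have "0 \<le> \<epsilon> * b" using \<epsilon> b by simp
  ultimately show ?thesis using \<epsilon>H b by linarith
qed

context exp_graphs
begin

lemma whp_lower:
  assumes \<epsilon>: "0 < \<epsilon>" "\<epsilon> \<le> 1"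
  shows "whp (\<lambda>n. lower_ok \<epsilon> n (s n) (t n))"
proof -
  \<comment> \<open>The errors of \<open>window_lower\<close> become \<beta>/\<eta> = \<epsilon>/4
    and (4x + 4/A + x)/\<beta> = 9x/\<beta> \<le> 9\<epsilon>/16, together below \<epsilon>. Beyond
    (1 - \<eta>)n the exponential gives h_k \<ge> 40/\<epsilon>.\<close>
  define \<eta> where "\<eta> = min (1 / 2) (exp (- (40 / \<epsilon>)))"
  define \<beta> where "\<beta> = \<epsilon> * \<eta> / 4"
  define x where "x = min (\<beta> * \<epsilon> / 16) (1 / 1000)"
  define A where "A = 1 / x"
  have \<eta>: "0 < \<eta>" "\<eta> \<le> 1 / 2" "\<eta> \<le> exp (- (40 / \<epsilon>))" by (auto simp: \<eta>_def)
  have "\<epsilon> * \<eta> \<le> 1 * (1 / 2)" using \<epsilon> \<eta> by (intro mult_mono) auto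
  hence \<beta>: "0 < \<beta>" "\<beta> \<le> 1" using \<epsilon> \<eta> by (auto simp: \<beta>_def)
  have x: "0 < x" "x \<le> 1 / 1000" "x \<le> \<beta> * \<epsilon> / 16" using \<beta> \<epsilon> by (auto simp: x_def)
  have "\<beta> * \<epsilon> \<le> 1 * \<epsilon>" using \<beta> \<epsilon> by (intro mult_right_mono) auto
  hence x\<epsilon>: "x \<le> \<epsilon> / 16" using x by linarith
  have A: "1 \<le> A" "4 / A = 4 * x" using x by (auto simp: A_def)
  have C: "0 < 8 * A + 2" using A by simp
  have sn: "\<And>n. n \<ge> 2 \<Longrightarrow> s n < n" and tn: "\<And>n. n \<ge> 2 \<Longrightarrow> t n < n" using st by blast+
  define G where "G n w \<longleftrightarrow> upper_ok x n (s n) (t n) w \<and> star_ok x n (s n) w \<and> star_ok x n (t n) w \<and>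
     no_cheap n (s n) (t n) ((8 * A + 2) * ln (real n) / real n) ((1 - x) * ln (real n) / real n) w \<and> deg_ok n w \<and> (\<forall>e\<in>complete_edges n. 0 \<le> w e)" for n w
  have "whp G" unfolding G_def
    by (intro whp_conj whp_star whp_upper whp_no_cheap[OF C] whp_deg whp_nonneg) (use x sn tn in auto)
  moreover have "\<forall>\<^sub>F n in sequentially. \<forall>w. G n w \<longrightarrow> lower_ok \<epsilon> n (s n) (t n) w"
  proof -
    have "\<forall>\<^sub>F n in sequentially. 1000 + 1000 * ln (real n) \<le> real n" "\<forall>\<^sub>F n in sequentially. 2 * A * ln (real n) \<le> real n"
      "\<forall>\<^sub>F n in sequentially. 2 \<le> ln (real n)" using A(1) by real_asymp+
    thus ?thesis
    proof eventually_elim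
      case (elim n)
      have n1000: "1000 \<le> real n" using elim by linarith
      hence n2: "2 \<le> n" by simp
      show ?case
      proof (intro allI impI)
        fix w assume w: "G n w"
        show "lower_ok \<epsilon> n (s n) (t n) w" unfolding lower_ok_def
        proof (intro ballI allI impI)
          fix k P assume k: "k \<in> {1..n-1}" and P: "successive_paths (complete_edges n) w (s n) (t n) k P"
          interpret greedy n w "s n" "t n" "Suc k" P
            by unfold_locales (use st[OF n2] w P in \<open>auto simp: G_def\<close>)
          have kn: "1 \<le> k" "k < n" using k n2 by auto
          have cost: "path_cost w (P i) \<le> (1 + x) * typical n i" if "i \<in> {1..<Suc k}" for i
            using w successive_paths_prefix[OF P, of i] that kn unfolding G_def upper_ok_def by auto
          have T0: "0 \<le> typical n k" by (rule typical_nonneg[OF kn(2)])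
          have ok: "star_ok x n (s n) w" "star_ok x n (t n) w" "deg_ok n w" using w by (auto simp: G_def)
          show "(1 - \<epsilon>) * typical n k \<le> path_cost w (P k)"
          proof (cases "real k \<le> (1 - \<eta>) * real n")
            case True
            have cost2: "path_cost w (P i) \<le> 2 * typical n i" if "i \<in> {1..<Suc k}" for i
              using cost[OF that] x typical_nonneg[of i n] that kn mult_right_mono[of "1 + x" 2 "typical n i"] by auto
            have "(\<Sum>i=1..Suc k - 1. typical n i) - (4 * x + 4 / A) * real (Suc k - 1) * typical n (Suc k - 1) \<le> (\<Sum>i=1..Suc k - 1. path_cost w (P i))"
              by (rule cost_sum_lower[OF _ _ ok(1,2) _ _ _ A(1) elim(2,3) cost2]) (use x kn w in \<open>auto simp: G_def\<close>)
            from window_lower[OF _ _ \<eta>(1) _ \<beta> _ this cost]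
            have "(1 - \<beta> / \<eta> - (4 * x + 4 / A + x) / \<beta>) * typical n k \<le> path_cost w (P k)" using True kn x A by simp
            moreover have "1 - \<epsilon> \<le> 1 - \<beta> / \<eta> - (4 * x + 4 / A + x) / \<beta>"
            proof -
              have "\<beta> / \<eta> = \<epsilon> / 4" using \<eta> by (simp add: \<beta>_def)
              moreover have "(4 * x + 4 / A + x) / \<beta> \<le> 9 * \<epsilon> / 16" using x \<beta> by (simp add: A(2) field_simps)
              ultimately show ?thesis using \<epsilon> by linarith
            qed
            hence "(1 - \<epsilon>) * typical n k \<le> (1 - \<beta> / \<eta> - (4 * x + 4 / A + x) / \<beta>) * typical n k" using T0 by (rule mult_right_mono)
            ultimately show ?thesis by linarith
          next
            case False
            have nk: "real (n - k) < \<eta> * real n" using False kn by (simp add: of_nat_diff algebra_simps)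
            have "1 / \<eta> \<le> real n / real (n - k)" using nk \<eta> kn by (simp add: field_simps)
            hence "ln (1 / \<eta>) \<le> ln (real n / real (n - k))" using \<eta> kn n2 by (subst ln_le_cancel_iff) auto
            also have "... \<le> hsum n k" by (rule hsum_ge_ln[OF kn(2)])
            finally have "- ln \<eta> \<le> hsum n k" using \<eta> by (simp add: ln_div)
            moreover have "ln \<eta> \<le> ln (exp (- (40 / \<epsilon>)))" using \<eta> by (subst ln_le_cancel_iff) auto
            ultimately have h: "40 / \<epsilon> \<le> hsum n k" by simp
            have "\<eta> * real n \<le> 1 / 2 * real n" using \<eta> by (intro mult_right_mono) auto
            moreover have "real (n - k) = real n - real k" using kn by (simp add: of_nat_diff)
            ultimately have "real n - real k \<le> 1 / 2 * real n" using nk by linarith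
            hence "100 \<le> real k" using n1000 by linarith
            hence k3: "100 \<le> k" by simp
            have ln_n: "ln (real n) \<le> real n" using elim by linarith
            have end_lo: "2 * star_lo n x (j - 1) - 12 \<le> path_cost w (P j)" if "j \<in> {2..<Suc k}" "P j \<noteq> [s n, t n]" for j
              by (rule end_lower[OF _ x(2) _ x(2) ok _ cost elim(1) that]) (use x kn in auto)
            show ?thesis
            proof (cases "P k = [s n, t n]")
              case False
              have "(1 - \<epsilon>) * typical n k \<le> 2 * star_lo n x (k - 1) - 12"
                by (rule star_lo_near_end[OF kn(2) _ _ x(1) x\<epsilon> \<epsilon>(2) h ln_n]) auto
              also have "... \<le> path_cost w (P k)" using k3 False by (intro end_lo) auto
              finally show ?thesis .
            next
              \<comment> \<open>At most one path is the direct edge, so P_(k-1) is not, and costs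
                are nondecreasing.\<close>
              case True
              have "k - 1 \<in> {1..<Suc k}" "k \<in> {1..<Suc k}" "k - 1 \<noteq> k" using k3 by auto
              hence ne: "P (k - 1) \<noteq> [s n, t n]" using direct_unique[of "k - 1" k] True by blast
              have "(1 - \<epsilon>) * typical n k \<le> 2 * star_lo n x (k - 1 - 1) - 12"
                by (rule star_lo_near_end[OF kn(2) _ _ x(1) x\<epsilon> \<epsilon>(2) h ln_n]) auto
              also have "... \<le> path_cost w (P (k - 1))" using k3 ne by (intro end_lo) auto
              also have "... \<le> path_cost w (P k)" using k3 by (intro cost_mono) auto
              finally show ?thesis .
            qed
          qed
        qed
      qed
    qed
  qed
  ultimately show ?thesis by (rule whp_mono)
qed

end

section \<open>Measurability of the event and conclusion\<close>

lemma is_kth_cost_finite: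
  assumes "k \<le> m" "1 \<le> k"
  shows "is_kth_cost A w s t k x \<longleftrightarrow> (\<exists>P\<in>{1..m} \<rightarrow>\<^sub>E insert [] {p. st_path A s t p}. successive_paths A w s t k P \<and> x = path_cost w (P k))"
proof
  assume "is_kth_cost A w s t k x"
  then obtain P where P: "successive_paths A w s t k P" "x = path_cost w (P k)" unfolding is_kth_cost_def by blast
  define Q where "Q = restrict (\<lambda>i. if i \<le> k then P i else []) {1..m}"
  have "successive_paths A w s t k Q" using P(1) successive_paths_cong[of k P Q] assms by (auto simp: Q_def)
  moreover have "st_path A s t (P i)" if "i \<in> {1..k}" for i
    using P(1) that unfolding successive_paths_def is_arg_min_def by blast
  hence "Q \<in> {1..m} \<rightarrow>\<^sub>E insert [] {p. st_path A s t p}" by (auto simp: Q_def)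
  moreover have "x = path_cost w (Q k)" using P assms by (simp add: Q_def)
  ultimately show "\<exists>P\<in>{1..m} \<rightarrow>\<^sub>E insert [] {p. st_path A s t p}. successive_paths A w s t k P \<and> x = path_cost w (P k)" by blast
qed (auto simp: is_kth_cost_def)

text \<open>By \<open>is_kth_cost_finite\<close> only finitely many sequences of paths have to be
  inspected, so the event becomes a finite Boolean combination of comparisons between measurable
  path costs.\<close>

lemma kth_cost_event_measurable:
  fixes W :: "nat set \<Rightarrow> 'a \<Rightarrow> real"
  assumes fin: "finite {p. st_path A s t p}" and W: "\<And>e. e \<in> A \<Longrightarrow> W e \<in> borel_measurable M" and fK: "finite K" "0 \<notin> K"
  shows "{\<omega> \<in> space M. \<forall>k\<in>K. (\<exists>x. is_kth_cost A (\<lambda>e. W e \<omega>) s t k x) \<and>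
     (\<forall>x. is_kth_cost A (\<lambda>e. W e \<omega>) s t k x \<longrightarrow> a k \<le> x / c k \<and> x / c k \<le> b k)} \<in> sets M"
proof -
  define S where "S = {p. st_path A s t p}"
  define X where "X p \<omega> = (if p \<in> S then path_cost (\<lambda>e. W e \<omega>) p else 0)" for p \<omega>
  have fS: "finite S" using fin by (simp add: S_def)
  have [measurable]: "X p \<in> borel_measurable M" for p
  proof (cases "p \<in> S")
    case True
    hence "path_edges p \<subseteq> A" by (auto simp: S_def st_path_def)
    hence "(\<lambda>\<omega>. path_cost (\<lambda>e. W e \<omega>) p) \<in> borel_measurable M"
      unfolding path_cost_def using W by (intro borel_measurable_sum) auto
    thus ?thesis using True by (simp add: X_def[abs_def])
  qed (simp add: X_def[abs_def])
  define D where "D P j p \<longleftrightarrow> path_edges p \<inter> (\<Union>i\<in>{1..<j}. path_edges (P i)) = {}" for P :: "nat \<Rightarrow> nat list" and j p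
  define Y where "Y k P \<omega> \<longleftrightarrow> (\<forall>j\<in>{1..k}. (P j \<in> S \<and> D P j (P j)) \<and> (\<forall>p\<in>S. D P j p \<longrightarrow> X (P j) \<omega> \<le> X p \<omega>))" for k P \<omega>
  have Y: "successive_paths A (\<lambda>e. W e \<omega>) s t k P \<longleftrightarrow> Y k P \<omega>" for k P \<omega>
    unfolding successive_paths_def is_arg_min_linorder Y_def D_def X_def S_def by auto
  have Xk: "path_cost (\<lambda>e. W e \<omega>) (P k) = X (P k) \<omega>" if "Y k P \<omega>" "1 \<le> k" for k P \<omega>
    using that by (auto simp: Y_def X_def)
  define Z where "Z k = {1..k} \<rightarrow>\<^sub>E insert [] S" for k :: nat
  have fZ: "finite (Z k)" for k unfolding Z_def using fS by (intro finite_PiE) auto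
  have kth: "is_kth_cost A (\<lambda>e. W e \<omega>) s t k x \<longleftrightarrow> (\<exists>P\<in>Z k. Y k P \<omega> \<and> x = X (P k) \<omega>)" if "k \<in> K" for k x \<omega>
  proof -
    have "1 \<le> k" using that fK by (cases k) auto
    show ?thesis unfolding is_kth_cost_finite[OF order_refl \<open>1 \<le> k\<close>] Y Z_def S_def[symmetric]
      using Xk[OF _ \<open>1 \<le> k\<close>] by (intro bex_cong refl) auto
  qed
  have "{\<omega> \<in> space M. \<forall>k\<in>K. (\<exists>x. is_kth_cost A (\<lambda>e. W e \<omega>) s t k x) \<and>
     (\<forall>x. is_kth_cost A (\<lambda>e. W e \<omega>) s t k x \<longrightarrow> a k \<le> x / c k \<and> x / c k \<le> b k)} =
     {\<omega> \<in> space M. \<forall>k\<in>K. (\<exists>P\<in>Z k. Y k P \<omega>) \<and> (\<forall>P\<in>Z k. Y k P \<omega> \<longrightarrow> a k \<le> X (P k) \<omega> / c k \<and> X (P k) \<omega> / c k \<le> b k)}"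
  proof -
    have "((\<exists>x. is_kth_cost A (\<lambda>e. W e \<omega>) s t k x) \<and> (\<forall>x. is_kth_cost A (\<lambda>e. W e \<omega>) s t k x \<longrightarrow> a k \<le> x / c k \<and> x / c k \<le> b k)) \<longleftrightarrow>
      ((\<exists>P\<in>Z k. Y k P \<omega>) \<and> (\<forall>P\<in>Z k. Y k P \<omega> \<longrightarrow> a k \<le> X (P k) \<omega> / c k \<and> X (P k) \<omega> / c k \<le> b k))" if "k \<in> K" for k \<omega>
      unfolding kth[OF that] by blast
    thus ?thesis by simp
  qed
  also have "... \<in> sets M"
  proof -
    have [measurable]: "Measurable.pred M (Y k P)" for k P
      unfolding Y_def[abs_def] by (intro pred_intros_finite pred_intros_logic fS finite_atLeastAtMost) measurable
    have "Measurable.pred M (\<lambda>\<omega>. \<forall>k\<in>K. (\<exists>P\<in>Z k. Y k P \<omega>) \<and> (\<forall>P\<in>Z k. Y k P \<omega> \<longrightarrow> a k \<le> X (P k) \<omega> / c k \<and> X (P k) \<omega> / c k \<le> b k))"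
      by (intro pred_intros_finite pred_intros_logic fK fZ) measurable
    thus ?thesis by (simp add: pred_def)
  qed
  finally show ?thesis .
qed

theorem theorem1p2:
  fixes M :: "nat \<Rightarrow> 'a measure"
    and W :: "nat \<Rightarrow> nat set \<Rightarrow> 'a \<Rightarrow> real"
    and s t :: "nat \<Rightarrow> nat"
  assumes "\<And>n. prob_space (M n)"
    and "\<And>n. prob_space.indep_vars (M n) (\<lambda>_. borel) (W n) (complete_edges n)"
    and "\<And>n e. e \<in> complete_edges n \<Longrightarrow>
           distributed (M n) lborel (W n e) (exponential_density 1)"
    and "\<And>n. n \<ge> 2 \<Longrightarrow> s n < n \<and> t n < n \<and> s n \<noteq> t n"
  shows "(\<forall>n. \<forall>k\<in>{1..n - 1}. expected_W n k = (\<Sum>i = 1..k. 1 / (real n - real i))) \<and>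
         (\<forall>\<epsilon>>0. (\<lambda>n. measure (M n) {\<omega> \<in> space (M n). \<forall>k\<in>{1..n - 1}.
              (\<exists>x. is_kth_cost (complete_edges n) (\<lambda>e. W n e \<omega>) (s n) (t n) k x) \<and>
              (\<forall>x. is_kth_cost (complete_edges n) (\<lambda>e. W n e \<omega>) (s n) (t n) k x \<longrightarrow>
                 1 - \<epsilon> \<le> x / (2 * expected_W n k + ln (real n) / real n) \<and>
                 x / (2 * expected_W n k + ln (real n) / real n) \<le> 1 + \<epsilon>)})
            \<longlonglongrightarrow> 1)"
proof (intro conjI allI impI)
  show "\<forall>k\<in>{1..n - 1}. expected_W n k = (\<Sum>i = 1..k. 1 / (real n - real i))" for n
    using expected_W_eq[of _ n] unfolding hsum_def by blast
next
  fix \<epsilon> :: real assume \<epsilon>: "0 < \<epsilon>"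
  interpret exp_graphs M W s t
    by (intro exp_graphs.intro exp_graph.intro exp_family.intro exp_family_axioms.intro) (use assms in auto)
  define A where "A n = {\<omega> \<in> space (M n). \<forall>k\<in>{1..n - 1}.
              (\<exists>x. is_kth_cost (complete_edges n) (\<lambda>e. W n e \<omega>) (s n) (t n) k x) \<and>
              (\<forall>x. is_kth_cost (complete_edges n) (\<lambda>e. W n e \<omega>) (s n) (t n) k x \<longrightarrow>
                 1 - \<epsilon> \<le> x / (2 * expected_W n k + ln (real n) / real n) \<and>
                 x / (2 * expected_W n k + ln (real n) / real n) \<le> 1 + \<epsilon>)}" for n
  \<comment> \<open>\<open>whp_upper\<close> is available for tolerances up to 1/1000, and a smaller
    tolerance gives a stronger conclusion.\<close>
  define u where "u = min \<epsilon> (1 / 1000)"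
  have u: "0 < u" "u \<le> 1 / 1000" "u \<le> \<epsilon>" using \<epsilon> by (auto simp: u_def)
  have "whp (\<lambda>n w. upper_ok u n (s n) (t n) w \<and> lower_ok u n (s n) (t n) w)"
    using u by (intro whp_conj whp_upper whp_lower) auto
  then obtain B where B: "\<And>n. B n \<in> sets (M n)"
    "\<And>n \<omega>. \<omega> \<in> space (M n) \<Longrightarrow> \<not> (upper_ok u n (s n) (t n) (\<lambda>e. W n e \<omega>) \<and> lower_ok u n (s n) (t n) (\<lambda>e. W n e \<omega>)) \<Longrightarrow> \<omega> \<in> B n"
    "(\<lambda>n. measure (M n) (B n)) \<longlonglongrightarrow> 0" unfolding whp_def by blast
  have low: "1 - measure (M n) (B n) \<le> measure (M n) (A n)" if n: "2 \<le> n" for n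
  proof -
    interpret prob_space "M n" by (rule assms)
    \<comment> \<open>\<open>whp\<close> provides a measurable set covering the failures; passing
      from the complement back to the event requires that the event be measurable itself.\<close>
    have meas: "A n \<in> sets (M n)" unfolding A_def
    proof (rule kth_cost_event_measurable)
      show "finite {p. st_path (complete_edges n) (s n) (t n) p}" using finite_st_paths assms(4)[OF n] by blast
      show "W n e \<in> borel_measurable (M n)" if "e \<in> complete_edges n" for e
        using distributed_measurable[OF assms(3)[OF that]] by simp
    qed auto
    have "space (M n) - A n \<subseteq> B n"
    proof
      fix \<omega> assume \<omega>: "\<omega> \<in> space (M n) - A n"
      have "\<omega> \<in> A n" if up: "upper_ok u n (s n) (t n) (\<lambda>e. W n e \<omega>)" and lw: "lower_ok u n (s n) (t n) (\<lambda>e. W n e \<omega>)"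
      proof -
        have "(\<exists>x. is_kth_cost (complete_edges n) (\<lambda>e. W n e \<omega>) (s n) (t n) k x) \<and>
              (\<forall>x. is_kth_cost (complete_edges n) (\<lambda>e. W n e \<omega>) (s n) (t n) k x \<longrightarrow>
                 1 - \<epsilon> \<le> x / (2 * expected_W n k + ln (real n) / real n) \<and>
                 x / (2 * expected_W n k + ln (real n) / real n) \<le> 1 + \<epsilon>)" if k: "k \<in> {1..n - 1}" for k
        proof -
          have kn: "1 \<le> k" "k < n" "k \<le> n - 1" using k n by auto
          have e: "2 * expected_W n k + ln (real n) / real n = typical n k" using expected_W_eq[OF k] by (simp add: typical_def)
          have T: "0 < typical n k"
          proof -
            have "0 < ln (real n) / real n" using n by simp
            moreover have "0 \<le> hsum n k" using kn by (intro hsum_nonneg) simp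
            ultimately show ?thesis unfolding typical_def by linarith
          qed
          have uT: "u * typical n k \<le> \<epsilon> * typical n k" using T u by (intro mult_right_mono) auto
          have "\<exists>x. is_kth_cost (complete_edges n) (\<lambda>e. W n e \<omega>) (s n) (t n) k x"
            using up successive_paths_prefix[OF _ kn(3)] unfolding upper_ok_def is_kth_cost_def by blast
          moreover have "1 - \<epsilon> \<le> x / typical n k \<and> x / typical n k \<le> 1 + \<epsilon>"
            if x: "is_kth_cost (complete_edges n) (\<lambda>e. W n e \<omega>) (s n) (t n) k x" for x
          proof -
            have "x \<le> (1 + u) * typical n k" "(1 - u) * typical n k \<le> x"
              using x up lw k unfolding upper_ok_def lower_ok_def is_kth_cost_def by auto
            hence "x \<le> (1 + \<epsilon>) * typical n k" "(1 - \<epsilon>) * typical n k \<le> x" using uT by (simp_all add: algebra_simps)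
            thus ?thesis using T by (simp add: pos_le_divide_eq pos_divide_le_eq)
          qed
          ultimately show ?thesis unfolding e by blast
        qed
        thus ?thesis using \<omega> unfolding A_def by blast
      qed
      thus "\<omega> \<in> B n" using B(2) \<omega> by blast
    qed
    hence "measure (M n) (space (M n) - A n) \<le> measure (M n) (B n)" using B(1) by (intro finite_measure_mono) auto
    thus ?thesis using prob_compl[OF meas] by simp
  qed
  have "(\<lambda>n. measure (M n) (A n)) \<longlonglongrightarrow> 1"
  proof (rule tendsto_sandwich)
    show "\<forall>\<^sub>F n in sequentially. 1 - measure (M n) (B n) \<le> measure (M n) (A n)"
      using eventually_ge_at_top[of 2] by eventually_elim (rule low)
    show "\<forall>\<^sub>F n in sequentially. measure (M n) (A n) \<le> 1"
      using prob_space.prob_le_1[OF assms(1)] by simp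
    show "(\<lambda>n. 1 - measure (M n) (B n)) \<longlonglongrightarrow> 1" using tendsto_diff[OF tendsto_const B(3), of 1] by simp
  qed simp
  thus "(\<lambda>n. measure (M n) {\<omega> \<in> space (M n). \<forall>k\<in>{1..n - 1}.
              (\<exists>x. is_kth_cost (complete_edges n) (\<lambda>e. W n e \<omega>) (s n) (t n) k x) \<and>
              (\<forall>x. is_kth_cost (complete_edges n) (\<lambda>e. W n e \<omega>) (s n) (t n) k x \<longrightarrow>
                 1 - \<epsilon> \<le> x / (2 * expected_W n k + ln (real n) / real n) \<and>
                 x / (2 * expected_W n k + ln (real n) / real n) \<le> 1 + \<epsilon>)}) \<longlonglongrightarrow> 1"
    unfolding A_def .
qed

end
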